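(* Let $g\geq 2$, let $\Sigma_g$ be a closed Riemann surface of genus $g$ and let $p$ be a prime number. The orbifold locus $\chi^i_{Sing}(\pi_1(\Sigma_g),PSL(p,\mathbb{C}))$ of $\chi^i(\pi_1(\Sigma_g),PSL(p,\mathbb{C}))$ has $p$ connected components, given by the fibers of the Euler invariant $e:\chi^i_{Sing}(\pi_1(\Sigma_g),PSL(p,\mathbb{C}))\to Z(SL(p,\mathbb{C}))$, and its (complex) dimension is $2(g-1)(p-1)$.
   Context: A subgroup of $PSL(p,\mathbb{C})$ is irreducible if it is not contained in any (proper) parabolic subgroup; an irreducible subgroup is bad if its centralizer in $PSL(p,\mathbb{C})$ is non-trivial. A representation is irreducible (resp. bad) if its image is. For $\Gamma$ generated by $r$ elements, $\mathrm{Hom}(\Gamma,PSL(p,\mathbb{C}))\subset PSL(p,\mathbb{C})^r$ has the usual (transcendental) topology; $\chi^i(\Gamma,PSL(p,\mathbb{C}))$ is the quotient, with quotient topology, of the subset of irreducible representations by conjugation by $PSL(p,\mathbb{C})$. The orbifold locus (= singular locus) $\chi^i_{Sing}(\Gamma,PSL(p,\mathbb{C}))$ is the subset of conjugacy classes of bad representations. Let $\pi_1(\Sigma_g)=\langle a_1,b_1,\dots,a_g,b_g\mid\prod_{i=1}^g[a_i,b_i]=1\rangle$, with $[x,y]=xyx^{-1}y^{-1}$. The Euler invariant of $\rho:\pi_1(\Sigma_g)\to PSL(p,\mathbb{C})$ is $e(\rho):=\prod_{i=1}^g[\hat\rho(a_i),\hat\rho(b_i)]\in Z(SL(p,\mathbb{C}))$,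 where $\hat\rho(\gamma)\in SL(p,\mathbb{C})$ denotes any lift of $\rho(\gamma)$; it does not depend on the lifts and is invariant under conjugation. *)

theory Defs
  imports
    "HOL-Analysis.Analysis"
    "HOL-Algebra.Coset"
    "HOL-Library.Extended_Nat"
    "HOL-Computational_Algebra.Primes"
begin

section \<open>Topological preliminaries\<close>

definition quotient_topology :: "'a topology \<Rightarrow> ('a \<Rightarrow> 'b) \<Rightarrow> 'b topology"
  where "quotient_topology X q =
    topology (\<lambda>U. U \<subseteq> q ` topspace X \<and> openin X {x \<in> topspace X. q x \<in> U})"

lemma openin_quotient_topology:
  "openin (quotient_topology X q) U \<longleftrightarrow>
    U \<subseteq> q ` topspace X \<and> openin X {x \<in> topspace X. q x \<in> U}"
proof -
  have "istopology (\<lambda>U. U \<subseteq> q ` topspace X \<and> openin X {x \<in> topspace X. q x \<in> U})"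
    unfolding istopology_def
  proof (intro conjI allI impI)
    fix S T
    assume S: "S \<subseteq> q ` topspace X \<and> openin X {x \<in> topspace X. q x \<in> S}"
      and T: "T \<subseteq> q ` topspace X \<and> openin X {x \<in> topspace X. q x \<in> T}"
    show "S \<inter> T \<subseteq> q ` topspace X" using S by blast
    have "{x \<in> topspace X. q x \<in> S \<inter> T} =
        {x \<in> topspace X. q x \<in> S} \<inter> {x \<in> topspace X. q x \<in> T}" by blast
    then show "openin X {x \<in> topspace X. q x \<in> S \<inter> T}" using S T by auto
  next
    fix K
    assume K: "\<forall>S\<in>K. S \<subseteq> q ` topspace X \<and> openin X {x \<in> topspace X. q x \<in> S}"
    then show "\<Union>K \<subseteq> q ` topspace X" by blast
    have "{x \<in> topspace X. q x \<in> \<Union>K} = (\<Union>S\<in>K. {x \<in> topspace X. q x \<in> S})" by blast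
    then show "openin X {x \<in> topspace X. q x \<in> \<Union>K}" using K by auto
  qed
  then show ?thesis
    by (simp add: quotient_topology_def)
qed

lemma topspace_quotient_topology [simp]:
  "topspace (quotient_topology X q) = q ` topspace X"
proof -
  have "{x \<in> topspace X. q x \<in> q ` topspace X} = topspace X" by blast
  then have op: "openin (quotient_topology X q) (q ` topspace X)"
    by (simp add: openin_quotient_topology)
  have sub: "topspace (quotient_topology X q) \<subseteq> q ` topspace X"
    using openin_quotient_topology[of X q "topspace (quotient_topology X q)"] openin_topspace
    by simp
  show ?thesis by (rule subset_antisym[OF sub openin_subset[OF op]])
qed

definition irreducible_closed :: "'a topology \<Rightarrow> 'a set \<Rightarrow> bool"
  where "irreducible_closed X Z \<longleftrightarrow> closedin X Z \<and> Z \<noteq> {} \<and>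
    (\<forall>A B. closedin X A \<and> closedin X B \<and> Z \<subseteq> A \<union> B \<longrightarrow> Z \<subseteq> A \<or> Z \<subseteq> B)"

text \<open>The supremum over the empty set is \<open>0\<close>, so this is the usual Krull dimension only for
  nonempty spaces.\<close>

definition krull_dim :: "'a topology \<Rightarrow> enat"
  where "krull_dim X = Sup {enat n | n. \<exists>Z :: nat \<Rightarrow> 'a set.
    (\<forall>i\<le>n. irreducible_closed X (Z i)) \<and> (\<forall>i<n. Z i \<subset> Z (Suc i))}"


section \<open>Groups given by generators and relations\<close>

definition center :: "('a, 'b) monoid_scheme \<Rightarrow> 'a set"
  where "center G = {z \<in> carrier G. \<forall>x \<in> carrier G. x \<otimes>\<^bsub>G\<^esub> z = z \<otimes>\<^bsub>G\<^esub> x}"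

definition centralizer :: "('a, 'b) monoid_scheme \<Rightarrow> 'a set \<Rightarrow> 'a set"
  where "centralizer G H = {z \<in> carrier G. \<forall>x \<in> H. x \<otimes>\<^bsub>G\<^esub> z = z \<otimes>\<^bsub>G\<^esub> x}"

text \<open>The letter \<open>(x, True)\<close> stands for the generator \<open>x\<close> and \<open>(x, False)\<close> for its inverse.\<close>

type_synonym 'x word = "('x \<times> bool) list"

definition words :: "'x set \<Rightarrow> 'x word set"
  where "words X = lists (X \<times> UNIV)"

inductive_set word_rel :: "'x set \<Rightarrow> 'x word set \<Rightarrow> ('x word \<times> 'x word) set"
  for X R where
  refl: "w \<in> words X \<Longrightarrow> (w, w) \<in> word_rel X R"
| sym: "(u, v) \<in> word_rel X R \<Longrightarrow> (v, u) \<in> word_rel X R"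
| trans: "(u, v) \<in> word_rel X R \<Longrightarrow> (v, w) \<in> word_rel X R \<Longrightarrow> (u, w) \<in> word_rel X R"
| cancel: "u \<in> words X \<Longrightarrow> v \<in> words X \<Longrightarrow> x \<in> X \<Longrightarrow>
    (u @ [(x, s), (x, \<not> s)] @ v, u @ v) \<in> word_rel X R"
| relator: "u \<in> words X \<Longrightarrow> v \<in> words X \<Longrightarrow> r \<in> R \<Longrightarrow> r \<in> words X \<Longrightarrow>
    (u @ r @ v, u @ v) \<in> word_rel X R"

definition presented_group :: "'x set \<Rightarrow> 'x word set \<Rightarrow> 'x word set monoid"
  where "presented_group X R =
    \<lparr>carrier = words X // word_rel X R,
     mult = (\<lambda>U V. \<Union>u\<in>U. \<Union>v\<in>V. word_rel X R `` {u @ v}),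
     one = word_rel X R `` {[]}\<rparr>"

definition presented_gen :: "'x set \<Rightarrow> 'x word set \<Rightarrow> 'x \<Rightarrow> 'x word set"
  where "presented_gen X R x = word_rel X R `` {[(x, True)]}"

lemma word_rel_words: "(u, v) \<in> word_rel X R \<Longrightarrow> u \<in> words X \<and> v \<in> words X"
  by (induction rule: word_rel.induct) (auto simp: words_def)

lemma equiv_word_rel: "equiv (words X) (word_rel X R)"
proof (rule equivI)
  show "word_rel X R \<subseteq> words X \<times> words X" by (auto dest: word_rel_words)
  show "refl_on (words X) (word_rel X R)" by (intro refl_onI word_rel.refl)
  show "sym (word_rel X R)" by (rule symI) (rule word_rel.sym)
  show "trans (word_rel X R)" by (rule transI) (rule word_rel.trans)
qed

lemma word_rel_append_right:
  assumes "(u, v) \<in> word_rel X R" "w \<in> words X"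
  shows "(u @ w, v @ w) \<in> word_rel X R"
  using assms
proof (induction rule: word_rel.induct)
  case (cancel u v x s)
  then show ?case
    using word_rel.cancel[of u X "v @ w" x s R] by (simp add: words_def)
next
  case (relator u v r)
  then show ?case
    using word_rel.relator[of u X "v @ w" r R] by (simp add: words_def)
next
  case (refl u)
  then show ?case by (simp add: word_rel.refl words_def)
next
  case (sym u v)
  then show ?case by (blast intro: word_rel.sym)
next
  case (trans u v z)
  then show ?case by (blast intro: word_rel.trans)
qed

lemma word_rel_append_left:
  assumes "(u, v) \<in> word_rel X R" "w \<in> words X"
  shows "(w @ u, w @ v) \<in> word_rel X R"
  using assms
proof (induction rule: word_rel.induct)
  case (cancel u v x s)
  then show ?case
    using word_rel.cancel[of "w @ u" X v x s R] by (simp add: words_def)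
next
  case (relator u v r)
  then show ?case
    using word_rel.relator[of "w @ u" X v r R] by (simp add: words_def)
next
  case (refl u)
  then show ?case by (simp add: word_rel.refl words_def)
next
  case (sym u v)
  then show ?case by (blast intro: word_rel.sym)
next
  case (trans u v z)
  then show ?case by (blast intro: word_rel.trans)
qed

lemma presented_group_mult:
  assumes "u \<in> words X" "v \<in> words X"
  shows "word_rel X R `` {u} \<otimes>\<^bsub>presented_group X R\<^esub> word_rel X R `` {v} =
    word_rel X R `` {u @ v}"
proof -
  let ?E = "word_rel X R"
  have *: "?E `` {u' @ v'} = ?E `` {u @ v}" if "(u, u') \<in> ?E" "(v, v') \<in> ?E" for u' v'
  proof -
    have "(u @ v, u' @ v) \<in> ?E"
      by (rule word_rel_append_right[OF that(1) assms(2)])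
    moreover have "(u' @ v, u' @ v') \<in> ?E"
      using word_rel_append_left[OF that(2)] word_rel_words[OF that(1)] by simp
    ultimately have "(u @ v, u' @ v') \<in> ?E"
      by (rule word_rel.trans)
    then show ?thesis
      by (rule equiv_class_eq[OF equiv_word_rel, symmetric])
  qed
  have "(\<Union>u'\<in>?E `` {u}. \<Union>v'\<in>?E `` {v}. ?E `` {u' @ v'}) =
      (\<Union>u'\<in>?E `` {u}. \<Union>v'\<in>?E `` {v}. ?E `` {u @ v})"
    by (intro SUP_cong HOL.refl) (simp only: Image_singleton_iff *)
  also have "\<dots> = ?E `` {u @ v}"
    using word_rel.refl[OF assms(1), of R] word_rel.refl[OF assms(2), of R]
    by (simp add: Image_singleton_iff) blast
  finally show ?thesis
    by (simp add: presented_group_def)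
qed

lemma word_rel_inverse:
  assumes "w \<in> words X"
  shows "(rev (map (map_prod (\<lambda>x. x) Not) w) @ w, []) \<in> word_rel X R"
  using assms
proof (induction w)
  case Nil
  then show ?case by (auto intro: word_rel.refl)
next
  case (Cons l w)
  obtain x s where l: "l = (x, s)" by force
  have w: "w \<in> words X" "x \<in> X" and r: "rev (map (map_prod (\<lambda>x. x) Not) w) \<in> words X"
    using Cons.prems l by (force simp: words_def)+
  show ?case
    using word_rel.trans[OF word_rel.cancel[of _ X w x "\<not> s" R, OF r w] Cons.IH[OF w(1)]]
    by (simp add: l id_def)
qed

lemma group_presented_group: "group (presented_group X R)"
proof (rule groupI)
  let ?G = "presented_group X R" and ?E = "word_rel X R"
  have carrier: "carrier ?G = words X // ?E" and one: "\<one>\<^bsub>?G\<^esub> = ?E `` {[]}"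
    by (simp_all add: presented_group_def)
  have nil: "[] \<in> words X" by (simp add: words_def)
  have app: "u @ v \<in> words X" if "u \<in> words X" "v \<in> words X" for u v
    using that by (simp add: words_def)
  show "\<one>\<^bsub>?G\<^esub> \<in> carrier ?G"
    using nil by (simp add: carrier one quotientI)
  fix U assume U: "U \<in> carrier ?G"
  then obtain u where u: "u \<in> words X" "U = ?E `` {u}"
    by (auto simp: carrier elim: quotientE)
  show "\<one>\<^bsub>?G\<^esub> \<otimes>\<^bsub>?G\<^esub> U = U"
    using presented_group_mult[OF nil u(1)] by (simp add: one u)
  have inv: "rev (map (map_prod (\<lambda>x. x) Not) u) \<in> words X"
    using u(1) by (fastforce simp: words_def)
  show "\<exists>V\<in>carrier ?G. V \<otimes>\<^bsub>?G\<^esub> U = \<one>\<^bsub>?G\<^esub>"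
  proof (rule bexI)
    show "?E `` {rev (map (map_prod (\<lambda>x. x) Not) u)} \<otimes>\<^bsub>?G\<^esub> U = \<one>\<^bsub>?G\<^esub>"
      unfolding u(2) one presented_group_mult[OF inv u(1)]
      by (rule equiv_class_eq[OF equiv_word_rel word_rel_inverse[OF u(1)]])
    show "?E `` {rev (map (map_prod (\<lambda>x. x) Not) u)} \<in> carrier ?G"
      using inv by (simp add: carrier quotientI)
  qed
  fix V assume V: "V \<in> carrier ?G"
  then obtain v where v: "v \<in> words X" "V = ?E `` {v}"
    by (auto simp: carrier elim: quotientE)
  show "U \<otimes>\<^bsub>?G\<^esub> V \<in> carrier ?G"
    by (simp add: u v presented_group_mult) (simp add: carrier quotientI app u v)
  fix W assume W: "W \<in> carrier ?G"
  then obtain w where w: "w \<in> words X" "W = ?E `` {w}"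
    by (auto simp: carrier elim: quotientE)
  show "U \<otimes>\<^bsub>?G\<^esub> V \<otimes>\<^bsub>?G\<^esub> W = U \<otimes>\<^bsub>?G\<^esub> (V \<otimes>\<^bsub>?G\<^esub> W)"
    by (simp add: u v w presented_group_mult app)
qed


section \<open>The fundamental group of a closed surface\<close>

datatype surface_letter = La nat | Lb nat

definition surface_letters :: "nat \<Rightarrow> surface_letter set"
  where "surface_letters g = La ` {1..g} \<union> Lb ` {1..g}"

definition surface_relator :: "nat \<Rightarrow> surface_letter word"
  where "surface_relator g =
    concat (map (\<lambda>i. [(La i, True), (Lb i, True), (La i, False), (Lb i, False)]) [1..<Suc g])"

definition surface_group :: "nat \<Rightarrow> surface_letter word set monoid"
  where "surface_group g = presented_group (surface_letters g) {surface_relator g}"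

definition surface_gen :: "nat \<Rightarrow> surface_letter \<Rightarrow> surface_letter word set"
  where "surface_gen g = presented_gen (surface_letters g) {surface_relator g}"

definition surface_gens :: "nat \<Rightarrow> surface_letter word set set"
  where "surface_gens g = surface_gen g ` surface_letters g"

definition commutator_prod :: "('a, 'b) monoid_scheme \<Rightarrow> nat \<Rightarrow> (nat \<Rightarrow> 'a) \<Rightarrow> (nat \<Rightarrow> 'a) \<Rightarrow> 'a"
  where "commutator_prod G g a b =
    foldr (mult G)
      (map (\<lambda>i. a i \<otimes>\<^bsub>G\<^esub> b i \<otimes>\<^bsub>G\<^esub> inv\<^bsub>G\<^esub> (a i) \<otimes>\<^bsub>G\<^esub> inv\<^bsub>G\<^esub> (b i)) [1..<Suc g]) \<one>\<^bsub>G\<^esub>"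


section \<open>The groups SL and PSL\<close>

definition SL :: "(complex ^ 'n::finite ^ 'n) monoid"
  where "SL = \<lparr>carrier = {A. det A = 1}, mult = (**), one = mat 1\<rparr>"

type_synonym 'n psl = "(complex ^ 'n ^ 'n) set"

definition PSL :: "'n::finite psl monoid"
  where "PSL = SL Mod center SL"

definition PSL_proj :: "complex ^ 'n::finite ^ 'n \<Rightarrow> 'n psl"
  where "PSL_proj A = center SL #>\<^bsub>SL\<^esub> A"

definition PSL_topology :: "'n::finite psl topology"
  where "PSL_topology = quotient_topology (top_of_set (carrier SL)) PSL_proj"

lemma group_SL: "group (SL :: (complex ^ 'n ^ 'n) monoid)"
proof (rule groupI)
  fix A :: "complex ^ 'n ^ 'n"
  assume "A \<in> carrier SL"
  then have A: "det A = 1" by (simp add: SL_def)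
  then have "invertible A" by (simp add: invertible_det_nz)
  then obtain B where B: "B ** A = mat 1" by (auto simp: invertible_def)
  then have "det B = 1"
    using A det_mul[of B A] by simp
  then show "\<exists>B\<in>carrier SL. B \<otimes>\<^bsub>SL\<^esub> A = \<one>\<^bsub>SL\<^esub>"
    using B by (auto simp: SL_def)
qed (simp_all add: SL_def det_mul matrix_mul_assoc)

lemma normal_center_SL: "center (SL :: (complex ^ 'n ^ 'n) monoid) \<lhd> SL"
proof -
  interpret group "SL :: (complex ^ 'n ^ 'n) monoid" by (rule group_SL)
  have "subgroup (center SL) (SL :: (complex ^ 'n ^ 'n) monoid)"
  proof (rule subgroupI)
    show "center SL \<subseteq> carrier (SL :: (complex ^ 'n ^ 'n) monoid)"
      by (auto simp: center_def)
    show "center SL \<noteq> ({} :: (complex ^ 'n ^ 'n) set)"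
      by (auto simp: center_def intro!: exI[of _ "\<one>\<^bsub>SL\<^esub>"])
  next
    fix z :: "complex ^ 'n ^ 'n"
    assume z: "z \<in> center SL"
    show "inv\<^bsub>SL\<^esub> z \<in> center SL"
      unfolding center_def
    proof (intro CollectI conjI ballI)
      show zc: "inv\<^bsub>SL\<^esub> z \<in> carrier SL" using z by (auto simp: center_def)
      fix x :: "complex ^ 'n ^ 'n"
      assume x: "x \<in> carrier SL"
      have zx: "z \<in> carrier SL" "x \<otimes>\<^bsub>SL\<^esub> z = z \<otimes>\<^bsub>SL\<^esub> x"
        using z x by (auto simp: center_def)
      then have "inv\<^bsub>SL\<^esub> z \<otimes>\<^bsub>SL\<^esub> x \<otimes>\<^bsub>SL\<^esub> z = x"
        using x by (simp add: m_assoc inv_solve_left')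
      then show "x \<otimes>\<^bsub>SL\<^esub> inv\<^bsub>SL\<^esub> z = inv\<^bsub>SL\<^esub> z \<otimes>\<^bsub>SL\<^esub> x"
        using inv_solve_right'[of "inv\<^bsub>SL\<^esub> z \<otimes>\<^bsub>SL\<^esub> x" x z] x zx(1) by simp
    qed
  next
    fix y z :: "complex ^ 'n ^ 'n"
    assume yz: "y \<in> center SL" "z \<in> center SL"
    then have c: "y \<in> carrier SL" "z \<in> carrier SL" by (auto simp: center_def)
    have "x \<otimes>\<^bsub>SL\<^esub> (y \<otimes>\<^bsub>SL\<^esub> z) = y \<otimes>\<^bsub>SL\<^esub> z \<otimes>\<^bsub>SL\<^esub> x"
      if x: "x \<in> carrier SL" for x
    proof -
      have xy: "x \<otimes>\<^bsub>SL\<^esub> y = y \<otimes>\<^bsub>SL\<^esub> x" and xz: "x \<otimes>\<^bsub>SL\<^esub> z = z \<otimes>\<^bsub>SL\<^esub> x"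
        using yz x unfolding center_def by blast+
      have "x \<otimes>\<^bsub>SL\<^esub> (y \<otimes>\<^bsub>SL\<^esub> z) = y \<otimes>\<^bsub>SL\<^esub> x \<otimes>\<^bsub>SL\<^esub> z"
        using xy c x m_assoc[of x y z] by metis
      also have "\<dots> = y \<otimes>\<^bsub>SL\<^esub> (z \<otimes>\<^bsub>SL\<^esub> x)"
        using xz c x m_assoc[of y x z] by metis
      finally show ?thesis
        using c x by (simp add: m_assoc)
    qed
    then show "y \<otimes>\<^bsub>SL\<^esub> z \<in> center SL"
      using c m_closed[OF c] unfolding center_def by blast
  qed
  then show ?thesis
    by (rule normalI) (auto simp: r_coset_def l_coset_def center_def)
qed

lemma group_PSL: "group (PSL :: 'n::finite psl monoid)"
  unfolding PSL_def using normal.factorgroup_is_group[OF normal_center_SL] .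

text \<open>A partial flag is a family of complex subspaces that is totally ordered by inclusion (such a
  family is automatically finite); the parabolic subgroups are the stabilizers of partial flags.
  Stabilizing a subspace does not depend on the representative of an element of PSL.\<close>

definition is_flag :: "(complex ^ 'n::finite) set set \<Rightarrow> bool"
  where "is_flag F \<longleftrightarrow> subset.chain {V. vec.subspace V} F"

definition flag_stabilizer :: "(complex ^ 'n::finite) set set \<Rightarrow> 'n psl set"
  where "flag_stabilizer F = {x \<in> carrier PSL. \<forall>A\<in>x. \<forall>V\<in>F. (*v) A ` V = V}"

definition parabolic :: "'n::finite psl set \<Rightarrow> bool"
  where "parabolic P \<longleftrightarrow> (\<exists>F. is_flag F \<and> P = flag_stabilizer F)"

definition irreducible_subgroup :: "'n::finite psl set \<Rightarrow> bool"
  where "irreducible_subgroup H \<longleftrightarrow> subgroup H PSL \<and>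
    \<not> (\<exists>P. parabolic P \<and> P \<noteq> carrier PSL \<and> H \<subseteq> P)"

definition bad_subgroup :: "'n::finite psl set \<Rightarrow> bool"
  where "bad_subgroup H \<longleftrightarrow> irreducible_subgroup H \<and> centralizer PSL H \<noteq> {\<one>\<^bsub>PSL\<^esub>}"


section \<open>Zariski topologies\<close>

inductive poly_fun :: "'s set \<Rightarrow> (('s \<Rightarrow> complex ^ 'n::finite ^ 'n) \<Rightarrow> complex) \<Rightarrow> bool"
  for S where
  const: "poly_fun S (\<lambda>t. c)"
| entry: "s \<in> S \<Longrightarrow> poly_fun S (\<lambda>t. t s $ i $ j)"
| add: "poly_fun S f \<Longrightarrow> poly_fun S h \<Longrightarrow> poly_fun S (\<lambda>t. f t + h t)"
| mult: "poly_fun S f \<Longrightarrow> poly_fun S h \<Longrightarrow> poly_fun S (\<lambda>t. f t * h t)"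

definition SL_zariski :: "'s set \<Rightarrow> ('s \<Rightarrow> complex ^ 'n::finite ^ 'n) topology"
  where "SL_zariski S = topology (\<lambda>U. \<exists>F. (\<forall>f\<in>F. poly_fun S f) \<and>
    U = {t \<in> (\<Pi>\<^sub>E s\<in>S. carrier SL). \<exists>f\<in>F. f t \<noteq> 0})"

lemma openin_SL_zariski:
  fixes U :: "('s \<Rightarrow> complex ^ 'n ^ 'n) set"
  shows "openin (SL_zariski S) U \<longleftrightarrow> (\<exists>F. (\<forall>f\<in>F. poly_fun S f) \<and>
    U = {t \<in> (\<Pi>\<^sub>E s\<in>S. carrier SL). \<exists>f\<in>F. f t \<noteq> 0})"
proof -
  let ?P = "\<Pi>\<^sub>E s\<in>S. carrier (SL :: (complex ^ 'n ^ 'n) monoid)"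
  have "istopology (\<lambda>U. \<exists>F. (\<forall>f\<in>F. poly_fun S f) \<and> U = {t \<in> ?P. \<exists>f\<in>F. f t \<noteq> 0})"
    unfolding istopology_def
  proof (intro conjI allI impI; (elim exE conjE)?)
    fix U V and F H :: "(('s \<Rightarrow> complex ^ 'n ^ 'n) \<Rightarrow> complex) set"
    assume F: "\<forall>f\<in>F. poly_fun S f" "U = {t \<in> ?P. \<exists>f\<in>F. f t \<noteq> 0}"
      and H: "\<forall>f\<in>H. poly_fun S f" "V = {t \<in> ?P. \<exists>f\<in>H. f t \<noteq> 0}"
    let ?FH = "(\<lambda>p t. fst p t * snd p t) ` (F \<times> H)"
    have "\<forall>f\<in>?FH. poly_fun S f"
      using F(1) H(1) by (auto intro: poly_fun.mult)
    moreover have "U \<inter> V = {t \<in> ?P. \<exists>f\<in>?FH. f t \<noteq> 0}"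
      unfolding F(2) H(2) by fastforce
    ultimately show "\<exists>F. (\<forall>f\<in>F. poly_fun S f) \<and> U \<inter> V = {t \<in> ?P. \<exists>f\<in>F. f t \<noteq> 0}"
      by (rule exI[of _ ?FH, OF conjI])
  next
    fix K
    assume "\<forall>U\<in>K. \<exists>F. (\<forall>f\<in>F. poly_fun S f) \<and> U = {t \<in> ?P. \<exists>f\<in>F. f t \<noteq> 0}"
    from bchoice[OF this] obtain F
      where F: "\<forall>U\<in>K. (\<forall>f\<in>F U. poly_fun S f) \<and> U = {t \<in> ?P. \<exists>f\<in>F U. f t \<noteq> 0}" ..
    have U: "\<Union>K = {t \<in> ?P. \<exists>f\<in>\<Union>(F ` K). f t \<noteq> 0}"
    proof (rule Set.set_eqI)
      fix t
      have "t \<in> U \<longleftrightarrow> t \<in> ?P \<and> (\<exists>f\<in>F U. f t \<noteq> 0)" if "U \<in> K" for U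
        using eqset_imp_iff[OF conjunct2[OF bspec[OF F that]], of t] unfolding mem_Collect_eq .
      then show "t \<in> \<Union>K \<longleftrightarrow> t \<in> {t \<in> ?P. \<exists>f\<in>\<Union>(F ` K). f t \<noteq> 0}" by blast
    qed
    have P: "\<forall>f\<in>\<Union>(F ` K). poly_fun S f"
      using conjunct1[OF bspec[OF F]] by blast
    show "\<exists>F. (\<forall>f\<in>F. poly_fun S f) \<and> \<Union>K = {t \<in> ?P. \<exists>f\<in>F. f t \<noteq> 0}"
      by (rule exI[of _ "\<Union>(F ` K)"]) (rule conjI[OF P U])
  qed
  then show ?thesis
    unfolding SL_zariski_def by (subst topology_inverse') (auto simp only:)
qed

text \<open>The variety \<open>PSL\<^sup>S\<close> is the geometric quotient of \<open>SL\<^sup>S\<close> by the finite group \<open>Z(SL)\<^sup>S\<close>, so its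
  Zariski topology is the quotient topology.\<close>

definition PSL_zariski :: "'s set \<Rightarrow> ('s \<Rightarrow> 'n::finite psl) topology"
  where "PSL_zariski S = quotient_topology (SL_zariski S) (\<lambda>t. \<lambda>s\<in>S. PSL_proj (t s))"


section \<open>Representations into PSL\<close>

type_synonym ('a, 'n) rep = "'a \<Rightarrow> 'n psl"

definition Hom :: "'a monoid \<Rightarrow> ('a, 'n::finite) rep set"
  where "Hom \<Gamma> = hom \<Gamma> PSL \<inter> extensional (carrier \<Gamma>)"

text \<open>Here \<open>S\<close> is a generating set of \<open>\<Gamma>\<close>, so that restriction to \<open>S\<close> embeds \<open>Hom \<Gamma>\<close> into
  \<open>PSL\<^sup>S\<close>, and \<open>T\<close> is a topology on \<open>PSL\<^sup>S\<close>.\<close>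

definition Hom_topology ::
    "'a monoid \<Rightarrow> 'a set \<Rightarrow> ('a, 'n::finite) rep topology \<Rightarrow> ('a, 'n) rep topology"
  where "Hom_topology \<Gamma> S T = pullback_topology (Hom \<Gamma>) (\<lambda>\<rho>. restrict \<rho> S) T"

definition irr_reps :: "'a monoid \<Rightarrow> ('a, 'n::finite) rep set"
  where "irr_reps \<Gamma> = {\<rho> \<in> Hom \<Gamma>. irreducible_subgroup (\<rho> ` carrier \<Gamma>)}"

definition bad_reps :: "'a monoid \<Rightarrow> ('a, 'n::finite) rep set"
  where "bad_reps \<Gamma> = {\<rho> \<in> Hom \<Gamma>. bad_subgroup (\<rho> ` carrier \<Gamma>)}"

definition conj_rep :: "'a monoid \<Rightarrow> 'n::finite psl \<Rightarrow> ('a, 'n) rep \<Rightarrow> ('a, 'n) rep"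
  where "conj_rep \<Gamma> x \<rho> = (\<lambda>\<gamma> \<in> carrier \<Gamma>. x \<otimes>\<^bsub>PSL\<^esub> \<rho> \<gamma> \<otimes>\<^bsub>PSL\<^esub> inv\<^bsub>PSL\<^esub> x)"

definition conj_class :: "'a monoid \<Rightarrow> ('a, 'n::finite) rep \<Rightarrow> ('a, 'n) rep set"
  where "conj_class \<Gamma> \<rho> = (\<lambda>x. conj_rep \<Gamma> x \<rho>) ` carrier PSL"

definition char_variety_topology ::
    "'a monoid \<Rightarrow> 'a set \<Rightarrow> ('a, 'n::finite) rep topology \<Rightarrow> ('a, 'n) rep set topology"
  where "char_variety_topology \<Gamma> S T =
    quotient_topology (subtopology (Hom_topology \<Gamma> S T) (irr_reps \<Gamma>)) (conj_class \<Gamma>)"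

definition sing_locus :: "'a monoid \<Rightarrow> ('a, 'n::finite) rep set set"
  where "sing_locus \<Gamma> = conj_class \<Gamma> ` bad_reps \<Gamma>"

definition sing_topology :: "'a monoid \<Rightarrow> 'a set \<Rightarrow> ('a, 'n::finite) rep set topology"
  where "sing_topology \<Gamma> S =
    subtopology (char_variety_topology \<Gamma> S (product_topology (\<lambda>_. PSL_topology) S)) (sing_locus \<Gamma>)"

text \<open>The set of classes of irreducible representations is a geometric quotient, so its Zariski
  topology is again the quotient topology.\<close>

definition sing_zariski :: "'a monoid \<Rightarrow> 'a set \<Rightarrow> ('a, 'n::finite) rep set topology"
  where "sing_zariski \<Gamma> S =
    subtopology (char_variety_topology \<Gamma> S (PSL_zariski S)) (sing_locus \<Gamma>)"

type_synonym 'n surface_rep = "(surface_letter word set, 'n) rep"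

text \<open>The images taken by \<open>the_elem\<close> below are singletons: the commutator product depends neither on
  the lifts nor on the representative of the conjugacy class.\<close>

definition euler :: "nat \<Rightarrow> 'n::finite surface_rep \<Rightarrow> complex ^ 'n ^ 'n"
  where "euler g \<rho> = the_elem
    ((\<lambda>(a, b). commutator_prod SL g a b) `
      {(a, b). \<forall>i. i \<in> {1..g} \<longrightarrow>
        a i \<in> \<rho> (surface_gen g (La i)) \<and> b i \<in> \<rho> (surface_gen g (Lb i))})"

definition euler_class :: "nat \<Rightarrow> 'n::finite surface_rep set \<Rightarrow> complex ^ 'n ^ 'n"
  where "euler_class g c = the_elem (euler g ` c)"

end

theory Submission
  imports Defs "HOL-Complex_Analysis.Conformal_Mappings"
    "HOL-Computational_Algebra.Fundamental_Theorem_Algebra"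
begin

text \<open>A representation of the surface group is recorded by a tuple of \<open>2 g\<close> lifts in \<open>SL\<close> whose product of
  commutators is central; this central value is the Euler invariant. Write \<open>p\<close> for the prime size of the matrices.
  If an irreducible representation is bad, then a noncentral matrix \<open>X\<close> commutes with each
  lift up to a \<open>p\<close>-th root of unity. The lifts then permute the eigenspaces of \<open>X\<close>, and because some
  of these roots of unity is primitive, there are \<open>p\<close> eigenlines, permuted cyclically. In a basis of eigenvectors
  every lift is monomial: an element of the torus of diagonal matrices times a power of the cyclic permutation matrix
  (\<open>nf_from_twisted\<close>). So the singular locus is the union of pieces, one for each
  vector \<open>c\<close> of exponents modulo \<open>p\<close>, not all zero, and each value \<open>z\<close> of the Euler invariant
  (\<open>sing_locus_pieces\<close>).

  One exponent can be normalised to \<open>1\<close> and the diagonal part of this letter to the identity. The Euler invariant of a monomial tuple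
  is a product of shifts of the diagonal parts, and the condition that it be \<open>z\<close> can be solved for the
  diagonal part of the partner letter (\<open>euler_solve\<close>). So every piece is the image of a product of \<open>2 (g - 1)\<close> tori of dimension \<open>p - 1\<close>,
  with the reducible tuples removed (\<open>piece_param\<close>).

  \<^emph>\<open>Components.\<close> The pieces are connected. Two pieces with the same \<open>z\<close> are joined by a chain of
  pieces in which neighbours share the class of a tuple in a finite Heisenberg group (\<open>link_hub\<close>). So the fibers of the Euler
  invariant are connected, and they are open because the Euler invariant is continuous with finitely many values (\<open>sing_components\<close>).

  \<^emph>\<open>Dimension.\<close> The parameters of a class of a piece form an orbit of a finite group, which acts by
  cyclic shifts and roots of unity. Polynomials in the parameters that are invariant under this group have Zariski closed zero sets in the
  singular locus (\<open>inv_poly_zero_set_closed\<close>) and separate points from closed sets (\<open>inv_poly_separation\<close>). A chain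
  of irreducible closed sets therefore gives algebraically independent Laurent polynomials (\<open>chain_alg_independent\<close>), of which there are at
  most as many as free coordinates (\<open>entry_polys_dependent\<close>). Conversely, prescribing the coordinates one
  after the other gives a chain of this length. Its members are irreducible because entire functions on a line
  have no zero divisors (\<open>irreducible_exp_closure\<close>).\<close>


section \<open>Roots of unity and cyclic index shifts\<close>

definition zeta :: "nat \<Rightarrow> complex"
  where "zeta p = cis (2 * pi / real p)"

lemma zeta_power: "zeta p ^ k = cis (2 * pi * real k / real p)"
  by (simp add: zeta_def Complex.DeMoivre mult_ac)

lemma zeta_power_self: "p > 0 \<Longrightarrow> zeta p ^ p = 1"
  by (simp add: zeta_power)

lemma zeta_nonzero [simp]: "zeta p \<noteq> 0"
  by (simp add: zeta_def)

lemma zeta_power_eq_1_iff: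
  assumes "p > 0" shows "zeta p ^ k = 1 \<longleftrightarrow> p dvd k"
proof
  assume "p dvd k"
  then show "zeta p ^ k = 1"
    using zeta_power_self[OF assms] by (auto simp: power_mult)
next
  assume 1: "zeta p ^ k = 1"
  have "zeta p ^ k = zeta p ^ (k mod p + p * (k div p))" by simp
  also have "\<dots> = zeta p ^ (k mod p)"
    unfolding power_add power_mult zeta_power_self[OF assms] by simp
  finally have "cis (2 * pi * real (k mod p) / real p) = cis (2 * pi * real 0 / real p)"
    using 1 by (simp add: zeta_power)
  moreover have "inj_on (\<lambda>j. cis (2 * pi * real j / real p)) {..<p}"
    using Complex.bij_betw_roots_unity[OF assms] by (rule bij_betw_imp_inj_on)
  ultimately have "k mod p = 0"
    using inj_onD[of "\<lambda>j. cis (2 * pi * real j / real p)" "{..<p}" "k mod p" 0] assms by auto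
  then show "p dvd k" by auto
qed

lemma zeta_power_cong: "p > 0 \<Longrightarrow> a mod p = b mod p \<Longrightarrow> zeta p ^ a = zeta p ^ b"
proof -
  assume p: "p > 0" and ab: "a mod p = b mod p"
  have "zeta p ^ k = zeta p ^ (k mod p)" for k
  proof -
    have "zeta p ^ k = zeta p ^ (k mod p + p * (k div p))" by simp
    also have "\<dots> = zeta p ^ (k mod p)"
      unfolding power_add power_mult zeta_power_self[OF p] by simp
    finally show ?thesis .
  qed
  then show ?thesis using ab by metis
qed

lemma root_of_unity_is_zeta_power:
  assumes p: "p > 0" and c: "c ^ p = 1"
  obtains k where "k < p" "c = zeta p ^ k"
proof -
  have "c \<in> (\<lambda>k. cis (2 * pi * real k / real p)) ` {..<p}"
    using Complex.bij_betw_roots_unity[OF p] c by (auto simp: bij_betw_def)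
  then show ?thesis using that by (auto simp: zeta_power)
qed

lemma sum_zeta_powers:
  assumes p: "p > 0"
  shows "(\<Sum>k<p. (zeta p ^ j) ^ k) = (if p dvd j then of_nat p else 0)"
proof (cases "p dvd j")
  case True
  then have "zeta p ^ j = 1" using zeta_power_eq_1_iff[OF p] by simp
  then show ?thesis using True by (simp only: power_one) simp
next
  case False
  then have ne: "zeta p ^ j \<noteq> 1" using zeta_power_eq_1_iff[OF p] by simp
  have "(zeta p ^ j) ^ p = 1"
    by (metis mult.commute power_mult zeta_power_self[OF p] power_one)
  then show ?thesis using False by (simp add: geometric_sum[OF ne])
qed

text \<open>The index type has no distinguished order, so an arbitrary numbering by residues is fixed; \<open>rot\<close> is
  addition of residues in it.\<close>

definition ix :: "'n::finite \<Rightarrow> nat"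
  where "ix = (SOME f. bij_betw f UNIV {..<CARD('n)})"

lemma bij_ix: "bij_betw (ix :: 'n::finite \<Rightarrow> nat) UNIV {..<CARD('n)}"
proof -
  have "\<exists>f. bij_betw f (UNIV :: 'n set) {..<CARD('n)}"
    using ex_bij_betw_finite_nat[of "UNIV :: 'n set"] by (auto simp: atLeast0LessThan)
  then show ?thesis unfolding ix_def by (rule someI_ex)
qed

lemma ix_less [simp]: "ix (l :: 'n::finite) < CARD('n)"
  using bij_ix[where 'n='n] by (auto simp: bij_betw_def)

lemma ix_eq_iff: "ix l = ix m \<longleftrightarrow> l = m"
  using bij_ix by (auto simp: bij_betw_def dest: injD)

lemma ex_ix: assumes "k < CARD('n)" shows "\<exists>l :: 'n::finite. ix l = k"
  using bij_ix[where 'n='n] assms unfolding bij_betw_def by (metis imageE lessThan_iff)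

definition rot :: "nat \<Rightarrow> 'n::finite \<Rightarrow> 'n"
  where "rot k l = (THE m. ix m = (ix l + k) mod CARD('n))"

lemma ix_rot: "ix (rot k l) = (ix l + k) mod CARD('n)" for l :: "'n::finite"
proof -
  have "\<exists>!m :: 'n. ix m = (ix l + k) mod CARD('n)"
    using ex_ix[of "(ix l + k) mod CARD('n)"] ix_eq_iff by (metis mod_less_divisor zero_less_card_finite)
  then show ?thesis unfolding rot_def by (rule theI')
qed

lemma rot_rot: "rot a (rot b l) = rot (a + b) l"
proof -
  have "ix (rot a (rot b l)) = ix (rot (a + b) l)"
    by (simp add: ix_rot mod_simps add_ac)
  then show ?thesis by (simp add: ix_eq_iff)
qed

lemma rot_cong: "a mod CARD('n) = b mod CARD('n) \<Longrightarrow> rot a l = rot b (l :: 'n::finite)"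
proof -
  assume "a mod CARD('n) = b mod CARD('n)"
  then have "ix (rot a l) = ix (rot b l)"
    by (simp add: ix_rot) (metis mod_add_right_eq)
  then show ?thesis by (simp add: ix_eq_iff)
qed

lemma rot_0 [simp]: "rot 0 l = l"
proof -
  have "ix (rot 0 l) = ix l" by (simp add: ix_rot)
  then show ?thesis by (simp add: ix_eq_iff)
qed

lemma rot_card [simp]: "rot CARD('n) l = (l :: 'n::finite)"
  using rot_cong[of "CARD('n)" 0 l] by simp

lemma bij_rot: "bij (rot k :: 'n::finite \<Rightarrow> 'n)"
proof -
  have "inj (rot k :: 'n \<Rightarrow> 'n)"
  proof (rule injI)
    fix x y :: 'n assume "rot k x = rot k y"
    then have "rot (CARD('n) - k mod CARD('n)) (rot k x) = rot (CARD('n) - k mod CARD('n)) (rot k y)" by simp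
    moreover have "rot (CARD('n) - k mod CARD('n)) (rot k z) = z" for z :: 'n
    proof -
      have "(CARD('n) - k mod CARD('n) + k) mod CARD('n) = (CARD('n) - k mod CARD('n) + k mod CARD('n)) mod CARD('n)"
        by (metis mod_add_right_eq)
      also have "\<dots> = 0"
        by (metis le_add_diff_inverse2 less_imp_le_nat mod_less_divisor mod_self zero_less_card_finite)
      finally show ?thesis by (simp add: rot_rot rot_cong[of _ 0 z])
    qed
    ultimately show "x = y" by simp
  qed
  then show ?thesis by (simp add: bij_def finite_UNIV_inj_surj)
qed

lemma rot_inj [simp]: "rot k x = rot k y \<longleftrightarrow> x = y"
  using bij_rot[of k] by (auto simp: bij_def dest: injD)

lemma ex_rot: "\<exists>k<CARD('n). m = rot k (l :: 'n::finite)"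
proof -
  let ?k = "(ix m + CARD('n) - ix l) mod CARD('n)"
  have "ix (rot ?k l) = ix m"
    by (simp add: ix_rot mod_simps) (simp add: less_imp_le trans_le_add2)
  then show ?thesis
    by (intro exI[of _ ?k]) (auto simp: ix_eq_iff)
qed

lemma add_mod_left_cancel: "(c + a) mod p = (c + b) mod p \<Longrightarrow> a mod p = b mod (p :: nat)"
  by (induction a b rule: linorder_wlog)
    (metis add_diff_cancel_left mod_eq_dvd_iff_nat nat_add_left_cancel_le, metis)

lemma rot_eq_iff: "rot a l = rot b (l :: 'n::finite) \<longleftrightarrow> a mod CARD('n) = b mod CARD('n)"
proof
  assume "rot a l = rot b l"
  then have "(ix l + a) mod CARD('n) = (ix l + b) mod CARD('n)"
    by (metis ix_rot)
  then show "a mod CARD('n) = b mod CARD('n)"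
    by (metis add_mod_left_cancel)
qed (rule rot_cong)

lemma prod_rot: "(\<Prod>l\<in>UNIV. f (rot k (l :: 'n::finite))) = prod f UNIV"
  using bij_rot[of k] by (intro prod.reindex_bij_betw)

lemma prod_all_rot: "(\<Prod>k<CARD('n). f (rot k (l :: 'n::finite))) = prod f UNIV"
proof (rule prod.reindex_bij_betw)
  have "inj_on (\<lambda>k. rot k l) {..<CARD('n)}"
    by (rule inj_onI) (simp add: rot_eq_iff)
  moreover have "(\<lambda>k. rot k l) ` {..<CARD('n)} = UNIV"
    using ex_rot[where l=l] by blast
  ultimately show "bij_betw (\<lambda>k. rot k l) {..<CARD('n)} UNIV"
    by (simp add: bij_betw_def)
qed

section \<open>Scalar and monomial matrices\<close>

lemma mat_mult_nth [simp]: "(mat c ** A) $ i $ j = c * A $ i $ j"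
  for A :: "complex ^ 'n::finite ^ 'n"
proof -
  have "(\<Sum>k\<in>UNIV. mat c $ i $ k * A $ k $ j) = (\<Sum>k\<in>UNIV. if k = i then c * A $ k $ j else 0)"
    by (intro sum.cong) (auto simp: mat_def)
  then show ?thesis by (simp add: matrix_matrix_mult_def)
qed

lemma mat_commute: "A ** mat c = mat c ** A" for A :: "complex ^ 'n::finite ^ 'n"
proof -
  have "(A ** mat c) $ i $ j = c * A $ i $ j" for i j
  proof -
    have "(\<Sum>k\<in>UNIV. A $ i $ k * mat c $ k $ j) = (\<Sum>k\<in>UNIV. if k = j then c * A $ i $ k else 0)"
      by (intro sum.cong) (auto simp: mat_def)
    then show ?thesis by (simp add: matrix_matrix_mult_def)
  qed
  then show ?thesis by (simp add: vec_eq_iff)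
qed

lemma mat_mult_mat: "mat c ** (mat d :: complex ^ 'n::finite ^ 'n) = mat (c * d)"
  by (simp add: vec_eq_iff) (simp add: mat_def)

lemma mat_vec: "mat c *v (v :: complex ^ 'n::finite) = c *s v"
proof -
  have "(\<Sum>j\<in>UNIV. mat c $ i $ j * v $ j) = (\<Sum>j\<in>UNIV. if j = i then c * v $ j else 0)" for i
    by (intro sum.cong) (auto simp: mat_def)
  then show ?thesis by (simp add: vec_eq_iff matrix_vector_mult_def)
qed

lemma det_mat: "det (mat c :: complex ^ 'n::finite ^ 'n) = c ^ CARD('n)"
  by (subst det_diagonal) (auto simp: mat_def)

lemma mat_eq_iff: "(mat c :: complex ^ 'n::finite ^ 'n) = mat d \<longleftrightarrow> c = d"
  by (auto simp: vec_eq_iff mat_def)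

lemma mat_left_commute: "A ** (mat c ** B) = mat c ** (A ** B)"
  for A B :: "complex ^ 'n::finite ^ 'n"
  by (metis mat_commute matrix_mul_assoc)

lemma matrix_left_cancel:
  fixes A B C :: "complex ^ 'n::finite ^ 'n"
  assumes "det A \<noteq> 0" "A ** B = A ** C" shows "B = C"
proof -
  obtain D where "D ** A = mat 1"
    using assms(1) by (auto simp: invertible_det_nz[symmetric] invertible_def)
  then show ?thesis using assms(2) by (metis matrix_mul_assoc matrix_mul_lid)
qed

lemma matrix_right_cancel:
  fixes A B C :: "complex ^ 'n::finite ^ 'n"
  assumes "det A \<noteq> 0" "B ** A = C ** A" shows "B = C"
proof -
  obtain D where "A ** D = mat 1"
    using assms(1) by (auto simp: invertible_det_nz[symmetric] invertible_def)
  then show ?thesis using assms(2) by (metis matrix_mul_assoc matrix_mul_rid)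
qed

definition mpow :: "complex ^ 'n::finite ^ 'n \<Rightarrow> nat \<Rightarrow> complex ^ 'n ^ 'n"
  where "mpow A k = ((**) A ^^ k) (mat 1)"

lemma mpow_0 [simp]: "mpow A 0 = mat 1"
  and mpow_Suc: "mpow A (Suc k) = A ** mpow A k"
  by (simp_all add: mpow_def)

lemma mpow_add: "mpow A (j + k) = mpow A j ** mpow A k"
  by (induction j) (simp_all add: mpow_Suc matrix_mul_assoc)

lemma det_mpow: "det (mpow A k) = det A ^ k"
  by (induction k) (simp_all add: mpow_Suc det_mul)

text \<open>A monomial matrix is a diagonal matrix times a power of the cyclic permutation matrix.
  The scalar \<open>mono_scale\<close> brings the permutation matrix into \<open>SL\<close>; it is needed because an even
  cycle (which for prime size only happens for two letters) has determinant \<open>-1\<close>.\<close>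

definition perm_mat :: "complex ^ 'n::finite ^ 'n"
  where "perm_mat = (\<chi> l m. if m = rot 1 l then 1 else 0)"

definition mono_scale :: "'n::finite itself \<Rightarrow> complex"
  where "mono_scale _ = (SOME e. e ^ CARD('n) * det (perm_mat :: complex ^ 'n ^ 'n) = 1)"

definition cyc_mono :: "complex ^ 'n::finite \<Rightarrow> nat \<Rightarrow> complex ^ 'n ^ 'n"
  where "cyc_mono x k = (\<chi> l m. if m = rot k l then mono_scale TYPE('n) ^ k * x $ l else 0)"

definition shift :: "nat \<Rightarrow> complex ^ 'n::finite \<Rightarrow> complex ^ 'n"
  where "shift k x = (\<chi> l. x $ rot k l)"

lemma shift_nth [simp]: "shift k x $ l = x $ rot k l"
  by (simp add: shift_def)

lemma vec_times_nth [simp]: "(x * y) $ l = x $ l * y $ l" for x y :: "complex ^ 'n::finite"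
  by (rule vector_mult_component)

lemma vec_one_nth [simp]: "(1 :: complex ^ 'n::finite) $ l = 1"
  by (rule one_index)

lemma vec_prod_nth: "(\<Prod>i\<in>I. f i) $ l = (\<Prod>i\<in>I. f i $ l)" for f :: "'i \<Rightarrow> complex ^ 'n::finite"
  by (induction I rule: infinite_finite_induct) simp_all

lemma sum_if_rot: "(\<Sum>j\<in>UNIV. if j = rot k (l :: 'n::finite) then f j else 0) = (f (rot k l) :: complex)"
  by simp

lemma cyc_mono_vec: "cyc_mono x k *v v = mono_scale TYPE('n) ^ k *s (x * shift k v)"
  for x v :: "complex ^ 'n::finite"
proof -
  have "(cyc_mono x k *v v) $ l = mono_scale TYPE('n) ^ k * (x $ l * v $ rot k l)" for l
  proof -
    have "(cyc_mono x k *v v) $ l =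
        (\<Sum>j\<in>UNIV. if j = rot k l then mono_scale TYPE('n) ^ k * x $ l * v $ j else 0)"
      unfolding matrix_vector_mult_def cyc_mono_def by (simp add: if_distrib if_distribR cong: if_cong)
    then show ?thesis by (simp add: mult_ac)
  qed
  then show ?thesis by (simp add: vec_eq_iff)
qed

lemma cyc_mono_mult: "cyc_mono x a ** cyc_mono y b = cyc_mono (x * shift a y) (a + b)"
  for x y :: "complex ^ 'n::finite"
proof -
  have "(cyc_mono x a ** cyc_mono y b) *v v = cyc_mono (x * shift a y) (a + b) *v v" for v :: "complex ^ 'n"
    by (simp add: matrix_vector_mul_assoc[symmetric] cyc_mono_vec vec_eq_iff rot_rot power_add add_ac mult_ac)
  then show ?thesis by (simp add: matrix_eq)
qed

lemma mono_scale: "mono_scale TYPE('n::finite) ^ CARD('n) * det (perm_mat :: complex ^ 'n ^ 'n) = 1"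
proof -
  define Q :: "complex ^ 'n ^ 'n" where "Q = (\<chi> l m. if m = rot (CARD('n) - 1) l then 1 else 0)"
  have "(perm_mat ** Q) $ i $ j = mat 1 $ i $ j" for i j
  proof -
    have "(perm_mat ** Q) $ i $ j = (\<Sum>k\<in>UNIV. if k = rot 1 i then Q $ k $ j else 0)"
      by (simp add: matrix_matrix_mult_def perm_mat_def if_distrib if_distribR cong: if_cong)
    also have "\<dots> = (if j = rot (CARD('n) - 1 + 1) i then 1 else 0)"
      by (simp only: sum_if_rot) (simp add: Q_def rot_rot)
    finally show ?thesis by (simp add: mat_def)
  qed
  then have "perm_mat ** Q = mat 1" by (simp add: vec_eq_iff)
  then have "det (perm_mat :: complex ^ 'n ^ 'n) * det Q = 1"
    by (metis det_I det_mul)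
  then have d: "det (perm_mat :: complex ^ 'n ^ 'n) \<noteq> 0" by auto
  obtain e :: complex where "e ^ CARD('n) = 1 / det (perm_mat :: complex ^ 'n ^ 'n)"
    by (metis exists_complex_root zero_less_card_finite less_not_refl)
  then have "\<exists>e. e ^ CARD('n) * det (perm_mat :: complex ^ 'n ^ 'n) = 1"
    using d by (metis nonzero_eq_divide_eq)
  then show ?thesis unfolding mono_scale_def by (rule someI_ex)
qed

lemma mono_scale_nonzero [simp]: "mono_scale TYPE('n::finite) \<noteq> 0"
  using mono_scale[where 'n='n] by (auto simp: power_0_left)

lemma det_cyc_mono: "det (cyc_mono x k) = (\<Prod>l\<in>UNIV. x $ l)" for x :: "complex ^ 'n::finite"
proof -
  have d: "det (cyc_mono x 0) = (\<Prod>l\<in>UNIV. x $ l)" for x :: "complex ^ 'n"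
    by (subst det_diagonal) (auto simp: cyc_mono_def)
  have "cyc_mono (1 :: complex ^ 'n) 1 = mat (mono_scale TYPE('n)) ** perm_mat"
    by (simp add: vec_eq_iff cyc_mono_def perm_mat_def)
  then have 1: "det (cyc_mono (1 :: complex ^ 'n) 1) = 1"
    using mono_scale[where 'n='n] by (simp add: det_mul det_mat)
  have "det (cyc_mono (1 :: complex ^ 'n) k) = 1" for k
  proof (induction k)
    case 0 show ?case by (simp add: d)
  next
    case (Suc k)
    have "cyc_mono (1 :: complex ^ 'n) (Suc k) = cyc_mono 1 1 ** cyc_mono 1 k"
      by (simp add: cyc_mono_mult vec_eq_iff shift_def) (simp add: cyc_mono_def)
    then show ?case using Suc 1 by (simp add: det_mul)
  qed
  moreover have "cyc_mono x k = cyc_mono x 0 ** cyc_mono 1 k"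
    by (simp add: cyc_mono_mult vec_eq_iff) (simp add: cyc_mono_def)
  ultimately show ?thesis by (simp add: det_mul d)
qed

text \<open>The diagonal parts of the monomial matrices of determinant one: a maximal torus of \<open>SL\<close>.\<close>

definition torus :: "(complex ^ 'n::finite) set"
  where "torus = {x. (\<Prod>l\<in>UNIV. x $ l) = 1}"

lemma torus_nonzero: "x \<in> torus \<Longrightarrow> x $ l \<noteq> 0"
  using prod_zero[of UNIV "\<lambda>l. x $ l"] by (auto simp: torus_def)

lemma torus_mult: "x \<in> torus \<Longrightarrow> y \<in> torus \<Longrightarrow> x * y \<in> torus"
  by (simp add: torus_def prod.distrib)

lemma torus_1 [simp]: "1 \<in> torus"
  by (simp add: torus_def)

lemma torus_shift: "x \<in> torus \<Longrightarrow> shift k x \<in> torus"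
  by (simp add: torus_def prod_rot)

lemma torus_prod: "(\<And>i. i \<in> I \<Longrightarrow> f i \<in> torus) \<Longrightarrow> (\<Prod>i\<in>I. f i) \<in> torus"
  by (induction I rule: infinite_finite_induct) (auto intro: torus_mult)

lemma det_cyc_mono_torus: "x \<in> torus \<Longrightarrow> det (cyc_mono x k) = 1"
  by (simp add: det_cyc_mono torus_def)

lemma shift_shift: "shift a (shift b x) = shift (a + b) x"
  by (simp add: vec_eq_iff rot_rot add_ac)

lemma shift_0 [simp]: "shift 0 x = x"
  by (simp add: vec_eq_iff)

lemma shift_card [simp]: "shift CARD('n) x = (x :: complex ^ 'n::finite)"
  by (simp add: vec_eq_iff)

lemma shift_mult: "shift k (x * y) = shift k x * shift k y"
  by (simp add: vec_eq_iff)

lemma shift_1 [simp]: "shift k 1 = 1"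
  by (simp add: vec_eq_iff)

lemma shift_cong: "a mod CARD('n) = b mod CARD('n) \<Longrightarrow> shift a x = shift b (x :: complex ^ 'n::finite)"
  by (simp add: vec_eq_iff rot_cong[of a b])

lemma shift_prod: "shift k (\<Prod>i\<in>I. f i) = (\<Prod>i\<in>I. shift k (f i))"
  by (simp add: vec_eq_iff vec_prod_nth)

lemma prod_all_shift: "x \<in> torus \<Longrightarrow> (\<Prod>k<CARD('n). shift k x) = (1 :: complex ^ 'n::finite)"
  by (simp add: vec_eq_iff vec_prod_nth prod_all_rot[of "\<lambda>l. x $ l"] torus_def)

definition const_vec :: "complex \<Rightarrow> complex ^ 'n::finite"
  where "const_vec c = (\<chi> l. c)"

lemma const_vec_nth [simp]: "const_vec c $ l = c"
  by (simp add: const_vec_def)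

lemma cyc_mono_const: "cyc_mono (const_vec c * x) k = mat c ** cyc_mono x k"
  by (simp add: vec_eq_iff) (simp add: cyc_mono_def)

lemma const_vec_torus: "const_vec c \<in> (torus :: (complex ^ 'n::finite) set) \<longleftrightarrow> c ^ CARD('n) = 1"
  by (simp add: torus_def)

lemma shift_const [simp]: "shift k (const_vec c) = const_vec c"
  by (simp add: vec_eq_iff)

lemma shift_1_eq_iff: "shift 1 x = x \<longleftrightarrow> (\<exists>c. x = const_vec c)" for x :: "complex ^ 'n::finite"
proof
  assume s: "shift 1 x = x"
  have "shift k x = x" for k
    by (induction k) (simp_all, metis s plus_1_eq_Suc shift_shift)
  then have "x $ rot k l = x $ l" for k l
    by (metis shift_nth)
  then have "x $ m = x $ l" for l m
    using ex_rot[of m l] by metis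
  then show "\<exists>c. x = const_vec c"
    by (auto simp: vec_eq_iff)
qed auto

section \<open>The center of SL and the projection to PSL\<close>

lemma carrier_SL: "A \<in> carrier SL \<longleftrightarrow> det A = 1"
  and mult_SL: "A \<otimes>\<^bsub>SL\<^esub> B = A ** B"
  and one_SL: "\<one>\<^bsub>SL\<^esub> = mat 1"
  by (simp_all add: SL_def)

lemma inv_SL:
  assumes "det A = 1"
  shows "A ** inv\<^bsub>SL\<^esub> A = mat 1" "inv\<^bsub>SL\<^esub> A ** A = mat 1" "det (inv\<^bsub>SL\<^esub> A) = 1"
  using group.r_inv[OF group_SL, of A] group.l_inv[OF group_SL, of A] group.inv_closed[OF group_SL, of A] assms
  by (simp_all add: carrier_SL mult_SL one_SL)

lemma inv_SL_unique:
  assumes "det A = 1" "A ** B = mat 1"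
  shows "inv\<^bsub>SL\<^esub> A = B"
proof (rule matrix_left_cancel)
  show "det A \<noteq> 0" using assms(1) by simp
  show "A ** inv\<^bsub>SL\<^esub> A = A ** B" unfolding inv_SL(1)[OF assms(1)] assms(2) ..
qed

lemma cyc_mono_inj: "cyc_mono x k = cyc_mono y k \<longleftrightarrow> x = y" for x y :: "complex ^ 'n::finite"
proof
  assume "cyc_mono x k = cyc_mono y k"
  then have "cyc_mono x k $ l $ rot k l = cyc_mono y k $ l $ rot k l" for l by simp
  then have "x $ l = y $ l" for l by (simp add: cyc_mono_def)
  then show "x = y" by (simp add: vec_eq_iff)
qed simp

lemma cyc_mono_const_0: "cyc_mono (const_vec c) 0 = mat c"
  by (simp add: cyc_mono_def mat_def vec_eq_iff)

lemma center_SL: "center (SL :: (complex ^ 'n::finite ^ 'n) monoid) = mat ` {c. c ^ CARD('n) = 1}"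
proof (intro equalityI subsetI)
  fix Z :: "complex ^ 'n ^ 'n" assume "Z \<in> mat ` {c. c ^ CARD('n) = 1}"
  then obtain c where "c ^ CARD('n) = 1" "Z = mat c" by blast
  then show "Z \<in> center SL"
    unfolding center_def by (simp add: carrier_SL mult_SL det_mat) (simp add: mat_commute)
next
  fix Z :: "complex ^ 'n ^ 'n" assume Z: "Z \<in> center SL"
  then have detZ: "det Z = 1" and comm: "\<And>A. det A = 1 \<Longrightarrow> A ** Z = Z ** A"
    by (auto simp: center_def carrier_SL mult_SL)
  have off: "Z $ i $ j = 0" if ij: "i \<noteq> j" for i j
  proof -
    define x :: "complex ^ 'n" where "x = (\<chi> l. if l = i then 2 else if l = j then 1 / 2 else 1)"
    have "(\<Prod>l\<in>UNIV. x $ l) = (\<Prod>l\<in>{i, j}. x $ l)"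
      by (rule prod.mono_neutral_right) (auto simp: x_def)
    then have "x \<in> torus" using ij by (simp add: torus_def x_def)
    then have "cyc_mono x 0 ** Z = Z ** cyc_mono x 0"
      by (intro comm det_cyc_mono_torus)
    then have "(cyc_mono x 0 ** Z) $ i $ j = (Z ** cyc_mono x 0) $ i $ j" by simp
    moreover have "(cyc_mono x 0 ** Z) $ i $ j = 2 * Z $ i $ j"
    proof -
      have "(cyc_mono x 0 ** Z) $ i $ j = (\<Sum>k\<in>UNIV. if k = i then x $ i * Z $ k $ j else 0)"
        by (simp add: matrix_matrix_mult_def cyc_mono_def if_distrib if_distribR cong: if_cong)
      then show ?thesis by (simp add: x_def)
    qed
    moreover have "(Z ** cyc_mono x 0) $ i $ j = Z $ i $ j / 2"
    proof -
      have "(Z ** cyc_mono x 0) $ i $ j = (\<Sum>k\<in>UNIV. if j = k then Z $ i $ k * x $ k else 0)"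
        by (simp add: matrix_matrix_mult_def cyc_mono_def if_distrib if_distribR cong: if_cong)
      then show ?thesis using ij by (simp add: x_def)
    qed
    ultimately show ?thesis by simp
  qed
  define z :: "complex ^ 'n" where "z = (\<chi> l. Z $ l $ l)"
  have Zz: "Z = cyc_mono z 0"
    using off by (auto simp: vec_eq_iff cyc_mono_def z_def)
  have "cyc_mono 1 1 ** Z = Z ** cyc_mono 1 1"
    by (rule comm) (simp add: det_cyc_mono_torus)
  then have "shift 1 z = z"
    by (simp add: Zz cyc_mono_mult cyc_mono_inj)
  then obtain c where "z = const_vec c"
    unfolding shift_1_eq_iff by blast
  then have "Z = mat c" by (simp add: Zz cyc_mono_const_0)
  moreover have "c ^ CARD('n) = 1"
    using detZ by (simp add: \<open>Z = mat c\<close> det_mat)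
  ultimately show "Z \<in> mat ` {c. c ^ CARD('n) = 1}" by blast
qed

lemma card_center_SL: "card (center (SL :: (complex ^ 'n::finite ^ 'n) monoid)) = CARD('n)"
  unfolding center_SL
  by (subst card_image) (auto simp: inj_on_def mat_eq_iff card_roots_unity_eq)

lemma PSL_proj_eq: "PSL_proj A = {mat c ** A | c. c ^ CARD('n) = 1}" for A :: "complex ^ 'n::finite ^ 'n"
  by (auto simp: PSL_proj_def r_coset_def center_SL mult_SL)

lemma PSL_proj_eq_iff:
  "PSL_proj A = PSL_proj B \<longleftrightarrow> (\<exists>c. c ^ CARD('n) = 1 \<and> B = mat c ** A)"
  for A B :: "complex ^ 'n::finite ^ 'n"
proof
  assume e: "PSL_proj A = PSL_proj B"
  have "B = mat 1 ** B" by simp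
  then have "B \<in> PSL_proj B"
    unfolding PSL_proj_eq by (intro CollectI exI[of _ 1]) simp
  then have "B \<in> PSL_proj A" by (simp only: e)
  then show "\<exists>c. c ^ CARD('n) = 1 \<and> B = mat c ** A"
    unfolding PSL_proj_eq by blast
next
  assume "\<exists>c. c ^ CARD('n) = 1 \<and> B = mat c ** A"
  then obtain c where c: "c ^ CARD('n) = 1" "B = mat c ** A" by blast
  then have c0: "c \<noteq> 0" by (auto simp: power_0_left)
  have sub: "PSL_proj (mat e ** M) \<subseteq> PSL_proj M" if e: "e ^ CARD('n) = 1" for e and M :: "complex ^ 'n ^ 'n"
  proof
    fix Y assume "Y \<in> PSL_proj (mat e ** M)"
    then obtain d where d: "d ^ CARD('n) = 1" "Y = mat d ** (mat e ** M)"
      unfolding PSL_proj_eq by blast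
    then have "Y = mat (d * e) ** M" by (simp add: matrix_mul_assoc mat_mult_mat)
    moreover have "(d * e) ^ CARD('n) = 1" using d e by (simp add: power_mult_distrib)
    ultimately show "Y \<in> PSL_proj M" unfolding PSL_proj_eq by blast
  qed
  have "mat (1 / c) ** B = A"
    using c c0 by (simp add: matrix_mul_assoc mat_mult_mat)
  moreover have "(1 / c) ^ CARD('n) = 1" using c by (simp add: power_divide)
  ultimately have "PSL_proj A \<subseteq> PSL_proj B" using sub[of "1 / c" B] by simp
  then show "PSL_proj A = PSL_proj B" using sub[OF c(1), of A] c(2) by simp
qed

lemma in_PSL_proj: "A \<in> PSL_proj A" for A :: "complex ^ 'n::finite ^ 'n"
  unfolding PSL_proj_eq by (rule CollectI, rule exI[of _ 1]) simp

lemma in_PSL_proj_iff: "B \<in> PSL_proj A \<longleftrightarrow> (\<exists>c. c ^ CARD('n) = 1 \<and> B = mat c ** A)"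
  for A B :: "complex ^ 'n::finite ^ 'n"
  unfolding PSL_proj_eq by blast

lemma carrier_PSL: "carrier PSL = PSL_proj ` {A. det A = 1}"
  by (auto simp: PSL_def FactGroup_def RCOSETS_def PSL_proj_def SL_def)

lemma PSL_proj_in: "det A = 1 \<Longrightarrow> PSL_proj A \<in> carrier PSL"
  by (auto simp: carrier_PSL)

lemma mult_PSL_proj:
  "det A = 1 \<Longrightarrow> det B = 1 \<Longrightarrow> PSL_proj A \<otimes>\<^bsub>PSL\<^esub> PSL_proj B = PSL_proj (A ** B)"
  using normal.rcos_sum[OF normal_center_SL, of A B]
  by (simp add: PSL_def FactGroup_def PSL_proj_def carrier_SL mult_SL)

lemma one_PSL: "\<one>\<^bsub>PSL\<^esub> = (PSL_proj (mat 1) :: 'n::finite psl)"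
  using group.coset_mult_one[OF group_SL, of "center (SL :: (complex ^ 'n ^ 'n) monoid)"]
  by (auto simp: PSL_def FactGroup_def PSL_proj_def one_SL center_def)

lemma inv_PSL_proj: "det A = 1 \<Longrightarrow> inv\<^bsub>PSL\<^esub> (PSL_proj A) = PSL_proj (inv\<^bsub>SL\<^esub> A)"
  by (rule group.inv_equality[OF group_PSL]) (simp_all add: mult_PSL_proj PSL_proj_in inv_SL one_PSL)

lemma PSL_elem:
  fixes x :: "'n::finite psl"
  assumes "x \<in> carrier PSL" "A \<in> x"
  shows "det A = 1" "x = PSL_proj A"
proof -
  obtain B where B: "det B = 1" "x = PSL_proj B"
    using assms(1) by (auto simp: carrier_PSL)
  then obtain c where c: "c ^ CARD('n) = 1" "A = mat c ** B"
    using assms(2) in_PSL_proj_iff by blast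
  then show "det A = 1" using B by (simp add: det_mul det_mat)
  show "x = PSL_proj A" using B c PSL_proj_eq_iff by metis
qed

section \<open>Homomorphisms out of a presented group\<close>

definition word_eval :: "('a, 'b) monoid_scheme \<Rightarrow> ('x \<Rightarrow> 'a) \<Rightarrow> 'x word \<Rightarrow> 'a"
  where "word_eval G f w =
    foldr (\<lambda>l a. (if snd l then f (fst l) else inv\<^bsub>G\<^esub> (f (fst l))) \<otimes>\<^bsub>G\<^esub> a) w \<one>\<^bsub>G\<^esub>"

lemma word_eval_Nil [simp]: "word_eval G f [] = \<one>\<^bsub>G\<^esub>"
  and word_eval_Cons: "word_eval G f (l # w) =
    (if snd l then f (fst l) else inv\<^bsub>G\<^esub> (f (fst l))) \<otimes>\<^bsub>G\<^esub> word_eval G f w"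
  by (simp_all add: word_eval_def)

context group
begin

lemma word_eval_closed: "f ` X \<subseteq> carrier G \<Longrightarrow> w \<in> words X \<Longrightarrow> word_eval G f w \<in> carrier G"
  by (induction w) (auto simp: word_eval_Cons words_def)

lemma word_eval_append:
  "f ` X \<subseteq> carrier G \<Longrightarrow> v \<in> words X \<Longrightarrow> w \<in> words X \<Longrightarrow>
    word_eval G f (v @ w) = word_eval G f v \<otimes> word_eval G f w"
proof (induction v)
  case Nil
  then show ?case by (simp add: word_eval_closed)
next
  case (Cons l v)
  then have "f (fst l) \<in> carrier G" "v \<in> words X" by (auto simp: words_def)
  with Cons show ?case
    by (simp add: word_eval_Cons word_eval_closed m_assoc)
qed

lemma word_eval_respects:
  assumes f: "f ` X \<subseteq> carrier G" and R: "\<And>r. r \<in> R \<Longrightarrow> r \<in> words X \<Longrightarrow> word_eval G f r = \<one>"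
    and uv: "(u, v) \<in> word_rel X R"
  shows "word_eval G f u = word_eval G f v"
  using uv
proof (induction rule: word_rel.induct)
  case (cancel u v x s)
  then have w: "[(x, s), (x, \<not> s)] \<in> words X" by (simp add: words_def)
  have "word_eval G f [(x, s), (x, \<not> s)] = \<one>"
    using cancel f by (auto simp: word_eval_Cons)
  then have "word_eval G f ([(x, s), (x, \<not> s)] @ v) = word_eval G f v"
    using cancel w f by (subst word_eval_append[of f X]) (auto simp: word_eval_closed)
  moreover have "[(x, s), (x, \<not> s)] @ v \<in> words X" using cancel by (simp add: words_def)
  ultimately show ?case
    using cancel f by (simp add: word_eval_append[of f X] del: append_Cons append_Nil)
next
  case (relator u v r)
  then have "word_eval G f (r @ v) = word_eval G f v"
    using R f by (subst word_eval_append[of f X]) (auto simp: word_eval_closed)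
  moreover have "r @ v \<in> words X" using relator by (simp add: words_def)
  ultimately show ?case
    using relator f by (simp add: word_eval_append[of f X])
qed simp_all

end

lemma carrier_presented: "U \<in> carrier (presented_group X R) \<longleftrightarrow> (\<exists>w\<in>words X. U = word_rel X R `` {w})"
  by (auto simp: presented_group_def quotient_def)

lemma presented_gen_in: "x \<in> X \<Longrightarrow> presented_gen X R x \<in> carrier (presented_group X R)"
  unfolding carrier_presented presented_gen_def by (rule bexI) (auto simp: words_def)

text \<open>Every word in the class of \<open>U\<close> evaluates to the same element once \<open>f\<close> sends the relators to one, so
  the choice of the word does not matter.\<close>

definition presented_hom :: "'x set \<Rightarrow> 'x word set \<Rightarrow> ('a, 'b) monoid_scheme \<Rightarrow> ('x \<Rightarrow> 'a) \<Rightarrow> 'x word set \<Rightarrow> 'a"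
  where "presented_hom X R G f =
    (\<lambda>U\<in>carrier (presented_group X R). word_eval G f (SOME w. w \<in> U))"

lemma presented_hom_class:
  assumes "group G" and f: "f ` X \<subseteq> carrier G"
    and R: "\<And>r. r \<in> R \<Longrightarrow> r \<in> words X \<Longrightarrow> word_eval G f r = \<one>\<^bsub>G\<^esub>" and w: "w \<in> words X"
  shows "presented_hom X R G f (word_rel X R `` {w}) = word_eval G f w"
proof -
  let ?U = "word_rel X R `` {w}"
  have "w \<in> ?U" using w by (simp add: word_rel.refl)
  then have "(SOME w. w \<in> ?U) \<in> ?U" by (rule someI)
  then have "(w, SOME w. w \<in> ?U) \<in> word_rel X R" by simp
  then have "word_eval G f w = word_eval G f (SOME w. w \<in> ?U)"
    using group.word_eval_respects[OF assms(1) f R] by blast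
  moreover have "?U \<in> carrier (presented_group X R)"
    using w carrier_presented by blast
  ultimately show ?thesis by (simp add: presented_hom_def)
qed

lemma presented_hom_hom:
  assumes "group G" and f: "f ` X \<subseteq> carrier G"
    and R: "\<And>r. r \<in> R \<Longrightarrow> r \<in> words X \<Longrightarrow> word_eval G f r = \<one>\<^bsub>G\<^esub>"
  shows "presented_hom X R G f \<in> hom (presented_group X R) G"
proof (rule homI)
  have cl: "presented_hom X R G f (word_rel X R `` {w}) = word_eval G f w" if "w \<in> words X" for w
    using presented_hom_class[OF assms(1) f _ that] R by blast
  fix U assume "U \<in> carrier (presented_group X R)"
  then obtain u where u: "u \<in> words X" "U = word_rel X R `` {u}"
    unfolding carrier_presented by blast
  show "presented_hom X R G f U \<in> carrier G"
    unfolding u(2) cl[OF u(1)] by (rule group.word_eval_closed[OF assms(1) f u(1)])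
  fix V assume "V \<in> carrier (presented_group X R)"
  then obtain v where v: "v \<in> words X" "V = word_rel X R `` {v}"
    unfolding carrier_presented by blast
  have uv: "u @ v \<in> words X" using u v by (simp add: words_def)
  show "presented_hom X R G f (U \<otimes>\<^bsub>presented_group X R\<^esub> V) =
      presented_hom X R G f U \<otimes>\<^bsub>G\<^esub> presented_hom X R G f V"
    unfolding u(2) v(2) presented_group_mult[OF u(1) v(1)] cl[OF u(1)]
      cl[OF v(1)] cl[OF uv]
    by (rule group.word_eval_append[OF assms(1) f u(1) v(1)])
qed

lemma presented_hom_gen:
  assumes "group G" and f: "f ` X \<subseteq> carrier G"
    and R: "\<And>r. r \<in> R \<Longrightarrow> r \<in> words X \<Longrightarrow> word_eval G f r = \<one>\<^bsub>G\<^esub>" and x: "x \<in> X"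
  shows "presented_hom X R G f (presented_gen X R x) = f x"
proof -
  have w: "[(x, True)] \<in> words X" using x by (simp add: words_def)
  have "f x \<in> carrier G" using f x by blast
  then show ?thesis
    using presented_hom_class[OF assms(1) f _ w] R group.is_monoid[OF assms(1)]
    by (fastforce simp: presented_gen_def word_eval_Cons monoid.r_one)
qed

lemma hom_presented_class:
  assumes "group G" and h: "h \<in> hom (presented_group X R) G" and w: "w \<in> words X"
  shows "h (word_rel X R `` {w}) = word_eval G (\<lambda>x. h (presented_gen X R x)) w"
  using w
proof (induction w)
  interpret gh: group_hom "presented_group X R" G h
    using assms(1) h group_presented_group by (auto simp: group_hom_def group_hom_axioms_def)
  case Nil
  have "word_rel X R `` {[]} = \<one>\<^bsub>presented_group X R\<^esub>" by (simp add: presented_group_def)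
  then show ?case using gh.hom_one by simp
next
  interpret gh: group_hom "presented_group X R" G h
    using assms(1) h group_presented_group by (auto simp: group_hom_def group_hom_axioms_def)
  case (Cons l w)
  obtain x s where l: "l = (x, s)" by force
  have x: "x \<in> X" and w: "w \<in> words X" and ls: "[(x, s)] \<in> words X" for s
    using Cons.prems l by (auto simp: words_def)
  have wc: "word_rel X R `` {w} \<in> carrier (presented_group X R)"
    and lc: "word_rel X R `` {[(x, s)]} \<in> carrier (presented_group X R)" for s
    using w ls carrier_presented by blast+
  have "word_rel X R `` {l # w} =
      word_rel X R `` {[(x, s)]} \<otimes>\<^bsub>presented_group X R\<^esub> word_rel X R `` {w}"
    using presented_group_mult[OF ls w] by (simp add: l)
  then have 1: "h (word_rel X R `` {l # w}) = h (word_rel X R `` {[(x, s)]}) \<otimes>\<^bsub>G\<^esub>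
      h (word_rel X R `` {w})"
    using gh.hom_mult[OF lc wc] by simp
  have "word_rel X R `` {[(x, False)]} \<otimes>\<^bsub>presented_group X R\<^esub> word_rel X R `` {[(x, True)]} =
      \<one>\<^bsub>presented_group X R\<^esub>"
    unfolding presented_group_mult[OF ls ls]
    using word_rel.cancel[of "[]" X "[]" x False R] x
    by (simp add: presented_group_def words_def equiv_class_eq[OF equiv_word_rel])
  then have "word_rel X R `` {[(x, False)]} = inv\<^bsub>presented_group X R\<^esub> (presented_gen X R x)"
    using gh.G.inv_equality[OF _ lc lc] by (simp add: presented_gen_def)
  then have "h (word_rel X R `` {[(x, False)]}) = inv\<^bsub>G\<^esub> (h (presented_gen X R x))"
    using gh.hom_inv[OF presented_gen_in[OF x]] by simp
  then have "h (word_rel X R `` {[(x, s)]}) =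
      (if s then h (presented_gen X R x) else inv\<^bsub>G\<^esub> (h (presented_gen X R x)))"
    by (cases s) (simp_all add: presented_gen_def)
  then show ?case
    using 1 Cons.IH[OF w] by (simp add: l word_eval_Cons)
qed

section \<open>Homomorphisms out of a surface group\<close>

lemma surface_relator_words: "surface_relator g \<in> words (surface_letters g)"
  by (auto simp: surface_relator_def words_def surface_letters_def)

lemma (in group) word_eval_surface_relator:
  assumes f: "f ` surface_letters g \<subseteq> carrier G"
  shows "word_eval G f (surface_relator g) = commutator_prod G g (\<lambda>i. f (La i)) (\<lambda>i. f (Lb i))"
proof -
  have f': "f (La i) \<in> carrier G" "f (Lb i) \<in> carrier G" if "i \<in> {1..g}" for i
    using f that by (auto simp: surface_letters_def)
  let ?w = "\<lambda>i. [(La i, True), (Lb i, True), (La i, False), (Lb i, False)]"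
  let ?c = "\<lambda>i. f (La i) \<otimes> f (Lb i) \<otimes> inv (f (La i)) \<otimes> inv (f (Lb i))"
  have "word_eval G f (concat (map ?w l)) = foldr (mult G) (map ?c l) \<one> \<and>
      foldr (mult G) (map ?c l) \<one> \<in> carrier G" if "set l \<subseteq> {1..g}" for l
    using that
  proof (induction l)
    case (Cons i l)
    then show ?case using f'[of i] by (simp add: word_eval_Cons m_assoc)
  qed simp
  moreover have "set [1..<Suc g] \<subseteq> {1..g}" by auto
  ultimately show ?thesis
    unfolding surface_relator_def commutator_prod_def by blast
qed

section \<open>Representations as tuples of matrices\<close>

lemma PSL_proj_hom: "PSL_proj \<in> hom SL PSL"
  by (rule homI) (simp_all add: carrier_SL mult_SL mult_PSL_proj PSL_proj_in)

lemma group_hom_PSL_proj: "group_hom SL PSL PSL_proj"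
  using group_SL group_PSL PSL_proj_hom by (simp add: group_hom_def group_hom_axioms_def)

lemma (in group_hom) hom_word_eval:
  assumes "f ` X \<subseteq> carrier G" "w \<in> words X"
  shows "h (word_eval G f w) = word_eval H (\<lambda>x. h (f x)) w"
  using assms(2)
proof (induction w)
  case (Cons l w)
  then have "f (fst l) \<in> carrier G" "w \<in> words X" using assms by (auto simp: words_def)
  then show ?case
    using Cons G.word_eval_closed[OF assms(1)] by (simp add: word_eval_Cons)
qed simp

lemma (in group) word_eval_commutes:
  assumes f: "f ` X \<subseteq> carrier G" and z: "z \<in> carrier G"
    and zf: "\<And>x. x \<in> X \<Longrightarrow> f x \<otimes> z = z \<otimes> f x" and w: "w \<in> words X"
  shows "word_eval G f w \<otimes> z = z \<otimes> word_eval G f w"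
  using w
proof (induction w)
  case Nil
  then show ?case using z by simp
next
  case (Cons l w)
  then have x: "fst l \<in> X" "f (fst l) \<in> carrier G" and w: "w \<in> words X"
    using assms by (auto simp: words_def)
  have c: "word_eval G f w \<in> carrier G" using w f by (rule word_eval_closed[rotated])
  define y where "y = (if snd l then f (fst l) else inv (f (fst l)))"
  have y: "y \<in> carrier G" using x by (simp add: y_def)
  have i: "inv (f (fst l)) \<otimes> z = z \<otimes> inv (f (fst l))"
    using zf[OF x(1)] x(2) z by (metis inv_closed inv_solve_left inv_solve_right m_assoc m_closed)
  have yz: "y \<otimes> z = z \<otimes> y"
    using zf[OF x(1)] i by (simp add: y_def)
  have "y \<otimes> word_eval G f w \<otimes> z = y \<otimes> (z \<otimes> word_eval G f w)"
    using Cons.IH[OF w] c y z by (simp add: m_assoc)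
  also have "\<dots> = y \<otimes> z \<otimes> word_eval G f w"
    using c y z by (simp add: m_assoc)
  also have "\<dots> = z \<otimes> (y \<otimes> word_eval G f w)"
    unfolding yz using c y z by (simp add: m_assoc)
  finally show ?case unfolding word_eval_Cons y_def[symmetric] .
qed

definition det_one :: "nat \<Rightarrow> (surface_letter \<Rightarrow> complex ^ 'n::finite ^ 'n) \<Rightarrow> bool"
  where "det_one g A \<longleftrightarrow> (\<forall>s\<in>surface_letters g. det (A s) = 1)"

definition euler_tuple :: "nat \<Rightarrow> (surface_letter \<Rightarrow> complex ^ 'n::finite ^ 'n) \<Rightarrow> complex ^ 'n ^ 'n"
  where "euler_tuple g A = commutator_prod SL g (\<lambda>i. A (La i)) (\<lambda>i. A (Lb i))"

text \<open>A representation is recorded by lifts of the images of the generators. These are subject to the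
  single condition that the product of their commutators is central, and its value is the Euler invariant.\<close>

definition rep_tuple :: "nat \<Rightarrow> (surface_letter \<Rightarrow> complex ^ 'n::finite ^ 'n) \<Rightarrow> bool"
  where "rep_tuple g A \<longleftrightarrow> det_one g A \<and> euler_tuple g A \<in> center SL"

definition rep_of :: "nat \<Rightarrow> (surface_letter \<Rightarrow> complex ^ 'n::finite ^ 'n) \<Rightarrow> 'n surface_rep"
  where "rep_of g A = presented_hom (surface_letters g) {surface_relator g} PSL (\<lambda>s. PSL_proj (A s))"

lemma det_one_D: "det_one g A \<Longrightarrow> s \<in> surface_letters g \<Longrightarrow> det (A s) = 1"
  by (simp add: det_one_def)

lemma det_one_image: "det_one g A \<Longrightarrow> A ` surface_letters g \<subseteq> carrier SL"
  by (auto simp: det_one_def carrier_SL)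

lemma det_one_PSL: "det_one g A \<Longrightarrow> (\<lambda>s. PSL_proj (A s)) ` surface_letters g \<subseteq> carrier PSL"
  by (auto simp: det_one_def intro: PSL_proj_in)

lemma word_eval_PSL:
  assumes "det_one g A" "w \<in> words (surface_letters g)"
  shows "word_eval PSL (\<lambda>s. PSL_proj (A s)) w = PSL_proj (word_eval SL A w)"
  using group_hom.hom_word_eval[OF group_hom_PSL_proj det_one_image[OF assms(1)] assms(2)] by simp

lemma word_eval_SL_relator:
  "det_one g A \<Longrightarrow> word_eval SL A (surface_relator g) = euler_tuple g A"
  unfolding euler_tuple_def
  by (rule group.word_eval_surface_relator[OF group_SL det_one_image])

lemma PSL_proj_one_iff: "PSL_proj A = \<one>\<^bsub>PSL\<^esub> \<longleftrightarrow> A \<in> center SL" for A :: "complex ^ 'n::finite ^ 'n"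
proof -
  have "PSL_proj A = \<one>\<^bsub>PSL\<^esub> \<longleftrightarrow> PSL_proj (mat 1) = PSL_proj A" by (auto simp: one_PSL)
  then show ?thesis by (auto simp: PSL_proj_eq_iff center_SL mat_mult_mat)
qed

lemma rep_tuple_relator:
  assumes "det_one g A"
  shows "word_eval PSL (\<lambda>s. PSL_proj (A s)) (surface_relator g) = \<one>\<^bsub>PSL\<^esub> \<longleftrightarrow> rep_tuple g A"
  using word_eval_PSL[OF assms surface_relator_words] word_eval_SL_relator[OF assms] assms
  by (simp add: PSL_proj_one_iff rep_tuple_def)

lemma rep_of_class:
  assumes "rep_tuple g A" "w \<in> words (surface_letters g)"
  shows "rep_of g A (word_rel (surface_letters g) {surface_relator g} `` {w}) = PSL_proj (word_eval SL A w)"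
proof -
  have d: "det_one g A" using assms(1) by (simp add: rep_tuple_def)
  show ?thesis
    unfolding rep_of_def word_eval_PSL[OF d assms(2), symmetric]
    by (rule presented_hom_class[OF group_PSL det_one_PSL[OF d] _ assms(2)])
      (use rep_tuple_relator[OF d] assms(1) in auto)
qed

lemma rep_of_Hom:
  assumes "rep_tuple g A"
  shows "rep_of g A \<in> Hom (surface_group g)"
proof -
  have d: "det_one g A" using assms(1) by (simp add: rep_tuple_def)
  have "rep_of g A \<in> hom (surface_group g) PSL"
    unfolding rep_of_def surface_group_def
    by (rule presented_hom_hom[OF group_PSL det_one_PSL[OF d]])
      (use rep_tuple_relator[OF d] assms(1) in auto)
  moreover have "rep_of g A \<in> extensional (carrier (surface_group g))"
    by (simp add: rep_of_def presented_hom_def surface_group_def)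
  ultimately show ?thesis by (simp add: Hom_def)
qed

lemma surface_gen_in: "s \<in> surface_letters g \<Longrightarrow> surface_gen g s \<in> carrier (surface_group g)"
  by (simp add: surface_gen_def surface_group_def presented_gen_in)

lemma rep_of_gen:
  assumes "rep_tuple g A" "s \<in> surface_letters g"
  shows "rep_of g A (surface_gen g s) = PSL_proj (A s)"
proof -
  have d: "det_one g A" using assms(1) by (simp add: rep_tuple_def)
  show ?thesis
    unfolding rep_of_def surface_gen_def
    by (rule presented_hom_gen[OF group_PSL det_one_PSL[OF d] _ assms(2)])
      (use rep_tuple_relator[OF d] assms(1) in auto)
qed

lemma word_eval_cong:
  "(\<And>x. x \<in> X \<Longrightarrow> f x = f' x) \<Longrightarrow> w \<in> words X \<Longrightarrow> word_eval G f w = word_eval G f' w"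
  by (induction w) (auto simp: word_eval_Cons words_def)

lemma Hom_is_rep_of:
  assumes r: "\<rho> \<in> Hom (surface_group g)" and A: "\<And>s. s \<in> surface_letters g \<Longrightarrow> A s \<in> \<rho> (surface_gen g s)"
  shows "rep_tuple g A" "\<rho> = rep_of g A"
proof -
  have h: "\<rho> \<in> hom (presented_group (surface_letters g) {surface_relator g}) PSL"
    using r by (simp add: Hom_def surface_group_def)
  have s: "det (A s) = 1" "\<rho> (surface_gen g s) = PSL_proj (A s)" if "s \<in> surface_letters g" for s
    using PSL_elem[OF hom_in_carrier[OF h] A[OF that]] surface_gen_in[OF that]
    by (auto simp: surface_group_def)
  then have d: "det_one g A" by (simp add: det_one_def)
  have cl: "\<rho> (word_rel (surface_letters g) {surface_relator g} `` {w}) =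
      word_eval PSL (\<lambda>s. PSL_proj (A s)) w" if w: "w \<in> words (surface_letters g)" for w
    unfolding hom_presented_class[OF group_PSL h w]
    by (rule word_eval_cong[OF _ w]) (simp add: s surface_gen_def[symmetric])
  let ?R = "word_rel (surface_letters g) {surface_relator g}"
  have "(surface_relator g, []) \<in> ?R"
    using word_rel.relator[of "[]" _ "[]" "surface_relator g" "{surface_relator g}"]
      surface_relator_words[of g] by (simp add: words_def)
  then have "?R `` {surface_relator g} = ?R `` {[]}"
    by (rule equiv_class_eq[OF equiv_word_rel])
  moreover have "[] \<in> words (surface_letters g)" by (simp add: words_def)
  ultimately have "word_eval PSL (\<lambda>s. PSL_proj (A s)) (surface_relator g) = \<one>\<^bsub>PSL\<^esub>"
    using cl[of "[]"] cl[OF surface_relator_words] by simp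
  then show t: "rep_tuple g A" using rep_tuple_relator[OF d] by simp
  show "\<rho> = rep_of g A"
  proof (rule extensionalityI)
    show "\<rho> \<in> extensional (carrier (surface_group g))" using r by (simp add: Hom_def)
    show "rep_of g A \<in> extensional (carrier (surface_group g))" using rep_of_Hom[OF t] by (simp add: Hom_def)
    fix U assume "U \<in> carrier (surface_group g)"
    then obtain w where w: "w \<in> words (surface_letters g)" "U = ?R `` {w}"
      unfolding surface_group_def carrier_presented by blast
    show "\<rho> U = rep_of g A U"
      unfolding w(2) cl[OF w(1)] rep_of_class[OF t w(1)] word_eval_PSL[OF d w(1)] ..
  qed
qed

lemma obtain_tuple:
  assumes "\<rho> \<in> Hom (surface_group g)"
  obtains A where "rep_tuple g A" "\<rho> = rep_of g A"
proof -
  have "\<exists>A. A \<in> \<rho> (surface_gen g s)" if "s \<in> surface_letters g" for s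
  proof -
    have "\<rho> (surface_gen g s) \<in> carrier PSL"
      using assms surface_gen_in[OF that] by (auto simp: Hom_def intro: hom_in_carrier)
    then show ?thesis unfolding carrier_PSL using in_PSL_proj by blast
  qed
  then have "\<forall>s\<in>surface_letters g. \<exists>A. A \<in> \<rho> (surface_gen g s)" by blast
  from bchoice[OF this] obtain A where "\<forall>s\<in>surface_letters g. A s \<in> \<rho> (surface_gen g s)" by blast
  then show ?thesis using that Hom_is_rep_of[OF assms] by blast
qed

lemma rep_of_eq_iff:
  fixes A B :: "surface_letter \<Rightarrow> complex ^ 'n::finite ^ 'n"
  assumes A: "rep_tuple g A" and B: "rep_tuple g B"
  shows "rep_of g A = rep_of g B \<longleftrightarrow>
    (\<forall>s\<in>surface_letters g. \<exists>c. c ^ CARD('n) = 1 \<and> B s = mat c ** A s)"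
proof
  assume "rep_of g A = rep_of g B"
  then show "\<forall>s\<in>surface_letters g. \<exists>c. c ^ CARD('n) = 1 \<and> B s = mat c ** A s"
    using rep_of_gen[OF A] rep_of_gen[OF B] PSL_proj_eq_iff by metis
next
  assume "\<forall>s\<in>surface_letters g. \<exists>c. c ^ CARD('n) = 1 \<and> B s = mat c ** A s"
  then have "B s \<in> rep_of g A (surface_gen g s)" if "s \<in> surface_letters g" for s
    using rep_of_gen[OF A that] in_PSL_proj_iff that by metis
  then show "rep_of g A = rep_of g B" by (rule Hom_is_rep_of(2)[OF rep_of_Hom[OF A]])
qed

lemma rep_tuple_scale:
  fixes A B :: "surface_letter \<Rightarrow> complex ^ 'n::finite ^ 'n"
  assumes A: "rep_tuple g A" and B: "\<forall>s\<in>surface_letters g. \<exists>c. c ^ CARD('n) = 1 \<and> B s = mat c ** A s"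
  shows "rep_tuple g B"
proof -
  have "B s \<in> rep_of g A (surface_gen g s)" if "s \<in> surface_letters g" for s
    using rep_of_gen[OF A that] in_PSL_proj_iff that B by metis
  then show ?thesis by (rule Hom_is_rep_of(1)[OF rep_of_Hom[OF A]])
qed

subsection \<open>The Euler invariant of a tuple\<close>

lemma inv_SL_mat_mult:
  assumes "c ^ CARD('n) = 1" "det A = 1"
  shows "inv\<^bsub>SL\<^esub> (mat c ** A) = mat (1 / c) ** inv\<^bsub>SL\<^esub> (A :: complex ^ 'n::finite ^ 'n)"
proof (rule inv_SL_unique)
  have "c \<noteq> 0" using assms(1) by (auto simp: power_0_left)
  have "mat c ** A ** (mat (1 / c) ** inv\<^bsub>SL\<^esub> A) = mat c ** (mat (1 / c) ** (A ** inv\<^bsub>SL\<^esub> A))"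
    by (metis mat_commute matrix_mul_assoc)
  then show "mat c ** A ** (mat (1 / c) ** inv\<^bsub>SL\<^esub> A) = mat 1"
    using \<open>c \<noteq> 0\<close> by (simp add: inv_SL[OF assms(2)] mat_mult_mat)
  show "det (mat c ** A) = 1" using assms by (simp add: det_mul det_mat)
qed

lemma mat_scaled_mult: "(mat c ** A) ** (mat d ** B) = mat (c * d) ** (A ** B)"
  for A B :: "complex ^ 'n::finite ^ 'n"
proof -
  have "(mat c ** A) ** (mat d ** B) = mat c ** (A ** mat d) ** B"
    by (simp only: matrix_mul_assoc)
  also have "\<dots> = (mat c ** mat d) ** (A ** B)"
    unfolding mat_commute[of A] by (simp only: matrix_mul_assoc)
  finally show ?thesis by (simp only: mat_mult_mat)
qed

lemma commutator_scale:
  fixes A B :: "complex ^ 'n::finite ^ 'n"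
  assumes c: "c ^ CARD('n) = 1" and d: "d ^ CARD('n) = 1" and A: "det A = 1" and B: "det B = 1"
  shows "(mat c ** A) ** (mat d ** B) ** inv\<^bsub>SL\<^esub> (mat c ** A) ** inv\<^bsub>SL\<^esub> (mat d ** B) =
    A ** B ** inv\<^bsub>SL\<^esub> A ** inv\<^bsub>SL\<^esub> B"
proof -
  have c0: "c \<noteq> 0" "d \<noteq> 0" using c d by (auto simp: power_0_left)
  have "(mat c ** A) ** (mat d ** B) ** (mat (1 / c) ** inv\<^bsub>SL\<^esub> A) ** (mat (1 / d) ** inv\<^bsub>SL\<^esub> B) =
    mat (c * d * (1 / c) * (1 / d)) ** (A ** B ** inv\<^bsub>SL\<^esub> A ** inv\<^bsub>SL\<^esub> B)"
    by (simp only: mat_scaled_mult)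
  also have "\<dots> = A ** B ** inv\<^bsub>SL\<^esub> A ** inv\<^bsub>SL\<^esub> B"
    using c0 by simp
  finally show ?thesis
    by (simp add: inv_SL_mat_mult[OF c A] inv_SL_mat_mult[OF d B])
qed

lemma euler_tuple_scale:
  fixes A B :: "surface_letter \<Rightarrow> complex ^ 'n::finite ^ 'n"
  assumes A: "det_one g A"
    and B: "\<forall>s\<in>surface_letters g. \<exists>c. c ^ CARD('n) = 1 \<and> B s = mat c ** A s"
  shows "euler_tuple g B = euler_tuple g A"
proof -
  have "B (La i) ** B (Lb i) ** inv\<^bsub>SL\<^esub> (B (La i)) ** inv\<^bsub>SL\<^esub> (B (Lb i)) =
      A (La i) ** A (Lb i) ** inv\<^bsub>SL\<^esub> (A (La i)) ** inv\<^bsub>SL\<^esub> (A (Lb i))" if "i \<in> {1..g}" for i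
  proof -
    have l: "La i \<in> surface_letters g" "Lb i \<in> surface_letters g"
      using that by (auto simp: surface_letters_def)
    obtain c d where c: "c ^ CARD('n) = 1" "B (La i) = mat c ** A (La i)"
      and d: "d ^ CARD('n) = 1" "B (Lb i) = mat d ** A (Lb i)" using B l by blast
    show ?thesis unfolding c(2) d(2)
      by (rule commutator_scale[OF c(1) d(1) det_one_D[OF A l(1)] det_one_D[OF A l(2)]])
  qed
  then show ?thesis
    unfolding euler_tuple_def commutator_prod_def mult_SL
    by (intro arg_cong[of _ _ "\<lambda>l. foldr _ l _"] map_cong) auto
qed

text \<open>Central factors of the lifts cancel in every commutator.\<close>

lemma euler_rep_of:
  fixes A :: "surface_letter \<Rightarrow> complex ^ 'n::finite ^ 'n"
  assumes A: "rep_tuple g A"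
  shows "euler g (rep_of g A) = euler_tuple g A"
proof -
  let ?S = "{(a, b). \<forall>i. i \<in> {1..g} \<longrightarrow>
        a i \<in> rep_of g A (surface_gen g (La i)) \<and> b i \<in> rep_of g A (surface_gen g (Lb i))}"
  have l: "La i \<in> surface_letters g" "Lb i \<in> surface_letters g" if "i \<in> {1..g}" for i
    using that by (auto simp: surface_letters_def)
  have "commutator_prod SL g a b = euler_tuple g A" if ab: "(a, b) \<in> ?S" for a b
  proof -
    define B where "B = (\<lambda>s. case s of La i \<Rightarrow> a i | Lb i \<Rightarrow> b i)"
    have "\<forall>s\<in>surface_letters g. \<exists>c. c ^ CARD('n) = 1 \<and> B s = mat c ** A s"
    proof
      fix s assume s: "s \<in> surface_letters g"
      then have "B s \<in> rep_of g A (surface_gen g s)"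
        using ab by (auto simp: surface_letters_def B_def)
      then show "\<exists>c. c ^ CARD('n) = 1 \<and> B s = mat c ** A s"
        unfolding rep_of_gen[OF A s] in_PSL_proj_iff .
    qed
    then have "euler_tuple g B = euler_tuple g A"
      using A by (intro euler_tuple_scale) (auto simp: rep_tuple_def)
    then show ?thesis by (simp add: euler_tuple_def B_def)
  qed
  moreover have "(\<lambda>i. A (La i), \<lambda>i. A (Lb i)) \<in> ?S"
    using l by (auto simp: rep_of_gen[OF A] intro: in_PSL_proj)
  ultimately have "(\<lambda>(a, b). commutator_prod SL g a b) ` ?S = {euler_tuple g A}"
  proof (intro equalityI subsetI)
    fix E assume "E \<in> {euler_tuple g A}"
    then have "E = (\<lambda>(a, b). commutator_prod SL g a b) (\<lambda>i. A (La i), \<lambda>i. A (Lb i))"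
      by (simp add: euler_tuple_def)
    then show "E \<in> (\<lambda>(a, b). commutator_prod SL g a b) ` ?S"
      using \<open>(\<lambda>i. A (La i), \<lambda>i. A (Lb i)) \<in> ?S\<close> by (rule image_eqI)
  qed (auto split: prod.splits)
  then show ?thesis by (simp add: euler_def)
qed

subsection \<open>Conjugation\<close>

definition conj_tuple :: "complex ^ 'n::finite ^ 'n \<Rightarrow> (surface_letter \<Rightarrow> complex ^ 'n ^ 'n) \<Rightarrow> surface_letter \<Rightarrow> complex ^ 'n ^ 'n"
  where "conj_tuple X A = (\<lambda>s. X ** A s ** inv\<^bsub>SL\<^esub> X)"

lemma conj_rep_Hom:
  fixes \<rho> :: "('a, 'n::finite) rep"
  assumes G: "group \<Gamma>" and r: "\<rho> \<in> Hom \<Gamma>" and x: "x \<in> carrier PSL"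
  shows "conj_rep \<Gamma> x \<rho> \<in> Hom \<Gamma>"
proof -
  interpret P: group "PSL :: 'n psl monoid" by (rule group_PSL)
  interpret G: group \<Gamma> by (rule G)
  have h: "\<rho> \<in> hom \<Gamma> PSL" using r by (simp add: Hom_def)
  have "conj_rep \<Gamma> x \<rho> \<in> hom \<Gamma> PSL"
  proof (rule homI)
    fix u assume u: "u \<in> carrier \<Gamma>"
    then have ru: "\<rho> u \<in> carrier PSL" by (rule hom_in_carrier[OF h])
    then show "conj_rep \<Gamma> x \<rho> u \<in> carrier PSL" using x u by (simp add: conj_rep_def)
    fix v assume v: "v \<in> carrier \<Gamma>"
    then have rv: "\<rho> v \<in> carrier PSL" by (rule hom_in_carrier[OF h])
    have "inv\<^bsub>PSL\<^esub> x \<otimes>\<^bsub>PSL\<^esub> (x \<otimes>\<^bsub>PSL\<^esub> (\<rho> v \<otimes>\<^bsub>PSL\<^esub> inv\<^bsub>PSL\<^esub> x)) = \<rho> v \<otimes>\<^bsub>PSL\<^esub> inv\<^bsub>PSL\<^esub> x"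
      using x rv by (simp add: P.m_assoc[symmetric])
    then show "conj_rep \<Gamma> x \<rho> (u \<otimes>\<^bsub>\<Gamma>\<^esub> v) = conj_rep \<Gamma> x \<rho> u \<otimes>\<^bsub>PSL\<^esub> conj_rep \<Gamma> x \<rho> v"
      using x u v ru rv hom_mult[OF h u v] by (simp add: conj_rep_def P.m_assoc)
  qed
  then show ?thesis by (simp add: Hom_def conj_rep_def)
qed

lemma group_surface_group: "group (surface_group g)"
  by (simp add: surface_group_def group_presented_group)

lemma conj_rep_of:
  assumes A: "rep_tuple g A" and X: "det X = 1"
  shows "rep_tuple g (conj_tuple X A)" "conj_rep (surface_group g) (PSL_proj X) (rep_of g A) = rep_of g (conj_tuple X A)"
proof -
  have d: "det_one g A" using A by (simp add: rep_tuple_def)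
  have "conj_tuple X A s \<in> conj_rep (surface_group g) (PSL_proj X) (rep_of g A) (surface_gen g s)"
    if s: "s \<in> surface_letters g" for s
  proof -
    have "conj_rep (surface_group g) (PSL_proj X) (rep_of g A) (surface_gen g s) = PSL_proj (conj_tuple X A s)"
      using surface_gen_in[OF s] X det_one_D[OF d s]
      by (simp add: conj_rep_def rep_of_gen[OF A s] inv_PSL_proj mult_PSL_proj conj_tuple_def
          inv_SL[OF X] det_mul)
    then show ?thesis by (simp add: in_PSL_proj)
  qed
  note * = Hom_is_rep_of[OF conj_rep_Hom[OF group_surface_group rep_of_Hom[OF A] PSL_proj_in[OF X]] this]
  show "rep_tuple g (conj_tuple X A)" by (rule *(1))
  show "conj_rep (surface_group g) (PSL_proj X) (rep_of g A) = rep_of g (conj_tuple X A)" by (rule *(2))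
qed

lemma conj_class_rep_of:
  "rep_tuple g A \<Longrightarrow>
    conj_class (surface_group g) (rep_of g A) = {rep_of g (conj_tuple X A) | X. det X = 1}"
  unfolding conj_class_def carrier_PSL image_image by (auto simp: conj_rep_of)

lemma euler_tuple_conj:
  assumes d: "det_one g A" and X: "det X = 1"
  shows "euler_tuple g (conj_tuple X A) = X ** euler_tuple g A ** inv\<^bsub>SL\<^esub> X"
proof -
  interpret S: group SL by (rule group_SL)
  have h: "(\<lambda>B. X ** B ** inv\<^bsub>SL\<^esub> X) \<in> hom SL SL"
  proof (rule homI)
    fix B C :: "complex ^ 'a ^ 'a" assume B: "B \<in> carrier SL" and C: "C \<in> carrier SL"
    then show "X ** B ** inv\<^bsub>SL\<^esub> X \<in> carrier SL" by (simp add: carrier_SL det_mul X inv_SL)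
    have "X ** B ** inv\<^bsub>SL\<^esub> X ** (X ** C ** inv\<^bsub>SL\<^esub> X) = X ** B ** (inv\<^bsub>SL\<^esub> X ** X) ** C ** inv\<^bsub>SL\<^esub> X"
      by (simp only: matrix_mul_assoc)
    then show "X ** (B \<otimes>\<^bsub>SL\<^esub> C) ** inv\<^bsub>SL\<^esub> X = X ** B ** inv\<^bsub>SL\<^esub> X \<otimes>\<^bsub>SL\<^esub> (X ** C ** inv\<^bsub>SL\<^esub> X)"
      by (simp add: mult_SL inv_SL[OF X] matrix_mul_assoc)
  qed
  then have gh: "group_hom SL SL (\<lambda>B. X ** B ** inv\<^bsub>SL\<^esub> X)"
    by (simp add: group_hom_def group_hom_axioms_def group_SL)
  have d': "det_one g (conj_tuple X A)"
    using d by (simp add: det_one_def conj_tuple_def det_mul X inv_SL)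
  show ?thesis
    unfolding word_eval_SL_relator[OF d, symmetric] word_eval_SL_relator[OF d', symmetric]
      group_hom.hom_word_eval[OF gh det_one_image[OF d] surface_relator_words]
    by (simp add: conj_tuple_def)
qed

lemma euler_conj_class:
  fixes A :: "surface_letter \<Rightarrow> complex ^ 'n::finite ^ 'n"
  assumes A: "rep_tuple g A"
  shows "euler_class g (conj_class (surface_group g) (rep_of g A)) = euler_tuple g A"
proof -
  have "euler g (rep_of g (conj_tuple X A)) = euler_tuple g A" if X: "det X = 1" for X
  proof -
    obtain c where c: "euler_tuple g A = mat c"
      using A by (auto simp: rep_tuple_def center_SL)
    have "euler g (rep_of g (conj_tuple X A)) = X ** euler_tuple g A ** inv\<^bsub>SL\<^esub> X"
      using A euler_tuple_conj[OF _ X, of g A] euler_rep_of[OF conj_rep_of(1)[OF A X]]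
      by (simp add: rep_tuple_def)
    also have "\<dots> = mat c ** (X ** inv\<^bsub>SL\<^esub> X)"
      unfolding c mat_commute[of X] by (simp only: matrix_mul_assoc)
    also have "\<dots> = mat c" by (simp add: inv_SL[OF X])
    finally show ?thesis by (simp add: c)
  qed
  moreover have "det (mat 1 :: complex ^ 'n ^ 'n) = 1" by simp
  ultimately have "euler g ` {rep_of g (conj_tuple X A) | X. det X = 1} = {euler_tuple g A}"
    by (auto simp: image_iff) (metis det_I)
  then show ?thesis by (simp add: euler_class_def conj_class_rep_of[OF A])
qed

lemma ex_det_one_scale:
  assumes "det (X :: complex ^ 'n::finite ^ 'n) \<noteq> 0"
  obtains d where "d \<noteq> 0" "det (mat d ** X) = 1"
proof -
  obtain d :: complex where d: "d ^ CARD('n) = 1 / det X"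
    by (metis exists_complex_root zero_less_card_finite less_not_refl)
  then have "det (mat d ** X) = 1" using assms by (simp add: det_mul det_mat)
  moreover have "d \<noteq> 0" using calculation by (auto simp: det_mul det_mat power_0_left)
  ultimately show ?thesis using that by blast
qed

text \<open>Conjugacy of the projective images, expressed by lifts.\<close>

definition equiv_tuple ::
    "nat \<Rightarrow> (surface_letter \<Rightarrow> complex ^ 'n::finite ^ 'n) \<Rightarrow> (surface_letter \<Rightarrow> complex ^ 'n ^ 'n) \<Rightarrow> bool"
  where "equiv_tuple g A B \<longleftrightarrow> (\<exists>X. det X \<noteq> 0 \<and>
    (\<forall>s\<in>surface_letters g. \<exists>c. c ^ CARD('n) = 1 \<and> B s ** X = mat c ** (X ** A s)))"

lemma rep_of_in_class_iff:
  fixes A B :: "surface_letter \<Rightarrow> complex ^ 'n::finite ^ 'n"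
  assumes A: "rep_tuple g A" and B: "rep_tuple g B"
  shows "rep_of g B \<in> conj_class (surface_group g) (rep_of g A) \<longleftrightarrow> equiv_tuple g A B"
proof -
  have eq: "B s ** X = mat c ** (X ** A s) \<longleftrightarrow> B s = mat c ** conj_tuple X A s" if "det X = 1" for X c s
  proof -
    have "conj_tuple X A s ** X = X ** A s ** (inv\<^bsub>SL\<^esub> X ** X)"
      unfolding conj_tuple_def by (simp only: matrix_mul_assoc)
    then have 1: "conj_tuple X A s ** X = X ** A s" by (simp add: inv_SL[OF that])
    have 2: "mat c ** conj_tuple X A s ** X = mat c ** (X ** A s)"
      by (simp only: matrix_mul_assoc[symmetric] 1)
    show ?thesis
    proof
      assume "B s ** X = mat c ** (X ** A s)"
      then have "B s ** X = mat c ** conj_tuple X A s ** X" by (simp only: 2)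
      then show "B s = mat c ** conj_tuple X A s"
        by (rule matrix_right_cancel[rotated]) (simp add: that)
    next
      assume "B s = mat c ** conj_tuple X A s"
      then show "B s ** X = mat c ** (X ** A s)" by (simp only: 2)
    qed
  qed
  have "rep_of g B \<in> conj_class (surface_group g) (rep_of g A) \<longleftrightarrow>
      (\<exists>X. det X = 1 \<and> rep_of g (conj_tuple X A) = rep_of g B)"
    unfolding conj_class_rep_of[OF A] mem_Collect_eq by metis
  also have "\<dots> \<longleftrightarrow> (\<exists>X. det X = 1 \<and> (\<forall>s\<in>surface_letters g. \<exists>c. c ^ CARD('n) = 1 \<and> B s ** X = mat c ** (X ** A s)))"
    using rep_of_eq_iff[OF conj_rep_of(1)[OF A] B] eq by (intro ex_cong) auto
  also have "\<dots> \<longleftrightarrow> equiv_tuple g A B"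
  proof
    assume "equiv_tuple g A B"
    then obtain X where X: "det X \<noteq> 0" "\<forall>s\<in>surface_letters g. \<exists>c. c ^ CARD('n) = 1 \<and> B s ** X = mat c ** (X ** A s)"
      by (auto simp: equiv_tuple_def)
    obtain d where d: "det (mat d ** X) = 1" using ex_det_one_scale[OF X(1)] by blast
    have "B s ** (mat d ** X) = mat c ** (mat d ** X ** A s)" if "B s ** X = mat c ** (X ** A s)" for c s
    proof -
      have "B s ** (mat d ** X) = mat d ** (mat c ** (X ** A s))"
        by (simp only: mat_left_commute[of "B s" d X] that)
      also have "\<dots> = mat c ** (mat d ** (X ** A s))" by (rule mat_left_commute)
      finally show ?thesis by (simp add: matrix_mul_assoc)
    qed
    then show "\<exists>X. det X = 1 \<and> (\<forall>s\<in>surface_letters g. \<exists>c. c ^ CARD('n) = 1 \<and> B s ** X = mat c ** (X ** A s))"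
      using X(2) d by (intro exI[of _ "mat d ** X"]) blast
  next
    assume "\<exists>X. det X = 1 \<and> (\<forall>s\<in>surface_letters g. \<exists>c. c ^ CARD('n) = 1 \<and> B s ** X = mat c ** (X ** A s))"
    then show "equiv_tuple g A B" unfolding equiv_tuple_def by (metis zero_neq_one)
  qed
  finally show ?thesis .
qed

section \<open>Irreducible and bad tuples\<close>

definition irr_tuple :: "nat \<Rightarrow> (surface_letter \<Rightarrow> complex ^ 'n::finite ^ 'n) \<Rightarrow> bool"
  where "irr_tuple g A \<longleftrightarrow> (\<forall>V. vec.subspace V \<and> (\<forall>s\<in>surface_letters g. \<forall>v\<in>V. A s *v v \<in> V) \<longrightarrow>
    V = {0} \<or> V = UNIV)"

lemma invertible_image_subspace:
  fixes A :: "complex ^ 'n::finite ^ 'n"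
  assumes "det A \<noteq> 0" "vec.subspace V" "\<And>v. v \<in> V \<Longrightarrow> A *v v \<in> V"
  shows "(*v) A ` V = V"
proof -
  have inj: "inj ((*v) A)"
    using assms(1) by (intro inj_matrix_vector_mult) (simp add: invertible_det_nz)
  have "vec.dim ((*v) A ` V) = vec.dim V"
    by (rule vec.dim_image_eq) (use inj inj_on_subset in auto)
  then show ?thesis
    using assms by (intro vec.subspace_dim_equal) (auto intro: vec.subspace_image)
qed

text \<open>Elementary matrices copy a nonzero coordinate of a vector to any other place, so an invariant
  nonzero subspace contains the standard basis.\<close>

lemma not_SL_invariant_subspace:
  fixes V :: "(complex ^ 'n::finite) set"
  assumes V: "vec.subspace V" "V \<noteq> {0}" "V \<noteq> UNIV"
  obtains M :: "complex ^ 'n ^ 'n" and v where "det M = 1" "v \<in> V" "M *v v \<notin> V"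
proof (rule ccontr)
  assume "\<not> thesis"
  with that have inv: "M *v v \<in> V" if "det M = 1" "v \<in> V" for M :: "complex ^ 'n ^ 'n" and v
    using \<open>det M = 1\<close> \<open>v \<in> V\<close> by blast
  have ax: "axis j (v $ i) \<in> V" if "v \<in> V" "i \<noteq> j" for i j v
  proof -
    define M :: "complex ^ 'n ^ 'n" where
      "M = (\<chi> k l. (if l = k then 1 else 0) + (if k = j \<and> l = i then 1 else 0))"
    have "M = (\<chi> k. if k = j then row j (mat 1) + 1 *s row i (mat 1) else row k (mat 1))"
      using that by (auto simp: M_def vec_eq_iff row_def mat_def)
    then have "det M = det (mat 1 :: complex ^ 'n ^ 'n)"
      using that det_row_operation[of j i "mat 1" "1 :: complex"] by simp
    then have "M *v v - v \<in> V" using inv[of M v] that V(1) by (intro vec.subspace_diff) auto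
    moreover have "(M *v v) $ k = v $ k + (if k = j then v $ i else 0)" for k
    proof -
      have "(M *v v) $ k = (\<Sum>l\<in>UNIV. (if l = k then v $ l else 0) +
          (if l = i then (if k = j then v $ l else 0) else 0))"
        unfolding matrix_vector_mult_def M_def by (simp, intro sum.cong) (auto simp: distrib_right)
      then show ?thesis by (simp add: sum.distrib)
    qed
    then have "M *v v - v = axis j (v $ i)" by (simp add: vec_eq_iff axis_def)
    ultimately show ?thesis by simp
  qed
  obtain v i where v: "v \<in> V" "v $ i \<noteq> 0"
  proof -
    obtain v where "v \<in> V" "v \<noteq> 0" using V(2) vec.subspace_0[OF V(1)] by blast
    then show thesis using that by (auto simp: vec_eq_iff)
  qed
  have e: "axis j 1 \<in> V" if "i \<noteq> j" for j
  proof -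
    have "(1 / v $ i) *s axis j (v $ i) \<in> V"
      by (rule vec.subspace_scale[OF V(1) ax[OF v(1) that]])
    moreover have "(1 / v $ i) *s axis j (v $ i) = axis j 1" using v by (simp add: vec_eq_iff axis_def)
    ultimately show ?thesis by simp
  qed
  have "axis i 1 \<in> V"
  proof (cases "\<exists>j. j \<noteq> i")
    case True
    then obtain j where j: "j \<noteq> i" by blast
    then show ?thesis using ax[OF e[of j], of j i] by (simp add: axis_def)
  next
    case False
    then have "axis i 1 = (1 / v $ i) *s v" using v by (auto simp: vec_eq_iff axis_def)
    then show ?thesis using vec.subspace_scale[OF V(1) v(1)] by simp
  qed
  then have all: "axis j 1 \<in> V" for j using e by (cases "i = j") auto
  have "w \<in> V" for w
  proof -
    have "(\<Sum>j\<in>UNIV. w $ j *s axis j 1) \<in> V"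
      by (intro vec.subspace_sum[OF V(1)] vec.subspace_scale[OF V(1)] all)
    then show ?thesis by (simp add: basis_expansion)
  qed
  then show False using V(3) by blast
qed

lemma rep_of_image_subgroup:
  assumes "rep_tuple g A"
  shows "subgroup (rep_of g A ` carrier (surface_group g)) PSL"
proof -
  have "group_hom (surface_group g) PSL (rep_of g A)"
    using rep_of_Hom[OF assms] group_surface_group group_PSL
    by (simp add: group_hom_def group_hom_axioms_def Hom_def)
  then show ?thesis by (rule group_hom.img_is_subgroup)
qed

lemma rep_of_image:
  assumes "rep_tuple g A"
  shows "rep_of g A ` carrier (surface_group g) = {PSL_proj (word_eval SL A w) | w. w \<in> words (surface_letters g)}"
  unfolding surface_group_def
proof (intro equalityI subsetI)
  let ?R = "word_rel (surface_letters g) {surface_relator g}"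
  fix x assume "x \<in> {PSL_proj (word_eval SL A w) | w. w \<in> words (surface_letters g)}"
  then obtain w where w: "w \<in> words (surface_letters g)" "x = rep_of g A (?R `` {w})"
    using rep_of_class[OF assms] by auto
  then show "x \<in> rep_of g A ` carrier (presented_group (surface_letters g) {surface_relator g})"
    using carrier_presented[of "?R `` {w}"] by blast
next
  fix x assume "x \<in> rep_of g A ` carrier (presented_group (surface_letters g) {surface_relator g})"
  then obtain w where "w \<in> words (surface_letters g)" "x = PSL_proj (word_eval SL A w)"
    by (auto simp: carrier_presented rep_of_class[OF assms])
  then show "x \<in> {PSL_proj (word_eval SL A w) | w. w \<in> words (surface_letters g)}" by blast
qed

lemma word_eval_stabilizes:
  fixes A :: "surface_letter \<Rightarrow> complex ^ 'n::finite ^ 'n"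
  assumes A: "det_one g A" and V: "\<And>s. s \<in> surface_letters g \<Longrightarrow> (*v) (A s) ` V = V"
    and w: "w \<in> words (surface_letters g)"
  shows "(*v) (word_eval SL A w) ` V = V"
  using w
proof (induction w)
  case Nil
  then show ?case by (simp add: one_SL)
next
  case (Cons l w)
  then have s: "fst l \<in> surface_letters g" and w: "w \<in> words (surface_letters g)"
    by (auto simp: words_def)
  have d: "det (A (fst l)) = 1" using A s by (rule det_one_D)
  have "(*v) (inv\<^bsub>SL\<^esub> (A (fst l))) ` V = (*v) (inv\<^bsub>SL\<^esub> (A (fst l))) ` ((*v) (A (fst l)) ` V)"
    using V[OF s] by simp
  also have "\<dots> = V" by (simp add: image_image matrix_vector_mul_assoc inv_SL[OF d])
  finally have i: "(*v) (inv\<^bsub>SL\<^esub> (A (fst l))) ` V = V" .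
  let ?y = "if snd l then A (fst l) else inv\<^bsub>SL\<^esub> (A (fst l))"
  have "(*v) (?y ** word_eval SL A w) ` V = (*v) ?y ` ((*v) (word_eval SL A w) ` V)"
    by (simp add: image_image matrix_vector_mul_assoc)
  also have "\<dots> = V" using Cons.IH[OF w] i V[OF s] by simp
  finally show ?case by (simp add: word_eval_Cons mult_SL)
qed

lemma subspace_scale_image:
  fixes M :: "complex ^ 'n::finite ^ 'n"
  assumes "vec.subspace V" "c \<noteq> 0"
  shows "(*v) (mat c ** M) ` V = (*v) M ` V"
proof -
  have "(*s) c ` V = V"
  proof (intro equalityI subsetI)
    fix v assume "v \<in> V"
    then have "(1 / c) *s v \<in> V" by (rule vec.subspace_scale[OF assms(1)])
    moreover have "v = c *s ((1 / c) *s v)" using assms(2) by (simp add: vec_eq_iff)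
    ultimately show "v \<in> (*s) c ` V" by blast
  qed (use vec.subspace_scale[OF assms(1)] in auto)
  moreover have "(*v) (mat c ** M) ` V = (*v) M ` ((*s) c ` V)"
    unfolding image_image mat_commute[of M c, symmetric] matrix_vector_mul_assoc[symmetric] mat_vec ..
  ultimately show ?thesis by simp
qed

text \<open>The stabilizer of a proper nonzero subspace is a proper parabolic subgroup, because \<open>SL\<close> stabilizes no
  such subspace; conversely a flag whose stabilizer is proper has a proper nonzero member.\<close>

lemma irreducible_rep_of_iff:
  fixes A :: "surface_letter \<Rightarrow> complex ^ 'n::finite ^ 'n"
  assumes A: "rep_tuple g A"
  shows "irreducible_subgroup (rep_of g A ` carrier (surface_group g)) \<longleftrightarrow> irr_tuple g A"
proof
  have d: "det_one g A" using A by (simp add: rep_tuple_def)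
  assume irr: "irreducible_subgroup (rep_of g A ` carrier (surface_group g))"
  show "irr_tuple g A"
    unfolding irr_tuple_def
  proof (intro allI impI; elim conjE)
    fix V assume V: "vec.subspace V" and inv: "\<forall>s\<in>surface_letters g. \<forall>v\<in>V. A s *v v \<in> V"
    show "V = {0} \<or> V = UNIV"
    proof (rule ccontr)
      assume "\<not> (V = {0} \<or> V = UNIV)"
      then obtain M v where M: "det M = 1" "v \<in> V" "M *v v \<notin> V"
        using not_SL_invariant_subspace[OF V] by metis
      have sV: "(*v) (A s) ` V = V" if "s \<in> surface_letters g" for s
        using det_one_D[OF d that] inv that by (intro invertible_image_subspace V) auto
      define P where "P = flag_stabilizer {V}"
      have "parabolic P" unfolding parabolic_def P_def is_flag_def
        using V by (intro exI[of _ "{V}"]) (auto simp: subset.chain_def)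
      moreover have "PSL_proj M \<notin> P"
        using M in_PSL_proj[of M] by (auto simp: P_def flag_stabilizer_def)
      then have "P \<noteq> carrier PSL" using PSL_proj_in[OF M(1)] by blast
      moreover have "rep_of g A ` carrier (surface_group g) \<subseteq> P"
      proof
        fix x assume x: "x \<in> rep_of g A ` carrier (surface_group g)"
        then obtain w where w: "w \<in> words (surface_letters g)" "x = PSL_proj (word_eval SL A w)"
          unfolding rep_of_image[OF A] by blast
        have "(*v) B ` V = V" if "B \<in> x" for B
        proof -
          obtain c where c: "c ^ CARD('n) = 1" "B = mat c ** word_eval SL A w"
            using \<open>B \<in> x\<close> unfolding w(2) in_PSL_proj_iff by blast
          then have "c \<noteq> 0" by (auto simp: power_0_left)
          then show ?thesis
            using subspace_scale_image[OF V, of c "word_eval SL A w"] word_eval_stabilizes[OF d sV w(1)] c(2)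
            by (simp only: simp_thms)
        qed
        moreover have "x \<in> carrier PSL"
          using x subgroup.subset[OF rep_of_image_subgroup[OF A]] by blast
        ultimately show "x \<in> P" by (simp add: P_def flag_stabilizer_def)
      qed
      ultimately show False using irr by (auto simp: irreducible_subgroup_def)
    qed
  qed
next
  have d: "det_one g A" using A by (simp add: rep_tuple_def)
  assume irr: "irr_tuple g A"
  show "irreducible_subgroup (rep_of g A ` carrier (surface_group g))"
    unfolding irreducible_subgroup_def
  proof (intro conjI notI rep_of_image_subgroup A; elim exE conjE)
    fix P assume P: "parabolic P" "P \<noteq> carrier PSL" and sub: "rep_of g A ` carrier (surface_group g) \<subseteq> P"
    obtain F where F: "is_flag F" "P = flag_stabilizer F" using P(1) by (auto simp: parabolic_def)
    have "P \<subseteq> carrier PSL" by (auto simp: F(2) flag_stabilizer_def)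
    then obtain x where x: "x \<in> carrier PSL" "x \<notin> P" using P(2) by blast
    then obtain B V where B: "B \<in> x" "V \<in> F" "(*v) B ` V \<noteq> V"
      by (auto simp: F(2) flag_stabilizer_def)
    have V: "vec.subspace V" using F(1) B(2) by (auto simp: is_flag_def subset.chain_def)
    have "A s *v v \<in> V" if s: "s \<in> surface_letters g" and v: "v \<in> V" for s v
    proof -
      have "rep_of g A (surface_gen g s) \<in> P" using sub surface_gen_in[OF s] by blast
      then have "PSL_proj (A s) \<in> P" by (simp add: rep_of_gen[OF A s])
      then have "(*v) (A s) ` V = V"
        using B(2) in_PSL_proj[of "A s"] unfolding F(2) flag_stabilizer_def by blast
      then show ?thesis using v by blast
    qed
    then have V01: "V = {0} \<or> V = UNIV" using irr V unfolding irr_tuple_def by blast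
    have dB: "det B = 1" by (rule PSL_elem(1)[OF x(1) B(1)])
    have "(*v) B ` V = V"
      using V01 dB by (intro invertible_image_subspace V) auto
    then show False using B(3) by simp
  qed
qed

definition bad_tuple :: "nat \<Rightarrow> (surface_letter \<Rightarrow> complex ^ 'n::finite ^ 'n) \<Rightarrow> bool"
  where "bad_tuple g A \<longleftrightarrow> rep_tuple g A \<and> irr_tuple g A \<and>
    (\<exists>X. det X = 1 \<and> X \<notin> center SL \<and>
      (\<forall>s\<in>surface_letters g. \<exists>c. c ^ CARD('n) = 1 \<and> A s ** X = mat c ** (X ** A s)))"

text \<open>Commuting in \<open>PSL\<close> means commuting up to a central factor in \<open>SL\<close>, and for the centralizer of a subgroup it suffices to look at
  generators.\<close>

lemma bad_rep_of_iff:
  fixes A :: "surface_letter \<Rightarrow> complex ^ 'n::finite ^ 'n"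
  assumes A: "rep_tuple g A"
  shows "rep_of g A \<in> bad_reps (surface_group g) \<longleftrightarrow> bad_tuple g A"
proof -
  have d: "det_one g A" using A by (simp add: rep_tuple_def)
  let ?H = "rep_of g A ` carrier (surface_group g)"
  interpret P: group "PSL :: 'n psl monoid" by (rule group_PSL)
  have "\<one>\<^bsub>PSL\<^esub> \<in> centralizer PSL ?H"
    using subgroup.subset[OF rep_of_image_subgroup[OF A]] by (auto simp: centralizer_def)
  then have "centralizer PSL ?H \<noteq> {\<one>\<^bsub>PSL\<^esub>} \<longleftrightarrow> (\<exists>z\<in>carrier PSL. z \<noteq> \<one>\<^bsub>PSL\<^esub> \<and> z \<in> centralizer PSL ?H)"
    by (auto simp: centralizer_def)
  also have "\<dots> \<longleftrightarrow> (\<exists>X. det X = 1 \<and> X \<notin> center SL \<and> PSL_proj X \<in> centralizer PSL ?H)"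
    by (auto simp: carrier_PSL PSL_proj_one_iff)
  also have "\<dots> \<longleftrightarrow> (\<exists>X. det X = 1 \<and> X \<notin> center SL \<and>
      (\<forall>s\<in>surface_letters g. \<exists>c. c ^ CARD('n) = 1 \<and> A s ** X = mat c ** (X ** A s)))"
  proof (rule ex_cong1, rule conj_cong[OF HOL.refl], rule conj_cong[OF HOL.refl])
    fix X :: "complex ^ 'n ^ 'n" assume X: "det X = 1" and "X \<notin> center SL"
    have com: "PSL_proj (A s) \<otimes>\<^bsub>PSL\<^esub> PSL_proj X = PSL_proj X \<otimes>\<^bsub>PSL\<^esub> PSL_proj (A s) \<longleftrightarrow>
        (\<exists>c. c ^ CARD('n) = 1 \<and> A s ** X = mat c ** (X ** A s))" if "s \<in> surface_letters g" for s
      unfolding mult_PSL_proj[OF X det_one_D[OF d that]] mult_PSL_proj[OF det_one_D[OF d that] X]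
      using PSL_proj_eq_iff[of "X ** A s" "A s ** X"] by auto
    show "PSL_proj X \<in> centralizer PSL ?H \<longleftrightarrow>
        (\<forall>s\<in>surface_letters g. \<exists>c. c ^ CARD('n) = 1 \<and> A s ** X = mat c ** (X ** A s))"
    proof
      assume Z: "PSL_proj X \<in> centralizer PSL ?H"
      show "\<forall>s\<in>surface_letters g. \<exists>c. c ^ CARD('n) = 1 \<and> A s ** X = mat c ** (X ** A s)"
      proof
        fix s assume s: "s \<in> surface_letters g"
        have "PSL_proj (A s) \<in> ?H"
          using rep_of_gen[OF A s] surface_gen_in[OF s] by (metis imageI)
        then show "\<exists>c. c ^ CARD('n) = 1 \<and> A s ** X = mat c ** (X ** A s)"
          using Z com[OF s] by (auto simp: centralizer_def)
      qed
    next
      assume "\<forall>s\<in>surface_letters g. \<exists>c. c ^ CARD('n) = 1 \<and> A s ** X = mat c ** (X ** A s)"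
      then have c: "PSL_proj (A s) \<otimes>\<^bsub>PSL\<^esub> PSL_proj X = PSL_proj X \<otimes>\<^bsub>PSL\<^esub> PSL_proj (A s)"
        if "s \<in> surface_letters g" for s using com that by blast
      show "PSL_proj X \<in> centralizer PSL ?H"
        unfolding centralizer_def
      proof (intro CollectI conjI ballI PSL_proj_in X)
        fix x assume "x \<in> ?H"
        then obtain w where w: "w \<in> words (surface_letters g)" "x = PSL_proj (word_eval SL A w)"
          unfolding rep_of_image[OF A] by blast
        show "x \<otimes>\<^bsub>PSL\<^esub> PSL_proj X = PSL_proj X \<otimes>\<^bsub>PSL\<^esub> x"
          unfolding w(2) word_eval_PSL[OF d w(1), symmetric]
          by (rule P.word_eval_commutes[OF det_one_PSL[OF d] PSL_proj_in[OF X] c w(1)])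
      qed
    qed
  qed
  finally show ?thesis
    using A irreducible_rep_of_iff[OF A] rep_of_Hom[OF A]
    by (simp add: bad_reps_def bad_subgroup_def bad_tuple_def)
qed

lemma irr_rep_of_iff:
  "rep_tuple g A \<Longrightarrow> rep_of g A \<in> irr_reps (surface_group g) \<longleftrightarrow> irr_tuple g A"
  by (simp add: irr_reps_def irreducible_rep_of_iff rep_of_Hom)

lemma bad_reps_irr: "bad_reps \<Gamma> \<subseteq> irr_reps \<Gamma>"
  by (auto simp: bad_reps_def irr_reps_def bad_subgroup_def)

definition tuple_class :: "nat \<Rightarrow> (surface_letter \<Rightarrow> complex ^ 'n::finite ^ 'n) \<Rightarrow> 'n surface_rep set"
  where "tuple_class g A = conj_class (surface_group g) (rep_of g A)"

lemma sing_locus_tuples: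
  "(sing_locus (surface_group g) :: 'n::finite surface_rep set set) = tuple_class g ` {A. bad_tuple g A}"
proof (intro equalityI subsetI)
  fix c :: "'n surface_rep set" assume "c \<in> sing_locus (surface_group g)"
  then obtain \<rho> where r: "\<rho> \<in> bad_reps (surface_group g)" "c = conj_class (surface_group g) \<rho>"
    by (auto simp: sing_locus_def)
  then have "\<rho> \<in> Hom (surface_group g)" by (auto simp: bad_reps_def)
  then obtain A where "rep_tuple g A" "\<rho> = rep_of g A" by (rule obtain_tuple)
  then show "c \<in> tuple_class g ` {A. bad_tuple g A}"
    using r bad_rep_of_iff by (auto simp: tuple_class_def)
next
  fix c :: "'n surface_rep set" assume "c \<in> tuple_class g ` {A. bad_tuple g A}"
  then show "c \<in> sing_locus (surface_group g)"
    using bad_rep_of_iff by (auto simp: tuple_class_def sing_locus_def bad_tuple_def)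
qed

lemma conj_class_refl:
  fixes A :: "surface_letter \<Rightarrow> complex ^ 'n::finite ^ 'n"
  assumes "rep_tuple g A"
  shows "rep_of g A \<in> tuple_class g A"
  unfolding tuple_class_def
proof (subst rep_of_in_class_iff[OF assms assms])
  have "\<forall>s\<in>surface_letters g. A s ** mat 1 = mat 1 ** (mat 1 ** A s)" by simp
  then show "equiv_tuple g A A"
    unfolding equiv_tuple_def by (intro exI[of _ "mat 1"] conjI ballI exI[of _ 1]) simp_all
qed

lemma equiv_tuple_sym:
  fixes A B :: "surface_letter \<Rightarrow> complex ^ 'n::finite ^ 'n"
  assumes "equiv_tuple g A B" shows "equiv_tuple g B A"
proof -
  obtain X where X: "det X \<noteq> 0" "\<forall>s\<in>surface_letters g. \<exists>c. c ^ CARD('n) = 1 \<and> B s ** X = mat c ** (X ** A s)"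
    using assms by (auto simp: equiv_tuple_def)
  then obtain Y where Y: "X ** Y = mat 1" "Y ** X = mat 1"
    unfolding invertible_det_nz[symmetric] invertible_def by blast
  have "det X * det Y = 1" using Y by (metis det_mul det_I)
  then have "det Y \<noteq> 0" by auto
  moreover have "\<exists>c. c ^ CARD('n) = 1 \<and> A s ** Y = mat c ** (Y ** B s)" if s: "s \<in> surface_letters g" for s
  proof -
    obtain c where c: "c ^ CARD('n) = 1" "B s ** X = mat c ** (X ** A s)" using X s by blast
    then have c0: "c \<noteq> 0" by (auto simp: power_0_left)
    have "Y ** (B s ** X) ** Y = Y ** (mat c ** (X ** A s)) ** Y" by (simp only: c)
    moreover have "Y ** (B s ** X) ** Y = Y ** B s"
      by (metis Y(1) matrix_mul_assoc matrix_mul_rid)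
    moreover have "Y ** (mat c ** (X ** A s)) ** Y = mat c ** (A s ** Y)"
      by (metis Y(2) mat_left_commute matrix_mul_assoc matrix_mul_lid)
    ultimately have "mat (1 / c) ** (Y ** B s) = mat (1 / c) ** (mat c ** (A s ** Y))" by simp
    then have "mat (1 / c) ** (Y ** B s) = A s ** Y"
      using c0 by (simp add: matrix_mul_assoc mat_mult_mat)
    then show ?thesis using c by (intro exI[of _ "1 / c"]) (simp add: power_divide)
  qed
  ultimately show ?thesis by (auto simp: equiv_tuple_def)
qed

lemma equiv_tuple_trans:
  fixes A B C :: "surface_letter \<Rightarrow> complex ^ 'n::finite ^ 'n"
  assumes "equiv_tuple g A B" "equiv_tuple g B C" shows "equiv_tuple g A C"
proof -
  obtain X where X: "det X \<noteq> 0" "\<forall>s\<in>surface_letters g. \<exists>c. c ^ CARD('n) = 1 \<and> B s ** X = mat c ** (X ** A s)"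
    using assms by (auto simp: equiv_tuple_def)
  obtain Y where Y: "det Y \<noteq> 0" "\<forall>s\<in>surface_letters g. \<exists>c. c ^ CARD('n) = 1 \<and> C s ** Y = mat c ** (Y ** B s)"
    using assms by (auto simp: equiv_tuple_def)
  have "\<exists>c. c ^ CARD('n) = 1 \<and> C s ** (Y ** X) = mat c ** (Y ** X ** A s)" if s: "s \<in> surface_letters g" for s
  proof -
    obtain c where c: "c ^ CARD('n) = 1" "B s ** X = mat c ** (X ** A s)" using X s by blast
    obtain d where d: "d ^ CARD('n) = 1" "C s ** Y = mat d ** (Y ** B s)" using Y s by blast
    have "C s ** (Y ** X) = mat d ** (Y ** (B s ** X))"
      unfolding matrix_mul_assoc d(2) ..
    also have "\<dots> = mat (d * c) ** (Y ** X ** A s)"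
      unfolding c(2) mat_left_commute[of Y] by (simp add: matrix_mul_assoc mat_mult_mat)
    finally show ?thesis using c d by (intro exI[of _ "d * c"]) (simp add: power_mult_distrib)
  qed
  then show ?thesis using X Y unfolding equiv_tuple_def by (intro exI[of _ "Y ** X"]) (simp add: det_mul)
qed

lemma conj_class_eq_iff:
  fixes A B :: "surface_letter \<Rightarrow> complex ^ 'n::finite ^ 'n"
  assumes A: "rep_tuple g A" and B: "rep_tuple g B"
  shows "tuple_class g A = tuple_class g B \<longleftrightarrow> equiv_tuple g A B"
proof
  assume "tuple_class g A = tuple_class g B"
  then show "equiv_tuple g A B"
    using conj_class_refl[OF B] rep_of_in_class_iff[OF A B] by (simp add: tuple_class_def)
next
  have sub: "tuple_class g B \<subseteq> tuple_class g A" if A: "rep_tuple g A" and B: "rep_tuple g B" and e: "equiv_tuple g A B"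
    for A B :: "surface_letter \<Rightarrow> complex ^ 'n::finite ^ 'n"
  proof
    fix \<rho> assume "\<rho> \<in> tuple_class g B"
    then obtain X where X: "det X = 1" "\<rho> = rep_of g (conj_tuple X B)"
      by (auto simp: tuple_class_def conj_class_rep_of[OF B])
    have C: "rep_tuple g (conj_tuple X B)" by (rule conj_rep_of(1)[OF B X(1)])
    have "rep_of g (conj_tuple X B) \<in> conj_class (surface_group g) (rep_of g B)"
      using \<open>\<rho> \<in> tuple_class g B\<close> X by (simp add: tuple_class_def)
    then have "equiv_tuple g B (conj_tuple X B)" using rep_of_in_class_iff[OF B C] by simp
    then have "equiv_tuple g A (conj_tuple X B)" using e equiv_tuple_trans by blast
    then show "\<rho> \<in> tuple_class g A" using rep_of_in_class_iff[OF A C] X by (simp add: tuple_class_def)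
  qed
  assume "equiv_tuple g A B"
  then show "tuple_class g A = tuple_class g B"
    using sub[OF A B] sub[OF B A] equiv_tuple_sym by blast
qed

section \<open>Homogeneous linear systems and eigenvectors\<close>

text \<open>Each equation is used to eliminate one unknown.\<close>

lemma homogeneous_system:
  fixes M :: "'e \<Rightarrow> 'b \<Rightarrow> complex"
  assumes "finite B" "finite E" "card B < card E"
  shows "\<exists>c. (\<exists>e\<in>E. c e \<noteq> 0) \<and> (\<forall>b\<in>B. (\<Sum>e\<in>E. c e * M e b) = 0)"
  using assms
proof (induction B arbitrary: E M rule: finite_induct)
  case empty
  then have "E \<noteq> {}" by auto
  then show ?case by (intro exI[of _ "\<lambda>_. 1"]) auto
next
  case (insert b B)
  show ?case
  proof (cases "\<forall>e\<in>E. M e b = 0")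
    case True
    have "card B < card E" using insert by simp
    then obtain c where c: "\<exists>e\<in>E. c e \<noteq> 0" "\<forall>b\<in>B. (\<Sum>e\<in>E. c e * M e b) = 0"
      using insert.IH[OF insert.prems(1), of M] by blast
    then show ?thesis using True by (intro exI[of _ c]) auto
  next
    case False
    then obtain e0 where e0: "e0 \<in> E" "M e0 b \<noteq> 0" by blast
    define M' where "M' e b' = M e b' - M e b / M e0 b * M e0 b'" for e b'
    have "card B < card (E - {e0})" using insert e0 by simp
    then obtain c where c: "\<exists>e\<in>E - {e0}. c e \<noteq> 0" "\<forall>b\<in>B. (\<Sum>e\<in>E - {e0}. c e * M' e b) = 0"
      using insert.IH[of "E - {e0}" M'] insert.prems(1) by blast
    define c' where "c' = c(e0 := - (\<Sum>e\<in>E - {e0}. c e * M e b / M e0 b))"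
    have split: "(\<Sum>e\<in>E. c' e * M e b') = (\<Sum>e\<in>E - {e0}. c e * M' e b')" for b'
    proof -
      have "(\<Sum>e\<in>E. c' e * M e b') = c' e0 * M e0 b' + (\<Sum>e\<in>E - {e0}. c' e * M e b')"
        using insert.prems(1) e0(1) by (rule sum.remove)
      also have "(\<Sum>e\<in>E - {e0}. c' e * M e b') = (\<Sum>e\<in>E - {e0}. c e * M e b')"
        by (intro sum.cong) (auto simp: c'_def)
      finally show ?thesis
        by (simp add: c'_def M'_def algebra_simps sum_subtractf sum_distrib_right sum_distrib_left)
    qed
    have "M' e b = 0" for e using e0 by (simp add: M'_def)
    then have "\<forall>b'\<in>insert b B. (\<Sum>e\<in>E. c' e * M e b') = 0"
      unfolding split using c(2) by auto
    moreover have "\<exists>e\<in>E. c' e \<noteq> 0" using c(1) by (auto simp: c'_def)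
    ultimately show ?thesis by blast
  qed
qed

definition poly_act :: "complex ^ 'n::finite ^ 'n \<Rightarrow> complex poly \<Rightarrow> complex ^ 'n \<Rightarrow> complex ^ 'n"
  where "poly_act X q v = fold_coeffs (\<lambda>a w. a *s v + X *v w) q 0"

lemma poly_act_0 [simp]: "poly_act X 0 v = 0"
  by (simp add: poly_act_def)

lemma poly_act_pCons [simp]: "poly_act X (pCons a q) v = a *s v + X *v poly_act X q v"
  by (cases "a = 0 \<and> q = 0") (auto simp: poly_act_def)

lemma poly_act_add: "poly_act X (p + q) v = poly_act X p v + poly_act X q v"
  by (induction p q rule: poly_induct2)
    (simp_all add: matrix_vector_right_distrib vector_sadd_rdistrib)

lemma poly_act_smult: "poly_act X (smult a q) v = a *s poly_act X q v"
  by (induction q) (simp_all add: matrix_vector_mult_scaleR vector_scalar_commute vector_add_ldistrib vector_smult_assoc)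

lemma poly_act_root: "poly_act X ([:- l, 1:] * q) v = X *v poly_act X q v - l *s poly_act X q v"
proof -
  have "[:- l, 1:] * q = smult (- l) q + pCons 0 q" by simp
  then show ?thesis by (simp only: poly_act_add poly_act_smult poly_act_pCons) simp
qed

lemma poly_act_sum: "poly_act X (\<Sum>i\<in>I. f i) v = (\<Sum>i\<in>I. poly_act X (f i) v)"
  by (induction I rule: infinite_finite_induct) (simp_all add: poly_act_add)

text \<open>Some nonzero polynomial in \<open>X\<close> kills a given vector of the subspace; splitting off linear factors one
  at a time finally produces an eigenvector.\<close>

lemma ex_eigenvector:
  fixes X :: "complex ^ 'n::finite ^ 'n"
  assumes V: "vec.subspace V" "V \<noteq> {0}" and inv: "\<And>v. v \<in> V \<Longrightarrow> X *v v \<in> V"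
  obtains v l where "v \<in> V" "v \<noteq> 0" "X *v v = l *s v"
proof -
  have actV: "poly_act X q v \<in> V" if "v \<in> V" for q v
    using that by (induction q) (auto intro: vec.subspace_0[OF V(1)] vec.subspace_add[OF V(1)] vec.subspace_scale[OF V(1)] inv)
  have main: "\<exists>v l. v \<in> V \<and> v \<noteq> 0 \<and> X *v v = l *s v"
    if "v \<in> V" "v \<noteq> 0" "q \<noteq> 0" "poly_act X q v = 0" for v q
    using that
  proof (induction "degree q" arbitrary: q rule: less_induct)
    case less
    show ?case
    proof (cases "degree q = 0")
      case True
      then obtain a where "q = [:a:]" by (metis degree_eq_zeroE)
      then show ?thesis using less.prems by simp
    next
      case False
      then obtain l where "poly q l = 0"
        using fundamental_theorem_of_algebra[of q] constant_degree[of q] by (metis)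
      then obtain r where r: "q = [:- l, 1:] * r" by (auto simp: poly_eq_0_iff_dvd dvd_def)
      then have "r \<noteq> 0" using less.prems by auto
      then have deg: "degree r < degree q" unfolding r by (subst degree_mult_eq) auto
      show ?thesis
      proof (cases "poly_act X r v = 0")
        case True
        then show ?thesis using less.hyps[OF deg less.prems(1,2) \<open>r \<noteq> 0\<close>] by blast
      next
        case False
        then show ?thesis
          using less.prems(4) actV[OF less.prems(1), of r] unfolding r poly_act_root by auto
      qed
    qed
  qed
  obtain v where v: "v \<in> V" "v \<noteq> 0" using V vec.subspace_0 by blast
  obtain c where c: "\<exists>i\<in>{..CARD('n)}. c i \<noteq> 0"
      "\<forall>b\<in>UNIV. (\<Sum>i\<in>{..CARD('n)}. c i * (poly_act X (monom 1 i) v) $ b) = 0"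
    using homogeneous_system[of "UNIV :: 'n set" "{..CARD('n)}" "\<lambda>i b. (poly_act X (monom 1 i) v) $ b"]
    by auto
  define q where "q = (\<Sum>i\<in>{..CARD('n)}. smult (c i) (monom 1 i))"
  have "poly_act X q v = 0"
    using c(2) by (simp add: q_def poly_act_sum poly_act_smult vec_eq_iff)
  moreover have "coeff q i = c i" if "i \<le> CARD('n)" for i
  proof -
    have "coeff q i = (\<Sum>j\<in>{..CARD('n)}. if j = i then c j else 0)"
      unfolding q_def coeff_sum by (intro sum.cong) auto
    then show ?thesis using that by simp
  qed
  then have "q \<noteq> 0" using c(1) by (metis atMost_iff coeff_0)
  ultimately show ?thesis using main[OF v, of q] that by blast
qed

text \<open>A nonzero invariant subspace of least dimension consists of common eigenvectors: an eigenspace inside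
  it is again invariant because the matrices commute.\<close>

lemma ex_common_eigenvector:
  fixes F :: "(complex ^ 'n::finite ^ 'n) set"
  assumes comm: "\<And>B C. B \<in> F \<Longrightarrow> C \<in> F \<Longrightarrow> B ** C = C ** B"
  obtains v where "v \<noteq> 0" "\<And>B. B \<in> F \<Longrightarrow> \<exists>l. B *v v = l *s v"
proof -
  define P where "P V \<longleftrightarrow> vec.subspace V \<and> V \<noteq> {0} \<and> (\<forall>B\<in>F. \<forall>v\<in>V. B *v v \<in> V)"
    for V :: "(complex ^ 'n) set"
  have "(1 :: complex ^ 'n) \<noteq> 0" by simp
  then have "P UNIV" by (auto simp: P_def)
  then obtain V where V: "P V" and min: "\<And>W. P W \<Longrightarrow> vec.dim V \<le> vec.dim W"
    using ex_has_least_nat[of P UNIV vec.dim] by blast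
  have Vs: "vec.subspace V" "V \<noteq> {0}" and Vinv: "\<And>B v. B \<in> F \<Longrightarrow> v \<in> V \<Longrightarrow> B *v v \<in> V"
    using V by (auto simp: P_def)
  obtain v where v: "v \<in> V" "v \<noteq> 0" using Vs vec.subspace_0 by blast
  have "\<exists>l. B *v v = l *s v" if B: "B \<in> F" for B
  proof -
    obtain w l where w: "w \<in> V" "w \<noteq> 0" "B *v w = l *s w"
      using ex_eigenvector[OF Vs Vinv[OF B]] by blast
    define W where "W = {u \<in> V. B *v u = l *s u}"
    have "vec.subspace W"
      unfolding vec.subspace_def W_def
      using Vs(1) by (auto simp: vec.subspace_0 vec.subspace_add vec.subspace_scale matrix_vector_right_distrib
          vector_add_ldistrib vector_scalar_commute vector_smult_assoc mult.commute)
    moreover have "W \<noteq> {0}" using w by (auto simp: W_def)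
    moreover have "C *v u \<in> W" if "C \<in> F" "u \<in> W" for C u
      using comm[OF B that(1)] that Vinv[OF that(1)] 
      by (auto simp: W_def) (metis matrix_vector_mul_assoc vector_scalar_commute)
    ultimately have "P W" by (auto simp: P_def)
    then have "vec.dim V \<le> vec.dim W" by (rule min)
    moreover have "W \<subseteq> V" by (auto simp: W_def)
    ultimately have "W = V"
      using Vs(1) \<open>vec.subspace W\<close> by (intro vec.subspace_dim_equal) auto
    then show ?thesis using v by (auto simp: W_def)
  qed
  then show ?thesis using v that by blast
qed

lemma schur:
  fixes A :: "surface_letter \<Rightarrow> complex ^ 'n::finite ^ 'n"
  assumes irr: "irr_tuple g A" and comm: "\<And>s. s \<in> surface_letters g \<Longrightarrow> A s ** B = B ** A s"
  obtains l where "B = mat l"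
proof -
  have U: "vec.subspace (UNIV :: (complex ^ 'n) set)" "(UNIV :: (complex ^ 'n) set) \<noteq> {0}"
    using one_neq_zero by (auto simp: set_eq_iff)
  obtain w l where w: "w \<noteq> 0" "B *v w = l *s w"
    using ex_eigenvector[OF U, of B] by blast
  define W where "W = {u. B *v u = l *s u}"
  have "vec.subspace W"
    unfolding vec.subspace_def W_def
    by (auto simp: matrix_vector_right_distrib
        vector_add_ldistrib vector_scalar_commute vector_smult_assoc mult.commute)
  moreover have "A s *v u \<in> W" if "s \<in> surface_letters g" "u \<in> W" for s u
    using comm[OF that(1)] that
    by (auto simp: W_def) (metis matrix_vector_mul_assoc vector_scalar_commute)
  ultimately have "W = {0} \<or> W = UNIV"
    using irr unfolding irr_tuple_def by blast
  then have "W = UNIV" using w by (auto simp: W_def)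
  then have "B *v u = mat l *v u" for u by (auto simp: W_def mat_vec)
  then have "B = mat l" by (simp add: matrix_eq)
  then show ?thesis by (rule that)
qed

text \<open>The kernel of \<open>X\<close> is an invariant subspace.\<close>

lemma twisted_commuting_invertible:
  fixes A :: "surface_letter \<Rightarrow> complex ^ 'n::finite ^ 'n"
  assumes irr: "irr_tuple g A" and "X \<noteq> 0"
    and tw: "\<And>s. s \<in> surface_letters g \<Longrightarrow> \<exists>c. c \<noteq> 0 \<and> A s ** X = mat c ** (X ** A s)"
  shows "det X \<noteq> 0"
proof -
  define W where "W = {u. X *v u = 0}"
  have "vec.subspace W"
    unfolding vec.subspace_def W_def
    by (auto simp: matrix_vector_right_distrib vector_scalar_commute)
  moreover have "A s *v u \<in> W" if s: "s \<in> surface_letters g" and u: "u \<in> W" for s u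
  proof -
    obtain c where c: "c \<noteq> 0" "A s ** X = mat c ** (X ** A s)" using tw[OF s] by blast
    have "c *s (X *v (A s *v u)) = A s *v (X *v u)"
      using c(2) by (metis mat_vec matrix_vector_mul_assoc)
    then show ?thesis using u c(1) by (simp add: W_def)
  qed
  ultimately have "W = {0} \<or> W = UNIV"
    using irr unfolding irr_tuple_def by blast
  moreover have "W \<noteq> UNIV"
  proof
    assume "W = UNIV"
    then have "X *v u = 0 *v u" for u by (auto simp: W_def)
    then show False using \<open>X \<noteq> 0\<close> by (simp add: matrix_eq)
  qed
  ultimately have "inj ((*v) X)"
  proof -
    assume "W = {0} \<or> W = UNIV" "W \<noteq> UNIV"
    then have W0: "W = {0}" by blast
    show "inj ((*v) X)"
    proof (rule injI)
      fix u u' assume "X *v u = X *v u'"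
      then have "u - u' \<in> W" by (simp add: W_def matrix_vector_mult_diff_distrib)
      then show "u = u'" using W0 by simp
    qed
  qed
  then have "invertible X"
    by (metis invertible_def matrix_left_invertible_injective matrix_left_right_inverse)
  then show ?thesis by (simp add: invertible_det_nz)
qed

section \<open>The monomial normal form\<close>

text \<open>The monomial tuple with exponents \<open>c\<close> of the cyclic permutation matrix and diagonal parts \<open>x\<close>.\<close>

definition nf :: "(surface_letter \<Rightarrow> nat) \<Rightarrow> (surface_letter \<Rightarrow> complex ^ 'n::finite) \<Rightarrow> surface_letter \<Rightarrow> complex ^ 'n ^ 'n"
  where "nf c x = (\<lambda>s. cyc_mono (x s) (c s))"

lemma mult_vec_sum: "A *v (\<Sum>i\<in>I. f i) = (\<Sum>i\<in>I. A *v f i)" for A :: "complex ^ 'n::finite ^ 'n"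
  by (induction I rule: infinite_finite_induct) (simp_all add: matrix_vector_right_distrib)

lemma mpow_vec: "mpow A (Suc k) *v v = A *v (mpow A k *v v)"
  by (simp add: mpow_Suc matrix_vector_mul_assoc)

lemma mpow_vec_nonzero:
  assumes "det A = 1" "v \<noteq> 0" shows "mpow A k *v v \<noteq> (0 :: complex ^ 'n::finite)"
proof
  assume 0: "mpow A k *v v = 0"
  have "det (mpow A k) \<noteq> 0" using assms(1) by (simp add: det_mpow)
  then obtain B where "B ** mpow A k = mat 1" by (auto simp: invertible_det_nz[symmetric] invertible_def)
  then have "v = B *v (mpow A k *v v)" by (simp add: matrix_vector_mul_assoc)
  then show False using 0 assms(2) by simp
qed

lemma rot_inverse: "k \<le> CARD('n) \<Longrightarrow> rot (CARD('n) - k) (rot k l) = (l :: 'n::finite)"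
  by (simp add: rot_rot)

text \<open>Let the vectors obtained from \<open>v\<close> by powers of \<open>A s0\<close> be permuted up to scalars by all letters. Then they
  span an invariant subspace, so by irreducibility they form a basis, in which every letter is monomial.\<close>

lemma monomial_form:
  fixes A :: "surface_letter \<Rightarrow> complex ^ 'n::finite ^ 'n"
  assumes irr: "irr_tuple g A" and d: "det_one g A" and s0: "s0 \<in> surface_letters g" "c s0 = 1"
    and c: "\<And>s. s \<in> surface_letters g \<Longrightarrow> c s \<le> CARD('n)"
    and v: "v \<noteq> 0" and mu: "mpow (A s0) CARD('n) *v v = mu *s v"
    and w: "\<And>l :: 'n. w l = mpow (A s0) (CARD('n) - ix l) *v v"
    and mono: "\<And>s l. s \<in> surface_letters g \<Longrightarrow> \<exists>a. A s *v w l = a *s w (rot (CARD('n) - c s) l)"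
  obtains x where "\<And>s. s \<in> surface_letters g \<Longrightarrow> x s \<in> torus" "x s0 = 1" "equiv_tuple g (nf c x) A"
proof -
  have d0: "det (A s0) = 1" by (rule det_one_D[OF d s0(1)])
  have wnz: "w l \<noteq> 0" for l unfolding w by (rule mpow_vec_nonzero[OF d0 v])
  have mu0: "mu \<noteq> 0" using mpow_vec_nonzero[OF d0 v, of "CARD('n)"] mu by auto
  \<comment> \<open>Scaling the orbit of \<open>v\<close> by powers of a root of \<open>mu\<close> distributes the factor \<open>mu\<close> evenly over the cycle.\<close>
  obtain k :: complex where k: "k ^ CARD('n) = mu"
    by (metis exists_complex_root zero_less_card_finite less_not_refl)
  have k0: "k \<noteq> 0" using k mu0 by (auto simp: power_0_left)
  define b where "b l = k ^ ix l *s w l" for l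
  define X :: "complex ^ 'n ^ 'n" where "X = (\<chi> i l. b l $ i)"
  have Xv: "X *v a = (\<Sum>l\<in>UNIV. a $ l *s b l)" for a
    by (simp add: vec_eq_iff X_def matrix_vector_mult_def mult.commute)
  have mono': "\<exists>a. A s *v b l = a *s b (rot (CARD('n) - c s) l)" if s: "s \<in> surface_letters g" for s l
  proof -
    obtain a where a: "A s *v w l = a *s w (rot (CARD('n) - c s) l)" using mono[OF s] by blast
    have "A s *v b l = (k ^ ix l * a / k ^ ix (rot (CARD('n) - c s) l)) *s b (rot (CARD('n) - c s) l)"
      using k0 by (simp add: b_def vector_scalar_commute a vector_smult_assoc)
    then show ?thesis by blast
  qed
  have "\<exists>n. \<forall>l. A s *v b l = n l *s b (rot (CARD('n) - c s) l)" if "s \<in> surface_letters g" for s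
    using mono'[OF that] by metis
  then obtain n where n: "A s *v b l = n s l *s b (rot (CARD('n) - c s) l)"
    if "s \<in> surface_letters g" for s l by metis
  define e where "e = mono_scale TYPE('n)"
  define y where "y s = (\<chi> i. n s (rot (c s) i) / e ^ c s)" for s
  have AX: "A s ** X = X ** cyc_mono (y s) (c s)" if s: "s \<in> surface_letters g" for s
  proof -
    have "(A s ** X) *v a = (X ** cyc_mono (y s) (c s)) *v a" for a
    proof -
      define f where "f l = (a $ l * n s l) *s b (rot (CARD('n) - c s) l)" for l
      have "(A s ** X) *v a = (\<Sum>l\<in>UNIV. a $ l *s (A s *v b l))"
        by (simp add: matrix_vector_mul_assoc[symmetric] Xv mult_vec_sum vector_scalar_commute)
      also have "\<dots> = (\<Sum>l\<in>UNIV. f l)" by (simp add: n[OF s] f_def vector_smult_assoc)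
      also have "\<dots> = (\<Sum>i\<in>UNIV. f (rot (c s) i))"
        using bij_rot[of "c s"] by (intro sum.reindex_bij_betw[symmetric])
      also have "\<dots> = X *v (cyc_mono (y s) (c s) *v a)"
        unfolding Xv cyc_mono_vec f_def rot_inverse[OF c[OF s]]
        by (intro sum.cong) (auto simp: y_def e_def mult.commute)
      finally show ?thesis by (simp add: matrix_vector_mul_assoc)
    qed
    then show ?thesis by (simp add: matrix_eq)
  qed
  have "range ((*v) X) = {0} \<or> range ((*v) X) = UNIV"
  proof -
    have "vec.subspace (range ((*v) X))" by (intro vec.subspace_image vec.subspace_UNIV)
    moreover have "A s *v u \<in> range ((*v) X)" if s: "s \<in> surface_letters g" and u: "u \<in> range ((*v) X)" for s u
      using u AX[OF s] by (metis (no_types, lifting) imageE matrix_vector_mul_assoc rangeI)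
    ultimately show ?thesis using irr unfolding irr_tuple_def by blast
  qed
  moreover have "range ((*v) X) \<noteq> {0}"
  proof
    assume r: "range ((*v) X) = {0}"
    fix l :: 'n
    have "X *v axis l 1 = (\<Sum>l'\<in>UNIV. if l' = l then b l' else 0)"
      unfolding Xv by (intro sum.cong) (auto simp: axis_def)
    then have "X *v axis l 1 = b l" by simp
    then have "b l = 0" using r by (metis rangeI singletonD)
    then show False using wnz k0 by (simp add: b_def)
  qed
  ultimately have "surj ((*v) X)" by blast
  then obtain Y where "X ** Y = mat 1"
    using matrix_right_invertible_surjective by blast
  then have "det X * det Y = 1" by (metis det_mul det_I)
  then have dX: "det X \<noteq> 0" by auto
  have yt: "y s \<in> torus" if s: "s \<in> surface_letters g" for s
  proof -
    have "det (A s) * det X = det X * det (cyc_mono (y s) (c s))"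
      using AX[OF s] by (metis det_mul)
    then show ?thesis using dX det_one_D[OF d s] by (simp add: det_cyc_mono torus_def)
  qed
  have A0b: "A s0 *v b l = k *s b (rot (CARD('n) - 1) l)" for l
  proof (cases "ix l")
    case 0
    have 1: "ix (rot (CARD('n) - 1) l) = CARD('n) - 1" by (simp add: ix_rot 0)
    have "b (rot (CARD('n) - 1) l) = k ^ (CARD('n) - 1) *s (A s0 *v v)"
      unfolding b_def w 1 using mpow_vec[of "A s0" 0 v] by simp
    then have "k *s b (rot (CARD('n) - 1) l) = k ^ (Suc (CARD('n) - 1)) *s (A s0 *v v)"
      by (simp only: vector_smult_assoc power_Suc)
    moreover have "A s0 *v b l = mu *s (A s0 *v v)"
      by (simp add: b_def w 0 mu vector_scalar_commute)
    ultimately show ?thesis by (simp add: k)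
  next
    case (Suc i)
    then have i: "Suc i < CARD('n)" using ix_less[of l] by simp
    have 1: "ix (rot (CARD('n) - 1) l) = i"
      using i Suc by (simp add: ix_rot)
    have 2: "CARD('n) - i = Suc (CARD('n) - Suc i)" using i by simp
    show ?thesis
      unfolding b_def w 1 Suc 2 mpow_vec by (simp add: vector_scalar_commute vector_smult_assoc)
  qed
  have bnz: "b l \<noteq> 0" for l using wnz k0 by (simp add: b_def)
  have "n s0 l = k" for l
  proof -
    have "n s0 l *s b (rot (CARD('n) - 1) l) = k *s b (rot (CARD('n) - 1) l)"
      using A0b[of l] unfolding n[OF s0(1)] s0(2) .
    then show ?thesis using bnz by (metis vec.scale_cancel_right)
  qed
  then have y0: "y s0 = const_vec (k / e) * 1" by (simp add: y_def vec_eq_iff s0(2))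
  have ke: "(k / e) ^ CARD('n) = 1"
    using yt[OF s0(1)] unfolding y0 by (simp add: torus_def)
  define x where "x = y(s0 := 1)"
  show thesis
  proof (rule that[of x])
    show "x s \<in> torus" if "s \<in> surface_letters g" for s using yt[OF that] by (simp add: x_def)
    show "x s0 = 1" by (simp add: x_def)
    have "\<exists>z. z ^ CARD('n) = 1 \<and> A s ** X = mat z ** (X ** nf c x s)" if s: "s \<in> surface_letters g" for s
    proof (cases "s = s0")
      case True
      have "A s ** X = X ** (mat (k / e) ** cyc_mono 1 (c s0))"
        using AX[OF s] unfolding True y0 cyc_mono_const .
      then show ?thesis using ke True mat_left_commute[of X] by (auto simp: nf_def x_def)
    next
      case False
      then show ?thesis using AX[OF s] by (intro exI[of _ 1]) (simp add: nf_def x_def)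
    qed
    then show "equiv_tuple g (nf c x) A" using dX by (auto simp: equiv_tuple_def)
  qed
qed

definition dft_vec :: "'n::finite itself \<Rightarrow> complex ^ 'n"
  where "dft_vec _ = (\<chi> l. zeta CARD('n) ^ ix l)"

lemma zeta_rot: "zeta CARD('n) ^ ix (rot k l) = zeta CARD('n) ^ k * zeta CARD('n) ^ ix (l :: 'n::finite)"
  unfolding ix_rot by (subst power_add[symmetric], rule zeta_power_cong) (simp_all add: add.commute)

definition twisted :: "nat \<Rightarrow> (surface_letter \<Rightarrow> nat) \<Rightarrow> (surface_letter \<Rightarrow> complex ^ 'n::finite ^ 'n) \<Rightarrow> complex ^ 'n ^ 'n \<Rightarrow> bool"
  where "twisted g c A X \<longleftrightarrow> (\<forall>s\<in>surface_letters g. A s ** X = mat (zeta CARD('n) ^ c s) ** (X ** A s))"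

text \<open>The diagonal matrix with all \<open>p\<close>-th roots of unity commutes with a monomial matrix up to the root of unity given by
  its exponent.\<close>

lemma nf_twisted: "twisted g c (nf c x) (cyc_mono (dft_vec TYPE('n::finite)) 0)"
  unfolding twisted_def nf_def cyc_mono_mult add_0_right add_0
proof
  fix s
  have "x s * shift (c s) (dft_vec TYPE('n)) = const_vec (zeta CARD('n) ^ c s) * (dft_vec TYPE('n) * x s)"
    by (simp add: vec_eq_iff dft_vec_def zeta_rot)
  then show "cyc_mono (x s * shift (c s) (dft_vec TYPE('n))) (c s) =
      mat (zeta CARD('n) ^ c s) ** cyc_mono (dft_vec TYPE('n) * shift 0 (x s)) (c s)"
    by (simp add: cyc_mono_const[symmetric])
qed

lemma twisted_mpow:
  fixes A X :: "complex ^ 'n::finite ^ 'n"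
  assumes "A ** X = mat z ** (X ** A)"
  shows "mpow A k ** X = mat (z ^ k) ** (X ** mpow A k)"
proof (induction k)
  case (Suc k)
  have "mpow A (Suc k) ** X = A ** (mat (z ^ k) ** (X ** mpow A k))"
    unfolding Suc.IH[symmetric] by (simp add: mpow_Suc matrix_mul_assoc)
  also have "\<dots> = mat (z ^ k) ** ((A ** X) ** mpow A k)"
    unfolding mat_left_commute[of A "z ^ k"] by (simp only: matrix_mul_assoc)
  also have "\<dots> = mat (z ^ k * z) ** (X ** mpow A (Suc k))"
    unfolding assms by (simp only: matrix_mul_assoc mat_mult_mat mpow_Suc)
  finally show ?case by (simp add: mult.commute)
qed simp

lemma zeta_ratio_power:
  fixes l m :: "'n::finite"
  shows "(\<Sum>k<CARD('n). (zeta CARD('n) ^ ix l / zeta CARD('n) ^ ix m) ^ k) = (if l = m then of_nat CARD('n) else 0)"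
proof -
  let ?p = "CARD('n)"
  let ?j = "ix l + (?p - ix m)"
  have m: "ix m < ?p" by simp
  have "zeta ?p ^ (?p - ix m) * zeta ?p ^ ix m = 1"
    using m zeta_power_self[of ?p] by (simp add: power_add[symmetric] less_imp_le)
  then have "zeta ?p ^ ix l / zeta ?p ^ ix m = zeta ?p ^ ?j"
    by (simp add: power_add field_simps)
  moreover have "?p dvd ?j \<longleftrightarrow> l = m"
  proof
    assume "?p dvd ?j"
    then have "(ix l + (?p - ix m)) mod ?p = 0" by (simp only: dvd_eq_mod_eq_0)
    moreover have "(ix m + (?p - ix m)) mod ?p = 0" using m by (simp add: less_imp_le)
    ultimately have "(ix l + (?p - ix m)) mod ?p = (ix m + (?p - ix m)) mod ?p" by (simp only:)
    then have "(?p - ix m + ix l) mod ?p = (?p - ix m + ix m) mod ?p" by (simp add: add.commute)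
    then have "ix l mod ?p = ix m mod ?p" by (rule add_mod_left_cancel)
    then show "l = m" by (simp add: ix_eq_iff)
  qed (use m in \<open>simp add: less_imp_le\<close>)
  ultimately show ?thesis by (simp add: sum_zeta_powers)
qed

text \<open>The letter \<open>s\<close> maps eigenvectors of \<open>X\<close> to eigenvectors and changes the eigenvalue by a root of unity that
  depends on \<open>c s\<close>. Since \<open>c s0 = 1\<close>, the powers of \<open>A s0\<close> lead through \<open>p\<close> different eigenvalues, so all eigenspaces are lines, and the
  letters permute them.\<close>

lemma nf_from_twisted:
  fixes A :: "surface_letter \<Rightarrow> complex ^ 'n::finite ^ 'n"
  assumes irr: "irr_tuple g A" and d: "det_one g A" and s0: "s0 \<in> surface_letters g" "c s0 = 1"
    and c: "\<And>s. s \<in> surface_letters g \<Longrightarrow> c s \<le> CARD('n)"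
    and X: "X \<noteq> 0" and tw: "twisted g c A X"
  obtains x where "\<And>s. s \<in> surface_letters g \<Longrightarrow> x s \<in> torus" "x s0 = 1" "equiv_tuple g (nf c x) A"
proof -
  let ?p = "CARD('n)" and ?z = "zeta CARD('n)"
  have zp: "?z ^ ?p = 1" by (simp add: zeta_power_self)
  have d0: "det (A s0) = 1" by (rule det_one_D[OF d s0(1)])
  have dX: "det X \<noteq> 0"
  proof (rule twisted_commuting_invertible[OF irr X])
    fix s assume "s \<in> surface_letters g"
    then show "\<exists>k. k \<noteq> 0 \<and> A s ** X = mat k ** (X ** A s)"
      using tw unfolding twisted_def by (intro exI[of _ "zeta CARD('n) ^ c s"]) auto
  qed
  have U: "vec.subspace (UNIV :: (complex ^ 'n) set)" "(UNIV :: (complex ^ 'n) set) \<noteq> {0}"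
    using one_neq_zero by (auto simp: set_eq_iff)
  obtain v la where v: "v \<noteq> 0" "X *v v = la *s v"
    using ex_eigenvector[OF U, of X] by blast
  have injX: "inj ((*v) X)" using dX by (intro inj_matrix_vector_mult) (simp add: invertible_det_nz)
  have la: "la \<noteq> 0"
  proof
    assume "la = 0"
    then have "X *v v = X *v 0" using v by simp
    then show False using injX v(1) by (metis injD)
  qed
  define w where "w l = mpow (A s0) (?p - ix l) *v v" for l :: 'n
  have wnz: "w l \<noteq> 0" for l unfolding w_def by (rule mpow_vec_nonzero[OF d0 v(1)])
  have tw0: "A s0 ** X = mat (?z ^ c s0) ** (X ** A s0)" using tw s0 by (simp add: twisted_def)
  have pw: "?z ^ k *s (X *v (mpow (A s0) k *v v)) = la *s (mpow (A s0) k *v v)" for k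
  proof -
    have "(mpow (A s0) k ** X) *v v = mat (?z ^ k) *v (X *v (mpow (A s0) k *v v))"
      unfolding twisted_mpow[OF tw0] by (simp add: s0(2) matrix_vector_mul_assoc matrix_mul_assoc)
    then show ?thesis by (simp add: matrix_vector_mul_assoc[symmetric] v(2) mat_vec vector_scalar_commute)
  qed
  have Xw: "X *v w l = (la * ?z ^ ix l) *s w l" for l
  proof -
    have "?z ^ ix l *s (?z ^ (?p - ix l) *s (X *v w l)) = ?z ^ ix l *s (la *s w l)"
      using pw[of "?p - ix l"] by (simp add: w_def)
    moreover have "?z ^ ix l * ?z ^ (?p - ix l) = 1"
      using ix_less[of l] by (simp add: power_add[symmetric] zp less_imp_le)
    ultimately show ?thesis by (simp add: vector_smult_assoc mult.commute)
  qed
  have Xkw: "mpow X k *v w l = (la * ?z ^ ix l) ^ k *s w l" for k l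
    by (induction k) (simp_all add: mpow_vec vector_scalar_commute Xw vector_smult_assoc mult_ac)
  define W :: "complex ^ 'n ^ 'n" where "W = (\<chi> i l. w l $ i)"
  have Wv: "W *v a = (\<Sum>l\<in>UNIV. a $ l *s w l)" for a
    by (simp add: vec_eq_iff W_def matrix_vector_mult_def mult.commute)
  \<comment> \<open>Fourier inversion along the eigenvalues of \<open>X\<close> isolates one coefficient.\<close>
  have dft: "(\<Sum>k<?p. (1 / (la * ?z ^ ix m)) ^ k *s (mpow X k *v (W *v a))) = (of_nat ?p * a $ m) *s w m" for m a
  proof -
    have "(1 / (la * ?z ^ ix m)) ^ k *s (mpow X k *v (W *v a)) =
        (\<Sum>l\<in>UNIV. (a $ l * (?z ^ ix l / ?z ^ ix m) ^ k) *s w l)" for k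
      using la by (simp add: Wv mult_vec_sum vector_scalar_commute Xkw vector_smult_assoc
          vec.scale_sum_right power_divide power_mult_distrib mult_ac)
    then have "(\<Sum>k<?p. (1 / (la * ?z ^ ix m)) ^ k *s (mpow X k *v (W *v a))) =
        (\<Sum>l\<in>UNIV. \<Sum>k<?p. (a $ l * (?z ^ ix l / ?z ^ ix m) ^ k) *s w l)"
      by (simp add: sum.swap[of _ "{..<?p}"])
    also have "\<dots> = (\<Sum>l\<in>UNIV. (a $ l * (if l = m then of_nat ?p else 0)) *s w l)"
      by (simp only: vec.scale_sum_left[symmetric] sum_distrib_left[symmetric] zeta_ratio_power)
    also have "\<dots> = (\<Sum>l\<in>UNIV. if l = m then (of_nat ?p * a $ l) *s w l else 0)"
      by (intro sum.cong) (auto simp: mult.commute)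
    finally show ?thesis by simp
  qed
  have "a = a'" if "W *v a = W *v a'" for a a'
  proof -
    have "W *v (a - a') = 0" using that by (simp add: matrix_vector_mult_diff_distrib)
    then have "(of_nat ?p * (a - a') $ m) *s w m = 0" for m
      unfolding dft[symmetric] by simp
    then have "(a - a') $ m = 0" for m
      using wnz[of m] by (metis mult_eq_0_iff of_nat_eq_0_iff less_not_refl vec.scale_eq_0_iff zero_less_card_finite)
    then show ?thesis by (simp add: vec_eq_iff)
  qed
  then have "inj ((*v) W)" by (rule injI)
  then obtain Z where "Z ** W = mat 1" using matrix_left_invertible_injective by blast
  then have "W ** Z = mat 1" by (simp add: matrix_left_right_inverse)
  then have surj: "u = W *v (Z *v u)" for u by (simp add: matrix_vector_mul_assoc)
  have eig: "\<exists>a. u = a *s w m" if u: "X *v u = (la * ?z ^ ix m) *s u" for u m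
  proof -
    have l0: "la * ?z ^ ix m \<noteq> 0" using la by simp
    have "mpow X k *v u = (la * ?z ^ ix m) ^ k *s u" for k
      by (induction k) (simp_all add: mpow_vec vector_scalar_commute u vector_smult_assoc mult_ac)
    then have "(1 / (la * ?z ^ ix m)) ^ k *s (mpow X k *v u) = u" for k
      using l0 by (simp add: vector_smult_assoc power_mult_distrib[symmetric] del: mult_eq_0_iff)
    then have "(\<Sum>k<?p. u) = (of_nat ?p * (Z *v u) $ m) *s w m"
      using dft[of m "Z *v u"] unfolding surj[symmetric] by simp
    then have "of_nat ?p *s u = (of_nat ?p * (Z *v u) $ m) *s w m"
      by (simp add: vec_eq_iff of_nat_index)
    then have "u = (1 / of_nat ?p * (of_nat ?p * (Z *v u) $ m)) *s w m"
      by (metis (no_types, lifting) mult.commute nonzero_eq_divide_eq of_nat_eq_0_iff vector_smult_assoc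
          vector_smult_lid zero_less_card_finite less_not_refl)
    then show ?thesis by blast
  qed
  have mono: "\<exists>a. A s *v w l = a *s w (rot (?p - c s) l)" if s: "s \<in> surface_letters g" for s l
  proof (rule eig)
    have t: "A s ** X = mat (?z ^ c s) ** (X ** A s)" using tw s by (simp add: twisted_def)
    have "?z ^ c s *s (X *v (A s *v w l)) = A s *v (X *v w l)"
      using t by (metis mat_vec matrix_vector_mul_assoc)
    then have 1: "?z ^ (?p - c s) *s (?z ^ c s *s (X *v (A s *v w l))) =
        ?z ^ (?p - c s) *s ((la * ?z ^ ix l) *s (A s *v w l))"
      by (simp add: Xw vector_scalar_commute)
    have 2: "?z ^ (?p - c s) * ?z ^ c s = 1" using c[OF s] zp by (simp add: power_add[symmetric])
    have 3: "?z ^ ix (rot (?p - c s) l) = ?z ^ (?p - c s) * ?z ^ ix l" by (rule zeta_rot)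
    show "X *v (A s *v w l) = (la * ?z ^ ix (rot (?p - c s) l)) *s (A s *v w l)"
      using 1 2 by (simp add: vector_smult_assoc 3 mult_ac)
  qed
  obtain l0 :: 'n where l0: "ix l0 = 0" using ex_ix[of 0] by auto
  obtain a where a: "v = a *s w l0" using eig[of v l0] v(2) l0 by auto
  then have a0: "a \<noteq> 0" using v(1) by auto
  have mu: "mpow (A s0) ?p *v v = (1 / a) *s v"
  proof -
    have "(1 / a) *s v = (1 / a * a) *s w l0" unfolding a[symmetric] using a by (simp add: vector_smult_assoc[symmetric])
    then show ?thesis using a0 by (simp add: w_def l0)
  qed
  show thesis
    by (rule monomial_form[OF irr d s0 c v(1) mu w_def mono]) (use that in blast)+
qed

text \<open>If \<open>A\<close> is the cyclic permutation matrix and \<open>B\<close> is monomial with exponent \<open>k\<close>, then the exponents add up to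
  \<open>2 p\<close>, so this is a diagonal matrix, with the diagonal part of \<open>B\<close> shifted by \<open>m\<close>. Only nonnegative powers occur, so that it
  is a polynomial in \<open>A\<close> and \<open>B\<close>.\<close>

definition block :: "nat \<Rightarrow> complex ^ 'n::finite ^ 'n \<Rightarrow> complex ^ 'n ^ 'n \<Rightarrow> nat \<Rightarrow> nat \<Rightarrow> complex ^ 'n ^ 'n"
  where "block p A B k m = mpow A m ** B ** mpow A (p - k) ** mpow A (p - m)"

text \<open>Polynomial equations that force an irreducible tuple to be monomial; they will show that the pieces are Zariski
  closed. By Schur's lemma the \<open>p\<close>-th power of \<open>A s0\<close> is a scalar, and the powers of \<open>A s0\<close> move a common eigenvector of the
  commuting blocks through a basis that the letters permute up to scalars.\<close>

lemma nf_from_commuting: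
  fixes A :: "surface_letter \<Rightarrow> complex ^ 'n::finite ^ 'n"
  assumes irr: "irr_tuple g A" and d: "det_one g A" and s0: "s0 \<in> surface_letters g" "c s0 = 1"
    and c: "\<And>s. s \<in> surface_letters g \<Longrightarrow> c s \<le> CARD('n)"
    and cent: "\<And>s. s \<in> surface_letters g \<Longrightarrow> A s ** mpow (A s0) CARD('n) = mpow (A s0) CARD('n) ** A s"
    and comm: "\<And>s t m n. s \<in> surface_letters g \<Longrightarrow> t \<in> surface_letters g \<Longrightarrow> m < CARD('n) \<Longrightarrow> n < CARD('n) \<Longrightarrow>
      block CARD('n) (A s0) (A s) (c s) m ** block CARD('n) (A s0) (A t) (c t) n =
      block CARD('n) (A s0) (A t) (c t) n ** block CARD('n) (A s0) (A s) (c s) m"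
  obtains x where "\<And>s. s \<in> surface_letters g \<Longrightarrow> x s \<in> torus" "x s0 = 1" "equiv_tuple g (nf c x) A"
proof -
  let ?p = "CARD('n)"
  have d0: "det (A s0) = 1" by (rule det_one_D[OF d s0(1)])
  obtain mu where mu: "mpow (A s0) ?p = mat mu" using schur[OF irr cent] by blast
  have mu0: "mu \<noteq> 0"
  proof
    assume "mu = 0"
    then have "det (mpow (A s0) ?p) = 0" unfolding mu det_mat by (simp add: power_0_left)
    then show False by (simp add: det_mpow d0)
  qed
  have per: "\<exists>t. t \<noteq> 0 \<and> mpow (A s0) a = mat t ** mpow (A s0) (a mod ?p)" for a
  proof (induction a rule: less_induct)
    case (less a)
    show ?case
    proof (cases "a < ?p")
      case True
      then show ?thesis by (intro exI[of _ 1]) simp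
    next
      case False
      then have a: "a = ?p + (a - ?p)" "(a - ?p) mod ?p = a mod ?p" by (simp_all add: le_mod_geq)
      obtain t where t: "t \<noteq> 0" "mpow (A s0) (a - ?p) = mat t ** mpow (A s0) ((a - ?p) mod ?p)"
      proof -
        have "a - ?p < a" using False by (intro diff_less) (auto simp: not_less intro: less_le_trans[OF zero_less_card_finite])
        then show thesis using less[of "a - ?p"] that by blast
      qed
      have "mpow (A s0) a = mat mu ** mpow (A s0) (a - ?p)"
        by (subst a(1)) (simp only: mpow_add mu)
      then have "mpow (A s0) a = mat (mu * t) ** mpow (A s0) (a mod ?p)"
        unfolding t(2) a(2) by (simp add: matrix_mul_assoc mat_mult_mat)
      then show ?thesis using mu0 t(1) by (intro exI[of _ "mu * t"]) simp
    qed
  qed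
  have per2: "\<exists>t. t \<noteq> 0 \<and> mpow (A s0) a *v u = t *s (mpow (A s0) b *v u)" if ab: "a mod ?p = b mod ?p" for a b u
  proof -
    obtain t t' where t: "t \<noteq> 0" "mpow (A s0) a = mat t ** mpow (A s0) (a mod ?p)"
      "t' \<noteq> 0" "mpow (A s0) b = mat t' ** mpow (A s0) (b mod ?p)" using per by metis
    have "mpow (A s0) a *v u = (t / t') *s (mpow (A s0) b *v u)"
      unfolding t(2,4) ab using t(3) by (simp add: matrix_vector_mul_assoc[symmetric] mat_vec vector_smult_assoc)
    then show ?thesis using t by (intro exI[of _ "t / t'"]) simp
  qed
  define F where "F = {block ?p (A s0) (A s) (c s) m | s m. s \<in> surface_letters g \<and> m < ?p}"
  obtain v where v: "v \<noteq> 0" "\<And>B. B \<in> F \<Longrightarrow> \<exists>l. B *v v = l *s v"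
    using ex_common_eigenvector[of F] comm unfolding F_def by blast
  define w where "w l = mpow (A s0) (?p - ix l) *v v" for l :: 'n
  have mono: "\<exists>a. A s *v w l = a *s w (rot (?p - c s) l)" if s: "s \<in> surface_letters g" for s l
  proof -
    define m where "m = ix (rot (?p - c s) l)"
    have m: "m < ?p" by (simp add: m_def)
    have "block ?p (A s0) (A s) (c s) m \<in> F" using s m by (auto simp: F_def)
    then obtain b where b: "block ?p (A s0) (A s) (c s) m *v v = b *s v" using v(2) by blast
    have e: "(?p - c s + (?p - m)) mod ?p = (?p - ix l) mod ?p"
    proof (rule add_mod_left_cancel)
      have "(m + ix l + (?p - c s + (?p - m))) mod ?p = (ix l + (?p - c s) + ?p) mod ?p"
        using m by (simp add: add_ac)
      also have "\<dots> = (ix l + (?p - c s)) mod ?p" by simp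
      also have "\<dots> = m mod ?p" by (simp add: m_def ix_rot)
      also have "\<dots> = (m + ix l + (?p - ix l)) mod ?p" using ix_less[of l] by (simp add: less_imp_le)
      finally show "(m + ix l + (?p - c s + (?p - m))) mod ?p = (m + ix l + (?p - ix l)) mod ?p" .
    qed
    obtain t where t: "t \<noteq> 0" "mpow (A s0) (?p - c s + (?p - m)) *v v = t *s w l"
      using per2[OF e, of v] by (auto simp: w_def)
    have "block ?p (A s0) (A s) (c s) m *v v = mpow (A s0) m *v (A s *v (mpow (A s0) (?p - c s + (?p - m)) *v v))"
      by (simp add: block_def mpow_add matrix_vector_mul_assoc matrix_mul_assoc)
    then have "t *s (mpow (A s0) m *v (A s *v w l)) = b *s v"
      unfolding t(2) b by (simp add: vector_scalar_commute)
    then have "mpow (A s0) (?p - m) *v (t *s (mpow (A s0) m *v (A s *v w l))) = b *s (mpow (A s0) (?p - m) *v v)"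
      by (simp add: vector_scalar_commute)
    moreover have "mpow (A s0) (?p - m) *v (mpow (A s0) m *v u) = mu *s u" for u
      using m by (simp add: matrix_vector_mul_assoc mpow_add[symmetric] mu mat_vec)
    moreover have "mpow (A s0) (?p - m) *v v = w (rot (?p - c s) l)" by (simp add: w_def m_def)
    ultimately have "(t * mu) *s (A s *v w l) = b *s w (rot (?p - c s) l)"
      by (simp add: vector_scalar_commute vector_smult_assoc)
    then have "(1 / (t * mu)) *s ((t * mu) *s (A s *v w l)) = (1 / (t * mu) * b) *s w (rot (?p - c s) l)"
      by (simp add: vector_smult_assoc)
    then have "A s *v w l = (1 / (t * mu) * b) *s w (rot (?p - c s) l)"
      using t(1) mu0 by (simp add: vector_smult_assoc)
    then show ?thesis by blast
  qed
  have muv: "mpow (A s0) ?p *v v = mu *s v" by (simp add: mu mat_vec)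
  show thesis
    by (rule monomial_form[OF irr d s0 c v(1) muv w_def mono]) (use that in blast)+
qed

lemma mpow_cyc_mono: "mpow (cyc_mono 1 1) k = cyc_mono 1 k"
proof (induction k)
  case 0
  show ?case by (simp add: cyc_mono_def mat_def vec_eq_iff)
next
  case (Suc k)
  then show ?case by (simp add: mpow_Suc cyc_mono_mult)
qed

lemma block_nf:
  fixes x :: "complex ^ 'n::finite"
  assumes "k \<le> CARD('n)" "m \<le> CARD('n)"
  shows "block CARD('n) (cyc_mono 1 1) (cyc_mono x k) k m = cyc_mono (shift m x) (2 * CARD('n))"
proof -
  have e: "m + k + (CARD('n) - k) + (CARD('n) - m) = 2 * CARD('n)" using assms by simp
  show ?thesis by (simp add: block_def mpow_cyc_mono cyc_mono_mult e del: One_nat_def)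
qed

lemma cyc_mono_2p_commute:
  "cyc_mono x (2 * CARD('n)) ** cyc_mono y (2 * CARD('n)) = cyc_mono (x * y) (4 * CARD('n))"
  for x y :: "complex ^ 'n::finite"
proof -
  have "shift (2 * CARD('n)) y = y" using shift_cong[of "2 * CARD('n)" 0 y] by simp
  then show ?thesis by (simp add: cyc_mono_mult)
qed

lemma nf_commuting:
  fixes x :: "surface_letter \<Rightarrow> complex ^ 'n::finite"
  assumes s0: "c s0 = 1" "x s0 = 1"
  shows "nf c x s ** mpow (nf c x s0) CARD('n) = mpow (nf c x s0) CARD('n) ** nf c x s"
    and "c s \<le> CARD('n) \<Longrightarrow> c t \<le> CARD('n) \<Longrightarrow> m < CARD('n) \<Longrightarrow> n < CARD('n) \<Longrightarrow>
      block CARD('n) (nf c x s0) (nf c x s) (c s) m ** block CARD('n) (nf c x s0) (nf c x t) (c t) n =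
      block CARD('n) (nf c x s0) (nf c x t) (c t) n ** block CARD('n) (nf c x s0) (nf c x s) (c s) m"
proof -
  have n0: "nf c x s0 = cyc_mono 1 1" by (simp add: nf_def s0)
  show "nf c x s ** mpow (nf c x s0) CARD('n) = mpow (nf c x s0) CARD('n) ** nf c x s"
    unfolding n0 mpow_cyc_mono by (simp add: nf_def cyc_mono_mult add.commute)
  assume "c s \<le> CARD('n)" "c t \<le> CARD('n)" "m < CARD('n)" "n < CARD('n)"
  then show "block CARD('n) (nf c x s0) (nf c x s) (c s) m ** block CARD('n) (nf c x s0) (nf c x t) (c t) n =
      block CARD('n) (nf c x s0) (nf c x t) (c t) n ** block CARD('n) (nf c x s0) (nf c x s) (c s) m"
    unfolding n0 by (simp add: nf_def block_nf cyc_mono_2p_commute mult.commute[of "shift m (x s)"] del: One_nat_def)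
qed

section \<open>Irreducibility of monomial tuples\<close>

lemma inverse_mod_prime:
  assumes "prime (p :: nat)" "\<not> p dvd k"
  obtains j where "(k * j) mod p = 1"
proof -
  have "k \<noteq> 0" using assms(2) by (metis dvd_0_right)
  then obtain x y where xy: "k * x = p * y + gcd k p" using bezout_nat by blast
  have "coprime k p" using prime_imp_coprime[OF assms] by (simp add: coprime_commute)
  then have "k * x = 1 + p * y" using xy by simp
  then have "(k * x) mod p = 1"
    using prime_gt_1_nat[OF assms(1)] by (simp only: mod_mult_self2 mod_less)
  then show ?thesis by (rule that)
qed

lemma prime_period_const:
  fixes x :: "complex ^ 'n::finite"
  assumes p: "prime CARD('n)" and k: "\<not> CARD('n) dvd k" and per: "shift k x = x"
  shows "\<exists>c. x = const_vec c"
proof -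
  obtain j where j: "(k * j) mod CARD('n) = 1" using inverse_mod_prime[OF p k] by blast
  have "shift (k * j) x = x"
    by (induction j) (simp_all add: shift_shift[symmetric] per)
  moreover have "shift (k * j) x = shift 1 x"
    using j prime_gt_1_nat[OF p] by (intro shift_cong) simp
  ultimately show ?thesis using shift_1_eq_iff[of x] by simp
qed

text \<open>A nonzero vector of least support in an invariant subspace has only one nonzero entry. Otherwise
  multiplying it by shifts of the diagonal part \<open>x s\<close> and subtracting multiples reduces its support: as \<open>p\<close> is prime and \<open>x s\<close> is not constant,
  some shift of \<open>x s\<close> separates any two given indices. Cyclic permutation then yields the standard basis.\<close>

lemma nf_irreducible:
  fixes x :: "surface_letter \<Rightarrow> complex ^ 'n::finite"
  assumes p: "prime CARD('n)" and s0: "s0 \<in> surface_letters g" "c s0 = 1" "x s0 = 1"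
    and s: "s \<in> surface_letters g" "c s \<le> CARD('n)" and nc: "\<not> (\<exists>k. x s = const_vec k)"
  shows "irr_tuple g (nf c x)"
  unfolding irr_tuple_def
proof (intro allI impI; elim conjE)
  fix V :: "(complex ^ 'n) set"
  assume V: "vec.subspace V" and inv: "\<forall>s\<in>surface_letters g. \<forall>v\<in>V. nf c x s *v v \<in> V"
  let ?p = "CARD('n)" and ?e = "mono_scale TYPE('n)"
  have sc: "v \<in> V" if "a *s v \<in> V" "a \<noteq> 0" for a v
  proof -
    have "(1 / a) *s (a *s v) \<in> V" by (rule vec.subspace_scale[OF V that(1)])
    then show ?thesis using that(2) by (simp add: vector_smult_assoc)
  qed
  have inv0: "cyc_mono 1 1 *v v \<in> V" if "v \<in> V" for v
    using inv s0 that by (auto simp: nf_def)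
  have invk: "cyc_mono 1 k *v v \<in> V" if "v \<in> V" for k v
  proof -
    have "mpow (cyc_mono 1 1) k *v v \<in> V"
      using that by (induction k) (auto simp: mpow_vec inv0 simp del: One_nat_def)
    then show ?thesis by (simp only: mpow_cyc_mono)
  qed
  have sh: "shift k v \<in> V" if "v \<in> V" for k v
  proof (rule sc)
    show "?e ^ k *s shift k v \<in> V" using invk[OF that, of k] by (simp add: cyc_mono_vec)
  qed simp
  have dg: "shift m (x s) * v \<in> V" if v: "v \<in> V" for m v
  proof -
    have "shift (m mod ?p) (x s) * v \<in> V"
    proof (rule sc[of "?e ^ (2 * ?p)"])
      have m: "m mod ?p \<le> ?p" by (simp add: less_imp_le)
      have "block ?p (cyc_mono 1 1) (nf c x s) (c s) (m mod ?p) *v v \<in> V"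
        unfolding block_def mpow_cyc_mono using v inv s(1) invk
        by (simp add: matrix_vector_mul_assoc[symmetric])
      moreover have "block ?p (cyc_mono 1 1) (nf c x s) (c s) (m mod ?p) = cyc_mono (shift (m mod ?p) (x s)) (2 * ?p)"
        unfolding nf_def by (rule block_nf[OF s(2) m])
      moreover have "shift (2 * ?p) v = v" using shift_cong[of "2 * ?p" 0 v] by simp
      ultimately show "?e ^ (2 * ?p) *s (shift (m mod ?p) (x s) * v) \<in> V"
        by (simp add: cyc_mono_vec)
    qed simp
    moreover have "shift (m mod ?p) (x s) = shift m (x s)" by (rule shift_cong) simp
    ultimately show ?thesis by simp
  qed
  show "V = {0} \<or> V = UNIV"
  proof (cases "V = {0}")
    case False
    then obtain v0 where v0: "v0 \<in> V" "v0 \<noteq> 0" using vec.subspace_0[OF V] by blast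
    define supp where "supp v = {l. v $ l \<noteq> 0}" for v :: "complex ^ 'n"
    obtain v where v: "v \<in> V" "v \<noteq> 0" and min: "\<And>u. u \<in> V \<Longrightarrow> u \<noteq> 0 \<Longrightarrow> card (supp v) \<le> card (supp u)"
      using ex_has_least_nat[of "\<lambda>v. v \<in> V \<and> v \<noteq> 0" v0 "\<lambda>v. card (supp v)"] v0 by blast
    obtain l where l: "v $ l \<noteq> 0" using v(2) by (auto simp: vec_eq_iff)
    have single: "v $ l' = 0" if l': "l' \<noteq> l" for l'
    proof (rule ccontr)
      assume vl': "v $ l' \<noteq> 0"
      obtain k where k: "k < ?p" "l' = rot k l" using ex_rot by blast
      then have "k \<noteq> 0" using l' by (metis rot_0)
      then have kp: "\<not> ?p dvd k" using k(1) by (auto dest: dvd_imp_le)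
      \<comment> \<open>Otherwise \<open>x s\<close> has period \<open>k\<close>, which is prime to \<open>p\<close>.\<close>
      obtain m where m: "x s $ rot m l \<noteq> x s $ rot m l'"
      proof (rule ccontr)
        assume "\<not> thesis"
        then have e: "x s $ rot m l = x s $ rot m l'" for m using that by blast
        have "shift k (x s) $ i = x s $ i" for i
        proof -
          obtain m where i: "i = rot m l" using ex_rot by blast
          have "rot m l' = rot k i" by (simp add: i k(2) rot_rot add.commute)
          then show ?thesis using e[of m] i by simp
        qed
        then have "shift k (x s) = x s" by (rule vec_eq_iff[THEN iffD2, rule_format])
        then show False using prime_period_const[OF p kp] nc by blast
      qed
      define u where "u = shift m (x s) * v - (x s $ rot m l) *s v"
      have uV: "u \<in> V" unfolding u_def
        by (rule vec.subspace_diff[OF V dg[OF v(1)] vec.subspace_scale[OF V v(1)]])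
      have un: "u $ i = (x s $ rot m i - x s $ rot m l) * v $ i" for i
        by (simp add: u_def left_diff_distrib)
      have "u $ l' \<noteq> 0" using m vl' by (simp add: un)
      then have "u \<noteq> 0" by auto
      moreover have "supp u \<subset> supp v"
        using l by (auto simp: supp_def un)
      then have "card (supp u) < card (supp v)" by (intro psubset_card_mono) auto
      ultimately show False using min[OF uV] by simp
    qed
    then have "(1 / v $ l) *s v = axis l 1" using l by (auto simp: vec_eq_iff axis_def)
    then have al: "axis l 1 \<in> V" using vec.subspace_scale[OF V v(1), of "1 / v $ l"] by simp
    have "axis i 1 \<in> V" for i
    proof -
      obtain k where k: "l = rot k i" using ex_rot by blast
      have "shift k (axis l 1) = axis i 1"
        by (simp add: vec_eq_iff axis_def k)
      then show ?thesis using sh[OF al, of k] by simp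
    qed
    then have "(\<Sum>j\<in>UNIV. w $ j *s axis j 1) \<in> V" for w
      by (intro vec.subspace_sum[OF V] vec.subspace_scale[OF V])
    then have "w \<in> V" for w by (simp only: basis_expansion)
    then show ?thesis by blast
  qed simp
qed

text \<open>The constant vectors form an invariant line.\<close>

lemma nf_const_reducible:
  fixes x :: "surface_letter \<Rightarrow> complex ^ 'n::finite"
  assumes p: "prime CARD('n)" and x: "\<And>s. s \<in> surface_letters g \<Longrightarrow> \<exists>k. x s = const_vec k"
  shows "\<not> irr_tuple g (nf c x)"
proof
  assume irr: "irr_tuple g (nf c x)"
  let ?V = "range const_vec :: (complex ^ 'n) set"
  have eq: "const_vec a + const_vec b = const_vec (a + b)" "a *s const_vec b = const_vec (a * b)"
    "const_vec a * const_vec b = const_vec (a * b)" "0 = const_vec 0" for a b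
    by (simp_all add: vec_eq_iff)
  have "vec.subspace ?V"
    unfolding vec.subspace_def by (auto simp: eq intro: range_eqI)
  moreover have "nf c x s *v v \<in> ?V" if s: "s \<in> surface_letters g" and v: "v \<in> ?V" for s v
    using x[OF s] v by (auto simp: nf_def cyc_mono_vec eq)
  ultimately have "?V = {0} \<or> ?V = UNIV" using irr unfolding irr_tuple_def by blast
  moreover have "?V \<noteq> {0}"
  proof
    assume "?V = {0}"
    then have "const_vec 1 = (0 :: complex ^ 'n)" by (metis rangeI singletonD)
    then show False by (simp add: vec_eq_iff)
  qed
  moreover have "?V \<noteq> UNIV"
  proof
    assume "?V = UNIV"
    obtain l l' :: 'n where l: "ix l = 0" "ix l' = 1"
      using ex_ix[of 0] ex_ix[of 1] prime_gt_1_nat[OF p] by (metis zero_less_card_finite)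
    then have "l \<noteq> l'" by auto
    obtain a where "axis l 1 = (const_vec a :: complex ^ 'n)" using \<open>?V = UNIV\<close> by (metis UNIV_I imageE)
    then have "axis l 1 $ i = a" for i by simp
    from this[of l] this[of l'] show False using \<open>l \<noteq> l'\<close> by (simp add: axis_def)
  qed
  ultimately show False by blast
qed

section \<open>The Euler invariant of monomial tuples\<close>

definition tinv :: "complex ^ 'n::finite \<Rightarrow> complex ^ 'n"
  where "tinv x = (\<chi> l. 1 / x $ l)"

lemma tinv_nth [simp]: "tinv x $ l = 1 / x $ l"
  by (simp add: tinv_def)

lemma tinv_mult [simp]: "x \<in> torus \<Longrightarrow> x * tinv x = 1" "x \<in> torus \<Longrightarrow> tinv x * x = 1"
  using torus_nonzero by (auto simp: vec_eq_iff)

lemma torus_tinv: "x \<in> torus \<Longrightarrow> tinv x \<in> torus"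
  by (simp add: torus_def prod_dividef)

lemma torus_cancel: "x \<in> torus \<Longrightarrow> x * y = x * z \<longleftrightarrow> y = z"
  by (metis mult.assoc mult_1 tinv_mult(2))

lemma tinv_unique: "x \<in> torus \<Longrightarrow> x * y = 1 \<Longrightarrow> y = tinv x"
  by (metis tinv_mult(1) torus_cancel)

lemma tinv_distrib: "tinv (x * y) = tinv x * tinv y"
  by (simp add: vec_eq_iff)

lemma tinv_prod: "tinv (\<Prod>i\<in>I. f i) = (\<Prod>i\<in>I. tinv (f i))"
  by (simp add: vec_eq_iff vec_prod_nth prod_dividef)

definition comm_vec :: "complex ^ 'n::finite \<Rightarrow> nat \<Rightarrow> complex ^ 'n \<Rightarrow> nat \<Rightarrow> complex ^ 'n"
  where "comm_vec t a s b = (t * tinv (shift b t)) * (shift a s * tinv s)"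

lemma commutator_cyc_mono:
  assumes t: "t \<in> torus" and s: "s \<in> torus"
  shows "cyc_mono t a ** cyc_mono s b ** inv\<^bsub>SL\<^esub> (cyc_mono t a) ** inv\<^bsub>SL\<^esub> (cyc_mono s b) =
    cyc_mono (comm_vec t a s b) 0"
proof -
  note i = inv_SL[OF det_cyc_mono_torus[OF t, of a]] inv_SL[OF det_cyc_mono_torus[OF s, of b]]
  have "comm_vec t a s b * (s * shift b t) =
      t * shift a s * (shift b t * tinv (shift b t)) * (s * tinv s)"
    by (simp add: comm_vec_def mult_ac)
  then have "comm_vec t a s b * (s * shift b t) = t * shift a s"
    using t s by (simp add: torus_shift)
  then have "cyc_mono t a ** cyc_mono s b = cyc_mono (comm_vec t a s b) 0 ** (cyc_mono s b ** cyc_mono t a)"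
    by (simp add: cyc_mono_mult add.commute)
  then have "cyc_mono t a ** cyc_mono s b ** inv\<^bsub>SL\<^esub> (cyc_mono t a) ** inv\<^bsub>SL\<^esub> (cyc_mono s b) =
      cyc_mono (comm_vec t a s b) 0 ** (cyc_mono s b ** (cyc_mono t a ** inv\<^bsub>SL\<^esub> (cyc_mono t a)) ** inv\<^bsub>SL\<^esub> (cyc_mono s b))"
    by (simp only: matrix_mul_assoc)
  then show ?thesis by (simp add: i)
qed

lemma euler_nf:
  fixes x :: "surface_letter \<Rightarrow> complex ^ 'n::finite"
  assumes x: "\<And>s. s \<in> surface_letters g \<Longrightarrow> x s \<in> torus"
  shows "euler_tuple g (nf c x) =
    cyc_mono (\<Prod>i\<in>{1..g}. comm_vec (x (La i)) (c (La i)) (x (Lb i)) (c (Lb i))) 0"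
proof -
  let ?u = "\<lambda>i. comm_vec (x (La i)) (c (La i)) (x (Lb i)) (c (Lb i))"
  have "map (\<lambda>i. nf c x (La i) ** nf c x (Lb i) ** inv\<^bsub>SL\<^esub> (nf c x (La i)) ** inv\<^bsub>SL\<^esub> (nf c x (Lb i))) [1..<Suc g] =
      map (\<lambda>i. cyc_mono (?u i) 0) [1..<Suc g]"
    by (intro map_cong HOL.refl, unfold nf_def, rule commutator_cyc_mono; rule x)
      (auto simp: surface_letters_def)
  moreover have "foldr (**) (map (\<lambda>i. cyc_mono (?u i) 0) l) (mat 1) = cyc_mono (prod_list (map ?u l)) 0" for l
  proof (induction l)
    case Nil
    show ?case by (simp add: cyc_mono_def mat_def vec_eq_iff)
  next
    case (Cons i l)
    then show ?case by (simp add: cyc_mono_mult)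
  qed
  moreover have "prod_list (map ?u [1..<Suc g]) = (\<Prod>i\<in>{1..g}. ?u i)"
    using prod.distinct_set_conv_list[of "[1..<Suc g]" ?u] by (simp only: distinct_upt set_upt atLeastLessThanSuc_atLeastAtMost)
  ultimately show ?thesis
    unfolding euler_tuple_def commutator_prod_def mult_SL one_SL by (simp only:)
qed

text \<open>Each commutator is a coboundary \<open>q * tinv (shift 1 q)\<close>; the exponents below describe \<open>q\<close>.\<close>

definition pot_set :: "nat \<Rightarrow> (surface_letter \<Rightarrow> nat) \<Rightarrow> surface_letter \<Rightarrow> nat set"
  where "pot_set p c s = (case s of La i \<Rightarrow> {..<c (Lb i)} | Lb i \<Rightarrow> {c (La i)..<p})"

definition pot :: "nat set \<Rightarrow> complex ^ 'n::finite \<Rightarrow> complex ^ 'n"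
  where "pot K x = (\<Prod>k\<in>K. shift k x)"

lemma pot_torus: "x \<in> torus \<Longrightarrow> pot K x \<in> torus"
  by (simp add: pot_def torus_prod torus_shift)

lemma pot_telescope:
  assumes "x \<in> torus" "a \<le> b"
  shows "pot {a..<b} x * shift b x = shift a x * shift 1 (pot {a..<b} x)"
  using assms(2)
proof (induction b rule: dec_induct)
  case base
  show ?case by (simp add: pot_def)
next
  case (step b)
  have e: "pot {a..<Suc b} x = pot {a..<b} x * shift b x"
    using step.hyps by (simp add: pot_def)
  have "shift 1 (pot {a..<Suc b} x) = shift 1 (pot {a..<b} x) * shift (Suc b) x"
    by (simp add: e shift_mult shift_shift)
  then show ?case unfolding e step.IH by (simp add: mult_ac)
qed

lemma pot_coboundary:
  assumes "x \<in> torus" "a \<le> b"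
  shows "shift a x * tinv (shift b x) = pot {a..<b} x * tinv (shift 1 (pot {a..<b} x))"
proof -
  let ?q = "pot {a..<b} x"
  have q: "shift 1 ?q \<in> torus" "shift b x \<in> torus" using assms(1) by (simp_all add: torus_shift pot_torus)
  have "shift b x * (shift 1 ?q * (shift a x * tinv (shift b x))) = (shift b x * tinv (shift b x)) * (shift a x * shift 1 ?q)"
    by (simp add: mult_ac)
  also have "\<dots> = shift b x * (shift 1 ?q * tinv (shift 1 ?q)) * ?q"
    using q pot_telescope[OF assms] by (simp add: mult_ac)
  finally have "shift b x * (shift 1 ?q * (shift a x * tinv (shift b x))) = shift b x * (shift 1 ?q * (?q * tinv (shift 1 ?q)))"
    by (simp add: mult_ac)
  then show ?thesis using q by (simp add: torus_cancel)
qed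

lemma comm_vec_pot:
  fixes t s :: "complex ^ 'n::finite"
  assumes t: "t \<in> torus" and s: "s \<in> torus" and a: "a \<le> CARD('n)"
  shows "comm_vec t a s b = (pot {..<b} t * pot {a..<CARD('n)} s) * tinv (shift 1 (pot {..<b} t * pot {a..<CARD('n)} s))"
  using pot_coboundary[OF t, of 0 b] pot_coboundary[OF s a]
  by (simp add: comm_vec_def shift_mult tinv_distrib atLeast0LessThan mult_ac)

lemma prod_surface_letters: "(\<Prod>s\<in>surface_letters g. f s) = (\<Prod>i\<in>{1..g}. f (La i) * f (Lb i))"
  for f :: "surface_letter \<Rightarrow> 'a::comm_monoid_mult"
proof -
  have "(\<Prod>s\<in>surface_letters g. f s) = (\<Prod>s\<in>La ` {1..g}. f s) * (\<Prod>s\<in>Lb ` {1..g}. f s)"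
    unfolding surface_letters_def by (rule prod.union_disjoint) auto
  also have "(\<Prod>s\<in>La ` {1..g}. f s) = (\<Prod>i\<in>{1..g}. f (La i))"
    by (subst prod.reindex) (auto simp: inj_on_def)
  also have "(\<Prod>s\<in>Lb ` {1..g}. f s) = (\<Prod>i\<in>{1..g}. f (Lb i))"
    by (subst prod.reindex) (auto simp: inj_on_def)
  finally show ?thesis by (simp add: prod.distrib)
qed

lemma finite_surface_letters [simp]: "finite (surface_letters g)"
  by (simp add: surface_letters_def)

lemma euler_nf_iff:
  fixes x :: "surface_letter \<Rightarrow> complex ^ 'n::finite"
  assumes x: "\<And>s. s \<in> surface_letters g \<Longrightarrow> x s \<in> torus"
    and c: "\<And>s. s \<in> surface_letters g \<Longrightarrow> c s \<le> CARD('n)"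
  defines "q \<equiv> \<Prod>s\<in>surface_letters g. pot (pot_set CARD('n) c s) (x s)"
  shows "euler_tuple g (nf c x) = mat z \<longleftrightarrow> q = const_vec z * shift 1 q"
proof -
  have l: "La i \<in> surface_letters g" "Lb i \<in> surface_letters g" if "i \<in> {1..g}" for i
    using that by (auto simp: surface_letters_def)
  have qt: "q \<in> torus" unfolding q_def by (intro torus_prod pot_torus x)
  have "(\<Prod>i\<in>{1..g}. comm_vec (x (La i)) (c (La i)) (x (Lb i)) (c (Lb i))) = q * tinv (shift 1 q)"
    unfolding q_def prod_surface_letters shift_prod tinv_prod prod.distrib[symmetric]
    by (intro prod.cong HOL.refl) (simp add: comm_vec_pot x l c pot_set_def)
  moreover have "euler_tuple g (nf c x) = cyc_mono (\<Prod>i\<in>{1..g}. comm_vec (x (La i)) (c (La i)) (x (Lb i)) (c (Lb i))) 0"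
    using x by (rule euler_nf)
  ultimately have "euler_tuple g (nf c x) = mat z \<longleftrightarrow> q * tinv (shift 1 q) = const_vec z"
    by (simp only: cyc_mono_const_0[symmetric] cyc_mono_inj)
  also have "\<dots> \<longleftrightarrow> shift 1 q * (q * tinv (shift 1 q)) = shift 1 q * const_vec z"
    using qt by (simp add: torus_cancel torus_shift)
  also have "shift 1 q * (q * tinv (shift 1 q)) = q * (shift 1 q * tinv (shift 1 q))"
    by (simp add: mult_ac)
  also have "\<dots> = q" using qt by (simp add: torus_shift)
  finally show ?thesis by (simp add: mult.commute)
qed

text \<open>The entries are the powers of \<open>z\<close>, scaled to have product one.\<close>

lemma ex_twist_vec:
  fixes z :: complex
  assumes z: "z ^ CARD('n::finite) = 1"
  obtains d :: "complex ^ 'n" where "d \<in> torus" "d = const_vec z * shift 1 d"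
proof -
  let ?p = "CARD('n)"
  have z0: "z \<noteq> 0" using z by (auto simp: power_0_left)
  define e :: "complex ^ 'n" where "e = (\<chi> l. z ^ (?p - ix l))"
  have rz: "z ^ a = z ^ b" if "a mod ?p = b mod ?p" for a b
  proof -
    have "z ^ k = z ^ (k mod ?p)" for k
    proof -
      have "z ^ k = z ^ (?p * (k div ?p) + k mod ?p)" by simp
      also have "\<dots> = z ^ (k mod ?p)" unfolding power_add power_mult z by simp
      finally show ?thesis .
    qed
    then show ?thesis using that by metis
  qed
  have e: "e = const_vec z * shift 1 e"
  proof -
    have "z ^ (?p - ix l) = z * z ^ (?p - ix (rot 1 l))" for l :: 'n
    proof (cases "Suc (ix l) < ?p")
      case True
      then have "ix (rot 1 l) = Suc (ix l)" by (simp add: ix_rot)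
      moreover have "?p - ix l = Suc (?p - Suc (ix l))" using True by simp
      ultimately show ?thesis by simp
    next
      case False
      then have "Suc (ix l) = ?p" using ix_less[of l] by linarith
      then have "ix (rot 1 l) = 0" "?p - ix l = 1" by (auto simp: ix_rot)
      then show ?thesis using z by simp
    qed
    then have "e $ l = (const_vec z * shift 1 e) $ l" for l
      unfolding vec_times_nth const_vec_nth shift_nth e_def vec_lambda_beta .
    then show ?thesis by (rule vec_eq_iff[THEN iffD2, rule_format])
  qed
  have "(\<Prod>l\<in>UNIV. e $ l) \<noteq> 0" using z0 by (simp add: e_def)
  moreover obtain r :: complex where r: "r ^ ?p = 1 / (\<Prod>l\<in>UNIV. e $ l)"
    by (metis exists_complex_root zero_less_card_finite less_not_refl)
  ultimately have "const_vec r * e \<in> torus" by (simp add: torus_def prod.distrib)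
  moreover have "const_vec r * e = const_vec z * shift 1 (const_vec r * e)"
    by (subst e) (simp add: shift_mult mult_ac)
  ultimately show ?thesis by (rule that)
qed

text \<open>The quotient of two solutions is invariant under the shift, hence constant.\<close>

lemma same_twist_iff:
  fixes d q :: "complex ^ 'n::finite"
  assumes d: "d \<in> torus" "d = const_vec z * shift 1 d" and q: "q \<in> torus" and z: "z ^ CARD('n) = 1"
  shows "q = const_vec z * shift 1 q \<longleftrightarrow> (\<exists>r. r ^ CARD('n) = 1 \<and> q = const_vec r * d)"
proof
  assume qz: "q = const_vec z * shift 1 q"
  let ?h = "q * tinv d"
  have cz: "const_vec z \<in> (torus :: (complex ^ 'n) set)" using z by (simp add: const_vec_torus)
  have dq: "d * shift 1 q = q * shift 1 d"
  proof -
    have "const_vec z * (d * shift 1 q) = d * (const_vec z * shift 1 q)" by (simp add: mult_ac)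
    also have "\<dots> = d * q" using qz by simp
    also have "\<dots> = (const_vec z * shift 1 d) * q" using d(2) by simp
    finally have "const_vec z * (d * shift 1 q) = const_vec z * (q * shift 1 d)" by (simp add: mult_ac)
    then show ?thesis using cz by (simp add: torus_cancel)
  qed
  have "d * (shift 1 d * shift 1 ?h) = d * (shift 1 q * shift 1 (tinv d * d))"
    by (simp add: shift_mult mult_ac)
  also have "\<dots> = q * shift 1 d * (d * tinv d)" using d dq by simp
  also have "\<dots> = d * (shift 1 d * ?h)" by (simp add: mult_ac)
  finally have "shift 1 ?h = ?h" using d by (simp add: torus_cancel torus_shift)
  then obtain r where r: "?h = const_vec r" using shift_1_eq_iff by blast
  have "q = const_vec r * d"
    unfolding r[symmetric] using d by (simp add: mult.assoc)
  moreover have "const_vec r \<in> (torus :: (complex ^ 'n) set)"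
    unfolding r[symmetric] by (intro torus_mult torus_tinv q d)
  ultimately show "\<exists>r. r ^ CARD('n) = 1 \<and> q = const_vec r * d" by (auto simp: const_vec_torus)
next
  assume "\<exists>r. r ^ CARD('n) = 1 \<and> q = const_vec r * d"
  then obtain r where r: "q = const_vec r * d" by blast
  show "q = const_vec z * shift 1 q"
    unfolding r by (subst d(2)) (simp add: shift_mult mult_ac)
qed

fun partner :: "surface_letter \<Rightarrow> surface_letter"
  where "partner (La i) = Lb i" | "partner (Lb i) = La i"

lemma partner_in: "s \<in> surface_letters g \<Longrightarrow> partner s \<in> surface_letters g"
  by (auto simp: surface_letters_def)

lemma partner_neq [simp]: "partner s \<noteq> s"
  by (cases s) auto

definition free_letters :: "nat \<Rightarrow> surface_letter \<Rightarrow> surface_letter set"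
  where "free_letters g s = surface_letters g - {s, partner s}"

lemma finite_free_letters [simp]: "finite (free_letters g s)"
  by (simp add: free_letters_def)

lemma card_free_letters:
  assumes "s \<in> surface_letters g" shows "card (free_letters g s) = 2 * (g - 1)"
proof -
  have "card (surface_letters g) = card (La ` {1..g}) + card (Lb ` {1..g})"
    unfolding surface_letters_def by (rule card_Un_disjoint) auto
  also have "\<dots> = g + g" by (simp add: card_image inj_on_def)
  finally have "card (surface_letters g) = 2 * g" by simp
  then show ?thesis
    using assms partner_in[OF assms] not_sym[OF partner_neq[of s]]
    by (simp add: free_letters_def card_Diff_subset)
qed

text \<open>All diagonal parts are recovered from the free ones: the one at \<open>s0\<close> is normalised to one, and the one at
  the partner of \<open>s0\<close> is solved for from the value of the Euler invariant, with \<open>d\<close> and \<open>K\<close> as the data of the solution.\<close>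

definition fill :: "nat \<Rightarrow> surface_letter \<Rightarrow> complex ^ 'n::finite \<Rightarrow> (surface_letter \<Rightarrow> nat set) \<Rightarrow>
    (surface_letter \<Rightarrow> complex ^ 'n) \<Rightarrow> surface_letter \<Rightarrow> complex ^ 'n"
  where "fill g s0 d K y = (\<lambda>s. if s = s0 then 1 else if s = partner s0
    then d * (\<Prod>j\<in>free_letters g s0. pot (K j) (y j)) else y s)"

lemma pot_complement:
  fixes x :: "complex ^ 'n::finite"
  assumes x: "x \<in> torus" and K: "K \<subseteq> {..<CARD('n)}"
  shows "tinv (pot K x) = pot ({..<CARD('n)} - K) x"
proof -
  have "pot K x * pot ({..<CARD('n)} - K) x = pot {..<CARD('n)} x"
    using K unfolding pot_def
    by (subst prod.union_disjoint[symmetric]) (auto intro: finite_subset simp: Un_absorb1)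
  also have "\<dots> = 1" using prod_all_shift[OF x] by (simp add: pot_def)
  finally show ?thesis using tinv_unique[OF pot_torus[OF x]] by metis
qed

text \<open>As \<open>c s0 = 1\<close> and \<open>x s0 = 1\<close>, the diagonal part at the partner of \<open>s0\<close> enters the equation either through a single
  shift or through all shifts but one, that is, through its inverse. In both cases the equation can be solved for
  it up to a root of unity.\<close>

lemma euler_solve:
  fixes z :: complex and c :: "surface_letter \<Rightarrow> nat"
  assumes s0: "s0 \<in> surface_letters g" "c s0 = 1"
    and c: "\<And>s. s \<in> surface_letters g \<Longrightarrow> c s \<le> CARD('n::finite)" and z: "z ^ CARD('n) = 1"
  obtains d :: "complex ^ 'n" and K where "d \<in> torus"
    "\<And>x :: surface_letter \<Rightarrow> complex ^ 'n. (\<And>s. s \<in> surface_letters g \<Longrightarrow> x s \<in> torus) \<Longrightarrow> x s0 = 1 \<Longrightarrow>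
      euler_tuple g (nf c x) = mat z \<longleftrightarrow>
      (\<exists>r. r ^ CARD('n) = 1 \<and> x (partner s0) = const_vec r * fill g s0 d K x (partner s0))"
proof -
  let ?p = "CARD('n)" and ?S = "surface_letters g" and ?J = "free_letters g s0"
  obtain e :: "complex ^ 'n" where e: "e \<in> torus" "e = const_vec z * shift 1 e"
    using ex_twist_vec[OF z] by blast
  let ?P = "pot_set ?p c"
  have psub: "?P s \<subseteq> {..<?p}" if "s \<in> ?S" for s
    using c that by (cases s) (force simp: pot_set_def surface_letters_def)+
  have base: "euler_tuple g (nf c x) = mat z \<longleftrightarrow>
      (\<exists>r. r ^ ?p = 1 \<and> pot (?P (partner s0)) (x (partner s0)) * (\<Prod>j\<in>?J. pot (?P j) (x j)) = const_vec r * e)"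
    if x: "\<And>s. s \<in> ?S \<Longrightarrow> x s \<in> torus" and x0: "x s0 = 1" for x :: "surface_letter \<Rightarrow> complex ^ 'n"
  proof -
    have "(\<Prod>s\<in>?S. pot (?P s) (x s)) = pot (?P s0) (x s0) * (\<Prod>s\<in>?S - {s0}. pot (?P s) (x s))"
      using s0(1) by (intro prod.remove) auto
    also have "pot (?P s0) (x s0) = 1" by (simp add: x0 pot_def)
    also have "(\<Prod>s\<in>?S - {s0}. pot (?P s) (x s)) =
        pot (?P (partner s0)) (x (partner s0)) * (\<Prod>s\<in>?S - {s0} - {partner s0}. pot (?P s) (x s))"
      using partner_in[OF s0(1)] by (intro prod.remove) auto
    also have "?S - {s0} - {partner s0} = ?J" by (auto simp: free_letters_def)
    finally have q: "(\<Prod>s\<in>?S. pot (?P s) (x s)) =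
        pot (?P (partner s0)) (x (partner s0)) * (\<Prod>j\<in>?J. pot (?P j) (x j))" by simp
    have "(\<Prod>s\<in>?S. pot (?P s) (x s)) \<in> torus" by (intro torus_prod pot_torus x)
    moreover have "euler_tuple g (nf c x) = mat z \<longleftrightarrow> (\<Prod>s\<in>?S. pot (?P s) (x s)) =
        const_vec z * shift 1 (\<Prod>s\<in>?S. pot (?P s) (x s))"
      by (rule euler_nf_iff) (use x c in auto)
    ultimately show ?thesis
      using same_twist_iff[OF e _ z, of "\<Prod>s\<in>?S. pot (?P s) (x s)"] by (simp only: q)
  qed
  have Jt: "(\<Prod>j\<in>?J. pot (K j) (x j)) \<in> torus" if "\<And>s. s \<in> ?S \<Longrightarrow> x s \<in> torus"
    for x :: "surface_letter \<Rightarrow> complex ^ 'n" and K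
    using that by (intro torus_prod pot_torus) (auto simp: free_letters_def)
  show ?thesis
  proof (cases s0)
    case (Lb i)
    then have pt: "pot (?P (partner s0)) y = y" for y :: "complex ^ 'n"
      using s0(2) by (simp add: pot_set_def pot_def lessThan_Suc)
    show ?thesis
    proof (rule that[of e "\<lambda>j. {..<?p} - ?P j"])
      fix x :: "surface_letter \<Rightarrow> complex ^ 'n" assume x: "\<And>s. s \<in> ?S \<Longrightarrow> x s \<in> torus" and x0: "x s0 = 1"
      let ?Q = "\<Prod>j\<in>?J. pot (?P j) (x j)"
      have Q: "?Q \<in> torus" using x by (rule Jt)
      have iQ: "(\<Prod>j\<in>?J. pot ({..<?p} - ?P j) (x j)) = tinv ?Q"
        unfolding tinv_prod
        by (intro prod.cong HOL.refl pot_complement[symmetric] x psub) (auto simp: free_letters_def)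
      have "x (partner s0) * ?Q = const_vec r * e \<longleftrightarrow> x (partner s0) = const_vec r * (e * tinv ?Q)" for r
      proof -
        have "x (partner s0) * ?Q = const_vec r * e \<longleftrightarrow>
            tinv ?Q * (x (partner s0) * ?Q) = tinv ?Q * (const_vec r * e)"
          using Q by (simp add: torus_cancel torus_tinv)
        also have "tinv ?Q * (x (partner s0) * ?Q) = x (partner s0) * (?Q * tinv ?Q)" by (simp add: mult_ac)
        finally show ?thesis using Q by (simp add: mult_ac)
      qed
      moreover have b: "euler_tuple g (nf c x) = mat z \<longleftrightarrow>
          (\<exists>r. r ^ ?p = 1 \<and> pot (?P (partner s0)) (x (partner s0)) * (\<Prod>j\<in>?J. pot (?P j) (x j)) = const_vec r * e)"
        using x x0 by (rule base)
      ultimately show "euler_tuple g (nf c x) = mat z \<longleftrightarrow> (\<exists>r. r ^ ?p = 1 \<and>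
          x (partner s0) = const_vec r * fill g s0 e (\<lambda>j. {..<?p} - ?P j) x (partner s0))"
        unfolding b pt by (simp add: fill_def iQ)
    qed (rule e(1))
  next
    case (La i)
    have p1: "{..<?p} - {Suc 0..<?p} = {0}" by auto
    have pt: "pot (?P (partner s0)) y = tinv y" if "y \<in> torus" for y :: "complex ^ 'n"
    proof -
      have "?P (partner s0) = {Suc 0..<?p}" using La s0(2) by (simp add: pot_set_def)
      moreover have "{Suc 0..<?p} \<subseteq> {..<?p}" by auto
      then have "tinv (pot {Suc 0..<?p} y) = y"
        using pot_complement[OF that, of "{Suc 0..<?p}"] by (simp add: p1 pot_def)
      then have "y * pot {Suc 0..<?p} y = 1"
        using tinv_mult(2)[OF pot_torus[OF that, of "{Suc 0..<?p}"]] by simp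
      then have "pot {Suc 0..<?p} y = tinv y" by (rule tinv_unique[OF that])
      ultimately show ?thesis by simp
    qed
    show ?thesis
    proof (rule that[of "tinv e" ?P])
      fix x :: "surface_letter \<Rightarrow> complex ^ 'n" assume x: "\<And>s. s \<in> ?S \<Longrightarrow> x s \<in> torus" and x0: "x s0 = 1"
      let ?Q = "\<Prod>j\<in>?J. pot (?P j) (x j)" and ?y = "x (partner s0)"
      have Q: "?Q \<in> torus" using x by (rule Jt)
      have y: "?y \<in> torus" using x partner_in[OF s0(1)] by blast
      have iff: "tinv ?y * ?Q = const_vec r * e \<longleftrightarrow> ?y = const_vec (1 / r) * (tinv e * ?Q)"
        if r: "r ^ ?p = 1" for r
      proof -
        have r0: "r \<noteq> 0" using r by (auto simp: power_0_left)
        have rt: "const_vec r \<in> (torus :: (complex ^ 'n) set)" using r by (simp add: const_vec_torus)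
        have "const_vec r * const_vec (1 / r) = (1 :: complex ^ 'n)" using r0 by (simp add: vec_eq_iff)
        moreover have "(const_vec r * e * ?y) * (const_vec (1 / r) * (tinv e * ?Q)) =
            ?y * ((const_vec r * const_vec (1 / r)) * (e * tinv e) * ?Q)" by (simp add: mult_ac)
        ultimately have 1: "(const_vec r * e * ?y) * (const_vec (1 / r) * (tinv e * ?Q)) = ?y * ?Q" using e by simp
        have 2: "const_vec r * e * ?y \<in> torus" using rt e y by (intro torus_mult)
        have "tinv ?y * ?Q = const_vec r * e \<longleftrightarrow> ?y * ?y * (tinv ?y * ?Q) = ?y * ?y * (const_vec r * e)"
          using y by (simp add: torus_cancel torus_mult)
        also have "?y * ?y * (tinv ?y * ?Q) = ?y * (?y * tinv ?y) * ?Q" by (simp add: mult_ac)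
        also have "\<dots> = ?y * ?Q" using y by simp
        also have "\<dots> = (const_vec r * e * ?y) * (const_vec (1 / r) * (tinv e * ?Q))" using 1 by simp
        also have "?y * ?y * (const_vec r * e) = (const_vec r * e * ?y) * ?y" by (simp add: mult_ac)
        finally show ?thesis using 2 by (auto simp: torus_cancel)
      qed
      have "(\<exists>r. r ^ ?p = 1 \<and> tinv ?y * ?Q = const_vec r * e) \<longleftrightarrow>
          (\<exists>r. r ^ ?p = 1 \<and> ?y = const_vec r * (tinv e * ?Q))"
      proof
        assume "\<exists>r. r ^ ?p = 1 \<and> tinv ?y * ?Q = const_vec r * e"
        then obtain r where "r ^ ?p = 1" "?y = const_vec (1 / r) * (tinv e * ?Q)" using iff by blast
        then show "\<exists>r. r ^ ?p = 1 \<and> ?y = const_vec r * (tinv e * ?Q)"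
          by (intro exI[of _ "1 / r"]) (simp add: power_divide)
      next
        assume "\<exists>r. r ^ ?p = 1 \<and> ?y = const_vec r * (tinv e * ?Q)"
        then obtain r where r: "r ^ ?p = 1" "?y = const_vec r * (tinv e * ?Q)" by blast
        then have "(1 / r) ^ ?p = 1" by (simp add: power_divide)
        then show "\<exists>r. r ^ ?p = 1 \<and> tinv ?y * ?Q = const_vec r * e"
          using iff[of "1 / r"] r(2) by auto
      qed
      moreover have b: "euler_tuple g (nf c x) = mat z \<longleftrightarrow>
          (\<exists>r. r ^ ?p = 1 \<and> pot (?P (partner s0)) (x (partner s0)) * (\<Prod>j\<in>?J. pot (?P j) (x j)) = const_vec r * e)"
        using x x0 by (rule base)
      ultimately show "euler_tuple g (nf c x) = mat z \<longleftrightarrow> (\<exists>r. r ^ ?p = 1 \<and>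
          x (partner s0) = const_vec r * fill g s0 (tinv e) ?P x (partner s0))"
        unfolding b pt[OF y] by (simp add: fill_def)
    qed (intro torus_tinv e(1))
  qed
qed

section \<open>The pieces of the singular locus\<close>

lemma irr_tuple_equiv:
  fixes A B :: "surface_letter \<Rightarrow> complex ^ 'n::finite ^ 'n"
  assumes e: "equiv_tuple g A B" and irr: "irr_tuple g A"
  shows "irr_tuple g B"
  unfolding irr_tuple_def
proof (intro allI impI; elim conjE)
  fix V assume V: "vec.subspace V" and inv: "\<forall>s\<in>surface_letters g. \<forall>v\<in>V. B s *v v \<in> V"
  obtain X where X: "det X \<noteq> 0" "\<forall>s\<in>surface_letters g. \<exists>c. c ^ CARD('n) = 1 \<and> B s ** X = mat c ** (X ** A s)"
    using e by (auto simp: equiv_tuple_def)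
  then obtain Y where Y: "X ** Y = mat 1" unfolding invertible_det_nz[symmetric] invertible_def by blast
  define W where "W = {u. X *v u \<in> V}"
  have "vec.subspace W"
    unfolding vec.subspace_def W_def
    by (auto simp: matrix_vector_right_distrib vector_scalar_commute vec.subspace_0[OF V] vec.subspace_add[OF V] vec.subspace_scale[OF V])
  moreover have "A s *v u \<in> W" if s: "s \<in> surface_letters g" and u: "u \<in> W" for s u
  proof -
    obtain c where c: "c ^ CARD('n) = 1" "B s ** X = mat c ** (X ** A s)" using X(2) s by blast
    then have c0: "c \<noteq> 0" by (auto simp: power_0_left)
    have "c *s (X *v (A s *v u)) = B s *v (X *v u)"
      using c(2) by (metis mat_vec matrix_vector_mul_assoc)
    then have "X *v (A s *v u) = (1 / c) *s (B s *v (X *v u))"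
      using c0 by (metis divide_self_if mult.commute times_divide_eq_right mult_1_right vector_smult_assoc vector_smult_lid)
    then show ?thesis using inv s u vec.subspace_scale[OF V] by (auto simp: W_def)
  qed
  ultimately have "W = {0} \<or> W = UNIV" using irr unfolding irr_tuple_def by blast
  moreover have XY: "v = X *v (Y *v v)" for v by (simp add: matrix_vector_mul_assoc Y)
  moreover have "V = {0}" if "W = {0}"
  proof (intro equalityI subsetI)
    fix v assume "v \<in> V"
    then have "Y *v v \<in> W" using XY[of v] by (simp add: W_def)
    then have "Y *v v = 0" using that by simp
    then show "v \<in> {0}" using XY[of v] by simp
  qed (use vec.subspace_0[OF V] in auto)
  moreover have "V = UNIV" if "W = UNIV"
  proof -
    have "X *v (Y *v v) \<in> V" for v using that by (auto simp: W_def)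
    then show ?thesis using XY by (metis UNIV_eq_I)
  qed
  ultimately show "V = {0} \<or> V = UNIV" by blast
qed

lemma rep_tuple_equiv:
  fixes A B :: "surface_letter \<Rightarrow> complex ^ 'n::finite ^ 'n"
  assumes A: "rep_tuple g A" and e: "equiv_tuple g A B"
  shows "rep_tuple g B"
proof -
  obtain M where M: "det M \<noteq> 0" "\<forall>s\<in>surface_letters g. \<exists>c. c ^ CARD('n) = 1 \<and> B s ** M = mat c ** (M ** A s)"
    using e by (auto simp: equiv_tuple_def)
  obtain d where d: "det (mat d ** M) = 1" using ex_det_one_scale[OF M(1)] by blast
  let ?X = "mat d ** M"
  have "\<forall>s\<in>surface_letters g. \<exists>c. c ^ CARD('n) = 1 \<and> B s = mat c ** conj_tuple ?X A s"
  proof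
    fix s assume "s \<in> surface_letters g"
    then obtain c where c: "c ^ CARD('n) = 1" "B s ** M = mat c ** (M ** A s)" using M(2) by blast
    have "B s = B s ** (?X ** inv\<^bsub>SL\<^esub> ?X)" by (simp add: inv_SL[OF d])
    also have "\<dots> = (B s ** ?X) ** inv\<^bsub>SL\<^esub> ?X" by (rule matrix_mul_assoc)
    also have "B s ** ?X = mat d ** (mat c ** (M ** A s))"
      unfolding c(2)[symmetric] by (rule mat_left_commute)
    also have "\<dots> = mat c ** (mat d ** (M ** A s))" by (rule mat_left_commute)
    also have "\<dots> ** inv\<^bsub>SL\<^esub> ?X = mat c ** (mat d ** M ** A s ** inv\<^bsub>SL\<^esub> ?X)"
      by (simp only: matrix_mul_assoc)
    finally show "\<exists>c. c ^ CARD('n) = 1 \<and> B s = mat c ** conj_tuple ?X A s"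
      using c(1) by (auto simp: conj_tuple_def)
  qed
  then show ?thesis by (rule rep_tuple_scale[OF conj_rep_of(1)[OF A d]])
qed

definition piece_tuple ::
    "nat \<Rightarrow> (surface_letter \<Rightarrow> nat) \<Rightarrow> complex \<Rightarrow> (surface_letter \<Rightarrow> complex ^ 'n::finite ^ 'n) \<Rightarrow> bool"
  where "piece_tuple g c z A \<longleftrightarrow> rep_tuple g A \<and> irr_tuple g A \<and> euler_tuple g A = mat z \<and>
    (\<exists>X. X \<noteq> 0 \<and> twisted g c A X)"

definition piece :: "nat \<Rightarrow> (surface_letter \<Rightarrow> nat) \<Rightarrow> complex \<Rightarrow> 'n::finite surface_rep set set"
  where "piece g c z = tuple_class g ` {A. piece_tuple g c z A}"

lemma euler_class_tuple: "rep_tuple g A \<Longrightarrow> euler_class g (tuple_class g A) = euler_tuple g A"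
  by (simp add: tuple_class_def euler_conj_class)

definition nontrivial_mod :: "nat \<Rightarrow> nat \<Rightarrow> (surface_letter \<Rightarrow> nat) \<Rightarrow> bool"
  where "nontrivial_mod g p c \<longleftrightarrow> (\<exists>s\<in>surface_letters g. \<not> p dvd c s)"

lemma piece_tuple_bad:
  fixes A :: "surface_letter \<Rightarrow> complex ^ 'n::finite ^ 'n"
  assumes c: "nontrivial_mod g CARD('n) c" and A: "piece_tuple g c z A"
  shows "bad_tuple g A"
proof -
  let ?z = "zeta CARD('n)"
  have irr: "irr_tuple g A" and rep: "rep_tuple g A" using A by (auto simp: piece_tuple_def)
  obtain X where X: "X \<noteq> 0" "twisted g c A X" using A by (auto simp: piece_tuple_def)
  have dX: "det X \<noteq> 0"
  proof (rule twisted_commuting_invertible[OF irr X(1)])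
    fix s assume "s \<in> surface_letters g"
    then show "\<exists>k. k \<noteq> 0 \<and> A s ** X = mat k ** (X ** A s)"
      using X(2) unfolding twisted_def by (intro exI[of _ "?z ^ c s"]) auto
  qed
  obtain d where d: "d \<noteq> 0" "det (mat d ** X) = 1" using ex_det_one_scale[OF dX] by blast
  let ?X = "mat d ** X"
  have com: "A s ** ?X = mat (?z ^ c s) ** (?X ** A s)" if "s \<in> surface_letters g" for s
  proof -
    have "A s ** ?X = mat d ** (A s ** X)" by (rule mat_left_commute)
    also have "\<dots> = mat d ** (mat (?z ^ c s) ** (X ** A s))" using X(2) that by (simp add: twisted_def)
    also have "\<dots> = mat (?z ^ c s) ** (?X ** A s)" by (simp add: matrix_mul_assoc mat_mult_mat mult.commute)
    finally show ?thesis .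
  qed
  have root: "(?z ^ k) ^ CARD('n) = 1" for k
    by (simp add: power_mult[symmetric] mult.commute[of k]) (simp add: power_mult zeta_power_self)
  obtain s where s: "s \<in> surface_letters g" "\<not> CARD('n) dvd c s" using c by (auto simp: nontrivial_mod_def)
  have "?X \<notin> center SL"
  proof
    assume "?X \<in> center SL"
    then obtain k where k: "?X = mat k" "k ^ CARD('n) = 1" by (auto simp: center_SL)
    then have k0: "k \<noteq> 0" by (auto simp: power_0_left)
    have "mat k ** A s = mat (?z ^ c s) ** (mat k ** A s)"
      using com[OF s(1)] unfolding k(1) mat_commute[of "A s"] .
    moreover have "det (mat k ** A s) \<noteq> 0"
      using rep s(1) k0 by (simp add: det_mul det_mat rep_tuple_def det_one_def)
    moreover have "mat 1 ** (mat k ** A s) = mat k ** A s" by simp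
    ultimately have "mat 1 = (mat (?z ^ c s) :: complex ^ 'n ^ 'n)" using matrix_right_cancel by metis
    then have "?z ^ c s = 1" by (simp only: mat_eq_iff)
    then show False using s(2) by (simp add: zeta_power_eq_1_iff)
  qed
  then show ?thesis
    unfolding bad_tuple_def using rep irr d(2) com root by blast
qed

text \<open>By Schur's lemma a noncentral matrix cannot commute with all letters, so some exponent is nontrivial.\<close>

lemma bad_tuple_piece:
  fixes A :: "surface_letter \<Rightarrow> complex ^ 'n::finite ^ 'n"
  assumes A: "bad_tuple g A"
  obtains c z where "nontrivial_mod g CARD('n) c" "z ^ CARD('n) = 1" "piece_tuple g c z A"
proof -
  let ?z = "zeta CARD('n)"
  obtain X where X: "det X = 1" "X \<notin> center SL"
    "\<And>s. s \<in> surface_letters g \<Longrightarrow> \<exists>c. c ^ CARD('n) = 1 \<and> A s ** X = mat c ** (X ** A s)"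
    using A by (auto simp: bad_tuple_def)
  have rep: "rep_tuple g A" and irr: "irr_tuple g A" using A by (auto simp: bad_tuple_def)
  have "\<exists>k. A s ** X = mat (?z ^ k) ** (X ** A s)" if "s \<in> surface_letters g" for s
    using X(3)[OF that] root_of_unity_is_zeta_power[OF zero_less_card_finite] by metis
  then obtain c where c: "\<And>s. s \<in> surface_letters g \<Longrightarrow> A s ** X = mat (?z ^ c s) ** (X ** A s)" by metis
  have X0: "X \<noteq> 0"
  proof
    assume "X = 0"
    then have "X = mat 0" by (simp add: mat_def vec_eq_iff)
    then have "det X = 0 ^ CARD('n)" by (simp only: det_mat)
    then show False using X(1) by (simp add: power_0_left)
  qed
  have "nontrivial_mod g CARD('n) c"
  proof (rule ccontr)
    assume "\<not> nontrivial_mod g CARD('n) c"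
    then have "A s ** X = X ** A s" if "s \<in> surface_letters g" for s
      using c[OF that] that zeta_power_eq_1_iff[of "CARD('n)" "c s"] by (auto simp: nontrivial_mod_def)
    then obtain l where "X = mat l" using schur[OF irr] by blast
    then show False using X(1,2) by (auto simp: center_SL det_mat)
  qed
  moreover obtain z where "z ^ CARD('n) = 1" "euler_tuple g A = mat z"
    using rep by (auto simp: rep_tuple_def center_SL)
  ultimately show ?thesis
    using that rep irr X0 c unfolding piece_tuple_def twisted_def by blast
qed

lemma sing_locus_pieces:
  "(sing_locus (surface_group g) :: 'n::finite surface_rep set set) =
    (\<Union>c\<in>{c. nontrivial_mod g CARD('n) c}. \<Union>z\<in>{z. z ^ CARD('n) = 1}. piece g c z)"
proof (intro equalityI subsetI)
  fix C :: "'n surface_rep set" assume "C \<in> sing_locus (surface_group g)"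
  then obtain A :: "surface_letter \<Rightarrow> complex ^ 'n ^ 'n" where "bad_tuple g A" "C = tuple_class g A"
    unfolding sing_locus_tuples by blast
  then show "C \<in> (\<Union>c\<in>{c. nontrivial_mod g CARD('n) c}. \<Union>z\<in>{z. z ^ CARD('n) = 1}. piece g c z)"
  proof -
    assume A: "bad_tuple g A" "C = tuple_class g A"
    obtain c z where "nontrivial_mod g CARD('n) c" "z ^ CARD('n) = 1" "piece_tuple g c z A"
      by (rule bad_tuple_piece[OF A(1)])
    moreover have "C \<in> piece g c z" using A(2) calculation by (auto simp: piece_def)
    ultimately show ?thesis by blast
  qed
next
  fix C :: "'n surface_rep set"
  assume "C \<in> (\<Union>c\<in>{c. nontrivial_mod g CARD('n) c}. \<Union>z\<in>{z. z ^ CARD('n) = 1}. piece g c z)"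
  then show "C \<in> sing_locus (surface_group g)"
    by (auto simp: sing_locus_tuples piece_def intro: piece_tuple_bad)
qed

lemma euler_class_piece: "C \<in> piece g c z \<Longrightarrow> euler_class g C = mat z"
  by (auto simp: piece_def piece_tuple_def euler_class_tuple)

lemma twisted_power:
  fixes A :: "surface_letter \<Rightarrow> complex ^ 'n::finite ^ 'n"
  assumes "twisted g c A X" shows "twisted g (\<lambda>s. k * c s) A (mpow X k)"
  unfolding twisted_def
proof
  fix s assume s: "s \<in> surface_letters g"
  let ?z = "zeta CARD('n)"
  have t: "A s ** X = mat (?z ^ c s) ** (X ** A s)" using assms s by (simp add: twisted_def)
  show "A s ** mpow X k = mat (?z ^ (k * c s)) ** (mpow X k ** A s)"
  proof (induction k)
    case (Suc k)
    have "A s ** mpow X (Suc k) = (A s ** X) ** mpow X k" by (simp add: mpow_Suc matrix_mul_assoc)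
    also have "\<dots> = mat (?z ^ c s) ** (X ** (A s ** mpow X k))" unfolding t by (simp only: matrix_mul_assoc)
    also have "\<dots> = mat (?z ^ c s) ** (mat (?z ^ (k * c s)) ** (X ** mpow X k ** A s))"
      unfolding Suc.IH mat_left_commute[of X "?z ^ (k * c s)"] by (simp only: matrix_mul_assoc)
    finally show ?case by (simp add: matrix_mul_assoc mat_mult_mat power_add mpow_Suc)
  qed simp
qed

lemma piece_cong:
  fixes z :: complex
  assumes "\<And>s. s \<in> surface_letters g \<Longrightarrow> c s mod CARD('n::finite) = c' s mod CARD('n)"
  shows "(piece g c z :: 'n surface_rep set set) = piece g c' z"
proof -
  have "twisted g c A X = twisted g c' A X" for A :: "surface_letter \<Rightarrow> complex ^ 'n ^ 'n" and X
    unfolding twisted_def using zeta_power_cong[OF zero_less_card_finite assms] by (metis (no_types, lifting))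
  then show ?thesis by (simp add: piece_def piece_tuple_def)
qed

text \<open>The power \<open>X\<^sup>k\<close> has the \<open>k\<close>-fold exponents.\<close>

lemma piece_multiple: "(piece g c z :: 'n::finite surface_rep set set) \<subseteq> piece g (\<lambda>s. k * c s) z"
proof -
  have "piece_tuple g (\<lambda>s. k * c s) z A" if A: "piece_tuple g c z A" for A :: "surface_letter \<Rightarrow> complex ^ 'n ^ 'n"
  proof -
    obtain X where X: "X \<noteq> 0" "twisted g c A X" using A by (auto simp: piece_tuple_def)
    have "det X \<noteq> 0"
    proof (rule twisted_commuting_invertible[OF _ X(1)])
      show "irr_tuple g A" using A by (simp add: piece_tuple_def)
      fix s assume "s \<in> surface_letters g"
      then show "\<exists>k. k \<noteq> 0 \<and> A s ** X = mat k ** (X ** A s)"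
        using X(2) unfolding twisted_def by (intro exI[of _ "zeta CARD('n) ^ c s"]) auto
    qed
    then have "det (mpow X k) \<noteq> 0" by (simp add: det_mpow)
    then have "mpow X k \<noteq> 0"
      by (metis (no_types, lifting) det_mat mat_0 power_0_left zero_less_card_finite less_not_refl)
    then show ?thesis using A twisted_power[OF X(2)] by (auto simp: piece_tuple_def)
  qed
  then show ?thesis by (auto simp: piece_def)
qed

definition normal_at :: "nat \<Rightarrow> nat \<Rightarrow> surface_letter \<Rightarrow> (surface_letter \<Rightarrow> nat) \<Rightarrow> bool"
  where "normal_at g p s c \<longleftrightarrow> s \<in> surface_letters g \<and> c s = 1 \<and> (\<forall>t\<in>surface_letters g. c t < p)"

lemma piece_normalise:
  fixes z :: complex
  assumes p: "prime CARD('n::finite)" and s: "s \<in> surface_letters g" "\<not> CARD('n) dvd c s"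
  obtains c' where "normal_at g CARD('n) s c'" "(piece g c z :: 'n surface_rep set set) = piece g c' z"
    "\<exists>k. \<forall>t. c' t = (k * c t) mod CARD('n)"
proof -
  let ?p = "CARD('n)"
  obtain k where k: "(c s * k) mod ?p = 1" using inverse_mod_prime[OF p s(2)] by blast
  define c' where "c' t = (k * c t) mod ?p" for t
  have 1: "(piece g c z :: 'n surface_rep set set) \<subseteq> piece g c' z"
  proof -
    have "(piece g (\<lambda>t. k * c t) z :: 'n surface_rep set set) = piece g c' z"
      by (rule piece_cong) (simp add: c'_def)
    moreover have "(piece g c z :: 'n surface_rep set set) \<subseteq> piece g (\<lambda>t. k * c t) z"
      by (rule piece_multiple)
    ultimately show ?thesis by (simp only:)
  qed
  have "(piece g c' z :: 'n surface_rep set set) \<subseteq> piece g (\<lambda>t. c s * c' t) z" by (rule piece_multiple)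
  also have "\<dots> = piece g c z"
  proof (rule piece_cong)
    fix t
    have "c s * c' t mod ?p = ((c s * k) mod ?p) * c t mod ?p"
      by (simp add: c'_def mod_simps mult_ac)
    then show "c s * c' t mod ?p = c t mod ?p" by (simp add: k)
  qed
  finally have 2: "(piece g c z :: 'n surface_rep set set) = piece g c' z" using 1 by blast
  have "normal_at g ?p s c'"
    using s k by (auto simp: normal_at_def c'_def mult.commute)
  then show ?thesis using that[OF _ 2] c'_def by blast
qed

subsection \<open>Parametrisation of a piece\<close>

text \<open>The data \<open>d\<close> and \<open>K\<close> for which \<open>fill\<close> solves the equation that the Euler invariant is \<open>z\<close>.\<close>

definition solves :: "nat \<Rightarrow> (surface_letter \<Rightarrow> nat) \<Rightarrow> surface_letter \<Rightarrow> complex \<Rightarrow> complex ^ 'n::finite \<Rightarrow>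
    (surface_letter \<Rightarrow> nat set) \<Rightarrow> bool"
  where "solves g c s0 z d K \<longleftrightarrow> normal_at g CARD('n) s0 c \<and> z ^ CARD('n) = 1 \<and> d \<in> torus \<and>
    (\<forall>x :: surface_letter \<Rightarrow> complex ^ 'n. (\<forall>s\<in>surface_letters g. x s \<in> torus) \<and> x s0 = 1 \<longrightarrow>
      (euler_tuple g (nf c x) = mat z \<longleftrightarrow>
      (\<exists>r. r ^ CARD('n) = 1 \<and> x (partner s0) = const_vec r * fill g s0 d K x (partner s0))))"

lemma ex_solves:
  assumes c: "normal_at g CARD('n::finite) s0 c" and z: "z ^ CARD('n) = 1"
  obtains d :: "complex ^ 'n" and K where "solves g c s0 z d K"
proof -
  have c': "s0 \<in> surface_letters g" "c s0 = 1" "\<And>s. s \<in> surface_letters g \<Longrightarrow> c s \<le> CARD('n)"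
    using c by (auto simp: normal_at_def less_imp_le)
  show ?thesis
  proof (rule euler_solve[where g = g and c = c and ?s0.0 = s0 and z = z])
    show "s0 \<in> surface_letters g" "c s0 = 1" "z ^ CARD('n) = 1" by (fact c' z)+
    show "c s \<le> CARD('n)" if "s \<in> surface_letters g" for s using that by (rule c'(3))
  next
    fix d :: "complex ^ 'n" and K
    assume d: "d \<in> torus"
      and *: "\<And>x :: surface_letter \<Rightarrow> complex ^ 'n. (\<And>s. s \<in> surface_letters g \<Longrightarrow> x s \<in> torus) \<Longrightarrow> x s0 = 1 \<Longrightarrow>
      (euler_tuple g (nf c x) = mat z) =
      (\<exists>r. r ^ CARD('n) = 1 \<and> x (partner s0) = const_vec r * fill g s0 d K x (partner s0))"
    show thesis
    proof (rule that[of d K], unfold solves_def, intro conjI c z d allI impI; elim conjE)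
      fix x :: "surface_letter \<Rightarrow> complex ^ 'n"
      assume "\<forall>s\<in>surface_letters g. x s \<in> torus" "x s0 = 1"
      then show "(euler_tuple g (nf c x) = mat z) =
          (\<exists>r. r ^ CARD('n) = 1 \<and> x (partner s0) = const_vec r * fill g s0 d K x (partner s0))"
        by (intro *) auto
    qed
  qed
qed

definition torus_fam :: "nat \<Rightarrow> surface_letter \<Rightarrow> (surface_letter \<Rightarrow> complex ^ 'n::finite) set"
  where "torus_fam g s0 = (\<Pi>\<^sub>E j\<in>free_letters g s0. torus)"

lemma fill_torus:
  assumes "d \<in> torus" "y \<in> torus_fam g s0" "s \<in> surface_letters g"
  shows "fill g s0 d K y s \<in> torus"
  using assms by (auto simp: fill_def torus_fam_def free_letters_def intro!: torus_mult torus_prod pot_torus)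

lemma fill_partner: "(\<And>j. j \<in> free_letters g s0 \<Longrightarrow> x j = y j) \<Longrightarrow>
    fill g s0 d K x (partner s0) = fill g s0 d K y (partner s0)"
  by (simp add: fill_def)

lemma param_rep:
  fixes d :: "complex ^ 'n::finite"
  assumes s: "solves g c s0 z d K" and y: "y \<in> torus_fam g s0"
  shows "euler_tuple g (nf c (fill g s0 d K y)) = mat z" "rep_tuple g (nf c (fill g s0 d K y))"
proof -
  let ?x = "fill g s0 d K y"
  have x: "\<forall>s\<in>surface_letters g. ?x s \<in> torus" "?x s0 = 1"
    using fill_torus[OF _ y] s by (auto simp: solves_def) (simp_all add: fill_def)
  have "?x (partner s0) = const_vec 1 * fill g s0 d K ?x (partner s0)"
  proof -
    have "fill g s0 d K ?x (partner s0) = ?x (partner s0)"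
      by (rule fill_partner) (auto simp: fill_def free_letters_def)
    then show ?thesis by (simp add: vec_eq_iff)
  qed
  then have "\<exists>r. r ^ CARD('n) = 1 \<and> ?x (partner s0) = const_vec r * fill g s0 d K ?x (partner s0)"
    by (intro exI[of _ 1]) simp
  then show e: "euler_tuple g (nf c ?x) = mat z" using s x unfolding solves_def by blast
  have "det_one g (nf c ?x)" using x by (simp add: det_one_def nf_def det_cyc_mono_torus)
  then show "rep_tuple g (nf c ?x)" using e s by (auto simp: rep_tuple_def center_SL solves_def)
qed

definition good_param :: "nat \<Rightarrow> surface_letter \<Rightarrow> complex \<Rightarrow> (surface_letter \<Rightarrow> complex ^ 'n::finite) set"
  where "good_param g s0 z = {y \<in> torus_fam g s0. z \<noteq> 1 \<or> (\<exists>j\<in>free_letters g s0. \<not> (\<exists>k. y j = const_vec k))}"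

lemma const_vec_simps:
  "const_vec a * const_vec b = const_vec (a * b)" "(1 :: complex ^ 'n::finite) = const_vec 1"
  "tinv (const_vec a) = const_vec (1 / a)"
  by (simp_all add: vec_eq_iff)

lemma const_vec_power: "const_vec c ^ m = const_vec (c ^ m)"
  by (induction m) (simp_all add: vec_eq_iff)

lemma const_vec_prod: "(\<Prod>i\<in>I. const_vec (f i)) = const_vec (\<Prod>i\<in>I. f i)"
  by (simp add: vec_eq_iff vec_prod_nth)

text \<open>If all diagonal parts are constant, then all commutators are trivial, so \<open>z = 1\<close>. If \<open>z = 1\<close>, then \<open>d\<close> is constant, and
  constant free parts make all parts constant.\<close>

lemma param_irr:
  fixes d :: "complex ^ 'n::finite"
  assumes p: "prime CARD('n)" and s: "solves g c s0 z d K" and y: "y \<in> torus_fam g s0"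
  shows "irr_tuple g (nf c (fill g s0 d K y)) \<longleftrightarrow> y \<in> good_param g s0 z"
proof -
  let ?x = "fill g s0 d K y"
  have c: "s0 \<in> surface_letters g" "c s0 = 1" "\<And>s. s \<in> surface_letters g \<Longrightarrow> c s \<le> CARD('n)"
    using s by (auto simp: solves_def normal_at_def less_imp_le)
  have x: "\<And>s. s \<in> surface_letters g \<Longrightarrow> ?x s \<in> torus" "?x s0 = 1"
    using fill_torus[OF _ y] s by (auto simp: solves_def) (simp_all add: fill_def)
  have "irr_tuple g (nf c ?x) \<longleftrightarrow> (\<exists>s\<in>surface_letters g. \<not> (\<exists>k. ?x s = const_vec k))"
  proof
    assume "irr_tuple g (nf c ?x)"
    then show "\<exists>s\<in>surface_letters g. \<not> (\<exists>k. ?x s = const_vec k)"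
      using nf_const_reducible[OF p, of g ?x c] by blast
  next
    assume "\<exists>s\<in>surface_letters g. \<not> (\<exists>k. ?x s = const_vec k)"
    then obtain s where "s \<in> surface_letters g" "\<not> (\<exists>k. ?x s = const_vec k)" by blast
    then show "irr_tuple g (nf c ?x)"
      using c(3) by (intro nf_irreducible[of s0 g c ?x s] p c(1,2) x(2))
  qed
  also have "\<dots> \<longleftrightarrow> z \<noteq> 1 \<or> (\<exists>j\<in>free_letters g s0. \<not> (\<exists>k. y j = const_vec k))"
  proof
    assume "z \<noteq> 1 \<or> (\<exists>j\<in>free_letters g s0. \<not> (\<exists>k. y j = const_vec k))"
    then show "\<exists>s\<in>surface_letters g. \<not> (\<exists>k. ?x s = const_vec k)"
    proof
      assume z: "z \<noteq> 1"
      show ?thesis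
      proof (rule ccontr)
        assume "\<not> ?thesis"
        then have "\<forall>s\<in>surface_letters g. \<exists>k. ?x s = const_vec k" by blast
        then obtain k where k: "\<And>s. s \<in> surface_letters g \<Longrightarrow> ?x s = const_vec (k s)" by metis
        have "comm_vec (?x (La i)) (c (La i)) (?x (Lb i)) (c (Lb i)) = 1" if "i \<in> {1..g}" for i
        proof -
          have l: "La i \<in> surface_letters g" "Lb i \<in> surface_letters g"
            using that by (auto simp: surface_letters_def)
          show ?thesis
            unfolding comm_vec_def k[OF l(1)] k[OF l(2)] shift_const
            using x(1)[OF l(1)] x(1)[OF l(2)] unfolding k[OF l(1)] k[OF l(2)] by simp
        qed
        then have "(\<Prod>i\<in>{1..g}. comm_vec (?x (La i)) (c (La i)) (?x (Lb i)) (c (Lb i))) = 1"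
          by (intro prod.neutral ballI)
        moreover have "euler_tuple g (nf c ?x) =
            cyc_mono (\<Prod>i\<in>{1..g}. comm_vec (?x (La i)) (c (La i)) (?x (Lb i)) (c (Lb i))) 0"
          by (rule euler_nf) (rule x(1))
        ultimately have "euler_tuple g (nf c ?x) = cyc_mono 1 0" by (simp only:)
        then have "mat z = (mat 1 :: complex ^ 'n ^ 'n)"
          unfolding param_rep(1)[OF s y] const_vec_simps(2) cyc_mono_const_0 .
        then show False using z by (simp only: mat_eq_iff)
      qed
    next
      assume "\<exists>j\<in>free_letters g s0. \<not> (\<exists>k. y j = const_vec k)"
      then show ?thesis by (auto simp: fill_def free_letters_def)
    qed
  next
    assume ex: "\<exists>s\<in>surface_letters g. \<not> (\<exists>k. ?x s = const_vec k)"
    show "z \<noteq> 1 \<or> (\<exists>j\<in>free_letters g s0. \<not> (\<exists>k. y j = const_vec k))"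
    proof (rule ccontr)
      assume "\<not> ?thesis"
      then have z: "z = 1" and "\<forall>j\<in>free_letters g s0. \<exists>k. y j = const_vec k" by auto
      then obtain k where k: "\<And>j. j \<in> free_letters g s0 \<Longrightarrow> y j = const_vec (k j)" by metis
      \<comment> \<open>The trivial tuple has Euler invariant one, which pins down \<open>d\<close> up to a scalar.\<close>
      have "euler_tuple g (nf c (\<lambda>_. 1 :: complex ^ 'n)) = mat z"
      proof -
        have "comm_vec 1 a 1 b = (1 :: complex ^ 'n)" for a b by (simp add: comm_vec_def vec_eq_iff)
        then have "euler_tuple g (nf c (\<lambda>_. 1 :: complex ^ 'n)) = cyc_mono 1 0"
          by (subst euler_nf) simp_all
        then show ?thesis unfolding z const_vec_simps(2) cyc_mono_const_0 .
      qed
      then have "\<exists>r. r ^ CARD('n) = 1 \<and> (1 :: complex ^ 'n) = const_vec r * fill g s0 d K (\<lambda>_. 1) (partner s0)"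
        using s[unfolded solves_def, THEN conjunct2, THEN conjunct2, THEN conjunct2, THEN spec, of "\<lambda>_. 1"] by simp
      then obtain r where r: "r ^ CARD('n) = 1" "(1 :: complex ^ 'n) = const_vec r * fill g s0 d K (\<lambda>_. 1) (partner s0)"
        by blast
      have "fill g s0 d K (\<lambda>_. 1) (partner s0) = d" by (simp add: fill_def pot_def)
      then have "const_vec r * d = 1" using r(2) by simp
      moreover have rt: "const_vec r \<in> (torus :: (complex ^ 'n) set)" using r(1) by (simp add: const_vec_torus)
      ultimately have d: "d = const_vec (1 / r)" using tinv_unique[OF rt] const_vec_simps(3) by metis
      have "\<exists>k. ?x s = const_vec k" if "s \<in> surface_letters g" for s
      proof (cases "s = partner s0")
        case True
        have "pot (K j) (y j) = const_vec (k j ^ card (K j))" if "j \<in> free_letters g s0" for j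
          by (simp add: pot_def k[OF that] const_vec_power)
        then have "?x s = d * (\<Prod>j\<in>free_letters g s0. const_vec (k j ^ card (K j)))"
          by (simp add: True fill_def)
        then show ?thesis by (simp add: d const_vec_prod const_vec_simps(1)) blast
      next
        case False
        then show ?thesis
          using that k[of s] const_vec_simps(2) by (auto simp: fill_def free_letters_def)
      qed
      then show False using ex by blast
    qed
  qed
  finally show ?thesis using y by (simp add: good_param_def)
qed

definition param :: "nat \<Rightarrow> (surface_letter \<Rightarrow> nat) \<Rightarrow> surface_letter \<Rightarrow> complex ^ 'n::finite \<Rightarrow>
    (surface_letter \<Rightarrow> nat set) \<Rightarrow> (surface_letter \<Rightarrow> complex ^ 'n) \<Rightarrow> 'n surface_rep set"
  where "param g c s0 d K y = tuple_class g (nf c (fill g s0 d K y))"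

lemma nf_twisted_nonzero: "cyc_mono (dft_vec TYPE('n::finite)) 0 \<noteq> 0"
proof
  assume "cyc_mono (dft_vec TYPE('n)) 0 = 0"
  then have "cyc_mono (dft_vec TYPE('n)) 0 $ l $ l = 0" for l by simp
  then show False by (simp add: cyc_mono_def dft_vec_def)
qed

lemma param_piece_tuple:
  fixes d :: "complex ^ 'n::finite"
  assumes p: "prime CARD('n)" and s: "solves g c s0 z d K" and y: "y \<in> good_param g s0 z"
  shows "piece_tuple g c z (nf c (fill g s0 d K y))"
proof -
  have y': "y \<in> torus_fam g s0" using y by (simp add: good_param_def)
  show ?thesis
    unfolding piece_tuple_def
    using param_rep[OF s y'] param_irr[OF p s y'] y nf_twisted nf_twisted_nonzero by blast
qed

text \<open>Equivalent tuples have the same Euler invariant, so the diagonal part at the partner of \<open>s0\<close> is the one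
  that \<open>fill\<close> computes from the free ones, up to a root of unity.\<close>

lemma nf_equiv_restrict:
  fixes d :: "complex ^ 'n::finite"
  assumes p: "prime CARD('n)" and s: "solves g c s0 z d K"
    and A: "rep_tuple g A" "irr_tuple g A" "euler_tuple g A = mat z"
    and x: "\<And>s. s \<in> surface_letters g \<Longrightarrow> x s \<in> torus" "x s0 = 1" "equiv_tuple g (nf c x) A"
  shows "restrict x (free_letters g s0) \<in> good_param g s0 z"
    "equiv_tuple g (nf c (fill g s0 d K (restrict x (free_letters g s0)))) A"
proof -
  have eA: "equiv_tuple g A (nf c x)" by (rule equiv_tuple_sym[OF x(3)])
  have rx: "rep_tuple g (nf c x)" by (rule rep_tuple_equiv[OF A(1) eA])
  have "tuple_class g A = tuple_class g (nf c x)" using conj_class_eq_iff[OF A(1) rx] eA by simp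
  then have "euler_tuple g (nf c x) = mat z"
    using euler_class_tuple[OF A(1)] euler_class_tuple[OF rx] A(3) by simp
  then obtain r where r: "r ^ CARD('n) = 1" "x (partner s0) = const_vec r * fill g s0 d K x (partner s0)"
    using s x unfolding solves_def by blast
  define y where "y = restrict x (free_letters g s0)"
  have yt: "y \<in> torus_fam g s0" using x by (auto simp: y_def torus_fam_def free_letters_def)
  have fp: "fill g s0 d K x (partner s0) = fill g s0 d K y (partner s0)"
    by (rule fill_partner) (simp add: y_def)
  have "\<exists>k. k ^ CARD('n) = 1 \<and> nf c x s ** mat 1 = mat k ** (mat 1 ** nf c (fill g s0 d K y) s)"
    if "s \<in> surface_letters g" for s
  proof (cases "s = partner s0")
    case True
    then show ?thesis using r(1) by (intro exI[of _ r]) (simp add: nf_def r(2) fp cyc_mono_const)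
  next
    case False
    then have "x s = fill g s0 d K y s"
      using that x(2) by (auto simp: fill_def y_def free_letters_def)
    then show ?thesis by (intro exI[of _ 1]) (simp add: nf_def)
  qed
  then have "equiv_tuple g (nf c (fill g s0 d K y)) (nf c x)"
    unfolding equiv_tuple_def by (intro exI[of _ "mat 1"]) simp
  then have e: "equiv_tuple g (nf c (fill g s0 d K y)) A" using x(3) equiv_tuple_trans by blast
  then show "equiv_tuple g (nf c (fill g s0 d K (restrict x (free_letters g s0)))) A" by (simp only: y_def)
  have "irr_tuple g (nf c (fill g s0 d K y))" using irr_tuple_equiv[OF equiv_tuple_sym[OF e] A(2)] by simp
  then show "restrict x (free_letters g s0) \<in> good_param g s0 z" using param_irr[OF p s yt] by (simp add: y_def)
qed

text \<open>Each class in a piece has a representative in monomial form.\<close>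

lemma piece_param:
  fixes d :: "complex ^ 'n::finite"
  assumes p: "prime CARD('n)" and s: "solves g c s0 z d K"
  shows "piece g c z = param g c s0 d K ` good_param g s0 z"
proof (intro equalityI subsetI)
  fix C :: "'n surface_rep set" assume "C \<in> piece g c z"
  then obtain A where A: "piece_tuple g c z A" "C = tuple_class g A" by (auto simp: piece_def)
  then have A': "rep_tuple g A" "irr_tuple g A" "euler_tuple g A = mat z" by (auto simp: piece_tuple_def)
  obtain X where X: "X \<noteq> 0" "twisted g c A X" using A(1) by (auto simp: piece_tuple_def)
  have c: "s0 \<in> surface_letters g" "c s0 = 1" "\<And>s. s \<in> surface_letters g \<Longrightarrow> c s \<le> CARD('n)"
    using s by (auto simp: solves_def normal_at_def less_imp_le)
  have d1: "det_one g A" using A' by (simp add: rep_tuple_def)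
  obtain x where x: "\<And>s. s \<in> surface_letters g \<Longrightarrow> x s \<in> torus" "x s0 = 1" "equiv_tuple g (nf c x) A"
    by (rule nf_from_twisted[of g A s0 c X, OF A'(2) d1 c(1) c(2) c(3) X]) blast+
  obtain y where y: "y \<in> good_param g s0 z" "equiv_tuple g (nf c (fill g s0 d K y)) A"
  proof -
    note nf_equiv_restrict[OF p s A', of x]
    then show thesis using x that by blast
  qed
  have "rep_tuple g (nf c (fill g s0 d K y))"
    using y(1) param_rep(2)[OF s] by (simp add: good_param_def)
  then have "C = param g c s0 d K y"
    unfolding A(2) param_def using conj_class_eq_iff[OF _ A'(1)] y(2) by blast
  then show "C \<in> param g c s0 d K ` good_param g s0 z" using y(1) by blast
next
  fix C :: "'n surface_rep set" assume "C \<in> param g c s0 d K ` good_param g s0 z"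
  then show "C \<in> piece g c z" using param_piece_tuple[OF p s] by (auto simp: piece_def param_def)
qed

section \<open>Heisenberg tuples link the pieces\<close>

text \<open>Together with the cyclic permutation matrix, this diagonal matrix generates a finite Heisenberg group.\<close>

definition heis_vec :: "'n::finite itself \<Rightarrow> complex ^ 'n"
  where "heis_vec _ = (SOME d. d \<in> torus \<and> d = const_vec (zeta CARD('n) ^ (CARD('n) - 1)) * shift 1 d)"

lemma zeta_root: "(zeta CARD('n::finite) ^ k) ^ CARD('n) = 1"
  by (simp add: power_mult[symmetric] mult.commute[of k]) (simp add: power_mult zeta_power_self)

lemma zeta_cancel:
  assumes "p > 0" shows "zeta p ^ x * zeta p ^ ((p - 1) * x) = 1"
proof -
  have "x + (p - 1) * x = p * x" using assms by (cases p) auto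
  then have "zeta p ^ x * zeta p ^ ((p - 1) * x) = zeta p ^ (p * x)" by (simp only: power_add[symmetric])
  also have "\<dots> = 1" unfolding power_mult zeta_power_self[OF assms] by simp
  finally show ?thesis .
qed

lemma heis_vec:
  shows heis_vec_torus: "heis_vec TYPE('n::finite) \<in> torus"
    and heis_vec_shift: "shift k (heis_vec TYPE('n)) = const_vec (zeta CARD('n) ^ k) * heis_vec TYPE('n)"
proof -
  let ?p = "CARD('n)" and ?z = "zeta CARD('n)" and ?d = "heis_vec TYPE('n)"
  obtain d :: "complex ^ 'n" where "d \<in> torus" "d = const_vec (?z ^ (?p - 1)) * shift 1 d"
    using ex_twist_vec[OF zeta_root[where 'n='n, of "?p - 1"]] by blast
  then have d: "?d \<in> torus" "?d = const_vec (?z ^ (?p - 1)) * shift 1 ?d"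
    unfolding heis_vec_def
    using someI[of "\<lambda>d. d \<in> torus \<and> d = const_vec (?z ^ (?p - 1)) * shift 1 d" d] by blast+
  show "?d \<in> torus" by (rule d(1))
  have zz: "?z * ?z ^ (?p - 1) = 1"
    using zeta_cancel[of ?p 1] by simp
  have s1: "shift 1 ?d = const_vec ?z * ?d"
  proof -
    have "const_vec ?z * ?d = const_vec (?z * ?z ^ (?p - 1)) * shift 1 ?d"
      by (subst d(2)) (simp only: const_vec_simps(1)[symmetric] mult.assoc)
    then show ?thesis unfolding zz const_vec_simps(2)[symmetric] by simp
  qed
  show "shift k ?d = const_vec (?z ^ k) * ?d"
  proof (induction k)
    case 0
    show ?case by (simp add: vec_eq_iff)
  next
    case (Suc k)
    have "shift (Suc k) ?d = shift k (shift 1 ?d)" by (simp add: shift_shift)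
    also have "\<dots> = const_vec ?z * shift k ?d" unfolding s1 by (simp add: shift_mult)
    also have "\<dots> = const_vec (?z ^ Suc k) * ?d" unfolding Suc.IH by (simp add: vec_eq_iff)
    finally show ?case .
  qed
qed

lemma torus_power: "x \<in> torus \<Longrightarrow> x ^ k \<in> torus"
  by (induction k) (auto intro: torus_mult)

lemma shift_power: "shift k (x ^ m) = shift k x ^ m"
  by (induction m) (simp_all add: shift_mult)

lemma heis_power_shift:
  "shift k (heis_vec TYPE('n::finite) ^ m) = const_vec (zeta CARD('n) ^ (k * m)) * heis_vec TYPE('n) ^ m"
  by (simp add: shift_power heis_vec_shift power_mult_distrib const_vec_power power_mult)

definition heis :: "(surface_letter \<Rightarrow> nat) \<Rightarrow> (surface_letter \<Rightarrow> nat) \<Rightarrow> surface_letter \<Rightarrow> complex ^ 'n::finite ^ 'n"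
  where "heis a b = nf a (\<lambda>s. heis_vec TYPE('n) ^ b s)"

text \<open>The intersection form of the surface modulo \<open>p\<close>, with \<open>p - 1\<close> for \<open>-1\<close>.\<close>

definition pairing :: "nat \<Rightarrow> nat \<Rightarrow> (surface_letter \<Rightarrow> nat) \<Rightarrow> (surface_letter \<Rightarrow> nat) \<Rightarrow> nat"
  where "pairing p g a b = (\<Sum>i\<in>{1..g}. a (La i) * b (Lb i) + (p - 1) * (a (Lb i) * b (La i)))"

lemma heis_euler: "euler_tuple g (heis a b) = (mat (zeta CARD('n) ^ pairing CARD('n) g a b) :: complex ^ 'n::finite ^ 'n)"
proof -
  let ?p = "CARD('n)" and ?z = "zeta CARD('n)" and ?d = "heis_vec TYPE('n)"
  have c: "comm_vec (?d ^ m) k (?d ^ m') k' = const_vec (?z ^ (k * m' + (?p - 1) * (k' * m)))" for m k m' k'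
  proof -
    have "?z ^ (k' * m) * ?z ^ ((?p - 1) * (k' * m)) = 1" by (rule zeta_cancel) simp
    then have i: "1 / ?z ^ (k' * m) = ?z ^ ((?p - 1) * (k' * m))"
      by (metis nonzero_eq_divide_eq power_not_zero zeta_nonzero mult.commute)
    have "comm_vec (?d ^ m) k (?d ^ m') k' =
        const_vec (?z ^ (k * m')) * const_vec (1 / ?z ^ (k' * m)) * (?d ^ m * tinv (?d ^ m)) * (?d ^ m' * tinv (?d ^ m'))"
      unfolding comm_vec_def heis_power_shift tinv_distrib const_vec_simps(3) by (simp add: mult_ac)
    also have "\<dots> = const_vec (?z ^ (k * m')) * const_vec (1 / ?z ^ (k' * m))"
      using torus_power[OF heis_vec_torus[where 'n='n]] by simp
    finally show ?thesis by (simp add: i const_vec_simps(1) power_add)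
  qed
  have "euler_tuple g (heis a b) = cyc_mono (\<Prod>i\<in>{1..g}. comm_vec (?d ^ b (La i)) (a (La i)) (?d ^ b (Lb i)) (a (Lb i))) 0"
    unfolding heis_def by (rule euler_nf) (intro torus_power heis_vec_torus)
  also have "\<dots> = mat (?z ^ pairing ?p g a b)"
    unfolding c const_vec_prod cyc_mono_const_0 pairing_def power_sum ..
  finally show ?thesis .
qed

text \<open>Elements of a Heisenberg group commute up to roots of unity, so each of them centralizes the tuple
  projectively. The tuple thus lies in the pieces of all combinations of \<open>a\<close> and \<open>b\<close>.\<close>

lemma heis_twisted:
  "twisted g (\<lambda>s. i * a s + j * b s) (heis a b) (cyc_mono (heis_vec TYPE('n::finite) ^ i) ((CARD('n) - 1) * j))"
  unfolding twisted_def
proof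
  fix s
  let ?p = "CARD('n)" and ?z = "zeta CARD('n)" and ?d = "heis_vec TYPE('n)"
  have z: "?z ^ (j * b s) * ?z ^ ((?p - 1) * j * b s) = 1"
    unfolding mult.assoc by (rule zeta_cancel) simp
  have l: "heis a b s ** cyc_mono (?d ^ i) ((?p - 1) * j) =
      cyc_mono (const_vec (?z ^ (a s * i)) * (?d ^ b s * ?d ^ i)) (a s + (?p - 1) * j)"
    unfolding heis_def nf_def cyc_mono_mult heis_power_shift by (simp add: mult_ac)
  have r: "cyc_mono (?d ^ i) ((?p - 1) * j) ** heis a b s =
      cyc_mono (const_vec (?z ^ ((?p - 1) * j * b s)) * (?d ^ b s * ?d ^ i)) (a s + (?p - 1) * j)"
    unfolding heis_def nf_def cyc_mono_mult heis_power_shift by (simp add: mult_ac add_ac)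
  have "mat (?z ^ (i * a s + j * b s)) ** (cyc_mono (?d ^ i) ((?p - 1) * j) ** heis a b s) =
      cyc_mono (const_vec (?z ^ (i * a s) * (?z ^ (j * b s) * ?z ^ ((?p - 1) * j * b s))) * (?d ^ b s * ?d ^ i)) (a s + (?p - 1) * j)"
    unfolding r cyc_mono_const[symmetric] mult.assoc[symmetric] const_vec_simps(1) power_add by (simp add: mult_ac)
  then show "heis a b s ** cyc_mono (?d ^ i) ((?p - 1) * j) =
      mat (?z ^ (i * a s + j * b s)) ** (cyc_mono (?d ^ i) ((?p - 1) * j) ** heis a b s)"
    unfolding l z by (simp add: mult.commute)
qed

lemma heis_piece:
  fixes z :: complex
  assumes p: "prime CARD('n::finite)" and a: "normal_at g CARD('n) s0 a" and b: "b s0 = 0"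
    and t: "t \<in> surface_letters g" "\<not> CARD('n) dvd b t"
    and z: "z = zeta CARD('n) ^ pairing CARD('n) g a b"
  shows "(tuple_class g (heis a b) :: 'n surface_rep set) \<in> piece g (\<lambda>s. i * a s + j * b s) z"
proof -
  let ?d = "heis_vec TYPE('n)"
  have nc: "\<not> (\<exists>k. ?d ^ b t = const_vec k)"
  proof
    assume "\<exists>k. ?d ^ b t = const_vec k"
    then have "shift 1 (?d ^ b t) = ?d ^ b t" by auto
    then have "?d ^ b t * const_vec (zeta CARD('n) ^ b t) = ?d ^ b t * 1"
      by (simp add: heis_power_shift mult.commute)
    then have "const_vec (zeta CARD('n) ^ b t) = (1 :: complex ^ 'n)"
      using torus_cancel[OF torus_power[OF heis_vec_torus]] by blast
    then have "zeta CARD('n) ^ b t = 1" by (simp add: vec_eq_iff)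
    then show False using t(2) by (simp add: zeta_power_eq_1_iff)
  qed
  have a': "s0 \<in> surface_letters g" "a s0 = 1" "a t \<le> CARD('n)"
    using a t by (auto simp: normal_at_def less_imp_le)
  have irr: "irr_tuple g (heis a b :: surface_letter \<Rightarrow> complex ^ 'n ^ 'n)"
    unfolding heis_def
    by (rule nf_irreducible[of s0 g a "\<lambda>s. ?d ^ b s" t, OF p a'(1,2) _ t(1) a'(3) nc]) (simp add: b)
  have "det_one g (heis a b :: surface_letter \<Rightarrow> complex ^ 'n ^ 'n)"
    by (simp add: det_one_def heis_def nf_def det_cyc_mono_torus torus_power heis_vec_torus)
  then have rep: "rep_tuple g (heis a b :: surface_letter \<Rightarrow> complex ^ 'n ^ 'n)"
    by (auto simp: rep_tuple_def heis_euler center_SL zeta_root)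
  have "cyc_mono (?d ^ i) ((CARD('n) - 1) * j) \<noteq> 0"
  proof
    assume "cyc_mono (?d ^ i) ((CARD('n) - 1) * j) = 0"
    then have "det (cyc_mono (?d ^ i) ((CARD('n) - 1) * j)) = det (mat 0 :: complex ^ 'n ^ 'n)" by simp
    then show False
      by (simp only: det_cyc_mono_torus[OF torus_power[OF heis_vec_torus]] det_mat) (simp add: power_0_left)
  qed
  then have "piece_tuple g (\<lambda>s. i * a s + j * b s) z (heis a b :: surface_letter \<Rightarrow> complex ^ 'n ^ 'n)"
    unfolding piece_tuple_def using rep irr heis_euler heis_twisted z by blast
  then show ?thesis by (auto simp: piece_def)
qed

definition letter_unit :: "surface_letter \<Rightarrow> nat \<Rightarrow> surface_letter \<Rightarrow> nat"
  where "letter_unit s u = (\<lambda>t. if t = s then u else 0)"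

definition meets :: "'n::finite itself \<Rightarrow> nat \<Rightarrow> complex \<Rightarrow> (surface_letter \<Rightarrow> nat) \<Rightarrow> (surface_letter \<Rightarrow> nat) \<Rightarrow> bool"
  where "meets _ g z a b \<longleftrightarrow> (piece g a z \<inter> piece g b z :: 'n surface_rep set set) \<noteq> {}"

lemma meets_sym: "meets T g z a b \<Longrightarrow> meets T g z b a"
  by (auto simp: meets_def)

text \<open>With \<open>u\<close> as in the assumption, the Heisenberg tuple with exponents \<open>k a\<close> and \<open>u b\<close> lies in the pieces of both \<open>a\<close> and
  \<open>b\<close>, by two different elements of the Heisenberg group.\<close>

lemma meets_heis:
  fixes z :: complex
  assumes p: "prime CARD('n::finite)" and s0: "s0 \<in> surface_letters g" "\<not> CARD('n) dvd a s0" and b: "b s0 = 0"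
    and t: "t \<in> surface_letters g" "\<not> CARD('n) dvd b t"
    and z: "\<And>k. \<exists>u. \<not> CARD('n) dvd u \<and> z = zeta CARD('n) ^ pairing CARD('n) g (\<lambda>t. (k * a t) mod CARD('n)) (\<lambda>t. u * b t)"
  shows "meets TYPE('n) g z a b"
proof -
  obtain a' k where a': "normal_at g CARD('n) s0 a'" "(piece g a z :: 'n surface_rep set set) = piece g a' z"
    "\<forall>t. a' t = (k * a t) mod CARD('n)"
    by (rule piece_normalise[where 'n='n, of s0 g a z, OF p s0]) blast
  obtain u where u: "\<not> CARD('n) dvd u" "z = zeta CARD('n) ^ pairing CARD('n) g (\<lambda>t. (k * a t) mod CARD('n)) (\<lambda>t. u * b t)"
    using z by blast
  have ak: "a' = (\<lambda>t. (k * a t) mod CARD('n))" using a'(3) by auto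
  let ?b = "\<lambda>t. u * b t"
  have bt: "\<not> CARD('n) dvd ?b t" using t(2) u(1) p by (simp add: prime_dvd_mult_iff)
  note H = heis_piece[where 'n='n, OF p a'(1), of ?b t z, OF _ t(1) bt u(2)[folded ak]]
  have "tuple_class g (heis a' ?b) \<in> (piece g a z :: 'n surface_rep set set)"
    using H[of 1 0] b a'(2) by simp
  moreover have "tuple_class g (heis a' ?b) \<in> (piece g b z :: 'n surface_rep set set)"
  proof -
    obtain v where v: "(u * v) mod CARD('n) = 1" using inverse_mod_prime[OF p u(1)] by blast
    have "tuple_class g (heis a' ?b) \<in> (piece g (\<lambda>s. 0 * a' s + v * ?b s) z :: 'n surface_rep set set)"
      using H[of 0 v] b by simp
    also have "(piece g (\<lambda>s. 0 * a' s + v * ?b s) z :: 'n surface_rep set set) = piece g b z"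
    proof (rule piece_cong)
      fix s
      have "(0 * a' s + v * ?b s) mod CARD('n) = (((u * v) mod CARD('n)) * b s) mod CARD('n)"
        by (simp add: mod_simps mult_ac)
      then show "(0 * a' s + v * ?b s) mod CARD('n) = b s mod CARD('n)" by (simp add: v)
    qed
    finally show ?thesis .
  qed
  ultimately show ?thesis unfolding meets_def by blast
qed

lemma pairing_unit:
  assumes s: "s \<in> surface_letters g"
  shows "pairing p g a (letter_unit (partner s) u) = (case s of La i \<Rightarrow> a s * u | Lb i \<Rightarrow> (p - 1) * (a s * u))"
proof (cases s)
  case (La i)
  then have i: "i \<in> {1..g}" using s by (auto simp: surface_letters_def)
  have "pairing p g a (letter_unit (partner s) u) = (\<Sum>j\<in>{1..g}. if j = i then a s * u else 0)"
    unfolding pairing_def by (intro sum.cong) (auto simp: La letter_unit_def)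
  then show ?thesis using i by (simp add: La)
next
  case (Lb i)
  then have i: "i \<in> {1..g}" using s by (auto simp: surface_letters_def)
  have "pairing p g a (letter_unit (partner s) u) = (\<Sum>j\<in>{1..g}. if j = i then (p - 1) * (a s * u) else 0)"
    unfolding pairing_def by (intro sum.cong) (auto simp: Lb letter_unit_def)
  then show ?thesis using i by (simp add: Lb)
qed

lemma solve_mod_prime:
  assumes p: "prime (p :: nat)" and m: "\<not> p dvd m"
  obtains u where "(m * u) mod p = k mod p"
proof -
  obtain v where v: "(m * v) mod p = 1" using inverse_mod_prime[OF p m] by blast
  have "(m * (v * k)) mod p = (((m * v) mod p) * k) mod p" by (simp add: mod_simps mult_ac)
  then show ?thesis using that[of "v * k"] v by simp
qed

text \<open>The pairing with multiples of the coordinate vector at the partner of \<open>s\<close> takes every value modulo \<open>p\<close>, and a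
  nontrivial \<open>z\<close> requires a nontrivial multiple.\<close>

lemma meets_unit:
  fixes z :: complex
  assumes p: "prime CARD('n::finite)" and s: "s \<in> surface_letters g" "\<not> CARD('n) dvd a s"
    and z: "z ^ CARD('n) = 1" "z \<noteq> 1"
  shows "meets TYPE('n) g z a (letter_unit (partner s) 1)"
proof -
  let ?p = "CARD('n)"
  obtain k where k: "z = zeta ?p ^ k" using root_of_unity_is_zeta_power[OF zero_less_card_finite z(1)] by metis
  have kp: "\<not> ?p dvd k" using z(2) by (simp add: k zeta_power_eq_1_iff)
  obtain k0 where k0: "normal_at g ?p s (\<lambda>t. (k0 * a t) mod ?p)" "(piece g a z :: 'n surface_rep set set) = piece g (\<lambda>t. (k0 * a t) mod ?p) z"
  proof -
    obtain a' k where a': "normal_at g CARD('n) s a'" "(piece g a z :: 'n surface_rep set set) = piece g a' z"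
      "\<forall>t. a' t = (k * a t) mod CARD('n)"
      by (rule piece_normalise[where 'n='n, of s g a z, OF p s]) blast
    then have "a' = (\<lambda>t. (k * a t) mod CARD('n))" by auto
    then show thesis using that a' by blast
  qed
  let ?a = "\<lambda>t. (k0 * a t) mod ?p"
  have a1: "?a s = 1" using k0(1) by (simp add: normal_at_def)
  have m: "\<not> ?p dvd (case s of La i \<Rightarrow> 1 | Lb i \<Rightarrow> ?p - 1)"
    using prime_gt_1_nat[OF p] by (auto split: surface_letter.splits dest: dvd_imp_le)
  obtain u where u: "((case s of La i \<Rightarrow> 1 | Lb i \<Rightarrow> ?p - 1) * u) mod ?p = k mod ?p"
    using solve_mod_prime[OF p m] by blast
  have up: "\<not> ?p dvd u"
  proof
    assume "?p dvd u"
    then have "((case s of La i \<Rightarrow> 1 | Lb i \<Rightarrow> ?p - 1) * u) mod ?p = 0" by (simp add: dvd_mult)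
    then show False using u kp by auto
  qed
  have "pairing ?p g ?a (letter_unit (partner s) u) = (case s of La i \<Rightarrow> 1 | Lb i \<Rightarrow> ?p - 1) * u"
    unfolding pairing_unit[OF s(1)] a1 by (cases s) auto
  then have zu: "z = zeta ?p ^ pairing ?p g ?a (letter_unit (partner s) u)"
    unfolding k by (intro zeta_power_cong) (simp_all add: u)
  have t: "partner s \<in> surface_letters g" "\<not> ?p dvd letter_unit (partner s) u (partner s)"
    using partner_in[OF s(1)] up by (auto simp: letter_unit_def)
  have b0: "letter_unit (partner s) u s = 0" using not_sym[OF partner_neq[of s]] by (simp add: letter_unit_def)
  note H = heis_piece[where 'n='n, OF p k0(1) b0 t zu]
  have "tuple_class g (heis ?a (letter_unit (partner s) u)) \<in> (piece g a z :: 'n surface_rep set set)"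
    using H[of 1 0] k0(2) by simp
  moreover have "tuple_class g (heis ?a (letter_unit (partner s) u)) \<in> (piece g (letter_unit (partner s) 1) z :: 'n surface_rep set set)"
  proof -
    obtain v where v: "(u * v) mod ?p = 1" using inverse_mod_prime[OF p up] by blast
    have "tuple_class g (heis ?a (letter_unit (partner s) u)) \<in>
        (piece g (\<lambda>t. 0 * ?a t + v * letter_unit (partner s) u t) z :: 'n surface_rep set set)"
      using H[of 0 v] by simp
    also have "(piece g (\<lambda>t. 0 * ?a t + v * letter_unit (partner s) u t) z :: 'n surface_rep set set) = piece g (letter_unit (partner s) 1) z"
      using v prime_gt_1_nat[OF p] by (intro piece_cong) (auto simp: letter_unit_def mult.commute)
    finally show ?thesis .
  qed
  ultimately show ?thesis unfolding meets_def by blast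
qed

lemma meets_orthogonal:
  assumes p: "prime CARD('n::finite)" and s0: "s0 \<in> surface_letters g" "\<not> CARD('n) dvd a s0" and b: "b s0 = 0"
    and t: "t \<in> surface_letters g" "\<not> CARD('n) dvd b t"
    and orth: "\<And>k. CARD('n) dvd pairing CARD('n) g (\<lambda>t. (k * a t) mod CARD('n)) b"
  shows "meets TYPE('n) g 1 a b"
proof (rule meets_heis[of s0 g a b t 1, OF p s0 b t])
  fix k
  have "\<not> CARD('n) dvd 1" using prime_gt_1_nat[OF p] by (auto dest: dvd_imp_le)
  moreover have "1 = zeta CARD('n) ^ pairing CARD('n) g (\<lambda>t. (k * a t) mod CARD('n)) (\<lambda>t. 1 * b t)"
    using orth[of k] zeta_power_eq_1_iff[of "CARD('n)"] by simp
  ultimately show "\<exists>u. \<not> CARD('n) dvd u \<and>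
      1 = zeta CARD('n) ^ pairing CARD('n) g (\<lambda>t. (k * a t) mod CARD('n)) (\<lambda>t. u * b t)" by blast
qed

fun letter_index :: "surface_letter \<Rightarrow> nat"
  where "letter_index (La i) = i" | "letter_index (Lb i) = i"

lemma pairing_block:
  assumes b: "\<And>t. t \<in> surface_letters g \<Longrightarrow> letter_index t \<noteq> j \<Longrightarrow> b t = 0" and j: "j \<in> {1..g}"
  shows "pairing p g a b = a (La j) * b (Lb j) + (p - 1) * (a (Lb j) * b (La j))"
proof -
  have "pairing p g a b = (\<Sum>i\<in>{1..g}. if i = j then a (La j) * b (Lb j) + (p - 1) * (a (Lb j) * b (La j)) else 0)"
    unfolding pairing_def
  proof (intro sum.cong HOL.refl)
    fix i assume i: "i \<in> {1..g}"
    then have "La i \<in> surface_letters g" "Lb i \<in> surface_letters g" by (auto simp: surface_letters_def)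
    then show "a (La i) * b (Lb i) + (p - 1) * (a (Lb i) * b (La i)) =
        (if i = j then a (La j) * b (Lb j) + (p - 1) * (a (Lb j) * b (La j)) else 0)"
      using b[of "La i"] b[of "Lb i"] by auto
  qed
  then show ?thesis using j by simp
qed

definition link :: "'n::finite itself \<Rightarrow> nat \<Rightarrow> complex \<Rightarrow> (surface_letter \<Rightarrow> nat) \<Rightarrow> (surface_letter \<Rightarrow> nat) \<Rightarrow> bool"
  where "link T g z a b \<longleftrightarrow> nontrivial_mod g CARD('n) a \<and> nontrivial_mod g CARD('n) b \<and> meets T g z a b"

lemma nontrivial_unit:
  assumes "prime p" "s \<in> surface_letters g" shows "nontrivial_mod g p (letter_unit s 1)"
  using assms prime_gt_1_nat[of p] unfolding nontrivial_mod_def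
  by (intro bexI[of _ s]) (auto simp: letter_unit_def dest: dvd_imp_le)

text \<open>For Euler invariant \<open>z \<noteq> 1\<close> every piece meets a coordinate piece, and the coordinate pieces of two
  letters are joined through the piece of their sum; for \<open>z = 1\<close> one uses classes that are orthogonal
  for the intersection form, which needs a second handle.\<close>

lemma link_hub:
  fixes z :: complex
  assumes g: "g \<ge> 2" and p: "prime CARD('n::finite)" and z: "z ^ CARD('n) = 1" and a: "nontrivial_mod g CARD('n) a"
  shows "(link TYPE('n) g z)\<^sup>*\<^sup>* a (letter_unit (La 1) 1)"
proof (cases "z = 1")
  case False
  let ?L = "link TYPE('n) g z" and ?S = "surface_letters g" and ?p = "CARD('n)"
  have p1: "\<not> ?p dvd 1" using prime_gt_1_nat[OF p] by (auto dest: dvd_imp_le)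
  have lk: "?L a (letter_unit (partner s) 1)" if "s \<in> ?S" "\<not> ?p dvd a s" for a s
    using meets_unit[of s g a z, OF p that z False] that nontrivial_unit[OF p partner_in[OF that(1)]]
    by (auto simp: link_def nontrivial_mod_def)
  have lk': "?L (letter_unit (partner s) 1) a" if "s \<in> ?S" "\<not> ?p dvd a s" for a s
    using lk[of s a, OF that] meets_sym by (auto simp: link_def)
  have unit: "?L\<^sup>*\<^sup>* (letter_unit (partner s) 1) (letter_unit (partner t) 1)" if s: "s \<in> ?S" and t: "t \<in> ?S" for s t
  proof -
    define b where "b = (\<lambda>u. if u = s \<or> u = t then 1 else 0 :: nat)"
    have "?L (letter_unit (partner s) 1) b" using s p1 by (intro lk') (auto simp: b_def)
    moreover have "?L b (letter_unit (partner t) 1)" using t p1 by (intro lk) (auto simp: b_def)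
    ultimately show ?thesis by (meson converse_rtranclp_into_rtranclp r_into_rtranclp)
  qed
  obtain s where s: "s \<in> ?S" "\<not> ?p dvd a s" using a by (auto simp: nontrivial_mod_def)
  have "Lb 1 \<in> ?S" using g by (auto simp: surface_letters_def)
  from unit[OF s(1) this] have "?L\<^sup>*\<^sup>* (letter_unit (partner s) 1) (letter_unit (La 1) 1)" by simp
  then show ?thesis by (rule converse_rtranclp_into_rtranclp[of ?L, OF lk[of s a, OF s]])
next
  case True
  let ?L = "link TYPE('n) g 1" and ?S = "surface_letters g" and ?p = "CARD('n)"
  have p1: "\<not> ?p dvd 1" using prime_gt_1_nat[OF p] by (auto dest: dvd_imp_le)
  have lin: "letter_index t \<in> {1..g}" if "t \<in> ?S" for t using that by (auto simp: surface_letters_def)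
  have block: "?L b (letter_unit t 1)"
    if t: "t \<in> ?S" and s: "s \<in> ?S" "\<not> ?p dvd b s" and b: "\<And>u. u \<in> ?S \<Longrightarrow> letter_index u = letter_index t \<Longrightarrow> b u = 0" for b s t
  proof -
    have "b (La (letter_index t)) = 0" "b (Lb (letter_index t)) = 0"
      using lin[OF t] by (auto intro!: b simp: surface_letters_def)
    then have "?p dvd pairing ?p g (\<lambda>t. (k * b t) mod ?p) (letter_unit t 1)" for k
      using lin[OF t] by (subst pairing_block[of g "letter_index t"]) (auto simp: letter_unit_def)
    moreover have "letter_unit t 1 s = 0" using b[OF s(1)] s(2) by (auto simp: letter_unit_def)
    ultimately have "meets TYPE('n) g 1 b (letter_unit t 1)"
      using p1 by (intro meets_orthogonal[of s g b "letter_unit t 1" t, OF p s _ t]) (auto simp: letter_unit_def)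
    then show ?thesis using s nontrivial_unit[OF p t] by (auto simp: link_def nontrivial_mod_def)
  qed
  obtain s where s: "s \<in> ?S" "\<not> ?p dvd a s" using a by (auto simp: nontrivial_mod_def)
  obtain j where j: "j \<in> {1..g}" "j \<noteq> letter_index s"
    using g by (metis (no_types) atLeastAtMost_iff one_le_numeral order_refl le_trans one_neq_zero numeral_eq_one_iff semiring_norm(85))
  have jS: "La j \<in> ?S" "Lb j \<in> ?S" using j by (auto simp: surface_letters_def)
  \<comment> \<open>Parallel to \<open>a\<close> on the handle \<open>j\<close>, hence orthogonal to \<open>a\<close>; where \<open>a\<close> vanishes on this handle, any nonzero choice is.\<close>
  define b where "b = (\<lambda>t. if letter_index t = j then
    (if ?p dvd a (La j) \<and> ?p dvd a (Lb j) then 1 else a t) else 0)"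
  have nb: "\<exists>t\<in>?S. \<not> ?p dvd b t"
    using jS p1 by (cases "?p dvd a (La j)"; cases "?p dvd a (Lb j)") (force simp: b_def)+
  then obtain t where t: "t \<in> ?S" "\<not> ?p dvd b t" by blast
  have "?p dvd pairing ?p g (\<lambda>t. (k * a t) mod ?p) b" for k
  proof -
    have e: "pairing ?p g (\<lambda>t. (k * a t) mod ?p) b =
        ((k * a (La j)) mod ?p) * b (Lb j) + (?p - 1) * (((k * a (Lb j)) mod ?p) * b (La j))"
      using j by (intro pairing_block) (auto simp: b_def)
    show ?thesis
    proof (cases "?p dvd a (La j) \<and> ?p dvd a (Lb j)")
      case True
      then have "(k * a (La j)) mod ?p = 0" "(k * a (Lb j)) mod ?p = 0" by (auto simp: dvd_mult)
      then show ?thesis unfolding e by simp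
    next
      case False
      have pp: "x + (?p - 1) * x = ?p * x" for x :: nat
        using mult_eq_if[of ?p x] by simp
      have "pairing ?p g (\<lambda>t. (k * a t) mod ?p) b mod ?p =
          ((k * a (La j)) * b (Lb j) + (?p - 1) * ((k * a (Lb j)) * b (La j))) mod ?p"
        unfolding e by (metis (no_types, opaque_lifting) mod_add_eq mod_mult_left_eq mod_mult_right_eq)
      also have "\<dots> = (?p * (k * a (La j) * a (Lb j))) mod ?p"
        unfolding pp[symmetric] using False by (auto simp: b_def mult_ac)
      finally show ?thesis by (simp add: mod_eq_0_iff_dvd)
    qed
  qed
  moreover have "b s = 0" using j(2) by (auto simp: b_def)
  ultimately have "meets TYPE('n) g 1 a b" by (intro meets_orthogonal[of s g a b t, OF p s _ t])
  then have ab: "?L a b" using a t by (auto simp: link_def nontrivial_mod_def)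
  have l1: "La 1 \<in> ?S" "La 2 \<in> ?S" using g by (auto simp: surface_letters_def)
  have "?L\<^sup>*\<^sup>* b (letter_unit (La 1) 1)"
  proof (cases "j = 1")
    case False
    then have "?L b (letter_unit (La 1) 1)" by (intro block[of "La 1" t b, OF l1(1) t]) (auto simp: b_def)
    then show ?thesis by blast
  next
    case True
    then have "?L b (letter_unit (La 2) 1)" by (intro block[of "La 2" t b, OF l1(2) t]) (auto simp: b_def)
    moreover have "?L (letter_unit (La 2) 1) (letter_unit (La 1) 1)"
      using p1 by (intro block[of "La 1" "La 2" "letter_unit (La 2) 1", OF l1(1) l1(2)]) (auto simp: letter_unit_def)
    ultimately show ?thesis by (meson converse_rtranclp_into_rtranclp r_into_rtranclp)
  qed
  then show ?thesis using ab True by (simp add: converse_rtranclp_into_rtranclp)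
qed

section \<open>Continuity of polynomial maps\<close>

lemma continuous_map_complex_mult:
  fixes f h :: "'a \<Rightarrow> complex"
  shows "continuous_map X euclidean f \<Longrightarrow> continuous_map X euclidean h \<Longrightarrow> continuous_map X euclidean (\<lambda>x. f x * h x)"
  by (simp add: continuous_map_atin tendsto_mult)

lemma continuous_map_complex_add:
  fixes f h :: "'a \<Rightarrow> complex"
  shows "continuous_map X euclidean f \<Longrightarrow> continuous_map X euclidean h \<Longrightarrow> continuous_map X euclidean (\<lambda>x. f x + h x)"
  by (simp add: continuous_map_atin tendsto_add)

lemma continuous_map_vec:
  fixes f :: "'a \<Rightarrow> 'b::topological_space ^ 'n::finite"
  assumes "\<And>i. continuous_map X euclidean (\<lambda>x. f x $ i)"
  shows "continuous_map X euclidean f"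
  unfolding continuous_map
proof (intro conjI allI impI)
  fix U :: "('b ^ 'n) set" assume "openin euclidean U"
  then have U: "open U" by simp
  show "openin X {x \<in> topspace X. f x \<in> U}"
  proof (subst openin_subopen, intro ballI)
    fix x assume "x \<in> {x \<in> topspace X. f x \<in> U}"
    then have x: "x \<in> topspace X" "f x \<in> U" by auto
    obtain A where A: "\<forall>i. open (A i) \<and> f x $ i \<in> A i" "\<forall>y. (\<forall>i. y $ i \<in> A i) \<longrightarrow> y \<in> U"
      using U x(2) unfolding open_vec_def by blast
    have o: "openin X {x \<in> topspace X. f x $ i \<in> A i}" for i
      using assms[of i] A(1) by (auto simp: continuous_map)
    have "openin X (\<Inter>i\<in>UNIV. {x \<in> topspace X. f x $ i \<in> A i})"
      using o by (intro openin_Inter) auto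
    moreover have "x \<in> (\<Inter>i\<in>UNIV. {x \<in> topspace X. f x $ i \<in> A i})" using x A(1) by auto
    moreover have "(\<Inter>i\<in>UNIV. {x \<in> topspace X. f x $ i \<in> A i}) \<subseteq> {x \<in> topspace X. f x \<in> U}"
      using A(2) by auto
    ultimately show "\<exists>T. openin X T \<and> x \<in> T \<and> T \<subseteq> {x \<in> topspace X. f x \<in> U}" by blast
  qed
qed auto

lemma continuous_map_vec_nth:
  fixes f :: "'a \<Rightarrow> 'b::topological_space ^ 'n::finite"
  assumes "continuous_map X euclidean f"
  shows "continuous_map X euclidean (\<lambda>x. f x $ i)"
proof -
  have "continuous_map euclidean euclidean (\<lambda>v :: 'b ^ 'n. v $ i)"
    by (auto intro: continuous_intros)
  from continuous_map_compose[OF assms this] show ?thesis by (simp only: o_def)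
qed

lemma poly_fun_continuous:
  fixes f :: "('s \<Rightarrow> complex ^ 'n::finite ^ 'n) \<Rightarrow> complex"
  assumes "poly_fun S f"
  shows "continuous_map (product_topology (\<lambda>_. euclidean) S) euclidean f"
  using assms
proof (induction rule: poly_fun.induct)
  case (entry s i j)
  then show ?case
    by (intro continuous_map_vec_nth continuous_map_product_projection) 
qed (auto intro: continuous_map_complex_mult continuous_map_complex_add)

lemma poly_fun_sum: "(\<And>i. i \<in> I \<Longrightarrow> poly_fun S (f i)) \<Longrightarrow> poly_fun S (\<lambda>t. \<Sum>i\<in>I. f i t)"
  by (induction I rule: infinite_finite_induct) (auto intro: poly_fun.intros)

lemma poly_fun_prod: "(\<And>i. i \<in> I \<Longrightarrow> poly_fun S (f i)) \<Longrightarrow> poly_fun S (\<lambda>t. \<Prod>i\<in>I. f i t)"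
  by (induction I rule: infinite_finite_induct) (auto intro: poly_fun.intros)

definition poly_mat :: "'s set \<Rightarrow> (('s \<Rightarrow> complex ^ 'n::finite ^ 'n) \<Rightarrow> complex ^ 'n ^ 'n) \<Rightarrow> bool"
  where "poly_mat S M \<longleftrightarrow> (\<forall>i j. poly_fun S (\<lambda>t. M t $ i $ j))"

lemma poly_mat_const: "poly_mat S (\<lambda>_. M)"
  by (simp add: poly_mat_def poly_fun.const)

lemma poly_mat_var: "s \<in> S \<Longrightarrow> poly_mat S (\<lambda>t. t s)"
  by (simp add: poly_mat_def poly_fun.entry)

lemma poly_mat_mult: "poly_mat S M \<Longrightarrow> poly_mat S N \<Longrightarrow> poly_mat S (\<lambda>t. M t ** N t)"
  by (auto simp: poly_mat_def matrix_matrix_mult_def intro!: poly_fun_sum poly_fun.mult)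

lemma poly_mat_add: "poly_mat S M \<Longrightarrow> poly_mat S N \<Longrightarrow> poly_mat S (\<lambda>t. M t + N t)"
  by (auto simp: poly_mat_def intro!: poly_fun.add)

lemma poly_fun_minus: "poly_fun S f \<Longrightarrow> poly_fun S h \<Longrightarrow> poly_fun S (\<lambda>t. f t - h t)"
  using poly_fun.add[of S f "\<lambda>t. (- 1) * h t"] poly_fun.mult[OF poly_fun.const, of S h "- 1"] by simp

lemma poly_mat_diff: "poly_mat S M \<Longrightarrow> poly_mat S N \<Longrightarrow> poly_mat S (\<lambda>t. M t - N t)"
  by (auto simp: poly_mat_def intro!: poly_fun_minus)

lemma poly_mat_mpow: "poly_mat S M \<Longrightarrow> poly_mat S (\<lambda>t. mpow (M t) k)"
  by (induction k) (simp_all add: poly_mat_const mpow_Suc poly_mat_mult)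

lemma column_mult_axis: "column l M = M *v axis l 1" for M :: "complex ^ 'n::finite ^ 'n"
proof -
  have "(\<Sum>j\<in>UNIV. M $ i $ j * axis l 1 $ j) = (\<Sum>j\<in>UNIV. if j = l then M $ i $ j else 0)" for i
    by (intro sum.cong) (auto simp: axis_def)
  then show ?thesis by (simp add: vec_eq_iff column_def matrix_vector_mult_def)
qed

text \<open>By Cramer's rule the inverse is polynomial on \<open>SL\<close>.\<close>

lemma poly_mat_inverse:
  assumes M: "poly_mat S M"
  obtains N where "poly_mat S N" "\<And>t. det (M t) = 1 \<Longrightarrow> N t = inv\<^bsub>SL\<^esub> (M t)"
proof -
  define N where "N t = (\<chi> k l. det (\<chi> i j. if j = k then axis l 1 $ i else M t $ i $ j))" for t
  have "poly_fun S (\<lambda>t. N t $ k $ l)" for k l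
  proof -
    have "poly_fun S (\<lambda>t. if j = k then axis l 1 $ i else M t $ i $ j)" for i j
      using M by (cases "j = k") (auto simp: poly_mat_def intro: poly_fun.const)
    then show ?thesis
      unfolding N_def det_def by (auto intro!: poly_fun_sum poly_fun.mult poly_fun_prod poly_fun.const)
  qed
  then have "poly_mat S N" by (simp add: poly_mat_def)
  moreover have "N t = inv\<^bsub>SL\<^esub> (M t)" if d: "det (M t) = 1" for t
  proof -
    have dn: "det (M t) \<noteq> 0" using d by simp
    have "M t *v (inv\<^bsub>SL\<^esub> (M t) *v axis l 1) = axis l 1" for l
      by (simp add: matrix_vector_mul_assoc inv_SL[OF d])
    from cramer[OF dn, THEN iffD1, OF this]
    have "column l (inv\<^bsub>SL\<^esub> (M t)) = (\<chi> k. det (\<chi> i j. if j = k then axis l 1 $ i else M t $ i $ j) / det (M t))" for l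
      by (simp only: column_mult_axis)
    then have "column l (inv\<^bsub>SL\<^esub> (M t)) $ k = N t $ k $ l" for k l
      by (simp add: d N_def)
    then show ?thesis by (simp add: column_def vec_eq_iff)
  qed
  ultimately show ?thesis by (rule that)
qed

section \<open>Tuples indexed by group elements\<close>

text \<open>The tuple with the permutation matrix at one letter and the identity elsewhere tells this letter from
  all others.\<close>

lemma surface_gen_inj:
  assumes p: "prime CARD('n::finite)"
  shows "inj_on (surface_gen g) (surface_letters g)"
proof (rule inj_onI, rule ccontr)
  fix s t assume s: "s \<in> surface_letters g" and t: "t \<in> surface_letters g"
    and e: "surface_gen g s = surface_gen g t" and st: "s \<noteq> t"
  define A :: "surface_letter \<Rightarrow> complex ^ 'n ^ 'n" where "A = nf (letter_unit s 1) (\<lambda>_. 1)"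
  have "comm_vec 1 a 1 b = (1 :: complex ^ 'n)" for a b by (simp add: comm_vec_def vec_eq_iff)
  then have "euler_tuple g A = cyc_mono 1 0" unfolding A_def by (subst euler_nf) simp_all
  then have "euler_tuple g A = mat 1" unfolding const_vec_simps(2) cyc_mono_const_0 .
  moreover have "det_one g A" by (simp add: det_one_def A_def nf_def det_cyc_mono_torus)
  ultimately have r: "rep_tuple g A" by (auto simp: rep_tuple_def center_SL)
  have "PSL_proj (A s) = PSL_proj (A t)"
    using rep_of_gen[OF r s] rep_of_gen[OF r t] e by simp
  then obtain c where c: "A t = mat c ** A s" unfolding PSL_proj_eq_iff by blast
  fix l :: 'n
  have "A t $ l $ l = 1" using st by (simp add: A_def nf_def letter_unit_def cyc_mono_def)
  moreover have "rot (Suc 0) l \<noteq> l"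
    using rot_eq_iff[of "Suc 0" l 0] prime_gt_1_nat[OF p] by auto
  then have "(mat c ** A s) $ l $ l = 0" by (auto simp: A_def nf_def letter_unit_def cyc_mono_def)
  ultimately show False using c by simp
qed

lemma finite_surface_gens [simp]: "finite (surface_gens g)"
  by (simp add: surface_gens_def)

text \<open>The topologies on representations refer to functions on the generators as group elements, the matrix computations
  to functions on letters.\<close>

definition tup :: "nat \<Rightarrow> (surface_letter word set \<Rightarrow> 'a) \<Rightarrow> surface_letter \<Rightarrow> 'a"
  where "tup g t = (\<lambda>s. t (surface_gen g s))"

definition untup :: "nat \<Rightarrow> (surface_letter \<Rightarrow> 'a) \<Rightarrow> surface_letter word set \<Rightarrow> 'a"
  where "untup g A = (\<lambda>\<gamma>\<in>surface_gens g. A (inv_into (surface_letters g) (surface_gen g) \<gamma>))"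

lemma tup_untup:
  assumes "inj_on (surface_gen g) (surface_letters g)" "s \<in> surface_letters g"
  shows "tup g (untup g A) s = A s"
  using assms by (simp add: tup_def untup_def surface_gens_def)

lemma untup_gen:
  assumes "inj_on (surface_gen g) (surface_letters g)" "s \<in> surface_letters g"
  shows "untup g A (surface_gen g s) = A s"
  using tup_untup[OF assms] by (simp add: tup_def)

lemma untup_SL:
  assumes i: "inj_on (surface_gen g) (surface_letters g)" and d: "det_one g A"
  shows "untup g A \<in> (\<Pi>\<^sub>E s\<in>surface_gens g. carrier SL)"
proof (rule PiE_I)
  fix \<gamma> assume "\<gamma> \<in> surface_gens g"
  then obtain s where "s \<in> surface_letters g" "\<gamma> = surface_gen g s" by (auto simp: surface_gens_def)
  then show "untup g A \<gamma> \<in> carrier SL"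
    using det_one_D[OF d] by (simp add: carrier_SL untup_gen[OF i])
qed (simp add: untup_def)

lemma det_one_tup: "t \<in> (\<Pi>\<^sub>E s\<in>surface_gens g. carrier SL) \<Longrightarrow> det_one g (tup g t)"
  by (auto simp: det_one_def tup_def surface_gens_def carrier_SL PiE_iff)

lemma restrict_rep_of:
  assumes "rep_tuple g A" and t: "\<And>s. s \<in> surface_letters g \<Longrightarrow> t (surface_gen g s) = A s"
  shows "restrict (rep_of g A) (surface_gens g) = (\<lambda>\<gamma>\<in>surface_gens g. PSL_proj (t \<gamma>))"
proof (rule restrict_ext)
  fix \<gamma> assume "\<gamma> \<in> surface_gens g"
  then obtain s where "s \<in> surface_letters g" "\<gamma> = surface_gen g s" by (auto simp: surface_gens_def)
  then show "rep_of g A \<gamma> = PSL_proj (t \<gamma>)" by (simp add: rep_of_gen[OF assms(1)] t)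
qed

lemma restrict_rep_tup:
  assumes r: "\<rho> \<in> Hom (surface_group g)" and e: "restrict \<rho> (surface_gens g) = (\<lambda>\<gamma>\<in>surface_gens g. PSL_proj (t \<gamma>))"
  shows "rep_tuple g (tup g t)" "\<rho> = rep_of g (tup g t)"
proof -
  have "tup g t s \<in> \<rho> (surface_gen g s)" if s: "s \<in> surface_letters g" for s
  proof -
    have "surface_gen g s \<in> surface_gens g" using s by (auto simp: surface_gens_def)
    then have "\<rho> (surface_gen g s) = PSL_proj (tup g t s)"
      using fun_cong[OF e, of "surface_gen g s"] by (simp add: tup_def)
    then show ?thesis by (simp add: in_PSL_proj)
  qed
  then show "rep_tuple g (tup g t)" "\<rho> = rep_of g (tup g t)"
    using Hom_is_rep_of[OF r] by blast+
qed

lemma poly_mat_euler: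
  obtains E where "poly_mat (surface_gens g) E"
    "\<And>t. t \<in> (\<Pi>\<^sub>E s\<in>surface_gens g. carrier (SL :: (complex ^ 'n::finite ^ 'n) monoid)) \<Longrightarrow> E t = euler_tuple g (tup g t)"
proof -
  let ?S = "surface_gens g" and ?P = "\<Pi>\<^sub>E s\<in>surface_gens g. carrier (SL :: (complex ^ 'n ^ 'n) monoid)"
  define good where "good l \<longleftrightarrow> (\<exists>E. poly_mat ?S E \<and> (\<forall>t\<in>?P. E t =
    foldr (**) (map (\<lambda>i. tup g t (La i) ** tup g t (Lb i) ** inv\<^bsub>SL\<^esub> (tup g t (La i)) ** inv\<^bsub>SL\<^esub> (tup g t (Lb i))) l) (mat 1)))" for l
  have "good l" if "set l \<subseteq> {1..g}" for l
    using that
  proof (induction l)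
    case Nil
    show ?case unfolding good_def by (intro exI[of _ "\<lambda>_. mat 1"]) (simp add: poly_mat_const)
  next
    case (Cons i l)
    then obtain E where E: "poly_mat ?S E" "\<forall>t\<in>?P. E t =
      foldr (**) (map (\<lambda>i. tup g t (La i) ** tup g t (Lb i) ** inv\<^bsub>SL\<^esub> (tup g t (La i)) ** inv\<^bsub>SL\<^esub> (tup g t (Lb i))) l) (mat 1)"
      unfolding good_def by auto
    have l: "La i \<in> surface_letters g" "Lb i \<in> surface_letters g" using Cons.prems by (auto simp: surface_letters_def)
    then have lS: "surface_gen g (La i) \<in> ?S" "surface_gen g (Lb i) \<in> ?S" by (auto simp: surface_gens_def)
    have v: "poly_mat ?S (\<lambda>t. tup g t (La i) :: complex ^ 'n ^ 'n)" "poly_mat ?S (\<lambda>t. tup g t (Lb i) :: complex ^ 'n ^ 'n)"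
      unfolding tup_def using lS by (auto intro: poly_mat_var)
    obtain Na where Na: "poly_mat ?S Na" "\<And>t. det (tup g t (La i) :: complex ^ 'n ^ 'n) = 1 \<Longrightarrow> Na t = inv\<^bsub>SL\<^esub> (tup g t (La i))"
      by (rule poly_mat_inverse[OF v(1)]) blast
    obtain Nb where Nb: "poly_mat ?S Nb" "\<And>t. det (tup g t (Lb i) :: complex ^ 'n ^ 'n) = 1 \<Longrightarrow> Nb t = inv\<^bsub>SL\<^esub> (tup g t (Lb i))"
      by (rule poly_mat_inverse[OF v(2)]) blast
    have "poly_mat ?S (\<lambda>t. (tup g t (La i) ** tup g t (Lb i) ** Na t ** Nb t) ** E t)"
      by (intro poly_mat_mult v Na Nb E)
    moreover have "(tup g t (La i) ** tup g t (Lb i) ** Na t ** Nb t) ** E t =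
      foldr (**) (map (\<lambda>i. tup g t (La i) ** tup g t (Lb i) ** inv\<^bsub>SL\<^esub> (tup g t (La i)) ** inv\<^bsub>SL\<^esub> (tup g t (Lb i))) (i # l)) (mat 1)"
      if "t \<in> ?P" for t
      using E(2) that Na(2)[of t] Nb(2)[of t] det_one_D[OF det_one_tup[OF that]] l by simp
    ultimately show ?case unfolding good_def by blast
  qed
  moreover have "set [1..<Suc g] \<subseteq> {1..g}" by auto
  ultimately have "good [1..<Suc g]" by blast
  then obtain E where "poly_mat ?S E" "\<forall>t\<in>?P. E t = foldr (**) (map (\<lambda>i. tup g t (La i) ** tup g t (Lb i) **
      inv\<^bsub>SL\<^esub> (tup g t (La i)) ** inv\<^bsub>SL\<^esub> (tup g t (Lb i))) [1..<Suc g]) (mat 1)"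
    unfolding good_def by blast
  moreover have "mult SL = ((**) :: complex ^ 'n ^ 'n \<Rightarrow> _)" by (simp add: SL_def)
  ultimately show ?thesis
    by (intro that[of E]) (auto simp: euler_tuple_def commutator_prod_def one_SL simp del: upt_Suc)
qed

section \<open>The classical topology\<close>

lemma continuous_PSL_proj: "continuous_map (top_of_set (carrier SL)) PSL_topology PSL_proj"
  unfolding PSL_topology_def continuous_map by (auto simp: openin_quotient_topology)

lemma topspace_PSL: "topspace PSL_topology = carrier PSL"
  by (auto simp: PSL_topology_def carrier_PSL carrier_SL)

text \<open>The full preimage of the image of an open set is the union of its finitely many central translates.\<close>

lemma open_PSL_proj:
  fixes U :: "(complex ^ 'n::finite ^ 'n) set"
  assumes "openin (top_of_set (carrier SL)) U"
  shows "openin PSL_topology (PSL_proj ` U)"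
  unfolding PSL_topology_def openin_quotient_topology
proof (intro conjI)
  show "PSL_proj ` U \<subseteq> PSL_proj ` topspace (top_of_set (carrier SL))"
    using openin_subset[OF assms] by (intro image_mono)
  let ?SL = "carrier (SL :: (complex ^ 'n ^ 'n) monoid)"
  have "{x \<in> topspace (top_of_set ?SL). PSL_proj x \<in> PSL_proj ` U} =
      (\<Union>c\<in>{c. c ^ CARD('n) = 1}. {x \<in> topspace (top_of_set ?SL). mat c ** x \<in> U})"
  proof (intro equalityI subsetI)
    fix x assume "x \<in> {x \<in> topspace (top_of_set ?SL). PSL_proj x \<in> PSL_proj ` U}"
    then obtain u where "x \<in> ?SL" "u \<in> U" "PSL_proj x = PSL_proj u" by auto
    then show "x \<in> (\<Union>c\<in>{c. c ^ CARD('n) = 1}. {x \<in> topspace (top_of_set ?SL). mat c ** x \<in> U})"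
      unfolding PSL_proj_eq_iff by auto
  next
    fix x assume "x \<in> (\<Union>c\<in>{c. c ^ CARD('n) = 1}. {x \<in> topspace (top_of_set ?SL). mat c ** x \<in> U})"
    then obtain c where c: "c ^ CARD('n) = 1" "x \<in> ?SL" "mat c ** x \<in> U" by auto
    then have "PSL_proj x = PSL_proj (mat c ** x)" unfolding PSL_proj_eq_iff by blast
    then show "x \<in> {x \<in> topspace (top_of_set ?SL). PSL_proj x \<in> PSL_proj ` U}" using c by auto
  qed
  moreover have "openin (top_of_set ?SL) {x \<in> topspace (top_of_set ?SL). mat c ** x \<in> U}" if "c ^ CARD('n) = 1" for c
  proof -
    have "continuous_map euclidean euclidean (\<lambda>x :: complex ^ 'n ^ 'n. mat c ** x)"
    proof (intro continuous_map_vec)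
      fix i j
      have "continuous_map euclidean euclidean (\<lambda>x :: complex ^ 'n ^ 'n. x $ i $ j)"
        by (intro continuous_map_vec_nth continuous_map_id[unfolded id_def])
      then show "continuous_map euclidean euclidean (\<lambda>x :: complex ^ 'n ^ 'n. (mat c ** x) $ i $ j)"
        unfolding mat_mult_nth by (intro continuous_map_complex_mult) auto
    qed
    then have "continuous_map (top_of_set ?SL) (top_of_set ?SL) (\<lambda>x. mat c ** x)"
      using that unfolding continuous_map_in_subtopology
      by (intro conjI continuous_map_from_subtopology) (auto simp: carrier_SL det_mul det_mat)
    then show ?thesis using assms by (auto simp: continuous_map)
  qed
  ultimately show "openin (top_of_set ?SL) {x \<in> topspace (top_of_set ?SL). PSL_proj x \<in> PSL_proj ` U}"
    by (auto intro: openin_Union)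
qed

lemma continuous_quotient: "continuous_map X (quotient_topology X q) q"
  by (auto simp: continuous_map openin_quotient_topology)

lemma topspace_Hom_topology:
  assumes "\<And>\<rho>. \<rho> \<in> Hom \<Gamma> \<Longrightarrow> restrict \<rho> S \<in> topspace T"
  shows "topspace (Hom_topology \<Gamma> S T) = Hom \<Gamma>"
  using assms by (auto simp: Hom_topology_def topspace_pullback_topology)

lemma surface_Hom_restrict:
  assumes "\<rho> \<in> Hom (surface_group g)"
  shows "restrict \<rho> (surface_gens g) \<in> (\<Pi>\<^sub>E s\<in>surface_gens g. carrier PSL)"
  using assms surface_gen_in by (auto simp: Hom_def surface_gens_def intro: hom_in_carrier)

abbreviation classical_topology :: "nat \<Rightarrow> 'n::finite surface_rep topology"
  where "classical_topology g \<equiv>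
    Hom_topology (surface_group g) (surface_gens g) (product_topology (\<lambda>_. PSL_topology) (surface_gens g))"

lemma topspace_classical: "topspace (classical_topology g) = Hom (surface_group g)"
  using surface_Hom_restrict by (intro topspace_Hom_topology) (simp add: topspace_PSL)

lemma irr_reps_Hom: "irr_reps \<Gamma> \<subseteq> Hom \<Gamma>"
  by (auto simp: irr_reps_def)

lemma sing_locus_subset: "sing_locus \<Gamma> \<subseteq> conj_class \<Gamma> ` irr_reps \<Gamma>"
  using bad_reps_irr by (auto simp: sing_locus_def)

lemma topspace_sing: "topspace (sing_topology (surface_group g) (surface_gens g)) = sing_locus (surface_group g)"
  using irr_reps_Hom sing_locus_subset
  by (fastforce simp: sing_topology_def char_variety_topology_def topspace_classical)

lemma continuous_tuple_class:
  fixes h :: "'a \<Rightarrow> surface_letter \<Rightarrow> complex ^ 'n::finite ^ 'n"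
  assumes rep: "\<And>y. y \<in> topspace Y \<Longrightarrow> bad_tuple g (h y)"
    and cont: "\<And>s. s \<in> surface_letters g \<Longrightarrow> continuous_map Y euclidean (\<lambda>y. h y s)"
  shows "continuous_map Y (sing_topology (surface_group g) (surface_gens g)) (\<lambda>y. tuple_class g (h y))"
proof -
  let ?S = "surface_gens g" and ?r = "\<lambda>y. rep_of g (h y)"
  have rt: "rep_tuple g (h y)" if "y \<in> topspace Y" for y using rep[OF that] by (simp add: bad_tuple_def)
  have "continuous_map Y (product_topology (\<lambda>_. PSL_topology) ?S) (\<lambda>y. restrict (?r y) ?S)"
    unfolding continuous_map_componentwise
  proof (intro conjI ballI)
    fix \<gamma> assume "\<gamma> \<in> ?S"
    then obtain s where s: "s \<in> surface_letters g" "\<gamma> = surface_gen g s" "\<gamma> \<in> ?S" by (auto simp: surface_gens_def)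
    have "continuous_map Y (top_of_set (carrier SL)) (\<lambda>y. h y s)"
      using cont[OF s(1)] rt s(1) by (auto simp: continuous_map_in_subtopology carrier_SL rep_tuple_def det_one_def)
    then have "continuous_map Y PSL_topology (\<lambda>y. PSL_proj (h y s))"
      using continuous_map_compose[OF _ continuous_PSL_proj] by (fastforce simp: o_def)
    then show "continuous_map Y PSL_topology (\<lambda>y. restrict (?r y) ?S \<gamma>)"
      by (rule continuous_map_eq) (use s(3) in \<open>simp add: s(2) rep_of_gen[OF rt s(1)]\<close>)
  qed auto
  then have "continuous_map Y (classical_topology g) ?r"
    unfolding Hom_topology_def using rt rep_of_Hom
    by (intro continuous_map_pullback') (auto simp: o_def)
  then have "continuous_map Y (subtopology (classical_topology g) (irr_reps (surface_group g))) ?r"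
    using rep irr_rep_of_iff by (auto simp: continuous_map_in_subtopology bad_tuple_def)
  from continuous_map_compose[OF this continuous_quotient, of "conj_class (surface_group g)"]
  have "continuous_map Y (char_variety_topology (surface_group g) ?S (product_topology (\<lambda>_. PSL_topology) ?S))
      (\<lambda>y. tuple_class g (h y))"
    by (simp add: o_def char_variety_topology_def tuple_class_def)
  then show ?thesis
    using rep by (auto simp: sing_topology_def continuous_map_in_subtopology sing_locus_tuples)
qed

section \<open>Polynomials in the coordinates of a family of vectors\<close>

inductive entry_poly :: "'j set \<Rightarrow> (('j \<Rightarrow> complex ^ 'n::finite) \<Rightarrow> complex) \<Rightarrow> bool"
  for J where
  const: "entry_poly J (\<lambda>y. c)"
| entry: "j \<in> J \<Longrightarrow> entry_poly J (\<lambda>y. y j $ l)"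
| add: "entry_poly J f \<Longrightarrow> entry_poly J h \<Longrightarrow> entry_poly J (\<lambda>y. f y + h y)"
| mult: "entry_poly J f \<Longrightarrow> entry_poly J h \<Longrightarrow> entry_poly J (\<lambda>y. f y * h y)"

lemma entry_poly_prod: "(\<And>i. i \<in> I \<Longrightarrow> entry_poly J (f i)) \<Longrightarrow> entry_poly J (\<lambda>t. \<Prod>i\<in>I. f i t)"
  by (induction I rule: infinite_finite_induct) (auto intro: entry_poly.intros)

lemma entry_poly_continuous:
  fixes f :: "('j \<Rightarrow> complex ^ 'n::finite) \<Rightarrow> complex"
  assumes "entry_poly J f"
  shows "continuous_map (product_topology (\<lambda>_. euclidean) J) euclidean f"
  using assms
proof (induction rule: entry_poly.induct)
  case (entry j l)
  then show ?case
    by (intro continuous_map_vec_nth continuous_map_product_projection)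
qed (auto intro: continuous_map_complex_mult continuous_map_complex_add)

lemma entry_poly_nf:
  fixes d :: "complex ^ 'n::finite"
  assumes s: "s \<in> surface_letters g"
  shows "entry_poly (free_letters g s0) (\<lambda>y. nf c (fill g s0 d K y) s $ i $ j)"
proof -
  let ?J = "free_letters g s0"
  have "entry_poly ?J (\<lambda>y. fill g s0 d K y s $ l)" for l
  proof -
    consider "s = s0" | "s \<noteq> s0" "s = partner s0" | "s \<in> ?J" "s \<noteq> s0" "s \<noteq> partner s0"
      using s by (auto simp: free_letters_def)
    then show ?thesis
    proof cases
      case 2
      then show ?thesis
        by (auto simp: fill_def vec_prod_nth pot_def
            intro!: entry_poly.mult entry_poly.const entry_poly_prod entry_poly.entry)
    qed (auto simp: fill_def intro: entry_poly.const entry_poly.entry)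
  qed
  then have *: "entry_poly ?J (\<lambda>y. (mono_scale TYPE('n) ^ c s) * fill g s0 d K y s $ i)"
    by (intro entry_poly.mult entry_poly.const)
  show ?thesis
    by (cases "j = rot (c s) i") (auto simp: nf_def cyc_mono_def intro: entry_poly.const *)
qed

section \<open>Connectedness of the pieces\<close>

definition exp_vec :: "complex ^ 'n::finite \<Rightarrow> complex ^ 'n"
  where "exp_vec u = (\<chi> l. exp (u $ l))"

definition trace_zero :: "(complex ^ 'n::finite) set"
  where "trace_zero = {u. (\<Sum>l\<in>UNIV. u $ l) = 0}"

definition nonconst_torus :: "(complex ^ 'n::finite) set"
  where "nonconst_torus = {x \<in> torus. \<not> (\<exists>k. x = const_vec k)}"

lemma exp_vec_image: "exp_vec ` trace_zero = (torus :: (complex ^ 'n::finite) set)"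
proof (intro equalityI subsetI)
  fix x :: "complex ^ 'n" assume "x \<in> exp_vec ` trace_zero"
  then show "x \<in> torus" by (auto simp: exp_vec_def trace_zero_def torus_def exp_sum[symmetric])
next
  fix x :: "complex ^ 'n" assume x: "x \<in> torus"
  fix l0 :: 'n
  define u :: "complex ^ 'n" where "u = (\<chi> l. if l = l0 then - (\<Sum>l\<in>UNIV - {l0}. Ln (x $ l)) else Ln (x $ l))"
  have "(\<Sum>l\<in>UNIV. u $ l) = u $ l0 + (\<Sum>l\<in>UNIV - {l0}. u $ l)" by (rule sum.remove) auto
  also have "(\<Sum>l\<in>UNIV - {l0}. u $ l) = (\<Sum>l\<in>UNIV - {l0}. Ln (x $ l))" by (intro sum.cong) (auto simp: u_def)
  finally have "u \<in> trace_zero" by (simp add: trace_zero_def u_def)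
  moreover have "exp_vec u = x"
  proof -
    have other: "exp (Ln (x $ l)) = x $ l" for l using torus_nonzero[OF x] by (rule exp_Ln)
    have "x $ l0 * (\<Prod>l\<in>UNIV - {l0}. x $ l) = (\<Prod>l\<in>UNIV. x $ l)" by (rule prod.remove[symmetric]) auto
    also have "\<dots> = 1" using x by (simp add: torus_def)
    finally have "1 / (\<Prod>l\<in>UNIV - {l0}. x $ l) = x $ l0"
      by (metis eq_divide_imp mult_zero_right zero_neq_one)
    moreover have "exp (u $ l0) = 1 / (\<Prod>l\<in>UNIV - {l0}. x $ l)"
      by (simp add: u_def exp_minus exp_sum other divide_inverse)
    ultimately show ?thesis by (auto simp: exp_vec_def vec_eq_iff u_def other)
  qed
  ultimately show "x \<in> exp_vec ` trace_zero" by blast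
qed

lemma continuous_exp_vec: "continuous_on A (exp_vec :: complex ^ 'n::finite \<Rightarrow> _)"
  unfolding exp_vec_def by (intro continuous_on_vec_lambda continuous_intros)

lemma convex_trace_zero: "convex (trace_zero :: (complex ^ 'n::finite) set)"
  unfolding convex_def trace_zero_def
  by (auto simp: sum.distrib scaleR_sum_right[symmetric])

lemma connected_torus: "connected (torus :: (complex ^ 'n::finite) set)"
  unfolding exp_vec_image[symmetric]
  by (intro connected_continuous_image continuous_exp_vec convex_connected convex_trace_zero)

text \<open>The torus is the exponential image of the trace zero hyperplane, and only countably many points of the
  latter become constant vectors. A convex set that is not contained in a line remains connected without countably many points.\<close>

lemma connected_nonconst_torus:
  assumes "CARD('n::finite) \<ge> 2"
  shows "connected (nonconst_torus :: (complex ^ 'n) set)"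
proof -
  let ?p = "CARD('n)"
  define D where "D = (\<lambda>n :: int. Complex 0 (of_int (2 * n) * pi / real ?p)) ` UNIV"
  define C :: "(complex ^ 'n) set" where "C = {u. \<forall>l. u $ l \<in> D}"
  define B :: "(complex ^ 'n) set" where "B = {u \<in> trace_zero. \<exists>k. exp_vec u = const_vec k}"
  have "B \<subseteq> C"
  proof
    fix u assume u: "u \<in> B"
    then obtain k where k: "exp_vec u = const_vec k" by (auto simp: B_def)
    have "exp_vec u \<in> torus" using u exp_vec_image by (auto simp: B_def)
    then have kp: "k ^ ?p = 1" by (simp add: k const_vec_torus)
    have "u $ l \<in> D" for l
    proof -
      have "exp_vec u $ l = k" by (simp add: k)
      then have "exp (of_nat ?p * u $ l) = 1" using kp by (simp add: exp_vec_def exp_of_nat_mult)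
      then have "Re (of_nat ?p * u $ l) = 0" "\<exists>n :: int. Im (of_nat ?p * u $ l) = of_int (2 * n) * pi"
        by (simp_all only: exp_eq_1)
      then obtain n :: int where "Re (u $ l) = 0" "real ?p * Im (u $ l) = of_int (2 * n) * pi" by auto
      then have "u $ l = Complex 0 (of_int (2 * n) * pi / real ?p)"
        by (simp add: complex_eq_iff field_simps)
      then show ?thesis by (auto simp: D_def)
    qed
    then show "u \<in> C" by (simp add: C_def)
  qed
  moreover have "countable C"
  proof -
    have cD: "countable D" by (simp add: D_def)
    have "($) ` C \<subseteq> PiE UNIV (\<lambda>_. D)" by (auto simp: C_def)
    moreover have "countable (PiE (UNIV :: 'n set) (\<lambda>_. D))" by (intro countable_PiE cD) auto
    ultimately have "countable (($) ` C)" by (rule countable_subset)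
    moreover have "inj_on (($)) C" by (rule inj_onI) (auto simp: vec_eq_iff dest: fun_cong)
    ultimately show ?thesis by (rule countable_image_inj_on)
  qed
  ultimately have cB: "countable B" by (rule countable_subset)
  have nc: "\<not> collinear (trace_zero :: (complex ^ 'n) set)"
  proof
    assume "collinear (trace_zero :: (complex ^ 'n) set)"
    then obtain w where w: "\<And>x y :: complex ^ 'n. x \<in> trace_zero \<Longrightarrow> y \<in> trace_zero \<Longrightarrow> \<exists>c. x - y = c *\<^sub>R w"
      unfolding collinear_def by blast
    obtain l l' :: 'n where ll: "l \<noteq> l'"
    proof -
      obtain l l' :: 'n where "ix l = 0" "ix l' = 1" using ex_ix[of 0] ex_ix[of 1] assms by fastforce
      then show thesis using that by (metis zero_neq_one)
    qed
    define a :: "complex \<Rightarrow> complex ^ 'n" where "a r = (\<chi> i. if i = l then r else if i = l' then - r else 0)" for r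
    have at: "a r \<in> trace_zero" for r
    proof -
      have "(\<Sum>i\<in>UNIV. a r $ i) = (\<Sum>i\<in>{l, l'}. a r $ i)"
        by (rule sum.mono_neutral_right) (auto simp: a_def)
      then show ?thesis using ll by (simp add: trace_zero_def a_def)
    qed
    have z: "(0 :: complex ^ 'n) \<in> trace_zero" by (simp add: trace_zero_def)
    obtain c1 c2 where c: "a 1 - 0 = c1 *\<^sub>R w" "a \<i> - 0 = c2 *\<^sub>R w" using w[OF at z] by metis
    have "1 = c1 *\<^sub>R (w $ l)" "\<i> = c2 *\<^sub>R (w $ l)"
      using arg_cong[OF c(1), of "\<lambda>v. v $ l"] arg_cong[OF c(2), of "\<lambda>v. v $ l"] by (simp_all add: a_def)
    then have "c1 *\<^sub>R \<i> = c2 *\<^sub>R (1 :: complex)" by (metis mult.commute scaleR_scaleR)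
    then have "c1 = 0" by (simp add: complex_eq_iff)
    then show False using \<open>1 = c1 *\<^sub>R (w $ l)\<close> by simp
  qed
  have "connected (trace_zero - B)"
    by (rule path_connected_imp_connected[OF path_connected_convex_diff_countable[OF convex_trace_zero nc cB]])
  then have "connected (exp_vec ` (trace_zero - B))"
    by (intro connected_continuous_image continuous_exp_vec)
  moreover have "exp_vec ` (trace_zero - B) = nonconst_torus"
    unfolding nonconst_torus_def exp_vec_image[symmetric] by (auto simp: B_def)
  ultimately show ?thesis by simp
qed

lemma ex_nonconst_torus:
  assumes "CARD('n::finite) \<ge> 2"
  shows "heis_vec TYPE('n) \<in> nonconst_torus"
proof -
  have "heis_vec TYPE('n) \<noteq> const_vec k" for k
  proof
    assume k: "heis_vec TYPE('n) = const_vec k"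
    then have k0: "k \<noteq> 0" using torus_nonzero[OF heis_vec_torus[where 'n='n]] by auto
    have "const_vec k = const_vec (zeta CARD('n) ^ 1) * (const_vec k :: complex ^ 'n)"
      using heis_vec_shift[where 'n='n, of 1] unfolding k by simp
    then have "k = zeta CARD('n) ^ 1 * k" by (simp only: vec_eq_iff const_vec_nth vec_times_nth)
    then have "zeta CARD('n) ^ 1 = 1" using k0 by simp
    then have "CARD('n) dvd 1" by (simp only: zeta_power_eq_1_iff zero_less_card_finite)
    then show False using assms by simp
  qed
  then show ?thesis by (simp add: nonconst_torus_def heis_vec_torus)
qed

text \<open>For \<open>z = 1\<close> the parameters are a union of products, one for each letter whose part is required not to be
  constant, and any two of these products meet.\<close>

lemma good_param_connected:
  assumes p: "CARD('n::finite) \<ge> 2"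
  shows "connectedin (product_topology (\<lambda>_. euclidean) (free_letters g s0))
    (good_param g s0 z :: (surface_letter \<Rightarrow> complex ^ 'n) set)"
proof (cases "z = 1")
  case False
  then have "good_param g s0 z = (\<Pi>\<^sub>E j\<in>free_letters g s0. (torus :: (complex ^ 'n) set))"
    by (auto simp: good_param_def torus_fam_def)
  then show ?thesis by (simp add: connectedin_PiE connected_torus)
next
  case True
  let ?J = "free_letters g s0" and ?X = "product_topology (\<lambda>_. euclidean :: (complex ^ 'n) topology) (free_letters g s0)"
  define U where "U j = (\<Pi>\<^sub>E i\<in>?J. if i = j then nonconst_torus else (torus :: (complex ^ 'n) set))" for j
  have "good_param g s0 z = \<Union>(U ` ?J)"
  proof (intro equalityI subsetI)
    fix y :: "surface_letter \<Rightarrow> complex ^ 'n" assume "y \<in> good_param g s0 z"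
    then obtain j where j: "y \<in> torus_fam g s0" "j \<in> ?J" "\<not> (\<exists>k. y j = const_vec k)"
      using True by (auto simp: good_param_def)
    then have "y j \<in> nonconst_torus" by (auto simp: nonconst_torus_def torus_fam_def)
    then have "y \<in> U j" using j(1) by (auto simp: U_def torus_fam_def PiE_iff)
    then show "y \<in> \<Union>(U ` ?J)" using j(2) by blast
  next
    fix y assume "y \<in> \<Union>(U ` ?J)"
    then obtain j where j: "j \<in> ?J" "y \<in> U j" by blast
    then have yj: "y j \<in> nonconst_torus" by (auto simp: U_def PiE_iff dest: bspec[of _ _ j])
    have "y i \<in> torus" if "i \<in> ?J" for i
      using j(2) that by (cases "i = j") (auto simp: U_def PiE_iff nonconst_torus_def dest: bspec[of _ _ i])
    then have "y \<in> torus_fam g s0" using j(2) by (auto simp: U_def torus_fam_def PiE_iff)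
    then show "y \<in> good_param g s0 z" using yj j(1) by (auto simp: good_param_def nonconst_torus_def)
  qed
  moreover have "connectedin ?X (U j)" for j
    unfolding U_def by (subst connectedin_PiE) (auto simp: connected_torus connected_nonconst_torus[OF p])
  moreover have "connectedin ?X (\<Union>(U ` ?J))"
  proof (cases "?J = {}")
    case False
    have "(\<lambda>j\<in>?J. heis_vec TYPE('n)) \<in> \<Inter>(U ` ?J)"
      using ex_nonconst_torus[OF p] by (auto simp: U_def nonconst_torus_def)
    then show ?thesis using calculation(2) by (intro connectedin_Union) auto
  qed simp
  ultimately show ?thesis by simp
qed

lemma good_param_nonempty:
  assumes p: "CARD('n::finite) \<ge> 2" and J: "free_letters g s0 \<noteq> {}"
  shows "(good_param g s0 z :: (surface_letter \<Rightarrow> complex ^ 'n) set) \<noteq> {}"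
proof -
  have "(\<lambda>j\<in>free_letters g s0. heis_vec TYPE('n)) \<in> good_param g s0 z"
    using J ex_nonconst_torus[OF p] by (auto simp: good_param_def torus_fam_def nonconst_torus_def)
  then show ?thesis by blast
qed

lemma free_letters_nonempty: "g \<ge> 2 \<Longrightarrow> s0 \<in> surface_letters g \<Longrightarrow> free_letters g s0 \<noteq> {}"
proof
  assume "g \<ge> 2" "s0 \<in> surface_letters g" "free_letters g s0 = {}"
  then show False using card_free_letters[of s0 g] by simp
qed

lemma normal_at_nontrivial: "prime p \<Longrightarrow> normal_at g p s c \<Longrightarrow> nontrivial_mod g p c"
  unfolding normal_at_def nontrivial_mod_def
  using prime_gt_1_nat[of p] by (metis dvd_1_iff_1 less_not_refl nat_dvd_1_iff_1)

lemma normal_piece_connected: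
  fixes z :: complex
  assumes p: "prime CARD('n::finite)" and g: "g \<ge> 2" and c: "normal_at g CARD('n) s0 c" and z: "z ^ CARD('n) = 1"
  shows "connectedin (sing_topology (surface_group g) (surface_gens g)) (piece g c z :: 'n surface_rep set set)"
    and "(piece g c z :: 'n surface_rep set set) \<noteq> {}"
proof -
  have p2: "CARD('n) \<ge> 2" using prime_ge_2_nat[OF p] .
  obtain d :: "complex ^ 'n" and K where s: "solves g c s0 z d K" by (rule ex_solves[OF c z])
  let ?X = "product_topology (\<lambda>_. euclidean :: (complex ^ 'n) topology) (free_letters g s0)"
  let ?G = "good_param g s0 z :: (surface_letter \<Rightarrow> complex ^ 'n) set"
  let ?Y = "subtopology ?X ?G"
  have "?G \<subseteq> topspace ?X"
    using PiE_mono[of "free_letters g s0" "\<lambda>_. torus" "\<lambda>_. UNIV :: (complex ^ 'n) set"]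
    by (auto simp: good_param_def torus_fam_def)
  then have top: "topspace ?Y = ?G" by (rule topspace_subtopology_subset)
  have "continuous_map ?Y (sing_topology (surface_group g) (surface_gens g)) (\<lambda>y. tuple_class g (nf c (fill g s0 d K y)))"
  proof (rule continuous_tuple_class)
    show "bad_tuple g (nf c (fill g s0 d K y))" if "y \<in> topspace ?Y" for y
      using that piece_tuple_bad[OF normal_at_nontrivial[OF p c] param_piece_tuple[OF p s]] unfolding top by blast
    show "continuous_map ?Y euclidean (\<lambda>y. nf c (fill g s0 d K y) t)" if "t \<in> surface_letters g" for t
      by (intro continuous_map_vec continuous_map_from_subtopology entry_poly_continuous entry_poly_nf that)
  qed
  moreover have "connectedin ?Y ?G"
    using good_param_connected[OF p2] by (simp add: connectedin_subtopology)
  ultimately have "connectedin (sing_topology (surface_group g) (surface_gens g)) ((\<lambda>y. tuple_class g (nf c (fill g s0 d K y))) ` ?G)"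
    by (rule connectedin_continuous_map_image)
  then show "connectedin (sing_topology (surface_group g) (surface_gens g)) (piece g c z :: 'n surface_rep set set)"
    unfolding piece_param[OF p s] param_def .
  have "s0 \<in> surface_letters g" using c by (simp add: normal_at_def)
  then show "(piece g c z :: 'n surface_rep set set) \<noteq> {}"
    unfolding piece_param[OF p s] using good_param_nonempty[OF p2 free_letters_nonempty[OF g]] by blast
qed

lemma piece_connected:
  fixes z :: complex
  assumes p: "prime CARD('n::finite)" and g: "g \<ge> 2" and c: "nontrivial_mod g CARD('n) c" and z: "z ^ CARD('n) = 1"
  shows "connectedin (sing_topology (surface_group g) (surface_gens g)) (piece g c z :: 'n surface_rep set set)"
    and "(piece g c z :: 'n surface_rep set set) \<noteq> {}"
proof -
  obtain s where s: "s \<in> surface_letters g" "\<not> CARD('n) dvd c s" using c by (auto simp: nontrivial_mod_def)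
  obtain c' where c': "normal_at g CARD('n) s c'" "(piece g c z :: 'n surface_rep set set) = piece g c' z"
    by (rule piece_normalise[where 'n='n, of s g c z, OF p s]) blast
  show "connectedin (sing_topology (surface_group g) (surface_gens g)) (piece g c z :: 'n surface_rep set set)"
    and "(piece g c z :: 'n surface_rep set set) \<noteq> {}"
    unfolding c'(2) using normal_piece_connected[OF p g c'(1) z] by blast+
qed

lemma connectedin_linked_Union:
  assumes conn: "\<And>a. a \<in> I \<Longrightarrow> connectedin X (P a)" and h: "h \<in> I" "P h \<noteq> {}"
    and link: "\<And>a. a \<in> I \<Longrightarrow> (\<lambda>a b. a \<in> I \<and> b \<in> I \<and> P a \<inter> P b \<noteq> {})\<^sup>*\<^sup>* a h"
  shows "connectedin X (\<Union>a\<in>I. P a)"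
proof -
  let ?U = "\<Union>a\<in>I. P a"
  have "\<exists>C. connectedin X C \<and> P a \<subseteq> C \<and> P h \<subseteq> C \<and> C \<subseteq> ?U" if "a \<in> I" for a
    using link[OF that] that
  proof (induction rule: converse_rtranclp_induct)
    case base
    then show ?case using conn[OF h(1)] h(1) by blast
  next
    case (step a b)
    then obtain C where C: "connectedin X C" "P b \<subseteq> C" "P h \<subseteq> C" "C \<subseteq> ?U" by blast
    have "connectedin X (P a \<union> C)" using step.hyps(1) C conn by (intro connectedin_Un) auto
    then show ?case using C step.hyps(1) by (intro exI[of _ "P a \<union> C"]) blast
  qed
  then have "\<forall>a\<in>I. \<exists>C. connectedin X C \<and> P a \<subseteq> C \<and> P h \<subseteq> C \<and> C \<subseteq> ?U" by blast
  from bchoice[OF this] obtain C where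
    C: "\<forall>a\<in>I. connectedin X (C a) \<and> P a \<subseteq> C a \<and> P h \<subseteq> C a \<and> C a \<subseteq> ?U" by blast
  have "?U = \<Union>(C ` I)" using C by blast
  moreover have "connectedin X (\<Union>(C ` I))"
  proof (rule connectedin_Union)
    show "connectedin X S" if "S \<in> C ` I" for S using that C by blast
    have "P h \<subseteq> \<Inter>(C ` I)" using C by blast
    then show "\<Inter>(C ` I) \<noteq> {}" using h(2) by blast
  qed
  ultimately show ?thesis by simp
qed

definition euler_fiber :: "nat \<Rightarrow> complex ^ 'n::finite ^ 'n \<Rightarrow> 'n surface_rep set set"
  where "euler_fiber g Z = {c \<in> sing_locus (surface_group g). euler_class g c = Z}"

lemma euler_fiber_pieces:
  fixes z :: complex
  assumes z: "z ^ CARD('n::finite) = 1"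
  shows "(euler_fiber g (mat z) :: 'n surface_rep set set) = (\<Union>c\<in>{c. nontrivial_mod g CARD('n) c}. piece g c z)"
proof (intro equalityI subsetI)
  fix C :: "'n surface_rep set" assume C: "C \<in> euler_fiber g (mat z)"
  then obtain c z' where c: "nontrivial_mod g CARD('n) c" "C \<in> piece g c z'"
    unfolding euler_fiber_def sing_locus_pieces by blast
  have "mat z' = (mat z :: complex ^ 'n ^ 'n)" using euler_class_piece[OF c(2)] C by (simp add: euler_fiber_def)
  then show "C \<in> (\<Union>c\<in>{c. nontrivial_mod g CARD('n) c}. piece g c z)" using c by (auto simp: mat_eq_iff)
next
  fix C :: "'n surface_rep set" assume "C \<in> (\<Union>c\<in>{c. nontrivial_mod g CARD('n) c}. piece g c z)"
  then show "C \<in> euler_fiber g (mat z)"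
    using z by (auto simp: euler_fiber_def sing_locus_pieces euler_class_piece)
qed

lemma euler_fiber_connected:
  fixes z :: complex
  assumes p: "prime CARD('n::finite)" and g: "g \<ge> 2" and z: "z ^ CARD('n) = 1"
  shows "connectedin (sing_topology (surface_group g) (surface_gens g)) (euler_fiber g (mat z) :: 'n surface_rep set set)"
    and "(euler_fiber g (mat z) :: 'n surface_rep set set) \<noteq> {}"
proof -
  let ?h = "letter_unit (La 1) 1"
  have h: "nontrivial_mod g CARD('n) ?h"
    using g by (intro nontrivial_unit[OF p]) (auto simp: surface_letters_def)
  have "connectedin (sing_topology (surface_group g) (surface_gens g))
      (\<Union>c\<in>{c. nontrivial_mod g CARD('n) c}. piece g c z :: 'n surface_rep set set)"
  proof (rule connectedin_linked_Union[where h = ?h])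
    fix a assume "a \<in> {c. nontrivial_mod g CARD('n) c}"
    then have a: "nontrivial_mod g CARD('n) a" by simp
    then show "connectedin (sing_topology (surface_group g) (surface_gens g)) (piece g a z :: 'n surface_rep set set)"
      by (rule piece_connected(1)[OF p g _ z])
    have "(link TYPE('n) g z)\<^sup>*\<^sup>* a ?h" by (rule link_hub[OF g p z a])
    then show "(\<lambda>a b. a \<in> {c. nontrivial_mod g CARD('n) c} \<and> b \<in> {c. nontrivial_mod g CARD('n) c} \<and>
        (piece g a z :: 'n surface_rep set set) \<inter> piece g b z \<noteq> {})\<^sup>*\<^sup>* a ?h"
      by (rule rtranclp_mono[THEN predicate2D, rotated]) (auto simp: link_def meets_def)
  qed (use h piece_connected(2)[OF p g h z] in auto)
  then show "connectedin (sing_topology (surface_group g) (surface_gens g)) (euler_fiber g (mat z) :: 'n surface_rep set set)"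
    unfolding euler_fiber_pieces[OF z] .
  show "(euler_fiber g (mat z) :: 'n surface_rep set set) \<noteq> {}"
    unfolding euler_fiber_pieces[OF z] using h piece_connected(2)[OF p g h z] by blast
qed

section \<open>The Euler invariant is locally constant\<close>

text \<open>The Euler invariant is a polynomial in the lifts with values in a finite set, and passing from lifts to
  \<open>PSL\<close> is open.\<close>

lemma euler_open_Hom:
  fixes Z :: "complex ^ 'n::finite ^ 'n"
  assumes Z: "Z \<in> center SL"
  shows "openin (classical_topology g) {\<rho> \<in> Hom (surface_group g). euler g \<rho> = Z}"
proof -
  let ?S = "surface_gens g" and ?SL = "carrier (SL :: (complex ^ 'n ^ 'n) monoid)"
  let ?XS = "product_topology (\<lambda>_. top_of_set ?SL) ?S"
  let ?proj = "\<lambda>t. \<lambda>\<gamma>\<in>?S. PSL_proj (t \<gamma>)"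
  obtain E where E: "poly_mat ?S E" "\<And>t. t \<in> (\<Pi>\<^sub>E s\<in>?S. ?SL) \<Longrightarrow> E t = euler_tuple g (tup g t)"
  proof (rule poly_mat_euler[where 'n='n, of g])
    fix E :: "(surface_letter word set \<Rightarrow> complex ^ 'n ^ 'n) \<Rightarrow> complex ^ 'n ^ 'n"
    assume a: "poly_mat ?S E" and b: "\<And>t. t \<in> (\<Pi>\<^sub>E s\<in>?S. ?SL) \<Longrightarrow> E t = euler_tuple g (tup g t)"
    show thesis by (rule that) (fact a, fact b)
  qed
  define W where "W = - (center SL - {Z})"
  have "finite (center (SL :: (complex ^ 'n ^ 'n) monoid))"
    using card_center_SL[where 'n='n] by (intro card_ge_0_finite) simp
  then have W: "open W" unfolding W_def by (intro open_Compl finite_imp_closed) auto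
  have cE: "continuous_map ?XS euclidean E"
  proof -
    have "continuous_map (product_topology (\<lambda>_. euclidean) ?S) euclidean E"
      using E(1) by (intro continuous_map_vec poly_fun_continuous) (auto simp: poly_mat_def)
    then have "continuous_map (subtopology (product_topology (\<lambda>_. euclidean) ?S) (\<Pi>\<^sub>E s\<in>?S. ?SL)) euclidean E"
      by (rule continuous_map_from_subtopology)
    then show ?thesis by (simp only: subtopology_product_topology)
  qed
  define Q where "Q = {t \<in> topspace ?XS. E t \<in> W}"
  have "openin ?XS Q" using cE W by (auto simp: Q_def continuous_map)
  define V where "V = ?proj ` Q"
  have "openin (product_topology (\<lambda>_. PSL_topology) ?S) V"
  proof (subst openin_subopen, intro ballI)
    fix x assume "x \<in> V"
    then obtain t where t: "t \<in> Q" "x = ?proj t" by (auto simp: V_def)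
    then obtain U where U: "\<forall>i\<in>?S. openin (top_of_set ?SL) (U i)" "t \<in> Pi\<^sub>E ?S U" "Pi\<^sub>E ?S U \<subseteq> Q"
    proof -
      assume "t \<in> Q"
      then show thesis
        using that \<open>openin ?XS Q\<close>[unfolded openin_product_topology_alt, rule_format, of t] by blast
    qed
    let ?B = "\<Pi>\<^sub>E i\<in>?S. PSL_proj ` U i"
    have "openin (product_topology (\<lambda>_. PSL_topology) ?S) ?B"
      using U(1) by (subst openin_PiE) (auto intro: open_PSL_proj)
    moreover have "x \<in> ?B" using U(2) t(2) by (auto simp: PiE_iff)
    moreover have "?B \<subseteq> V"
    proof
      fix y assume y: "y \<in> ?B"
      then have "\<forall>i\<in>?S. \<exists>u. u \<in> U i \<and> y i = PSL_proj u" by (auto simp: PiE_iff)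
      from bchoice[OF this] obtain u where u: "\<forall>i\<in>?S. u i \<in> U i \<and> y i = PSL_proj (u i)" by blast
      have "restrict u ?S \<in> Q" using u U(3) by auto
      moreover have "y = ?proj (restrict u ?S)" using u y by (auto simp: fun_eq_iff PiE_iff extensional_def)
      ultimately show "y \<in> V" unfolding V_def using image_eqI[of y ?proj "restrict u ?S" Q] by blast
    qed
    ultimately show "\<exists>T. openin (product_topology (\<lambda>_. PSL_topology) ?S) T \<and> x \<in> T \<and> T \<subseteq> V" by blast
  qed
  moreover have "{\<rho> \<in> Hom (surface_group g). euler g \<rho> = Z} = (\<lambda>\<rho>. restrict \<rho> ?S) -` V \<inter> Hom (surface_group g)"
  proof (intro equalityI subsetI)
    fix \<rho> :: "'n surface_rep" assume "\<rho> \<in> {\<rho> \<in> Hom (surface_group g). euler g \<rho> = Z}"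
    then have r: "\<rho> \<in> Hom (surface_group g)" "euler g \<rho> = Z" by auto
    have "restrict \<rho> ?S \<gamma> \<in> PSL_proj ` ?SL" if "\<gamma> \<in> ?S" for \<gamma>
      using surface_Hom_restrict[OF r(1)] that by (auto simp: carrier_PSL carrier_SL PiE_iff)
    then have "\<forall>\<gamma>\<in>?S. \<exists>u. u \<in> ?SL \<and> restrict \<rho> ?S \<gamma> = PSL_proj u" by blast
    from bchoice[OF this] obtain u where u: "\<forall>\<gamma>\<in>?S. u \<gamma> \<in> ?SL \<and> restrict \<rho> ?S \<gamma> = PSL_proj (u \<gamma>)" by blast
    let ?t = "restrict u ?S"
    have e: "restrict \<rho> ?S = ?proj ?t" using u by (auto simp: fun_eq_iff)
    have t: "?t \<in> (\<Pi>\<^sub>E s\<in>?S. ?SL)" using u by auto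
    have "E ?t = euler g \<rho>"
      unfolding E(2)[OF t] by (subst restrict_rep_tup(2)[OF r(1) e], rule euler_rep_of[symmetric, OF restrict_rep_tup(1)[OF r(1) e]])
    then have "?t \<in> Q" using t r(2) Z by (simp add: Q_def W_def)
    then have "?proj ?t \<in> V" unfolding V_def by (rule imageI)
    then show "\<rho> \<in> (\<lambda>\<rho>. restrict \<rho> ?S) -` V \<inter> Hom (surface_group g)"
      using r(1) unfolding e[symmetric] by blast
  next
    fix \<rho> :: "'n surface_rep" assume r: "\<rho> \<in> (\<lambda>\<rho>. restrict \<rho> ?S) -` V \<inter> Hom (surface_group g)"
    then obtain t where t: "t \<in> Q" "restrict \<rho> ?S = ?proj t" by (auto simp: V_def)
    have t': "t \<in> (\<Pi>\<^sub>E s\<in>?S. ?SL)" using t(1) by (simp add: Q_def)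
    have rt: "rep_tuple g (tup g t)" "\<rho> = rep_of g (tup g t)"
      using restrict_rep_tup[of \<rho> g t] r t(2) by auto
    have "E t = euler g \<rho>" unfolding E(2)[OF t'] rt(2) by (rule euler_rep_of[symmetric, OF rt(1)])
    moreover have "E t \<in> center SL" using E(2)[OF t'] rt(1) by (simp add: rep_tuple_def)
    moreover have "E t \<in> W" using t(1) by (simp add: Q_def)
    ultimately show "\<rho> \<in> {\<rho> \<in> Hom (surface_group g). euler g \<rho> = Z}" using r by (auto simp: W_def)
  qed
  ultimately show ?thesis
    unfolding Hom_topology_def openin_pullback_topology by blast
qed

lemma euler_class_conj_class:
  assumes "\<rho> \<in> Hom (surface_group g)"
  shows "euler_class g (conj_class (surface_group g) \<rho>) = euler g \<rho>"
proof -
  obtain A where A: "rep_tuple g A" "\<rho> = rep_of g A" by (rule obtain_tuple[OF assms])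
  show ?thesis unfolding A(2) euler_conj_class[OF A(1)] euler_rep_of[OF A(1)] ..
qed

lemma euler_fiber_open:
  fixes Z :: "complex ^ 'n::finite ^ 'n"
  assumes Z: "Z \<in> center SL"
  shows "openin (sing_topology (surface_group g) (surface_gens g)) (euler_fiber g Z)"
proof -
  let ?G = "surface_group g" and ?I = "irr_reps (surface_group g) :: 'n surface_rep set"
  let ?Q = "{c \<in> conj_class ?G ` ?I. euler_class g c = Z}"
  have top: "topspace (subtopology (classical_topology g) ?I) = ?I"
    using irr_reps_Hom by (auto simp: topspace_classical)
  have "{\<rho> \<in> topspace (subtopology (classical_topology g) ?I). conj_class ?G \<rho> \<in> ?Q} =
      {\<rho> \<in> Hom ?G. euler g \<rho> = Z} \<inter> ?I"
    unfolding top
  proof (intro equalityI subsetI)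
    fix \<rho> :: "'n surface_rep" assume r: "\<rho> \<in> {\<rho> \<in> ?I. conj_class ?G \<rho> \<in> ?Q}"
    then have "\<rho> \<in> Hom ?G" using irr_reps_Hom by blast
    moreover have "euler_class g (conj_class ?G \<rho>) = Z" "\<rho> \<in> ?I" using r by blast+
    ultimately show "\<rho> \<in> {\<rho> \<in> Hom ?G. euler g \<rho> = Z} \<inter> ?I" using euler_class_conj_class[of \<rho> g] by simp
  next
    fix \<rho> :: "'n surface_rep" assume "\<rho> \<in> {\<rho> \<in> Hom ?G. euler g \<rho> = Z} \<inter> ?I"
    then show "\<rho> \<in> {\<rho> \<in> ?I. conj_class ?G \<rho> \<in> ?Q}" using euler_class_conj_class[of \<rho> g] by auto
  qed
  moreover have "openin (subtopology (classical_topology g) ?I) ({\<rho> \<in> Hom ?G. euler g \<rho> = Z} \<inter> ?I)"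
    using euler_open_Hom[OF Z] by (auto simp: openin_subtopology)
  ultimately have "openin (char_variety_topology ?G (surface_gens g) (product_topology (\<lambda>_. PSL_topology) (surface_gens g))) ?Q"
    unfolding char_variety_topology_def openin_quotient_topology top by auto
  moreover have "euler_fiber g Z = ?Q \<inter> sing_locus ?G"
    using sing_locus_subset[of ?G] by (auto simp: euler_fiber_def)
  ultimately show ?thesis unfolding sing_topology_def openin_subtopology by blast
qed

lemma connected_components_of_open_partition:
  assumes open_U: "\<And>C. C \<in> U \<Longrightarrow> openin X C" and conn: "\<And>C. C \<in> U \<Longrightarrow> connectedin X C"
    and ne: "\<And>C. C \<in> U \<Longrightarrow> C \<noteq> {}" and disj: "\<And>C D. C \<in> U \<Longrightarrow> D \<in> U \<Longrightarrow> C \<noteq> D \<Longrightarrow> C \<inter> D = {}"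
    and un: "\<Union>U = topspace X"
  shows "connected_components_of X = U"
proof -
  have cc: "connected_component_of_set X x = C" if C: "C \<in> U" "x \<in> C" for x C
  proof
    have "topspace X - C = \<Union>(U - {C})"
    proof
      show "topspace X - C \<subseteq> \<Union>(U - {C})" unfolding un[symmetric] by blast
      have "D \<subseteq> topspace X - C" if "D \<in> U - {C}" for D
        using disj[of D C] that C(1) un by blast
      then show "\<Union>(U - {C}) \<subseteq> topspace X - C" by blast
    qed
    moreover have "openin X (\<Union>(U - {C}))" using open_U by blast
    ultimately have clo: "closedin X C"
      unfolding closedin_def using openin_subset[OF open_U[OF C(1)]] by (metis (no_types))
    have "x \<in> topspace X" using C un by blast
    then have "x \<in> connected_component_of_set X x" by (simp add: connected_component_of_refl)
    then show "connected_component_of_set X x \<subseteq> C"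
      using connectedin_clopen_cases[OF connectedin_connected_component_of clo open_U[OF C(1)], of x] C(2)
      by (auto simp: disjnt_def)
    show "C \<subseteq> connected_component_of_set X x"
      using connected_component_of_maximal[OF conn[OF C(1)] C(2)] .
  qed
  show ?thesis
  proof (intro equalityI subsetI)
    fix C assume "C \<in> connected_components_of X"
    then obtain x where x: "x \<in> topspace X" "C = connected_component_of_set X x"
      by (auto simp: connected_components_of_def)
    then obtain D where "D \<in> U" "x \<in> D" using un by blast
    then show "C \<in> U" using cc x(2) by simp
  next
    fix C assume C: "C \<in> U"
    then obtain x where x: "x \<in> C" using ne by blast
    then have "x \<in> topspace X" using C un by blast
    then show "C \<in> connected_components_of X"
      using cc[OF C x] by (auto simp: connected_components_of_def)
  qed
qed

text \<open>The fibers of the Euler invariant are open, connected and nonempty, and they partition the singular locus.\<close>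

lemma sing_components:
  assumes p: "prime CARD('n::finite)" and g: "g \<ge> 2"
  shows "connected_components_of (sing_topology (surface_group g) (surface_gens g) :: 'n surface_rep set topology) =
      euler_fiber g ` center SL"
    and "inj_on (euler_fiber g) (center (SL :: (complex ^ 'n ^ 'n) monoid))"
proof -
  have disj: "euler_fiber g Z \<inter> euler_fiber g Z' = {}" if "Z \<noteq> Z'" for Z Z' :: "complex ^ 'n ^ 'n"
    using that by (auto simp: euler_fiber_def)
  have ne: "euler_fiber g Z \<noteq> {}" "connectedin (sing_topology (surface_group g) (surface_gens g)) (euler_fiber g Z)"
    if "Z \<in> center SL" for Z :: "complex ^ 'n ^ 'n"
    using that euler_fiber_connected[OF p g] by (auto simp: center_SL)
  show "inj_on (euler_fiber g) (center (SL :: (complex ^ 'n ^ 'n) monoid))"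
    using disj ne(1) by (intro inj_onI) (metis inf.idem)
  have "\<Union>(euler_fiber g ` center (SL :: (complex ^ 'n ^ 'n) monoid)) = sing_locus (surface_group g)"
  proof (intro equalityI subsetI)
    fix C :: "'n surface_rep set" assume C: "C \<in> sing_locus (surface_group g)"
    then obtain c z where "nontrivial_mod g CARD('n) c" "z ^ CARD('n) = 1" "C \<in> piece g c z"
      unfolding sing_locus_pieces by blast
    then show "C \<in> \<Union>(euler_fiber g ` center SL)"
      using C by (auto simp: euler_fiber_def center_SL euler_class_piece)
  qed (auto simp: euler_fiber_def)
  then have un: "\<Union>(euler_fiber g ` center (SL :: (complex ^ 'n ^ 'n) monoid)) =
      topspace (sing_topology (surface_group g) (surface_gens g))"
    unfolding topspace_sing .
  show "connected_components_of (sing_topology (surface_group g) (surface_gens g) :: 'n surface_rep set topology) =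
      euler_fiber g ` center SL"
  proof (rule connected_components_of_open_partition[OF _ _ _ _ un])
    fix C D assume "C \<in> euler_fiber g ` center (SL :: (complex ^ 'n ^ 'n) monoid)"
      "D \<in> euler_fiber g ` center (SL :: (complex ^ 'n ^ 'n) monoid)" "C \<noteq> D"
    then obtain Z Z' where Z: "C = euler_fiber g Z" "D = euler_fiber g Z'" and "C \<noteq> D" by blast
    then have "Z \<noteq> Z'" by blast
    then show "C \<inter> D = {}" unfolding Z by (rule disj)
  next
    fix C assume "C \<in> euler_fiber g ` center (SL :: (complex ^ 'n ^ 'n) monoid)"
    then obtain Z where Z: "Z \<in> center (SL :: (complex ^ 'n ^ 'n) monoid)" "C = euler_fiber g Z" by blast
    show "openin (sing_topology (surface_group g) (surface_gens g)) C" unfolding Z(2) by (rule euler_fiber_open[OF Z(1)])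
    show "connectedin (sing_topology (surface_group g) (surface_gens g)) C" unfolding Z(2) by (rule ne(2)[OF Z(1)])
    show "C \<noteq> {}" unfolding Z(2) by (rule ne(1)[OF Z(1)])
  qed
qed

section \<open>Zariski closed sets of classes\<close>

abbreviation zariski_char :: "nat \<Rightarrow> 'n::finite surface_rep set topology"
  where "zariski_char g \<equiv> char_variety_topology (surface_group g) (surface_gens g) (PSL_zariski (surface_gens g))"

abbreviation zariski_sing :: "nat \<Rightarrow> 'n::finite surface_rep set topology"
  where "zariski_sing g \<equiv> sing_zariski (surface_group g) (surface_gens g)"

lemma topspace_SL_zariski: "topspace (SL_zariski S) = (\<Pi>\<^sub>E s\<in>S. carrier SL)"
proof
  have "openin (SL_zariski S) (topspace (SL_zariski S))" by simp
  then show "topspace (SL_zariski S) \<subseteq> (\<Pi>\<^sub>E s\<in>S. carrier SL)" unfolding openin_SL_zariski by blast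
  have "openin (SL_zariski S) (\<Pi>\<^sub>E s\<in>S. carrier SL)"
    unfolding openin_SL_zariski by (intro exI[of _ "{\<lambda>_. 1}"]) (auto intro: poly_fun.const)
  then show "(\<Pi>\<^sub>E s\<in>S. carrier SL) \<subseteq> topspace (SL_zariski S)" by (rule openin_subset)
qed

lemma topspace_PSL_zariski: "topspace (PSL_zariski S) = (\<Pi>\<^sub>E s\<in>S. carrier PSL)"
proof (intro equalityI subsetI)
  fix x :: "'a \<Rightarrow> 'b psl" assume "x \<in> topspace (PSL_zariski S)"
  then obtain t where "t \<in> (\<Pi>\<^sub>E s\<in>S. carrier SL)" "x = (\<lambda>s\<in>S. PSL_proj (t s))"
    by (auto simp: PSL_zariski_def topspace_SL_zariski)
  then show "x \<in> (\<Pi>\<^sub>E s\<in>S. carrier PSL)" by (auto simp: PiE_iff carrier_SL intro: PSL_proj_in)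
next
  fix x :: "'a \<Rightarrow> 'b psl" assume x: "x \<in> (\<Pi>\<^sub>E s\<in>S. carrier PSL)"
  then have "\<forall>s\<in>S. \<exists>A. det A = 1 \<and> x s = PSL_proj A" by (auto simp: PiE_iff carrier_PSL)
  from bchoice[OF this] obtain A where A: "\<forall>s\<in>S. det (A s) = 1 \<and> x s = PSL_proj (A s)" by blast
  have "x = (\<lambda>s\<in>S. PSL_proj (restrict A S s))" using A x by (auto simp: fun_eq_iff PiE_iff extensional_def)
  moreover have "restrict A S \<in> (\<Pi>\<^sub>E s\<in>S. carrier SL)" using A by (auto simp: carrier_SL)
  ultimately show "x \<in> topspace (PSL_zariski S)"
    unfolding PSL_zariski_def topspace_quotient_topology topspace_SL_zariski by (rule image_eqI)
qed

lemma topspace_zariski_Hom: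
  "topspace (Hom_topology (surface_group g) (surface_gens g) (PSL_zariski (surface_gens g))) = Hom (surface_group g)"
  using surface_Hom_restrict by (intro topspace_Hom_topology) (simp add: topspace_PSL_zariski)

lemma topspace_zariski_irr:
  "topspace (subtopology (Hom_topology (surface_group g) (surface_gens g) (PSL_zariski (surface_gens g))) (irr_reps (surface_group g))) =
    irr_reps (surface_group g)"
  using irr_reps_Hom by (auto simp: topspace_zariski_Hom)

lemma topspace_zariski_char: "topspace (zariski_char g) = conj_class (surface_group g) ` irr_reps (surface_group g)"
  unfolding char_variety_topology_def topspace_quotient_topology topspace_zariski_irr ..

lemma topspace_zariski_sing: "topspace (zariski_sing g) = sing_locus (surface_group g)"
  using sing_locus_subset by (auto simp: sing_zariski_def topspace_zariski_char)

definition scale_tuple :: "'s set \<Rightarrow> ('s \<Rightarrow> complex) \<Rightarrow> ('s \<Rightarrow> complex ^ 'n::finite ^ 'n) \<Rightarrow> 's \<Rightarrow> complex ^ 'n ^ 'n"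
  where "scale_tuple S r t = (\<lambda>s\<in>S. mat (r s) ** t s)"

lemma poly_fun_scale: "poly_fun S f \<Longrightarrow> poly_fun S (\<lambda>t. f (scale_tuple S r t))"
proof (induction rule: poly_fun.induct)
  case (entry s i j)
  then have "poly_fun S (\<lambda>t. r s * t s $ i $ j)" by (intro poly_fun.intros)
  then show ?case using entry by (simp add: scale_tuple_def)
qed (auto intro: poly_fun.intros)

lemma same_PSL_proj_scale:
  fixes t t' :: "'s \<Rightarrow> complex ^ 'n::finite ^ 'n"
  assumes "t' \<in> (\<Pi>\<^sub>E s\<in>S. carrier SL)" and e: "(\<lambda>s\<in>S. PSL_proj (t s)) = (\<lambda>s\<in>S. PSL_proj (t' s))"
  obtains r where "\<And>s. s \<in> S \<Longrightarrow> r s ^ CARD('n) = 1" "t' = scale_tuple S r t"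
proof -
  have "\<exists>c. c ^ CARD('n) = 1 \<and> t' s = mat c ** t s" if "s \<in> S" for s
    using fun_cong[OF e, of s] that by (simp add: PSL_proj_eq_iff)
  then have "\<forall>s\<in>S. \<exists>c. c ^ CARD('n) = 1 \<and> t' s = mat c ** t s" by blast
  from bchoice[OF this] obtain r where r: "\<forall>s\<in>S. r s ^ CARD('n) = 1 \<and> t' s = mat (r s) ** t s" by blast
  have "t' = scale_tuple S r t"
    using r assms(1) by (auto simp: fun_eq_iff scale_tuple_def PiE_iff extensional_def)
  then show ?thesis using that r by blast
qed

text \<open>Polynomial equations on lifts need not be invariant under the center. Passing to all central
  translates of their common zero set repairs this, so that equations which cut out a set of classes on the
  lifts of irreducible representations make it closed.\<close>

lemma closedin_from_polys:
  fixes P :: "'n::finite surface_rep set set"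
  assumes F: "\<And>f. f \<in> F \<Longrightarrow> poly_fun (surface_gens g) f"
    and P: "P \<subseteq> sing_locus (surface_group g)"
    and iff: "\<And>t. t \<in> (\<Pi>\<^sub>E s\<in>surface_gens g. carrier SL) \<Longrightarrow> rep_tuple g (tup g t) \<Longrightarrow> irr_tuple g (tup g t) \<Longrightarrow>
      (\<forall>f\<in>F. f t = 0) \<longleftrightarrow> tuple_class g (tup g t) \<in> P"
  shows "closedin (zariski_sing g) P"
proof -
  let ?S = "surface_gens g" and ?G = "surface_group g"
  let ?SL = "\<Pi>\<^sub>E s\<in>?S. carrier (SL :: (complex ^ 'n ^ 'n) monoid)"
  let ?proj = "\<lambda>t :: surface_letter word set \<Rightarrow> complex ^ 'n ^ 'n. \<lambda>\<gamma>\<in>?S. PSL_proj (t \<gamma>)"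
  let ?I = "irr_reps ?G :: 'n surface_rep set"
  have Psub: "P \<subseteq> conj_class ?G ` ?I" using P sing_locus_subset by blast
  define V where "V = ?proj ` {t \<in> ?SL. \<exists>f\<in>F. f t \<noteq> 0}"
  have V: "openin (PSL_zariski ?S) V"
    unfolding PSL_zariski_def openin_quotient_topology topspace_SL_zariski
  proof
    show "V \<subseteq> ?proj ` ?SL" by (auto simp: V_def)
    let ?F = "{(\<lambda>t. f (scale_tuple ?S r t)) | f r. f \<in> F \<and> (\<forall>s\<in>?S. r s ^ CARD('n) = 1)}"
    have "{t \<in> ?SL. ?proj t \<in> V} = {t \<in> ?SL. \<exists>f\<in>?F. f t \<noteq> 0}"
    proof (intro equalityI subsetI)
      fix t assume t: "t \<in> {t \<in> ?SL. ?proj t \<in> V}"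
      then obtain t' f where t': "t' \<in> ?SL" "f \<in> F" "f t' \<noteq> 0" "?proj t = ?proj t'" by (auto simp: V_def)
      obtain r where r: "\<And>s. s \<in> ?S \<Longrightarrow> r s ^ CARD('n) = 1" "t' = scale_tuple ?S r t"
        by (rule same_PSL_proj_scale[OF t'(1,4)]) blast
      then have "(\<lambda>t. f (scale_tuple ?S r t)) \<in> ?F" using t'(2) by blast
      then have "\<exists>f\<in>?F. f t \<noteq> 0"
        by (rule bexI[rotated]) (use t'(3) r(2) in simp)
      then show "t \<in> {t \<in> ?SL. \<exists>f\<in>?F. f t \<noteq> 0}" using t by simp
    next
      fix t assume "t \<in> {t \<in> ?SL. \<exists>f\<in>?F. f t \<noteq> 0}"
      then obtain h where h: "t \<in> ?SL" "h \<in> ?F" "h t \<noteq> 0" by blast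
      from h(2) obtain f r where f: "h = (\<lambda>t. f (scale_tuple ?S r t))" "f \<in> F" "\<forall>s\<in>?S. r s ^ CARD('n) = 1" by blast
      have t: "t \<in> ?SL" "f \<in> F" "\<forall>s\<in>?S. r s ^ CARD('n) = 1" "f (scale_tuple ?S r t) \<noteq> 0"
        using h f by auto
      let ?t = "scale_tuple ?S r t"
      have "?t \<in> ?SL" using t(1,3) by (auto simp: scale_tuple_def PiE_iff carrier_SL det_mul det_mat)
      moreover have "?proj t = ?proj ?t"
        using t(3) by (auto simp: fun_eq_iff scale_tuple_def PSL_proj_eq_iff)
      ultimately show "t \<in> {t \<in> ?SL. ?proj t \<in> V}" using t unfolding V_def by blast
    qed
    moreover have "\<forall>f\<in>?F. poly_fun ?S f" using F poly_fun_scale by blast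
    ultimately show "openin (SL_zariski ?S) {t \<in> ?SL. ?proj t \<in> V}"
      unfolding openin_SL_zariski by blast
  qed
  have lift: "restrict \<rho> ?S \<in> V \<longleftrightarrow> conj_class ?G \<rho> \<notin> P" if r: "\<rho> \<in> ?I" for \<rho>
  proof -
    have h: "\<rho> \<in> Hom ?G" using r irr_reps_Hom by blast
    have lifts: "(\<exists>f\<in>F. f t \<noteq> 0) \<longleftrightarrow> conj_class ?G \<rho> \<notin> P" if t: "t \<in> ?SL" "restrict \<rho> ?S = ?proj t" for t
    proof -
      have rt: "rep_tuple g (tup g t)" "\<rho> = rep_of g (tup g t)" using restrict_rep_tup[OF h t(2)] by auto
      then have "irr_tuple g (tup g t)" using r irr_rep_of_iff[OF rt(1)] by simp
      then show ?thesis using iff[OF t(1) rt(1)] rt(2) by (auto simp: tuple_class_def)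
    qed
    show ?thesis
    proof
      assume "restrict \<rho> ?S \<in> V"
      then show "conj_class ?G \<rho> \<notin> P" using lifts unfolding V_def by blast
    next
      assume nP: "conj_class ?G \<rho> \<notin> P"
      have "restrict \<rho> ?S \<in> topspace (PSL_zariski ?S)"
        unfolding topspace_PSL_zariski by (rule surface_Hom_restrict[OF h])
      then obtain t where t: "t \<in> ?SL" "restrict \<rho> ?S = ?proj t"
        unfolding PSL_zariski_def topspace_quotient_topology topspace_SL_zariski by blast
      then show "restrict \<rho> ?S \<in> V" using lifts[OF t] nP unfolding V_def by blast
    qed
  qed
  have "openin (zariski_char g) (conj_class ?G ` ?I - P)"
    unfolding char_variety_topology_def openin_quotient_topology topspace_zariski_irr
  proof
    have "{\<rho> \<in> ?I. conj_class ?G \<rho> \<in> conj_class ?G ` ?I - P} =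
        ((\<lambda>\<rho>. restrict \<rho> ?S) -` V \<inter> Hom ?G) \<inter> ?I"
      using lift irr_reps_Hom[of ?G] by blast
    moreover have "openin (Hom_topology ?G ?S (PSL_zariski ?S)) ((\<lambda>\<rho>. restrict \<rho> ?S) -` V \<inter> Hom ?G)"
      unfolding Hom_topology_def openin_pullback_topology using V by blast
    ultimately show "openin (subtopology (Hom_topology ?G ?S (PSL_zariski ?S)) ?I)
        {\<rho> \<in> ?I. conj_class ?G \<rho> \<in> conj_class ?G ` ?I - P}"
      unfolding openin_subtopology by blast
  qed blast
  then have "closedin (zariski_char g) P"
    unfolding closedin_def topspace_zariski_char using Psub by blast
  then show ?thesis
    using P by (auto simp: sing_zariski_def closedin_subtopology)
qed

lemma matrix_add_distrib_right: "(A + B) ** C = A ** C + B ** C" for A B C :: "complex ^ 'n::finite ^ 'n"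
  by (simp add: vec_eq_iff matrix_matrix_mult_def sum.distrib distrib_right)

text \<open>Unfolding the quotient topologies turns a closed set into a system of polynomial equations on lifts.\<close>

lemma closed_separation:
  fixes Z :: "'n::finite surface_rep set set"
  assumes inj: "inj_on (surface_gen g) (surface_letters g)"
    and Z: "closedin (zariski_sing g) Z" and A: "bad_tuple g A" "tuple_class g A \<notin> Z"
  obtains f where "poly_fun (surface_gens g) f" "f (untup g A) \<noteq> 0"
    "\<And>B. bad_tuple g B \<Longrightarrow> tuple_class g B \<in> Z \<Longrightarrow> f (untup g B) = 0"
proof -
  let ?S = "surface_gens g" and ?G = "surface_group g"
  let ?SL = "\<Pi>\<^sub>E s\<in>?S. carrier (SL :: (complex ^ 'n ^ 'n) monoid)"
  let ?proj = "\<lambda>t :: surface_letter word set \<Rightarrow> complex ^ 'n ^ 'n. \<lambda>\<gamma>\<in>?S. PSL_proj (t \<gamma>)"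
  let ?I = "irr_reps ?G :: 'n surface_rep set"
  obtain T where T: "closedin (zariski_char g) T" "Z = T \<inter> sing_locus ?G"
    using Z unfolding sing_zariski_def closedin_subtopology by blast
  have "openin (zariski_char g) (conj_class ?G ` ?I - T)"
    using T(1) unfolding closedin_def topspace_zariski_char by blast
  then have "openin (subtopology (Hom_topology ?G ?S (PSL_zariski ?S)) ?I) {\<rho> \<in> ?I. conj_class ?G \<rho> \<in> conj_class ?G ` ?I - T}"
    unfolding char_variety_topology_def openin_quotient_topology topspace_zariski_irr by blast
  then obtain V where V: "openin (PSL_zariski ?S) V"
    "{\<rho> \<in> ?I. conj_class ?G \<rho> \<in> conj_class ?G ` ?I - T} = ((\<lambda>\<rho>. restrict \<rho> ?S) -` V \<inter> Hom ?G) \<inter> ?I"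
    unfolding openin_subtopology Hom_topology_def openin_pullback_topology by blast
  have "openin (SL_zariski ?S) {t \<in> ?SL. ?proj t \<in> V}"
    using V(1) unfolding PSL_zariski_def openin_quotient_topology topspace_SL_zariski by blast
  then obtain F where "(\<forall>f\<in>F. poly_fun ?S f) \<and> {t \<in> ?SL. ?proj t \<in> V} = {t \<in> ?SL. \<exists>f\<in>F. f t \<noteq> 0}"
    unfolding openin_SL_zariski by (rule exE)
  then have F: "\<forall>f\<in>F. poly_fun ?S f" "{t \<in> ?SL. ?proj t \<in> V} = {t \<in> ?SL. \<exists>f\<in>F. f t \<noteq> 0}"
    by - (erule conjunct1, erule conjunct2)
  have key: "(\<exists>f\<in>F. f (untup g B) \<noteq> 0) \<longleftrightarrow> tuple_class g B \<notin> Z" if B: "bad_tuple g B" for B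
  proof -
    have rB: "rep_tuple g B" "irr_tuple g B" using B by (auto simp: bad_tuple_def)
    have t: "untup g B \<in> ?SL" using rB by (intro untup_SL[OF inj]) (simp add: rep_tuple_def)
    have r: "restrict (rep_of g B) ?S = ?proj (untup g B)"
      by (rule restrict_rep_of[OF rB(1) untup_gen[OF inj]])
    have h: "rep_of g B \<in> Hom ?G" "rep_of g B \<in> ?I" using rep_of_Hom[OF rB(1)] irr_rep_of_iff[OF rB(1)] rB(2) by auto
    have "tuple_class g B \<in> sing_locus ?G" using B by (auto simp: sing_locus_tuples)
    then have "tuple_class g B \<notin> Z \<longleftrightarrow> conj_class ?G (rep_of g B) \<notin> T" by (simp add: T(2) tuple_class_def)
    also have "\<dots> \<longleftrightarrow> rep_of g B \<in> {\<rho> \<in> ?I. conj_class ?G \<rho> \<in> conj_class ?G ` ?I - T}" using h(2) by blast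
    also have "\<dots> \<longleftrightarrow> restrict (rep_of g B) ?S \<in> V" unfolding V(2) using h by blast
    also have "\<dots> \<longleftrightarrow> untup g B \<in> {t \<in> ?SL. ?proj t \<in> V}" unfolding r using t by blast
    also have "\<dots> \<longleftrightarrow> (\<exists>f\<in>F. f (untup g B) \<noteq> 0)" unfolding F(2) using t by blast
    finally show ?thesis by blast
  qed
  obtain f where "f \<in> F" "f (untup g A) \<noteq> 0" using key[OF A(1)] A(2) by blast
  then show ?thesis using that[of f] F(1) key by blast
qed

section \<open>Invariant polynomials on the parameter torus\<close>

definition act :: "nat \<Rightarrow> surface_letter \<Rightarrow> (surface_letter \<Rightarrow> complex) \<Rightarrow> nat \<Rightarrow>
    (surface_letter \<Rightarrow> complex ^ 'n::finite) \<Rightarrow> surface_letter \<Rightarrow> complex ^ 'n"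
  where "act g s0 r k y = (\<lambda>j\<in>free_letters g s0. const_vec (r j) * shift k (y j))"

definition inv_poly :: "nat \<Rightarrow> surface_letter \<Rightarrow> ((surface_letter \<Rightarrow> complex ^ 'n::finite) \<Rightarrow> complex) \<Rightarrow> bool"
  where "inv_poly g s0 F \<longleftrightarrow> entry_poly (free_letters g s0) F \<and>
    (\<forall>r k. \<forall>y\<in>torus_fam g s0. (\<forall>j\<in>free_letters g s0. r j ^ CARD('n) = 1) \<longrightarrow> F (act g s0 r k y) = F y)"

lemma inv_poly_const: "inv_poly g s0 (\<lambda>_. c)"
  by (simp add: inv_poly_def entry_poly.const)

lemma inv_poly_add: "inv_poly g s0 f \<Longrightarrow> inv_poly g s0 h \<Longrightarrow> inv_poly g s0 (\<lambda>y. f y + h y)"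
  by (simp add: inv_poly_def entry_poly.add)

lemma inv_poly_mult: "inv_poly g s0 f \<Longrightarrow> inv_poly g s0 h \<Longrightarrow> inv_poly g s0 (\<lambda>y. f y * h y)"
  by (simp add: inv_poly_def entry_poly.mult)

lemma intertwine_mult:
  fixes A B :: "complex ^ 'n::finite ^ 'n"
  assumes "A ** G = mat a ** (G ** A')" "B ** G = mat b ** (G ** B')"
  shows "(A ** B) ** G = mat (a * b) ** (G ** (A' ** B'))"
proof -
  have "(A ** B) ** G = A ** (mat b ** (G ** B'))" by (simp only: matrix_mul_assoc[symmetric] assms(2))
  also have "\<dots> = mat b ** ((A ** G) ** B')" by (simp only: matrix_mul_assoc mat_commute[of A b])
  also have "\<dots> = mat (b * a) ** (G ** (A' ** B'))" unfolding assms(1) by (simp only: matrix_mul_assoc mat_mult_mat)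
  finally show ?thesis by (simp only: mult.commute)
qed

lemma intertwine_mpow:
  fixes A :: "complex ^ 'n::finite ^ 'n"
  assumes "A ** G = mat a ** (G ** A')"
  shows "mpow A k ** G = mat (a ^ k) ** (G ** mpow A' k)"
proof (induction k)
  case (Suc k)
  show ?case unfolding mpow_Suc power_Suc by (rule intertwine_mult[OF assms Suc])
qed simp

lemma intertwine_block:
  fixes A :: "complex ^ 'n::finite ^ 'n"
  assumes "A ** G = mat a ** (G ** A')" "B ** G = mat b ** (G ** B')" and a: "a ^ CARD('n) = 1" and m: "m \<le> CARD('n)"
  shows "block CARD('n) A B k m ** G = mat (b * a ^ (CARD('n) - k)) ** (G ** block CARD('n) A' B' k m)"
proof -
  have e: "a ^ m * b * a ^ (CARD('n) - k) * a ^ (CARD('n) - m) = b * a ^ (CARD('n) - k)"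
  proof -
    have "a ^ m * a ^ (CARD('n) - m) = 1" using m a by (simp add: power_add[symmetric])
    then show ?thesis by (simp add: mult_ac)
  qed
  have "block CARD('n) A B k m ** G = mat (a ^ m * b * a ^ (CARD('n) - k) * a ^ (CARD('n) - m)) ** (G ** block CARD('n) A' B' k m)"
    unfolding block_def by (intro intertwine_mult intertwine_mpow assms)
  then show ?thesis unfolding e .
qed

lemma cyc_mono_0_simps:
  "cyc_mono x 0 ** cyc_mono y 0 = cyc_mono (x * y) 0" "cyc_mono x 0 + cyc_mono y 0 = cyc_mono (x + y) 0"
  by (simp add: cyc_mono_mult) (simp add: vec_eq_iff, simp add: cyc_mono_def)

text \<open>The blocks recover the diagonal parts of a monomial tuple from its matrices. So an entry polynomial \<open>F\<close>
  extends to a matrix valued polynomial on all tuples, whose value at a tuple equivalent to a monomial one is conjugate to the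
  diagonal matrix that lists the values of \<open>F\<close> at the cyclic shifts of the parameter.\<close>

lemma entry_poly_matrix:
  fixes F :: "(surface_letter \<Rightarrow> complex ^ 'n::finite) \<Rightarrow> complex"
  assumes F: "entry_poly (free_letters g s0) F" and s0: "s0 \<in> surface_letters g" "c s0 = 1"
    and c: "\<And>s. s \<in> surface_letters g \<Longrightarrow> c s \<le> CARD('n)"
  shows "\<exists>M. poly_mat (surface_gens g) M \<and> (\<forall>t (G :: complex ^ 'n ^ 'n) r y.
    (\<forall>s\<in>surface_letters g. r s ^ CARD('n) = 1 \<and> tup g t s ** G = mat (r s) ** (G ** nf c (fill g s0 d K y) s)) \<longrightarrow>
    M t ** G = G ** cyc_mono (\<chi> l. F (act g s0 (\<lambda>j. r j * r s0 ^ (CARD('n) - c j)) (ix l) y)) 0)"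
  using F
proof (induction rule: entry_poly.induct)
  case (const a)
  have *: "mat a ** G = G ** cyc_mono (\<chi> l. a) 0" for G :: "complex ^ 'n ^ 'n"
    unfolding const_vec_def[symmetric] cyc_mono_const_0 by (rule mat_commute[symmetric])
  show ?case by (intro exI[of _ "\<lambda>_. mat a"] conjI poly_mat_const allI impI) (rule *)
next
  case (add f h)
  then obtain M N where M: "poly_mat (surface_gens g) M" "\<And>t (G :: complex ^ 'n ^ 'n) r y.
      (\<forall>s\<in>surface_letters g. r s ^ CARD('n) = 1 \<and> tup g t s ** G = mat (r s) ** (G ** nf c (fill g s0 d K y) s)) \<Longrightarrow>
      M t ** G = G ** cyc_mono (\<chi> l. f (act g s0 (\<lambda>j. r j * r s0 ^ (CARD('n) - c j)) (ix l) y)) 0"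
    and N: "poly_mat (surface_gens g) N" "\<And>t (G :: complex ^ 'n ^ 'n) r y.
      (\<forall>s\<in>surface_letters g. r s ^ CARD('n) = 1 \<and> tup g t s ** G = mat (r s) ** (G ** nf c (fill g s0 d K y) s)) \<Longrightarrow>
      N t ** G = G ** cyc_mono (\<chi> l. h (act g s0 (\<lambda>j. r j * r s0 ^ (CARD('n) - c j)) (ix l) y)) 0"
    by blast
  have v: "(\<chi> l. a l + b l) = (\<chi> l. a l) + (\<chi> l. b l)" for a b :: "'n \<Rightarrow> complex" by (simp add: vec_eq_iff)
  show ?case
  proof (intro exI[of _ "\<lambda>t. M t + N t"] conjI poly_mat_add M(1) N(1) allI impI)
    fix t r y and G :: "complex ^ 'n ^ 'n"
    assume *: "\<forall>s\<in>surface_letters g. r s ^ CARD('n) = 1 \<and> tup g t s ** G = mat (r s) ** (G ** nf c (fill g s0 d K y) s)"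
    show "(M t + N t) ** G = G ** cyc_mono (\<chi> l. f (act g s0 (\<lambda>j. r j * r s0 ^ (CARD('n) - c j)) (ix l) y) +
        h (act g s0 (\<lambda>j. r j * r s0 ^ (CARD('n) - c j)) (ix l) y)) 0"
      unfolding v cyc_mono_0_simps(2)[symmetric] matrix_add_distrib_right matrix_add_ldistrib M(2)[OF *] N(2)[OF *] ..
  qed
next
  case (mult f h)
  then obtain M N where M: "poly_mat (surface_gens g) M" "\<And>t (G :: complex ^ 'n ^ 'n) r y.
      (\<forall>s\<in>surface_letters g. r s ^ CARD('n) = 1 \<and> tup g t s ** G = mat (r s) ** (G ** nf c (fill g s0 d K y) s)) \<Longrightarrow>
      M t ** G = G ** cyc_mono (\<chi> l. f (act g s0 (\<lambda>j. r j * r s0 ^ (CARD('n) - c j)) (ix l) y)) 0"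
    and N: "poly_mat (surface_gens g) N" "\<And>t (G :: complex ^ 'n ^ 'n) r y.
      (\<forall>s\<in>surface_letters g. r s ^ CARD('n) = 1 \<and> tup g t s ** G = mat (r s) ** (G ** nf c (fill g s0 d K y) s)) \<Longrightarrow>
      N t ** G = G ** cyc_mono (\<chi> l. h (act g s0 (\<lambda>j. r j * r s0 ^ (CARD('n) - c j)) (ix l) y)) 0"
    by blast
  have v: "(\<chi> l. a l * b l) = (\<chi> l. a l) * (\<chi> l. b l)" for a b :: "'n \<Rightarrow> complex" by (simp add: vec_eq_iff)
  show ?case
  proof (intro exI[of _ "\<lambda>t. M t ** N t"] conjI poly_mat_mult M(1) N(1) allI impI)
    fix t r y and G :: "complex ^ 'n ^ 'n"
    assume *: "\<forall>s\<in>surface_letters g. r s ^ CARD('n) = 1 \<and> tup g t s ** G = mat (r s) ** (G ** nf c (fill g s0 d K y) s)"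
    have "(M t ** N t) ** G = (M t ** G) ** cyc_mono (\<chi> l. h (act g s0 (\<lambda>j. r j * r s0 ^ (CARD('n) - c j)) (ix l) y)) 0"
      by (simp only: matrix_mul_assoc[symmetric] N(2)[OF *])
    then show "(M t ** N t) ** G = G ** cyc_mono (\<chi> l. f (act g s0 (\<lambda>j. r j * r s0 ^ (CARD('n) - c j)) (ix l) y) *
        h (act g s0 (\<lambda>j. r j * r s0 ^ (CARD('n) - c j)) (ix l) y)) 0"
      unfolding v cyc_mono_0_simps(1)[symmetric] M(2)[OF *] by (simp only: matrix_mul_assoc)
  qed
next
  case (entry j l)
  let ?p = "CARD('n)" and ?e = "mono_scale TYPE('n)"
  have j: "j \<in> surface_letters g" "j \<noteq> s0" "j \<noteq> partner s0" using entry by (auto simp: free_letters_def)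
  have gens: "surface_gen g j \<in> surface_gens g" "surface_gen g s0 \<in> surface_gens g"
    using j s0 by (auto simp: surface_gens_def)
  let ?M = "\<lambda>t :: surface_letter word set \<Rightarrow> complex ^ 'n ^ 'n. mat (1 / ?e ^ (2 * ?p)) ** block ?p (tup g t s0) (tup g t j) (c j) (ix l)"
  have "poly_mat (surface_gens g) ?M"
    unfolding block_def tup_def by (intro poly_mat_mult poly_mat_mpow poly_mat_var poly_mat_const gens)
  moreover have "?M t ** G = G ** cyc_mono (\<chi> m. act g s0 (\<lambda>j. r j * r s0 ^ (?p - c j)) (ix m) y j $ l) 0"
    if *: "\<forall>s\<in>surface_letters g. r s ^ ?p = 1 \<and> tup g t s ** G = mat (r s) ** (G ** nf c (fill g s0 d K y) s)"
    for t r y and G :: "complex ^ 'n ^ 'n"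
  proof -
    have A0: "tup g t s0 ** G = mat (r s0) ** (G ** cyc_mono 1 1)" and r0: "r s0 ^ ?p = 1"
      using * s0 by (auto simp: nf_def fill_def)
    have Aj: "tup g t j ** G = mat (r j) ** (G ** cyc_mono (y j) (c j))"
      using * j by (auto simp: nf_def fill_def)
    let ?a = "r j * r s0 ^ (?p - c j)"
    have ixl: "ix l \<le> ?p" by (simp add: less_imp_le)
    have "block ?p (tup g t s0) (tup g t j) (c j) (ix l) ** G =
        mat ?a ** (G ** block ?p (cyc_mono 1 1) (cyc_mono (y j) (c j)) (c j) (ix l))"
      by (rule intertwine_block[OF A0 Aj r0 ixl])
    also have "block ?p (cyc_mono 1 1) (cyc_mono (y j) (c j)) (c j) (ix l) = cyc_mono (shift (ix l) (y j)) (2 * ?p)"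
      by (rule block_nf[OF c[OF j(1)] ixl])
    also have "cyc_mono (shift (ix l) (y j)) (2 * ?p) = mat (?e ^ (2 * ?p)) ** cyc_mono (shift (ix l) (y j)) 0"
    proof -
      have "rot (2 * ?p) i = i" for i :: 'n using rot_cong[of "2 * ?p" 0 i] by simp
      then show ?thesis by (simp add: vec_eq_iff) (simp add: cyc_mono_def)
    qed
    finally have "?M t ** G = mat (1 / ?e ^ (2 * ?p)) ** (mat ?a ** (G ** (mat (?e ^ (2 * ?p)) ** cyc_mono (shift (ix l) (y j)) 0)))"
      by (simp only: matrix_mul_assoc[symmetric])
    also have "\<dots> = mat (1 / ?e ^ (2 * ?p) * (?a * ?e ^ (2 * ?p))) ** (G ** cyc_mono (shift (ix l) (y j)) 0)"
      unfolding mat_left_commute[of G "?e ^ (2 * ?p)"] by (simp only: matrix_mul_assoc mat_mult_mat mult.assoc)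
    also have "1 / ?e ^ (2 * ?p) * (?a * ?e ^ (2 * ?p)) = ?a" by simp
    also have "mat ?a ** (G ** cyc_mono (shift (ix l) (y j)) 0) = G ** cyc_mono (const_vec ?a * shift (ix l) (y j)) 0"
      unfolding cyc_mono_const by (rule mat_left_commute[symmetric])
    also have "const_vec ?a * shift (ix l) (y j) = (\<chi> m. act g s0 (\<lambda>j. r j * r s0 ^ (?p - c j)) (ix m) y j $ l)"
    proof -
      have "rot (ix l) m = rot (ix m) l" for m :: 'n
        by (simp add: ix_eq_iff[symmetric] ix_rot add.commute)
      then show ?thesis using entry by (simp add: vec_eq_iff act_def)
    qed
    finally show ?thesis .
  qed
  ultimately show ?case by blast
qed

text \<open>For an invariant polynomial the diagonal matrix is scalar, so that the conjugation disappears.\<close>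

lemma inv_poly_matrix:
  fixes F :: "(surface_letter \<Rightarrow> complex ^ 'n::finite) \<Rightarrow> complex"
  assumes F: "inv_poly g s0 F" and s: "solves g c s0 z (d :: complex ^ 'n) K"
  obtains M :: "(surface_letter word set \<Rightarrow> complex ^ 'n ^ 'n) \<Rightarrow> complex ^ 'n ^ 'n" where "poly_mat (surface_gens g) M"
    "\<And>t y. y \<in> torus_fam g s0 \<Longrightarrow> equiv_tuple g (nf c (fill g s0 d K y)) (tup g t) \<Longrightarrow> M t = mat (F y)"
proof -
  have c: "s0 \<in> surface_letters g" "c s0 = 1" "\<And>s. s \<in> surface_letters g \<Longrightarrow> c s \<le> CARD('n)"
    using s by (auto simp: solves_def normal_at_def less_imp_le)
  have Fp: "entry_poly (free_letters g s0) F" using F by (simp add: inv_poly_def)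
  have "\<exists>M. poly_mat (surface_gens g) M \<and> (\<forall>t (G :: complex ^ 'n ^ 'n) r y.
    (\<forall>s\<in>surface_letters g. r s ^ CARD('n) = 1 \<and> tup g t s ** G = mat (r s) ** (G ** nf c (fill g s0 d K y) s)) \<longrightarrow>
    M t ** G = G ** cyc_mono (\<chi> l. F (act g s0 (\<lambda>j. r j * r s0 ^ (CARD('n) - c j)) (ix l) y)) 0)"
    by (rule entry_poly_matrix[of g s0 F c d K, OF Fp c(1,2)]) (rule c(3))
  then obtain M where M: "poly_mat (surface_gens g) M" "\<And>t (G :: complex ^ 'n ^ 'n) r y.
    (\<forall>s\<in>surface_letters g. r s ^ CARD('n) = 1 \<and> tup g t s ** G = mat (r s) ** (G ** nf c (fill g s0 d K y) s)) \<Longrightarrow>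
    M t ** G = G ** cyc_mono (\<chi> l. F (act g s0 (\<lambda>j. r j * r s0 ^ (CARD('n) - c j)) (ix l) y)) 0"
    by blast
  have "M t = mat (F y)" if y: "y \<in> torus_fam g s0" and e: "equiv_tuple g (nf c (fill g s0 d K y)) (tup g t)" for t y
  proof -
    obtain G where G: "det G \<noteq> 0" "\<forall>s\<in>surface_letters g. \<exists>r. r ^ CARD('n) = 1 \<and> tup g t s ** G = mat r ** (G ** nf c (fill g s0 d K y) s)"
      using e unfolding equiv_tuple_def by blast
    from bchoice[OF G(2)] obtain r where
      r: "\<forall>s\<in>surface_letters g. r s ^ CARD('n) = 1 \<and> tup g t s ** G = mat (r s) ** (G ** nf c (fill g s0 d K y) s)" by blast
    have "F (act g s0 (\<lambda>j. r j * r s0 ^ (CARD('n) - c j)) k y) = F y" for k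
    proof -
      have "(r j * r s0 ^ (CARD('n) - c j)) ^ CARD('n) = 1" if "j \<in> free_letters g s0" for j
      proof -
        have "(r s0 ^ (CARD('n) - c j)) ^ CARD('n) = (r s0 ^ CARD('n)) ^ (CARD('n) - c j)"
          by (simp only: power_mult[symmetric] mult.commute)
        then show ?thesis using r that c(1) by (simp add: power_mult_distrib free_letters_def)
      qed
      then show ?thesis
        using F y unfolding inv_poly_def by (elim conjE allE[of _ "\<lambda>j. r j * r s0 ^ (CARD('n) - c j)"] allE[of _ k]) blast
    qed
    then have "M t ** G = G ** cyc_mono (const_vec (F y)) 0"
      using M(2)[OF r] by (simp add: const_vec_def)
    then have "M t ** G = mat (F y) ** G" unfolding cyc_mono_const_0 mat_commute[of G] .
    then show ?thesis by (rule matrix_right_cancel[OF G(1)])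
  qed
  then show ?thesis using that M(1) by blast
qed

text \<open>Both values can be read off one matrix valued polynomial at a tuple of the common class.\<close>

lemma inv_poly_param_eq:
  fixes d :: "complex ^ 'n::finite"
  assumes p: "prime CARD('n)" and F: "inv_poly g s0 F" and s: "solves g c s0 z d K"
    and y: "y \<in> torus_fam g s0" "y' \<in> torus_fam g s0" and e: "param g c s0 d K y = param g c s0 d K y'"
  shows "F y = F y'"
proof -
  note inj = surface_gen_inj[OF p, of g]
  obtain M :: "(surface_letter word set \<Rightarrow> complex ^ 'n ^ 'n) \<Rightarrow> complex ^ 'n ^ 'n" where
    M: "\<And>t y. y \<in> torus_fam g s0 \<Longrightarrow> equiv_tuple g (nf c (fill g s0 d K y)) (tup g t) \<Longrightarrow> M t = mat (F y)"
    by (rule inv_poly_matrix[OF F s], rule that)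
  let ?t = "untup g (nf c (fill g s0 d K y'))"
  have tup_t: "equiv_tuple g A (tup g ?t) \<longleftrightarrow> equiv_tuple g A (nf c (fill g s0 d K y'))" for A
    by (simp add: equiv_tuple_def tup_untup[OF inj])
  have r: "rep_tuple g (nf c (fill g s0 d K y))" "rep_tuple g (nf c (fill g s0 d K y'))"
    using param_rep(2)[OF s] y by auto
  have "equiv_tuple g (nf c (fill g s0 d K y)) (nf c (fill g s0 d K y'))"
    using e conj_class_eq_iff[OF r] by (simp add: param_def)
  then have "M ?t = mat (F y)" using M[OF y(1)] tup_t by blast
  moreover have "equiv_tuple g (nf c (fill g s0 d K y')) (nf c (fill g s0 d K y'))"
    using conj_class_eq_iff[OF r(2,2)] by simp
  then have "M ?t = mat (F y')" using M[OF y(2)] tup_t by blast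
  ultimately show ?thesis by (simp add: mat_eq_iff)
qed

text \<open>The equations for monomial tuples together with the value of the Euler invariant cut out the
  piece, and on the piece the invariant polynomial is given by a polynomial on tuples.\<close>

lemma inv_poly_zero_set_closed:
  fixes d :: "complex ^ 'n::finite"
  assumes p: "prime CARD('n)" and F: "inv_poly g s0 F" and s: "solves g c s0 z d K"
  shows "closedin (zariski_sing g) (param g c s0 d K ` {y \<in> good_param g s0 z. F y = 0})"
proof -
  let ?S = "surface_gens g" and ?L = "surface_letters g" and ?p = "CARD('n)"
  have c: "s0 \<in> ?L" "c s0 = 1" "\<And>s. s \<in> ?L \<Longrightarrow> c s \<le> ?p"
    using s by (auto simp: solves_def normal_at_def less_imp_le)
  have norm: "normal_at g ?p s0 c" using s by (simp add: solves_def)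
  obtain M :: "(surface_letter word set \<Rightarrow> complex ^ 'n ^ 'n) \<Rightarrow> complex ^ 'n ^ 'n" where M: "poly_mat ?S M"
    "\<And>t y. y \<in> torus_fam g s0 \<Longrightarrow> equiv_tuple g (nf c (fill g s0 d K y)) (tup g t) \<Longrightarrow> M t = mat (F y)"
    by (rule inv_poly_matrix[OF F s], rule that)
  obtain E where E: "poly_mat ?S E" "\<And>t. t \<in> (\<Pi>\<^sub>E s\<in>?S. carrier (SL :: (complex ^ 'n ^ 'n) monoid)) \<Longrightarrow> E t = euler_tuple g (tup g t)"
  proof (rule poly_mat_euler[where 'n='n, of g])
    fix E :: "(surface_letter word set \<Rightarrow> complex ^ 'n ^ 'n) \<Rightarrow> complex ^ 'n ^ 'n"
    assume a: "poly_mat ?S E" and b: "\<And>t. t \<in> (\<Pi>\<^sub>E s\<in>?S. carrier SL) \<Longrightarrow> E t = euler_tuple g (tup g t)"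
    show thesis by (rule that) (fact a, fact b)
  qed
  define cent where "cent s t = tup g t s ** mpow (tup g t s0) ?p - mpow (tup g t s0) ?p ** tup g t s"
    for s and t :: "surface_letter word set \<Rightarrow> complex ^ 'n ^ 'n"
  define comm where "comm s s' m n t =
      block ?p (tup g t s0) (tup g t s) (c s) m ** block ?p (tup g t s0) (tup g t s') (c s') n -
      block ?p (tup g t s0) (tup g t s') (c s') n ** block ?p (tup g t s0) (tup g t s) (c s) m"
    for s s' m n and t :: "surface_letter word set \<Rightarrow> complex ^ 'n ^ 'n"
  define Ms where "Ms = {\<lambda>t. E t - mat z, M} \<union> {cent s | s. s \<in> ?L} \<union>
      {comm s s' m n | s s' m n. s \<in> ?L \<and> s' \<in> ?L \<and> m < ?p \<and> n < ?p}"
  define Fs where "Fs = {(\<lambda>t. N t $ i $ j) | N i j. N \<in> Ms}"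
  have var: "poly_mat ?S (\<lambda>t. tup g t s :: complex ^ 'n ^ 'n)" if "s \<in> ?L" for s
    unfolding tup_def using that by (intro poly_mat_var) (auto simp: surface_gens_def)
  have "poly_mat ?S N" if "N \<in> Ms" for N
    using that unfolding Ms_def
    by (auto simp: cent_def[abs_def] comm_def[abs_def] block_def
        intro!: poly_mat_diff poly_mat_mult poly_mat_mpow poly_mat_const var c(1) E(1) M(1))
  then have Fs: "poly_fun ?S f" if "f \<in> Fs" for f using that by (auto simp: Fs_def poly_mat_def)
  have zero: "(\<forall>f\<in>Fs. f t = 0) \<longleftrightarrow> (\<forall>N\<in>Ms. N t = 0)" for t
    unfolding Fs_def by (auto simp: vec_eq_iff) 
  have zero': "(\<forall>N\<in>Ms. N t = 0) \<longleftrightarrow> E t = mat z \<and> M t = 0 \<and> (\<forall>s\<in>?L. cent s t = 0) \<and>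
      (\<forall>s\<in>?L. \<forall>s'\<in>?L. \<forall>m<?p. \<forall>n<?p. comm s s' m n t = 0)" for t
    unfolding Ms_def by auto
  show ?thesis
  proof (rule closedin_from_polys[OF Fs])
    show "param g c s0 d K ` {y \<in> good_param g s0 z. F y = 0} \<subseteq> sing_locus (surface_group g)"
      using param_piece_tuple[OF p s] piece_tuple_bad[OF normal_at_nontrivial[OF p norm]]
      by (auto simp: param_def sing_locus_tuples)
    fix t :: "surface_letter word set \<Rightarrow> complex ^ 'n ^ 'n"
    assume t: "t \<in> (\<Pi>\<^sub>E s\<in>?S. carrier SL)" and rep: "rep_tuple g (tup g t)" and irr: "irr_tuple g (tup g t)"
    have d1: "det_one g (tup g t)" using rep by (simp add: rep_tuple_def)
    show "(\<forall>f\<in>Fs. f t = 0) \<longleftrightarrow> tuple_class g (tup g t) \<in> param g c s0 d K ` {y \<in> good_param g s0 z. F y = 0}"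
      unfolding zero zero'
    proof
      assume a: "E t = mat z \<and> M t = 0 \<and> (\<forall>s\<in>?L. cent s t = 0) \<and>
        (\<forall>s\<in>?L. \<forall>s'\<in>?L. \<forall>m<?p. \<forall>n<?p. comm s s' m n t = 0)"
      obtain x where x: "\<And>s. s \<in> ?L \<Longrightarrow> x s \<in> torus" "x s0 = 1" "equiv_tuple g (nf c x) (tup g t)"
      proof (rule nf_from_commuting[of g "tup g t" s0 c])
        show "irr_tuple g (tup g t)" "det_one g (tup g t)" "s0 \<in> ?L" "c s0 = 1" by (fact irr d1 c)+
        show "c s \<le> ?p" if "s \<in> ?L" for s using c(3)[OF that] .
        show "tup g t s ** mpow (tup g t s0) ?p = mpow (tup g t s0) ?p ** tup g t s" if "s \<in> ?L" for s
          using a that by (simp add: cent_def)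
        show "block ?p (tup g t s0) (tup g t s) (c s) m ** block ?p (tup g t s0) (tup g t s') (c s') n =
            block ?p (tup g t s0) (tup g t s') (c s') n ** block ?p (tup g t s0) (tup g t s) (c s) m"
          if "s \<in> ?L" "s' \<in> ?L" "m < ?p" "n < ?p" for s s' m n
          using a that by (simp add: comm_def)
      qed blast
      have et: "euler_tuple g (tup g t) = mat z" using a E(2)[OF t] by simp
      let ?y = "restrict x (free_letters g s0)"
      have y: "?y \<in> good_param g s0 z" "equiv_tuple g (nf c (fill g s0 d K ?y)) (tup g t)"
        using nf_equiv_restrict[OF p s rep irr et, of x] x by blast+
      have yt: "?y \<in> torus_fam g s0" using y(1) by (simp add: good_param_def)
      have "mat (F ?y) = (0 :: complex ^ 'n ^ 'n)" using M(2)[OF yt y(2)] a by simp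
      then have "mat (F ?y) = (mat 0 :: complex ^ 'n ^ 'n)" by simp
      then have "F ?y = 0" by (simp only: mat_eq_iff)
      moreover have "tuple_class g (tup g t) = param g c s0 d K ?y"
        unfolding param_def using conj_class_eq_iff[OF param_rep(2)[OF s yt] rep] y(2) by simp
      ultimately show "tuple_class g (tup g t) \<in> param g c s0 d K ` {y \<in> good_param g s0 z. F y = 0}"
        using y(1) by blast
    next
      assume "tuple_class g (tup g t) \<in> param g c s0 d K ` {y \<in> good_param g s0 z. F y = 0}"
      then obtain y where y: "y \<in> good_param g s0 z" "F y = 0" "tuple_class g (tup g t) = param g c s0 d K y" by blast
      then have yt: "y \<in> torus_fam g s0" by (simp add: good_param_def)
      have e: "equiv_tuple g (nf c (fill g s0 d K y)) (tup g t)"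
        using y(3) conj_class_eq_iff[OF param_rep(2)[OF s yt] rep] by (simp add: param_def)
      have Mt: "M t = 0" using M(2)[OF yt e] y(2) by simp
      have Et: "E t = mat z"
        using euler_class_tuple[OF rep] euler_class_tuple[OF param_rep(2)[OF s yt]] param_rep(1)[OF s yt] y(3) E(2)[OF t]
        by (simp add: param_def)
      obtain G where G: "det G \<noteq> 0" "\<forall>s\<in>?L. \<exists>r. r ^ ?p = 1 \<and> tup g t s ** G = mat r ** (G ** nf c (fill g s0 d K y) s)"
        using e unfolding equiv_tuple_def by blast
      have com: "A ** B = B ** A"
        if "A ** G = mat a ** (G ** A')" "B ** G = mat b ** (G ** B')" "A' ** B' = B' ** A'" for A B A' B' a b
      proof -
        have "(A ** B) ** G = (B ** A) ** G"
          unfolding intertwine_mult[OF that(1,2)] intertwine_mult[OF that(2,1)] that(3) by (simp only: mult.commute)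
        then show ?thesis by (rule matrix_right_cancel[OF G(1)])
      qed
      let ?N = "nf c (fill g s0 d K y)"
      have x0: "fill g s0 d K y s0 = 1" by (simp add: fill_def)
      obtain r0 where r0: "r0 ^ ?p = 1" "tup g t s0 ** G = mat r0 ** (G ** ?N s0)" using G(2) c(1) by blast
      have "cent s t = 0" if "s \<in> ?L" for s
      proof -
        obtain r where r: "r ^ ?p = 1" "tup g t s ** G = mat r ** (G ** ?N s)" using G(2) \<open>s \<in> ?L\<close> by blast
        show ?thesis
          using com[OF r(2) intertwine_mpow[OF r0(2), of ?p] nf_commuting(1)[of c s0 "fill g s0 d K y", OF c(2) x0]] by (simp add: cent_def)
      qed
      moreover have "comm s s' m n t = 0" if "s \<in> ?L" "s' \<in> ?L" "m < ?p" "n < ?p" for s s' m n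
      proof -
        obtain r where r: "r ^ ?p = 1" "tup g t s ** G = mat r ** (G ** ?N s)" using G(2) \<open>s \<in> ?L\<close> by blast
        obtain r' where r': "r' ^ ?p = 1" "tup g t s' ** G = mat r' ** (G ** ?N s')" using G(2) \<open>s' \<in> ?L\<close> by blast
        show ?thesis
          using com[OF intertwine_block[OF r0(2) r(2) r0(1) less_imp_le[OF that(3)]]
              intertwine_block[OF r0(2) r'(2) r0(1) less_imp_le[OF that(4)]]
              nf_commuting(2)[of c s0 "fill g s0 d K y", OF c(2) x0 c(3)[OF that(1)] c(3)[OF that(2)] that(3,4)]]
          by (simp add: comm_def)
      qed
      ultimately show "E t = mat z \<and> M t = 0 \<and> (\<forall>s\<in>?L. cent s t = 0) \<and>
        (\<forall>s\<in>?L. \<forall>s'\<in>?L. \<forall>m<?p. \<forall>n<?p. comm s s' m n t = 0)"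
        using Mt Et by blast
    qed
  qed
qed

lemma entry_poly_act: "entry_poly (free_letters g s0) q \<Longrightarrow> entry_poly (free_letters g s0) (\<lambda>y. q (act g s0 r k y))"
proof (induction rule: entry_poly.induct)
  case (entry j l)
  then have "entry_poly (free_letters g s0) (\<lambda>y. r j * y j $ rot k l)" by (intro entry_poly.intros)
  then show ?case using entry by (simp add: act_def)
qed (auto intro: entry_poly.intros)

lemma act_act: "act g s0 r k (act g s0 r' k' y) = act g s0 (\<lambda>j. r j * r' j) (k + k') y"
  by (rule ext) (simp add: act_def vec_eq_iff rot_rot add_ac mult_ac)

lemma act_one: "y \<in> torus_fam g s0 \<Longrightarrow> act g s0 (\<lambda>_. 1) 0 y = y"
  by (auto simp: act_def torus_fam_def PiE_iff extensional_def fun_eq_iff vec_eq_iff)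

lemma act_cong:
  fixes y :: "surface_letter \<Rightarrow> complex ^ 'n::finite"
  assumes "\<And>j. j \<in> free_letters g s0 \<Longrightarrow> r j = r' j" "k mod CARD('n) = k' mod CARD('n)"
  shows "act g s0 r k y = act g s0 r' k' y"
  using assms(1) shift_cong[OF assms(2)] by (auto simp: act_def fun_eq_iff)

text \<open>Conjugation by the \<open>k\<close>-th power of the cyclic permutation matrix shifts all parameters, and the
  lifts of an image in \<open>PSL\<close> differ by roots of unity; so the parameters of a class form a union of orbits of this
  finite group.\<close>

lemma act_param:
  fixes d :: "complex ^ 'n::finite"
  assumes p: "prime CARD('n)" and s: "solves g c s0 z d K" and y: "y \<in> good_param g s0 z"
    and r: "\<And>j. j \<in> free_letters g s0 \<Longrightarrow> r j ^ CARD('n) = 1"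
  shows "act g s0 r k y \<in> good_param g s0 z" "param g c s0 d K (act g s0 r k y) = param g c s0 d K y"
proof -
  let ?J = "free_letters g s0" and ?p = "CARD('n)" and ?x = "fill g s0 d K y"
  have y': "y \<in> torus_fam g s0" using y by (simp add: good_param_def)
  have d: "d \<in> torus" using s by (simp add: solves_def)
  note rep = param_rep[OF s y']
  have irr: "irr_tuple g (nf c ?x)" using param_irr[OF p s y'] y by simp
  define r' where "r' j = (if j \<in> ?J then r j else 1)" for j
  define x where "x j = const_vec (r' j) * shift k (?x j)" for j
  have r': "r' j ^ ?p = 1" for j using r by (simp add: r'_def)
  have t: "x j \<in> torus" if "j \<in> surface_letters g" for j
    unfolding x_def using fill_torus[OF d y' that] r'
    by (intro torus_mult torus_shift) (auto simp: const_vec_torus)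
  have x0: "x s0 = 1" by (simp add: x_def r'_def free_letters_def fill_def vec_eq_iff)
  have e: "equiv_tuple g (nf c x) (nf c ?x)"
    unfolding equiv_tuple_def
  proof (intro exI[of _ "cyc_mono 1 ((?p - 1) * k)"] conjI ballI)
    show "det (cyc_mono (1 :: complex ^ 'n) ((?p - 1) * k)) \<noteq> 0" by (simp add: det_cyc_mono_torus)
    \<comment> \<open>The exponent \<open>(p - 1) k\<close> stands for \<open>-k\<close>.\<close>
    fix j
    have "(?p - 1) * k + k = ?p * k" by (cases ?p) auto
    then have "((?p - 1) * k + k) mod ?p = 0 mod ?p" by simp
    then have "shift ((?p - 1) * k + k) (?x j) = shift 0 (?x j)" by (rule shift_cong)
    then have "shift ((?p - 1) * k) (x j) = const_vec (r' j) * ?x j"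
      by (simp add: x_def shift_mult shift_shift)
    moreover have "r' j \<noteq> 0" using r'[of j] by (auto simp: zero_power)
    ultimately have "nf c ?x j ** cyc_mono 1 ((?p - 1) * k) = mat (1 / r' j) ** (cyc_mono 1 ((?p - 1) * k) ** nf c x j)"
      by (simp add: nf_def cyc_mono_mult cyc_mono_const matrix_mul_assoc mat_mult_mat add.commute)
    moreover have "(1 / r' j) ^ ?p = 1" using r' by (simp add: power_divide)
    ultimately show "\<exists>a. a ^ ?p = 1 \<and> nf c ?x j ** cyc_mono 1 ((?p - 1) * k) = mat a ** (cyc_mono 1 ((?p - 1) * k) ** nf c x j)"
      by blast
  qed
  have eq: "restrict x ?J = act g s0 r k y"
  proof
    fix j
    show "restrict x ?J j = act g s0 r k y j" by (auto simp: act_def x_def r'_def fill_def free_letters_def)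
  qed
  note res = nf_equiv_restrict[OF p s rep(2) irr rep(1), of x, OF t x0 e, unfolded eq]
  show g: "act g s0 r k y \<in> good_param g s0 z" by (rule res(1))
  then have t': "act g s0 r k y \<in> torus_fam g s0" by (simp add: good_param_def)
  show "param g c s0 d K (act g s0 r k y) = param g c s0 d K y"
    unfolding param_def using res(2) conj_class_eq_iff[OF param_rep(2)[OF s t'] rep(2)] by simp
qed

definition act_group :: "'n::finite itself \<Rightarrow> nat \<Rightarrow> surface_letter \<Rightarrow> ((surface_letter \<Rightarrow> complex) \<times> nat) set"
  where "act_group _ g s0 = (\<Pi>\<^sub>E j\<in>free_letters g s0. {w. w ^ CARD('n) = 1}) \<times> {..<CARD('n)}"

lemma finite_act_group: "finite (act_group TYPE('n::finite) g s0)"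
  unfolding act_group_def by (intro finite_cartesian_product finite_PiE finite_free_letters finite_lessThan finite_roots_unity) simp

text \<open>Translation by a group element permutes the factors of an orbit product.\<close>

lemma inv_poly_orbit_prod:
  fixes q :: "(surface_letter \<Rightarrow> complex ^ 'n::finite) \<Rightarrow> complex"
  assumes q: "entry_poly (free_letters g s0) q"
  shows "inv_poly g s0 (\<lambda>y. \<Prod>h\<in>act_group TYPE('n) g s0. T + q (act g s0 (fst h) (snd h) y))"
  unfolding inv_poly_def
proof (intro conjI allI ballI impI)
  let ?J = "free_letters g s0" and ?p = "CARD('n)" and ?G = "act_group TYPE('n) g s0"
  show "entry_poly ?J (\<lambda>y. \<Prod>h\<in>?G. T + q (act g s0 (fst h) (snd h) y))"
    by (intro entry_poly_prod entry_poly.add entry_poly.const entry_poly_act q)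
  fix r :: "surface_letter \<Rightarrow> complex" and k and y :: "surface_letter \<Rightarrow> complex ^ 'n"
  assume r: "\<forall>j\<in>?J. r j ^ ?p = 1"
  define \<phi> where "\<phi> h = (\<lambda>j\<in>?J. fst h j * r j, (k + snd h) mod ?p)" for h :: "(surface_letter \<Rightarrow> complex) \<times> nat"
  have sub: "\<phi> ` ?G \<subseteq> ?G"
    using r by (auto simp: \<phi>_def act_group_def PiE_iff power_mult_distrib)
  have "inj_on \<phi> ?G"
  proof (rule inj_onI)
    fix h h' assume h: "h \<in> ?G" "h' \<in> ?G" "\<phi> h = \<phi> h'"
    have "fst h j = fst h' j" for j
    proof (cases "j \<in> ?J")
      case True
      then have "r j \<noteq> 0" using r by (auto simp: zero_power)
      moreover have "fst h j * r j = fst h' j * r j" using h(3) True by (auto simp: \<phi>_def dest: fun_cong[of _ _ j])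
      ultimately show ?thesis by simp
    qed (use h(1,2) in \<open>auto simp: act_group_def PiE_iff extensional_def\<close>)
    moreover have "snd h mod ?p = snd h' mod ?p"
      using h(3) add_mod_left_cancel[of k "snd h" ?p "snd h'"] by (simp add: \<phi>_def)
    then have "snd h = snd h'" using h(1,2) by (auto simp: act_group_def)
    ultimately show "h = h'" by (auto simp: prod_eq_iff)
  qed
  then have bij: "\<phi> ` ?G = ?G" and inj: "inj_on \<phi> ?G" using endo_inj_surj[OF finite_act_group sub] by auto
  have "(\<Prod>h\<in>?G. T + q (act g s0 (fst h) (snd h) (act g s0 r k y))) = (\<Prod>h\<in>?G. T + q (act g s0 (fst (\<phi> h)) (snd (\<phi> h)) y))"
  proof (intro prod.cong HOL.refl)
    fix h
    have "act g s0 (fst h) (snd h) (act g s0 r k y) = act g s0 (fst (\<phi> h)) (snd (\<phi> h)) y"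
      unfolding act_act by (rule act_cong) (simp_all add: \<phi>_def add.commute)
    then show "T + q (act g s0 (fst h) (snd h) (act g s0 r k y)) = T + q (act g s0 (fst (\<phi> h)) (snd (\<phi> h)) y)" by simp
  qed
  also have "\<dots> = (\<Prod>h\<in>\<phi> ` ?G. T + q (act g s0 (fst h) (snd h) y))"
    by (simp add: prod.reindex[OF inj])
  finally show "(\<Prod>h\<in>?G. T + q (act g s0 (fst h) (snd h) (act g s0 r k y))) = (\<Prod>h\<in>?G. T + q (act g s0 (fst h) (snd h) y))"
    unfolding bij .
qed

lemma one_in_act_group: "(\<lambda>j\<in>free_letters g s0. 1, 0) \<in> act_group TYPE('n::finite) g s0"
  by (simp add: act_group_def)

lemma act_group_one: "y \<in> torus_fam g s0 \<Longrightarrow> act g s0 (\<lambda>j\<in>free_letters g s0. 1) 0 y = y"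
  by (subst act_cong[where r' = "\<lambda>_. 1" and k' = 0]) (auto simp: act_one)

lemma act_group_root: "h \<in> act_group TYPE('n::finite) g s0 \<Longrightarrow> j \<in> free_letters g s0 \<Longrightarrow> fst h j ^ CARD('n) = 1"
  by (auto simp: act_group_def)

lemma entry_poly_pullback:
  fixes d :: "complex ^ 'n::finite"
  assumes inj: "inj_on (surface_gen g) (surface_letters g)" and f: "poly_fun (surface_gens g) f"
  shows "entry_poly (free_letters g s0) (\<lambda>y. f (untup g (nf c (fill g s0 d K y))))"
  using f
proof (induction rule: poly_fun.induct)
  case (entry \<gamma> i j)
  then obtain s where s: "s \<in> surface_letters g" "\<gamma> = surface_gen g s" by (auto simp: surface_gens_def)
  then show ?case using entry_poly_nf[OF s(1)] by (simp add: untup_gen[OF inj])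
qed (auto intro: entry_poly.intros)

text \<open>Take an entry polynomial \<open>q\<close> that vanishes on the parameters of the closed set and not at \<open>y\<close>. The orbit product of \<open>T + q\<close> minus its
  value for \<open>q = 0\<close> still vanishes on the parameters of the closed set, and for \<open>T = - q(y)\<close> it is nonzero at \<open>y\<close>.\<close>

lemma inv_poly_separation:
  fixes d :: "complex ^ 'n::finite"
  assumes p: "prime CARD('n)" and s: "solves g c s0 z d K"
    and Z: "closedin (zariski_sing g) Z" and y: "y \<in> good_param g s0 z" "param g c s0 d K y \<notin> Z"
  obtains F where "inv_poly g s0 F" "F y \<noteq> 0"
    "\<And>y'. y' \<in> good_param g s0 z \<Longrightarrow> param g c s0 d K y' \<in> Z \<Longrightarrow> F y' = 0"
proof -
  let ?G = "act_group TYPE('n) g s0"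
  note inj = surface_gen_inj[OF p, of g]
  have norm: "normal_at g CARD('n) s0 c" using s by (simp add: solves_def)
  have bad: "bad_tuple g (nf c (fill g s0 d K y'))" if "y' \<in> good_param g s0 z" for y'
    by (rule piece_tuple_bad[OF normal_at_nontrivial[OF p norm] param_piece_tuple[OF p s that]])
  obtain f where f: "poly_fun (surface_gens g) f" "f (untup g (nf c (fill g s0 d K y))) \<noteq> 0"
    "\<And>B. bad_tuple g B \<Longrightarrow> tuple_class g B \<in> Z \<Longrightarrow> f (untup g B) = 0"
  proof (rule closed_separation[OF inj Z bad[OF y(1)]])
    show "tuple_class g (nf c (fill g s0 d K y)) \<notin> Z" using y(2) by (simp add: param_def)
  qed blast
  define q where "q y = f (untup g (nf c (fill g s0 d K y)))" for y
  have q: "entry_poly (free_letters g s0) q"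
    unfolding q_def[abs_def] by (rule entry_poly_pullback[OF inj f(1)])
  have q0: "q y' = 0" if "y' \<in> good_param g s0 z" "param g c s0 d K y' \<in> Z" for y'
    unfolding q_def by (rule f(3)[OF bad[OF that(1)]]) (use that(2) in \<open>simp add: param_def\<close>)
  define T where "T = - q y"
  have T: "T \<noteq> 0" using f(2) by (simp add: T_def q_def)
  define F where "F y = (\<Prod>h\<in>?G. T + q (act g s0 (fst h) (snd h) y)) + - (T ^ card ?G)" for y
  have "inv_poly g s0 F" unfolding F_def by (intro inv_poly_add inv_poly_const inv_poly_orbit_prod q)
  moreover have "F y \<noteq> 0"
  proof -
    have "y \<in> torus_fam g s0" using y(1) by (simp add: good_param_def)
    then have "T + q (act g s0 (fst (\<lambda>j\<in>free_letters g s0. 1, 0 :: nat)) (snd (\<lambda>j\<in>free_letters g s0. 1 :: complex, 0)) y) = 0"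
      by (simp add: act_group_one T_def)
    then have "(\<Prod>h\<in>?G. T + q (act g s0 (fst h) (snd h) y)) = 0"
      by (intro prod_zero finite_act_group bexI[OF _ one_in_act_group[where 'n='n]])
    then show ?thesis using T by (simp add: F_def)
  qed
  moreover have "F y' = 0" if y': "y' \<in> good_param g s0 z" "param g c s0 d K y' \<in> Z" for y'
  proof -
    have "q (act g s0 (fst h) (snd h) y') = 0" if "h \<in> ?G" for h
      using act_param[OF p s y'(1) act_group_root[OF that]] y'(2) by (intro q0) auto
    then show ?thesis by (simp add: F_def)
  qed
  ultimately show ?thesis using that by blast
qed

section \<open>Algebraic dependence\<close>

text \<open>In a vanishing polynomial expression divide by the largest power of the last function, which does not
  vanish on the last set, and restrict to the set before, where that function vanishes; this leaves a
  vanishing expression in one function less. Dividing is possible because on each of the sets the ring \<open>R\<close> has no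
  zero divisors.\<close>

lemma chain_alg_independent:
  fixes F :: "nat \<Rightarrow> 'x \<Rightarrow> complex" and W :: "nat \<Rightarrow> 'x set" and e :: "'k \<Rightarrow> nat \<Rightarrow> nat"
  assumes R: "\<And>c. (\<lambda>_. c) \<in> R" "\<And>f h. f \<in> R \<Longrightarrow> h \<in> R \<Longrightarrow> (\<lambda>y. f y + h y) \<in> R"
      "\<And>f h. f \<in> R \<Longrightarrow> h \<in> R \<Longrightarrow> (\<lambda>y. f y * h y) \<in> R"
    and irr: "\<And>i f h. i \<le> n \<Longrightarrow> f \<in> R \<Longrightarrow> h \<in> R \<Longrightarrow> \<forall>y\<in>W i. f y * h y = 0 \<Longrightarrow>
      (\<forall>y\<in>W i. f y = 0) \<or> (\<forall>y\<in>W i. h y = 0)"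
    and W: "W 0 \<noteq> {}" "\<And>i. i < n \<Longrightarrow> W i \<subseteq> W (Suc i)"
    and F: "\<And>i. i < n \<Longrightarrow> F i \<in> R" "\<And>i y. i < n \<Longrightarrow> y \<in> W i \<Longrightarrow> F i y = 0" "\<And>i. i < n \<Longrightarrow> \<exists>y\<in>W (Suc i). F i y \<noteq> 0"
    and E: "finite E" "\<And>k k'. k \<in> E \<Longrightarrow> k' \<in> E \<Longrightarrow> \<forall>i<n. e k i = e k' i \<Longrightarrow> k = k'"
    and zero: "\<forall>y\<in>W n. (\<Sum>k\<in>E. a k * (\<Prod>i<n. F i y ^ e k i)) = 0"
  shows "\<forall>k\<in>E. a k = 0"
  using irr W F E zero
proof (induction n arbitrary: E a)
  case 0
  then obtain y where y: "y \<in> W 0" by blast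
  show ?case
  proof
    fix k assume k: "k \<in> E"
    then have "E = {k}" using 0(8) by blast
    then have "a k * (\<Prod>i<0. F i y ^ e k i) = 0" using 0(9) y by auto
    then show "a k = 0" by simp
  qed
next
  case (Suc n)
  have R_prod: "(\<lambda>y. \<Prod>i\<in>I. f i y) \<in> R" if "finite I" "\<And>i. i \<in> I \<Longrightarrow> f i \<in> R" for I :: "nat set" and f
    using that by (induction I rule: finite_induct) (auto intro: R)
  have R_pow: "(\<lambda>y. f y ^ m) \<in> R" if "f \<in> R" for f and m :: nat
    using that by (induction m) (auto intro: R)
  have R_sum: "(\<lambda>y. \<Sum>k\<in>I. f k y) \<in> R" if "finite I" "\<And>k. k \<in> I \<Longrightarrow> f k \<in> R" for I :: "'k set" and f
    using that by (induction I rule: finite_induct) (auto intro: R)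
  show ?case
  proof (rule ccontr)
    assume "\<not> (\<forall>k\<in>E. a k = 0)"
    then have ne: "{k \<in> E. a k \<noteq> 0} \<noteq> {}" by blast
    define E' where "E' = {k \<in> E. a k \<noteq> 0}"
    have E': "finite E'" "E' \<noteq> {}" "E' \<subseteq> E" using Suc.prems(7) ne by (auto simp: E'_def)
    define m where "m = Min ((\<lambda>k. e k n) ` E')"
    have m: "m \<le> e k n" if "k \<in> E'" for k using E'(1) that by (simp add: m_def)
    have "m \<in> (\<lambda>k. e k n) ` E'" unfolding m_def by (rule Min_in) (use E' in auto)
    then obtain k0 where k0: "k0 \<in> E'" "e k0 n = m" by auto
    \<comment> \<open>The quotient of the polynomial by the largest power of the last function.\<close>
    define Q where "Q y = (\<Sum>k\<in>E'. a k * ((\<Prod>i<n. F i y ^ e k i) * F n y ^ (e k n - m)))" for y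
    have "Q \<in> R" unfolding Q_def[abs_def]
      using Suc.prems(4) by (intro R_sum R R_prod R_pow E'(1)) auto
    moreover have Fm: "(\<lambda>y. F n y ^ m) \<in> R" using Suc.prems(4) by (intro R_pow) auto
    moreover have "\<forall>y\<in>W (Suc n). F n y ^ m * Q y = 0"
    proof
      fix y assume y: "y \<in> W (Suc n)"
      have "F n y ^ m * Q y = (\<Sum>k\<in>E'. a k * (\<Prod>i<Suc n. F i y ^ e k i))"
        unfolding Q_def sum_distrib_left
      proof (intro sum.cong HOL.refl)
        fix k assume "k \<in> E'"
        then have "F n y ^ e k n = F n y ^ m * F n y ^ (e k n - m)"
          using m by (simp add: power_add[symmetric])
        then show "F n y ^ m * (a k * ((\<Prod>i<n. F i y ^ e k i) * F n y ^ (e k n - m))) = a k * (\<Prod>i<Suc n. F i y ^ e k i)"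
          by simp
      qed
      also have "\<dots> = (\<Sum>k\<in>E. a k * (\<Prod>i<Suc n. F i y ^ e k i))"
        by (rule sum.mono_neutral_left) (use Suc.prems(7) in \<open>auto simp: E'_def\<close>)
      also have "\<dots> = 0" using Suc.prems(9) y by blast
      finally show "F n y ^ m * Q y = 0" .
    qed
    ultimately have "(\<forall>y\<in>W (Suc n). F n y ^ m = 0) \<or> (\<forall>y\<in>W (Suc n). Q y = 0)"
      using Suc.prems(1)[of "Suc n" "\<lambda>y. F n y ^ m" Q] by simp
    then have Q0: "\<forall>y\<in>W n. Q y = 0" using Suc.prems(6)[of n] Suc.prems(3)[of n] by auto
    define E'' where "E'' = {k \<in> E'. e k n = m}"
    have "\<forall>k\<in>E''. a k = 0"
    proof (rule Suc.IH)
      show "(\<forall>y\<in>W i. f y = 0) \<or> (\<forall>y\<in>W i. h y = 0)"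
        if "i \<le> n" "f \<in> R" "h \<in> R" "\<forall>y\<in>W i. f y * h y = 0" for i f h
        using Suc.prems(1)[of i f h] that by simp
      show "W 0 \<noteq> {}" by (rule Suc.prems(2))
      show "W i \<subseteq> W (Suc i)" "F i \<in> R" "\<exists>y\<in>W (Suc i). F i y \<noteq> 0" if "i < n" for i
        using Suc.prems(3,4,6)[of i] that by auto
      show "F i y = 0" if "i < n" "y \<in> W i" for i y using Suc.prems(5)[of i y] that by simp
      show "finite E''" using E' by (simp add: E''_def)
      show "k = k'" if "k \<in> E''" "k' \<in> E''" "\<forall>i<n. e k i = e k' i" for k k'
        using Suc.prems(8)[of k k'] that by (auto simp: E''_def E'_def less_Suc_eq)
      show "\<forall>y\<in>W n. (\<Sum>k\<in>E''. a k * (\<Prod>i<n. F i y ^ e k i)) = 0"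
      proof
        fix y assume y: "y \<in> W n"
        have "0 = Q y" using Q0 y by simp
        also have "\<dots> = (\<Sum>k\<in>E''. a k * ((\<Prod>i<n. F i y ^ e k i) * F n y ^ (e k n - m)))"
          unfolding Q_def
        proof (rule sum.mono_neutral_right[OF E'(1)])
          show "E'' \<subseteq> E'" by (auto simp: E''_def)
          show "\<forall>k\<in>E' - E''. a k * ((\<Prod>i<n. F i y ^ e k i) * F n y ^ (e k n - m)) = 0"
          proof
            fix k assume k: "k \<in> E' - E''"
            then have "e k n - m > 0" using m[of k] by (auto simp: E''_def)
            then show "a k * ((\<Prod>i<n. F i y ^ e k i) * F n y ^ (e k n - m)) = 0"
              using Suc.prems(5)[of n y] y by (simp add: zero_power)
          qed
        qed
        also have "\<dots> = (\<Sum>k\<in>E''. a k * (\<Prod>i<n. F i y ^ e k i))"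
          by (intro sum.cong) (auto simp: E''_def)
        finally show "(\<Sum>k\<in>E''. a k * (\<Prod>i<n. F i y ^ e k i)) = 0" by simp
      qed
    qed
    then show False using k0 by (auto simp: E''_def E'_def)
  qed
qed

text \<open>On the torus the entry at \<open>l0\<close> is determined by the others, which are free.\<close>

definition free_coords :: "nat \<Rightarrow> surface_letter \<Rightarrow> 'n::finite \<Rightarrow> (surface_letter \<times> 'n) set"
  where "free_coords g s0 l0 = free_letters g s0 \<times> (UNIV - {l0})"

lemma finite_free_coords: "finite (free_coords g s0 l0)"
  by (simp add: free_coords_def finite_free_letters)

lemma card_free_coords:
  "s0 \<in> surface_letters g \<Longrightarrow> card (free_coords g s0 (l0 :: 'n::finite)) = 2 * (g - 1) * (CARD('n) - 1)"
  by (simp add: free_coords_def card_cartesian_product card_free_letters card_Diff_singleton)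

definition laurent_mono :: "nat \<Rightarrow> surface_letter \<Rightarrow> 'n \<Rightarrow> (surface_letter \<times> 'n \<Rightarrow> int) \<Rightarrow>
    (surface_letter \<Rightarrow> complex ^ 'n::finite) \<Rightarrow> complex"
  where "laurent_mono g s0 l0 b y = (\<Prod>q\<in>free_coords g s0 l0. (y (fst q) $ snd q) powi b q)"

definition laurent_exps :: "nat \<Rightarrow> surface_letter \<Rightarrow> 'n::finite \<Rightarrow> nat \<Rightarrow> (surface_letter \<times> 'n \<Rightarrow> int) set"
  where "laurent_exps g s0 l0 D = (\<Pi>\<^sub>E q\<in>free_coords g s0 l0. {- int D..int D})"

text \<open>On the torus, these are the Laurent polynomials in the free coordinates with all exponents between \<open>-D\<close> and \<open>D\<close>.\<close>

definition laurent :: "nat \<Rightarrow> surface_letter \<Rightarrow> 'n \<Rightarrow> nat \<Rightarrow> ((surface_letter \<Rightarrow> complex ^ 'n::finite) \<Rightarrow> complex) \<Rightarrow> bool"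
  where "laurent g s0 l0 D F \<longleftrightarrow>
    (\<exists>M. \<forall>y\<in>torus_fam g s0. F y = (\<Sum>b\<in>laurent_exps g s0 l0 D. M b * laurent_mono g s0 l0 b y))"

lemma finite_laurent_exps: "finite (laurent_exps g s0 l0 D)"
  unfolding laurent_exps_def by (intro finite_PiE finite_free_coords) simp

lemma laurent_cong: "laurent g s0 l0 D f \<Longrightarrow> (\<And>y. y \<in> torus_fam g s0 \<Longrightarrow> h y = f y) \<Longrightarrow> laurent g s0 l0 D h"
  by (auto simp: laurent_def)

lemma laurent_add:
  assumes "laurent g s0 l0 D f" "laurent g s0 l0 D h" shows "laurent g s0 l0 D (\<lambda>y. f y + h y)"
proof -
  obtain M N where "\<forall>y\<in>torus_fam g s0. f y = (\<Sum>b\<in>laurent_exps g s0 l0 D. M b * laurent_mono g s0 l0 b y)"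
    "\<forall>y\<in>torus_fam g s0. h y = (\<Sum>b\<in>laurent_exps g s0 l0 D. N b * laurent_mono g s0 l0 b y)"
    using assms unfolding laurent_def by blast
  then show ?thesis
    unfolding laurent_def by (intro exI[of _ "\<lambda>b. M b + N b"]) (simp add: distrib_right sum.distrib)
qed

lemma laurent_scale:
  assumes "laurent g s0 l0 D f" shows "laurent g s0 l0 D (\<lambda>y. c * f y)"
proof -
  obtain M where "\<forall>y\<in>torus_fam g s0. f y = (\<Sum>b\<in>laurent_exps g s0 l0 D. M b * laurent_mono g s0 l0 b y)"
    using assms unfolding laurent_def by blast
  then show ?thesis
    unfolding laurent_def by (intro exI[of _ "\<lambda>b. c * M b"]) (simp add: sum_distrib_left mult_ac)
qed

lemma laurent_zero: "laurent g s0 l0 D (\<lambda>_. 0)"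
  unfolding laurent_def by (rule exI[of _ "\<lambda>_. 0"]) simp

lemma laurent_sum: "finite I \<Longrightarrow> (\<And>i. i \<in> I \<Longrightarrow> laurent g s0 l0 D (f i)) \<Longrightarrow> laurent g s0 l0 D (\<lambda>y. \<Sum>i\<in>I. f i y)"
  by (induction I rule: finite_induct) (auto intro: laurent_add laurent_zero)

lemma laurent_laurent_mono:
  assumes "b \<in> laurent_exps g s0 l0 D" shows "laurent g s0 l0 D (laurent_mono g s0 l0 b)"
  unfolding laurent_def
proof (intro exI[of _ "\<lambda>b'. if b' = b then 1 else 0"] ballI)
  fix y
  have "(\<Sum>b'\<in>laurent_exps g s0 l0 D. (if b' = b then 1 else 0) * laurent_mono g s0 l0 b' y) =
      (\<Sum>b'\<in>laurent_exps g s0 l0 D. if b' = b then laurent_mono g s0 l0 b' y else 0)"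
    by (intro sum.cong) auto
  then show "laurent_mono g s0 l0 b y = (\<Sum>b'\<in>laurent_exps g s0 l0 D. (if b' = b then 1 else 0) * laurent_mono g s0 l0 b' y)"
    using assms by (simp add: finite_laurent_exps)
qed

lemma laurent_exps_mono: "D \<le> D' \<Longrightarrow> laurent_exps g s0 l0 D \<subseteq> laurent_exps g s0 l0 D'"
  unfolding laurent_exps_def by (intro PiE_mono) auto

lemma laurent_mono_degree:
  assumes "laurent g s0 l0 D f" "D \<le> D'" shows "laurent g s0 l0 D' f"
proof -
  obtain M where M: "\<forall>y\<in>torus_fam g s0. f y = (\<Sum>b\<in>laurent_exps g s0 l0 D. M b * laurent_mono g s0 l0 b y)"
    using assms unfolding laurent_def by blast
  have "laurent g s0 l0 D' (\<lambda>y. \<Sum>b\<in>laurent_exps g s0 l0 D. M b * laurent_mono g s0 l0 b y)"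
    using laurent_exps_mono[OF assms(2), of g s0 l0]
    by (intro laurent_sum finite_laurent_exps laurent_scale laurent_laurent_mono) blast
  then show ?thesis by (rule laurent_cong) (use M in blast)
qed

lemma laurent_mult:
  fixes f h :: "(surface_letter \<Rightarrow> complex ^ 'n::finite) \<Rightarrow> complex"
  assumes "laurent g s0 l0 D f" "laurent g s0 l0 D' h" shows "laurent g s0 l0 (D + D') (\<lambda>y. f y * h y)"
proof -
  let ?Q = "free_coords g s0 l0"
  obtain M N where M: "\<forall>y\<in>torus_fam g s0. f y = (\<Sum>b\<in>laurent_exps g s0 l0 D. M b * laurent_mono g s0 l0 b y)"
    and N: "\<forall>y\<in>torus_fam g s0. h y = (\<Sum>b\<in>laurent_exps g s0 l0 D'. N b * laurent_mono g s0 l0 b y)"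
    using assms unfolding laurent_def by blast
  have "laurent g s0 l0 (D + D') (\<lambda>y. \<Sum>b\<in>laurent_exps g s0 l0 D. \<Sum>b'\<in>laurent_exps g s0 l0 D'.
      (M b * N b') * laurent_mono g s0 l0 (\<lambda>q\<in>?Q. b q + b' q) y)"
    by (intro laurent_sum finite_laurent_exps laurent_scale laurent_laurent_mono)
      (fastforce simp: laurent_exps_def PiE_iff)
  then show ?thesis
  proof (rule laurent_cong)
    fix y :: "surface_letter \<Rightarrow> complex ^ 'n" assume y: "y \<in> torus_fam g s0"
    have "laurent_mono g s0 l0 b y * laurent_mono g s0 l0 b' y = laurent_mono g s0 l0 (\<lambda>q\<in>?Q. b q + b' q) y" for b b'
      unfolding laurent_mono_def prod.distrib[symmetric]
    proof (intro prod.cong HOL.refl)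
      fix q assume q: "q \<in> ?Q"
      then have "y (fst q) $ snd q \<noteq> 0" using y by (intro torus_nonzero) (auto simp: free_coords_def torus_fam_def)
      then show "(y (fst q) $ snd q) powi b q * (y (fst q) $ snd q) powi b' q =
          (y (fst q) $ snd q) powi restrict (\<lambda>q. b q + b' q) ?Q q"
        using q by (simp add: power_int_add)
    qed
    then show "f y * h y = (\<Sum>b\<in>laurent_exps g s0 l0 D. \<Sum>b'\<in>laurent_exps g s0 l0 D'.
        (M b * N b') * laurent_mono g s0 l0 (\<lambda>q\<in>?Q. b q + b' q) y)"
      using M N y by (simp add: sum_product mult_ac)
  qed
qed

lemma laurent_const: "laurent g s0 l0 D (\<lambda>_. c)"
proof -
  have "(\<lambda>q\<in>free_coords g s0 l0. 0) \<in> laurent_exps g s0 l0 D" by (auto simp: laurent_exps_def)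
  then have "laurent g s0 l0 D (\<lambda>y. c * laurent_mono g s0 l0 (\<lambda>q\<in>free_coords g s0 l0. 0) y)"
    by (intro laurent_scale laurent_laurent_mono)
  then show ?thesis by (rule laurent_cong) (simp add: laurent_mono_def)
qed

lemma laurent_entry:
  fixes l :: "'n::finite"
  assumes j: "j \<in> free_letters g s0"
  shows "laurent g s0 l0 1 (\<lambda>y. y j $ l)"
proof -
  let ?Q = "free_coords g s0 l0" and ?U = "UNIV - {l0}"
  define b :: "surface_letter \<times> 'n \<Rightarrow> int"
    where "b = (\<lambda>q\<in>?Q. if fst q = j then (if l = l0 then - 1 else if snd q = l then 1 else 0) else 0)"
  have "b \<in> laurent_exps g s0 l0 1" by (auto simp: b_def laurent_exps_def)
  then have "laurent g s0 l0 1 (laurent_mono g s0 l0 b)" by (rule laurent_laurent_mono)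
  then show ?thesis
  proof (rule laurent_cong)
    fix y :: "surface_letter \<Rightarrow> complex ^ 'n" assume y: "y \<in> torus_fam g s0"
    then have yt: "y j \<in> torus" using j by (auto simp: torus_fam_def)
    have "laurent_mono g s0 l0 b y = (\<Prod>q\<in>{j} \<times> ?U. (y (fst q) $ snd q) powi b q)"
      unfolding laurent_mono_def
      by (rule prod.mono_neutral_right) (use j in \<open>auto simp: free_coords_def b_def finite_free_letters\<close>)
    also have "\<dots> = (\<Prod>m\<in>?U. (y j $ m) powi b (j, m))"
    proof -
      have "{j} \<times> ?U = Pair j ` ?U" by auto
      then show ?thesis by (simp add: prod.reindex inj_on_def)
    qed
    also have "\<dots> = y j $ l"
    proof (cases "l = l0")
      case True
      have "(\<Prod>m\<in>?U. (y j $ m) powi b (j, m)) = (\<Prod>m\<in>?U. inverse (y j $ m))"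
        using True j by (intro prod.cong) (auto simp: b_def free_coords_def)
      also have "\<dots> = y j $ l0 * inverse (\<Prod>m\<in>UNIV. y j $ m)"
        using torus_nonzero[OF yt] by (subst (2) prod.remove[of _ l0]) (simp_all add: prod_inversef[symmetric] o_def)
      finally show ?thesis using yt True by (simp add: torus_def)
    next
      case False
      have "(\<Prod>m\<in>?U. (y j $ m) powi b (j, m)) = (\<Prod>m\<in>?U. if m = l then y j $ m else 1)"
        using False j by (intro prod.cong) (auto simp: b_def free_coords_def)
      then show ?thesis using False by simp
    qed
    finally show "y j $ l = laurent_mono g s0 l0 b y" ..
  qed
qed

lemma entry_poly_laurent:
  "entry_poly (free_letters g s0) F \<Longrightarrow> \<exists>D. laurent g s0 l0 D F"
proof (induction rule: entry_poly.induct)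
  case (add f h)
  then obtain D D' where "laurent g s0 l0 D f" "laurent g s0 l0 D' h" by blast
  then have "laurent g s0 l0 (D + D') (\<lambda>y. f y + h y)"
    by (intro laurent_add) (auto elim: laurent_mono_degree)
  then show ?case ..
qed (auto intro: laurent_const laurent_entry laurent_mult)

lemma laurent_power: "laurent g s0 l0 D f \<Longrightarrow> laurent g s0 l0 (k * D) (\<lambda>y. f y ^ k)"
  by (induction k) (auto intro: laurent_const laurent_mult)

lemma laurent_prod:
  assumes "\<And>i. i < n \<Longrightarrow> laurent g s0 l0 D (f i)" shows "laurent g s0 l0 (n * D) (\<lambda>y. \<Prod>i<n. f i y)"
  using assms
proof (induction n)
  case (Suc n)
  have "laurent g s0 l0 (n * D + D) (\<lambda>y. (\<Prod>i<n. f i y) * f n y)"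
    using Suc by (intro laurent_mult) auto
  then show ?case by (simp add: add.commute)
qed (simp add: laurent_const)

text \<open>The monomials with exponents up to \<open>m\<close> in \<open>n\<close> entry polynomials number \<open>(m + 1)\<^sup>n\<close>, but lie in the span of
  \<open>O(m\<^sup>N)\<close> Laurent monomials in the \<open>N < n\<close> free coordinates, so for large \<open>m\<close> they are linearly dependent.\<close>

lemma entry_polys_dependent:
  fixes F :: "nat \<Rightarrow> (surface_letter \<Rightarrow> complex ^ 'n::finite) \<Rightarrow> complex"
  assumes F: "\<And>i. i < n \<Longrightarrow> entry_poly (free_letters g s0) (F i)"
    and n: "n > card (free_coords g s0 (l0 :: 'n))"
  obtains m a where "\<exists>e\<in>(\<Pi>\<^sub>E i\<in>{..<n}. {..m :: nat}). a e \<noteq> 0"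
    "\<forall>y\<in>torus_fam g s0. (\<Sum>e\<in>(\<Pi>\<^sub>E i\<in>{..<n}. {..m}). a e * (\<Prod>i<n. F i y ^ e i)) = 0"
proof -
  let ?N = "card (free_coords g s0 l0)"
  have "\<forall>i\<in>{..<n}. \<exists>D. laurent g s0 l0 D (F i)" using F entry_poly_laurent by blast
  from bchoice[OF this] obtain D where D: "\<forall>i\<in>{..<n}. laurent g s0 l0 (D i) (F i)" by blast
  define d where "d = (\<Sum>i<n. D i)"
  have d: "laurent g s0 l0 d (F i)" if "i < n" for i
    by (rule laurent_mono_degree[of _ _ _ "D i"]) (use D that in \<open>auto simp: d_def intro!: member_le_sum\<close>)
  \<comment> \<open>Chosen such that \<open>(2 n m d + 1)\<^sup>N \<le> m (m + 1)\<^sup>N < (m + 1)\<^sup>n\<close>.\<close>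
  define m where "m = (2 * (n * d) + 1) ^ ?N"
  let ?E = "\<Pi>\<^sub>E i\<in>{..<n}. {..m}" and ?B = "laurent_exps g s0 l0 (n * (m * d))"
  have "laurent g s0 l0 (n * (m * d)) (\<lambda>y. \<Prod>i<n. F i y ^ e i)" if "e \<in> ?E" for e
  proof (rule laurent_prod)
    fix i assume i: "i < n"
    then have "e i * d \<le> m * d" using that by (intro mult_right_mono) auto
    then show "laurent g s0 l0 (m * d) (\<lambda>y. F i y ^ e i)"
      by (rule laurent_mono_degree[OF laurent_power[OF d[OF i]]])
  qed
  then have "\<forall>e\<in>?E. \<exists>M. \<forall>y\<in>torus_fam g s0. (\<Prod>i<n. F i y ^ e i) = (\<Sum>b\<in>?B. M b * laurent_mono g s0 l0 b y)"
    unfolding laurent_def by blast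
  from bchoice[OF this] obtain M where
    M: "\<forall>e\<in>?E. \<forall>y\<in>torus_fam g s0. (\<Prod>i<n. F i y ^ e i) = (\<Sum>b\<in>?B. M e b * laurent_mono g s0 l0 b y)" by blast
  have E: "finite ?E" "card ?E = (m + 1) ^ n" by (auto intro: finite_PiE simp: card_PiE)
  have "card ?B = (2 * (n * (m * d)) + 1) ^ ?N"
    unfolding laurent_exps_def by (simp add: card_PiE finite_free_coords nat_add_distrib nat_mult_distrib mult_ac)
  also have "\<dots> \<le> ((2 * (n * d) + 1) * (m + 1)) ^ ?N"
    by (intro power_mono) (simp_all add: algebra_simps)
  also have "\<dots> = m * (m + 1) ^ ?N" by (simp only: power_mult_distrib m_def)
  also have "\<dots> < (m + 1) * (m + 1) ^ ?N" by simp
  also have "\<dots> \<le> (m + 1) ^ n" unfolding power_Suc[symmetric] by (rule power_increasing) (use n in auto)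
  finally have "card ?B < card ?E" using E by simp
  from homogeneous_system[OF finite_laurent_exps E(1) this, of M]
  obtain a where a: "\<exists>e\<in>?E. a e \<noteq> 0" "\<forall>b\<in>?B. (\<Sum>e\<in>?E. a e * M e b) = 0" by blast
  have "(\<Sum>e\<in>?E. a e * (\<Prod>i<n. F i y ^ e i)) = 0" if y: "y \<in> torus_fam g s0" for y
  proof -
    have "(\<Sum>e\<in>?E. a e * (\<Prod>i<n. F i y ^ e i)) = (\<Sum>e\<in>?E. \<Sum>b\<in>?B. a e * M e b * laurent_mono g s0 l0 b y)"
      using M y by (intro sum.cong HOL.refl) (simp add: sum_distrib_left mult_ac)
    also have "\<dots> = (\<Sum>b\<in>?B. (\<Sum>e\<in>?E. a e * M e b) * laurent_mono g s0 l0 b y)"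
      unfolding sum_distrib_right by (rule sum.swap)
    also have "\<dots> = 0" using a(2) by simp
    finally show ?thesis .
  qed
  then show ?thesis using that a(1) by blast
qed

section \<open>Dimension\<close>

lemma irreducible_in_one_of_finite:
  assumes Z: "irreducible_closed X Z" and I: "finite I" and P: "\<And>i. i \<in> I \<Longrightarrow> closedin X (P i)" "Z \<subseteq> (\<Union>i\<in>I. P i)"
  shows "\<exists>i\<in>I. Z \<subseteq> P i"
  using I P
proof (induction I rule: finite_induct)
  case empty
  then show ?case using Z by (auto simp: irreducible_closed_def)
next
  case (insert i I)
  have "closedin X (\<Union>j\<in>I. P j)" using insert by (intro closedin_Union) auto
  then have "Z \<subseteq> P i \<or> Z \<subseteq> (\<Union>j\<in>I. P j)"
    using Z insert.prems unfolding irreducible_closed_def by (metis UN_insert insertI1)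
  then show ?case using insert by blast
qed

text \<open>Only normalised exponents matter, and modulo \<open>p\<close> there are finitely many.\<close>

lemma sing_locus_finite_pieces:
  assumes p: "prime CARD('n::finite)"
  shows "(sing_locus (surface_group g) :: 'n surface_rep set set) =
    (\<Union>(s0, c, z)\<in>{(s0, c, z). s0 \<in> surface_letters g \<and> c \<in> surface_letters g \<rightarrow>\<^sub>E {..<CARD('n)} \<and>
      normal_at g CARD('n) s0 c \<and> z ^ CARD('n) = 1}. piece g c z)" (is "_ = (\<Union>(s0, c, z)\<in>?I. _)")
proof (intro equalityI subsetI)
  let ?p = "CARD('n)" and ?L = "surface_letters g"
  fix C :: "'n surface_rep set"
  { assume "C \<in> sing_locus (surface_group g)"
    then obtain c z where c: "nontrivial_mod g ?p c" "z ^ ?p = 1" "C \<in> piece g c z"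
      unfolding sing_locus_pieces by blast
    then obtain s0 where s0: "s0 \<in> ?L" "\<not> ?p dvd c s0" by (auto simp: nontrivial_mod_def)
    obtain c' where c': "normal_at g ?p s0 c'" "(piece g c z :: 'n surface_rep set set) = piece g c' z"
      by (rule piece_normalise[where 'n='n, of s0 g c z, OF p s0]) blast
    have e: "(piece g c' z :: 'n surface_rep set set) = piece g (restrict c' ?L) z"
      by (rule piece_cong) simp
    have "normal_at g ?p s0 (restrict c' ?L)" "restrict c' ?L \<in> ?L \<rightarrow>\<^sub>E {..<?p}"
      using c'(1) by (auto simp: normal_at_def)
    then show "C \<in> (\<Union>(s0, c, z)\<in>?I. piece g c z)"
      using s0 c c' e by (intro UN_I[of "(s0, restrict c' ?L, z)"]) auto }
  { assume "C \<in> (\<Union>(s0, c, z)\<in>?I. piece g c z)"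
    then obtain s0 c z where "normal_at g ?p s0 c" "z ^ ?p = 1" "C \<in> piece g c z" by auto
    then show "C \<in> sing_locus (surface_group g)"
      unfolding sing_locus_pieces using normal_at_nontrivial[OF p] by blast }
qed

lemma piece_closed:
  fixes d :: "complex ^ 'n::finite"
  assumes p: "prime CARD('n)" and s: "solves g c s0 z d K"
  shows "closedin (zariski_sing g) (piece g c z :: 'n surface_rep set set)"
  using inv_poly_zero_set_closed[OF p inv_poly_const[of g s0 0] s] by (simp add: piece_param[OF p s])

lemma irreducible_in_piece:
  fixes Z :: "'n::finite surface_rep set set"
  assumes p: "prime CARD('n)" and Z: "irreducible_closed (zariski_sing g) Z"
  obtains s0 c z and d :: "complex ^ 'n" and K where "solves g c s0 z d K" "Z \<subseteq> piece g c z"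
proof -
  let ?p = "CARD('n)" and ?L = "surface_letters g"
  let ?I = "{(s0, c, z). s0 \<in> ?L \<and> c \<in> ?L \<rightarrow>\<^sub>E {..<?p} \<and> normal_at g ?p s0 c \<and> z ^ ?p = (1 :: complex)}"
  have fL: "finite ?L" by (simp add: surface_letters_def)
  have "finite (?L \<times> (?L \<rightarrow>\<^sub>E {..<?p}) \<times> {z :: complex. z ^ ?p = 1})"
    by (intro finite_cartesian_product finite_PiE fL finite_lessThan finite_roots_unity) simp
  then have fI: "finite ?I" by (rule rev_finite_subset) auto
  have "\<exists>i\<in>?I. Z \<subseteq> (case i of (s0, c, z) \<Rightarrow> piece g c z)"
  proof (rule irreducible_in_one_of_finite[OF Z fI])
    fix i assume "i \<in> ?I"
    then obtain s0 c z where i: "i = (s0, c, z)" "normal_at g ?p s0 c" "z ^ ?p = 1" by auto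
    obtain d :: "complex ^ 'n" and K where "solves g c s0 z d K" by (rule ex_solves[OF i(2,3)])
    then show "closedin (zariski_sing g :: 'n surface_rep set topology) (case i of (s0, c, z) \<Rightarrow> piece g c z)"
      unfolding i using piece_closed[OF p] by simp
  next
    have "Z \<subseteq> sing_locus (surface_group g)"
      using Z closedin_subset[of "zariski_sing g" Z] by (simp add: irreducible_closed_def topspace_zariski_sing)
    then show "Z \<subseteq> (\<Union>i\<in>?I. case i of (s0, c, z) \<Rightarrow> piece g c z)" unfolding sing_locus_finite_pieces[OF p] .
  qed
  then obtain s0 c z where i: "normal_at g ?p s0 c" "z ^ ?p = 1" "Z \<subseteq> piece g c z" by auto
  obtain d :: "complex ^ 'n" and K where "solves g c s0 z d K" by (rule ex_solves[OF i(1,2)])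
  then show ?thesis using that i(3) by blast
qed

text \<open>A chain of irreducible closed sets lies in one piece, so it comes from parameters, and the invariant polynomials
  that separate consecutive members are algebraically independent. There are at most
  as many of these as free coordinates.\<close>

lemma chain_length_le:
  fixes Z :: "nat \<Rightarrow> 'n::finite surface_rep set set"
  assumes p: "prime CARD('n)" and irr: "\<And>i. i \<le> n \<Longrightarrow> irreducible_closed (zariski_sing g) (Z i)"
    and chain: "\<And>i. i < n \<Longrightarrow> Z i \<subset> Z (Suc i)"
  shows "n \<le> 2 * (g - 1) * (CARD('n) - 1)"
proof (rule ccontr)
  assume "\<not> ?thesis"
  then have n: "n > 2 * (g - 1) * (CARD('n) - 1)" by simp
  obtain s0 c z and d :: "complex ^ 'n" and K where s: "solves g c s0 z d K" and Zn: "Z n \<subseteq> piece g c z"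
    by (rule irreducible_in_piece[OF p irr[OF order.refl]])
  have s0: "s0 \<in> surface_letters g" using s by (simp add: solves_def normal_at_def)
  let ?P = "param g c s0 d K" and ?Y = "good_param g s0 z"
  have YT: "y \<in> torus_fam g s0" if "y \<in> ?Y" for y using that by (simp add: good_param_def)
  have ZZ: "Z i \<subseteq> Z n" if "i \<le> n" for i
    using that by (induction rule: inc_induct) (use chain in blast)+
  have Zparam: "Z i \<subseteq> ?P ` ?Y" if "i \<le> n" for i
    using ZZ[OF that] Zn unfolding piece_param[OF p s] by blast
  define W where "W i = {y \<in> ?Y. ?P y \<in> Z i}" for i
  have "\<exists>F. inv_poly g s0 F \<and> (\<forall>y\<in>W i. F y = 0) \<and> (\<exists>y\<in>W (Suc i). F y \<noteq> 0)" if i: "i < n" for i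
  proof -
    obtain y where y: "y \<in> ?Y" "?P y \<in> Z (Suc i)" "?P y \<notin> Z i"
      using chain[OF i] Zparam[of "Suc i"] i by (auto simp: psubset_eq)
    have "closedin (zariski_sing g) (Z i)" using irr[of i] i by (simp add: irreducible_closed_def)
    then obtain F where "inv_poly g s0 F" "F y \<noteq> 0" "\<And>y'. y' \<in> ?Y \<Longrightarrow> ?P y' \<in> Z i \<Longrightarrow> F y' = 0"
      by (rule inv_poly_separation[OF p s _ y(1,3)]) blast
    then show ?thesis using y by (intro exI[of _ F]) (auto simp: W_def)
  qed
  then have "\<forall>i\<in>{..<n}. \<exists>F. inv_poly g s0 F \<and> (\<forall>y\<in>W i. F y = 0) \<and> (\<exists>y\<in>W (Suc i). F y \<noteq> 0)" by blast
  from bchoice[OF this] obtain F where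
    F: "\<forall>i\<in>{..<n}. inv_poly g s0 (F i) \<and> (\<forall>y\<in>W i. F i y = 0) \<and> (\<exists>y\<in>W (Suc i). F i y \<noteq> 0)" by blast
  have Fp: "entry_poly (free_letters g s0) (F i)" if "i < n" for i using F that by (auto simp: inv_poly_def)
  have n': "n > card (free_coords g s0 (undefined :: 'n))" using n by (simp add: card_free_coords[OF s0])
  obtain m a where a: "\<exists>e\<in>(\<Pi>\<^sub>E i\<in>{..<n}. {..m :: nat}). a e \<noteq> 0"
    "\<forall>y\<in>torus_fam g s0. (\<Sum>e\<in>(\<Pi>\<^sub>E i\<in>{..<n}. {..m}). a e * (\<Prod>i<n. F i y ^ e i)) = 0"
    by (rule entry_polys_dependent[OF Fp n'])
  have "\<forall>e\<in>(\<Pi>\<^sub>E i\<in>{..<n}. {..m}). a e = 0"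
  proof (rule chain_alg_independent[where R = "{f. inv_poly g s0 f}" and W = W and F = F and n = n and e = "\<lambda>e. e"])
    show "(\<forall>y\<in>W i. f y = 0) \<or> (\<forall>y\<in>W i. h y = 0)"
      if i: "i \<le> n" and f: "f \<in> {f. inv_poly g s0 f}" and h: "h \<in> {f. inv_poly g s0 f}" and 0: "\<forall>y\<in>W i. f y * h y = 0" for i f h
    proof -
      let ?V = "\<lambda>f. ?P ` {y \<in> ?Y. f y = 0}"
      have cl: "closedin (zariski_sing g) (?V f)" "closedin (zariski_sing g) (?V h)"
        using inv_poly_zero_set_closed[OF p _ s] f h by auto
      have "Z i \<subseteq> ?V f \<union> ?V h" using Zparam[OF i] 0 by (fastforce simp: W_def)
      then have "Z i \<subseteq> ?V f \<or> Z i \<subseteq> ?V h" using irr[OF i] cl unfolding irreducible_closed_def by blast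
      moreover have "\<forall>y\<in>W i. f y = 0" if f': "inv_poly g s0 f" "Z i \<subseteq> ?V f" for f
      proof
        fix y assume y: "y \<in> W i"
        then obtain y' where y': "y' \<in> ?Y" "f y' = 0" "?P y = ?P y'" using f'(2) by (force simp: W_def)
        have "f y = f y'" by (rule inv_poly_param_eq[OF p f'(1) s _ _ y'(3)]) (use y y' YT in \<open>auto simp: W_def\<close>)
        then show "f y = 0" using y' by simp
      qed
      ultimately show ?thesis using f h by blast
    qed
    have "Z 0 \<noteq> {}" using irr[of 0] by (simp add: irreducible_closed_def)
    then show "W 0 \<noteq> {}" using Zparam[of 0] by (auto simp: W_def)
    show "W i \<subseteq> W (Suc i)" if "i < n" for i using chain[OF that] by (auto simp: W_def)
    show "finite (\<Pi>\<^sub>E i\<in>{..<n}. {..m})" by (intro finite_PiE) auto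
    show "e = e'" if "e \<in> (\<Pi>\<^sub>E i\<in>{..<n}. {..m})" "e' \<in> (\<Pi>\<^sub>E i\<in>{..<n}. {..m})" "\<forall>i<n. e i = e' i" for e e'
      using that by (intro PiE_ext) auto
    show "\<forall>y\<in>W n. (\<Sum>e\<in>(\<Pi>\<^sub>E i\<in>{..<n}. {..m}). a e * (\<Prod>i<n. F i y ^ e i)) = 0"
      using a(2) YT by (auto simp: W_def)
  qed (use F in \<open>auto simp: inv_poly_const inv_poly_add inv_poly_mult\<close>)
  then show False using a(1) by blast
qed

text \<open>Exponential coordinates on the parameter torus, numbered by an injection \<open>\<beta>\<close> of the free coordinates
  into the natural numbers.\<close>

definition exp_param :: "nat \<Rightarrow> surface_letter \<Rightarrow> 'n::finite \<Rightarrow> (surface_letter \<times> 'n \<Rightarrow> nat) \<Rightarrow> (nat \<Rightarrow> complex) \<Rightarrow>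
    surface_letter \<Rightarrow> complex ^ 'n"
  where "exp_param g s0 l0 \<beta> u = (\<lambda>j\<in>free_letters g s0.
    \<chi> l. if l = l0 then exp (- (\<Sum>m\<in>UNIV - {l0}. u (\<beta> (j, m)))) else exp (u (\<beta> (j, l))))"

lemma exp_param_torus: "exp_param g s0 l0 \<beta> u \<in> torus_fam g s0"
proof -
  have "(\<Prod>l\<in>UNIV. exp_param g s0 l0 \<beta> u j $ l) = 1" if j: "j \<in> free_letters g s0" for j
  proof -
    have "(\<Prod>l\<in>UNIV - {l0}. exp_param g s0 l0 \<beta> u j $ l) = exp (\<Sum>m\<in>UNIV - {l0}. u (\<beta> (j, m)))"
      using j by (subst exp_sum) (auto simp: exp_param_def intro!: prod.cong)
    then show ?thesis
      using j by (subst prod.remove[of _ l0]) (simp_all add: exp_param_def mult_exp_exp)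
  qed
  then show ?thesis by (simp add: torus_fam_def torus_def) (simp add: exp_param_def)
qed

lemma entry_poly_exp_param_holomorphic:
  assumes F: "entry_poly (free_letters g s0) F" and u: "\<And>m. (\<lambda>t. u t m) holomorphic_on UNIV"
  shows "(\<lambda>t. F (exp_param g s0 l0 \<beta> (u t))) holomorphic_on UNIV"
  using F
proof (induction rule: entry_poly.induct)
  case (entry j l)
  then show ?case
    by (cases "l = l0") (auto simp: exp_param_def intro!: holomorphic_intros u)
qed (auto intro: holomorphic_intros)

lemma entire_product_zero:
  assumes h: "h1 holomorphic_on UNIV" "h2 holomorphic_on UNIV" and z: "\<And>t. h1 t * h2 t = (0 :: complex)"
    and "h1 a \<noteq> 0"
  shows "h2 t = 0"
proof -
  have "open {t. h1 t \<noteq> 0}"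
    using holomorphic_on_imp_continuous_on[OF h(1)] by (intro open_Collect_neq continuous_intros)
  then show ?thesis
    by (rule analytic_continuation_open[of "{t. h1 t \<noteq> 0}" UNIV h2 "\<lambda>_. 0"])
      (use z h \<open>h1 a \<noteq> 0\<close> in \<open>auto intro: holomorphic_intros\<close>)
qed

text \<open>Restricted to a complex line in the affine subspace \<open>V\<close>, the separating polynomials become entire functions, and
  the ring of these has no zero divisors.\<close>

lemma irreducible_exp_closure:
  fixes d :: "complex ^ 'n::finite"
  assumes p: "prime CARD('n)" and s: "solves g c s0 z d K" and good: "good_param g s0 z = (torus_fam g s0 :: (surface_letter \<Rightarrow> complex ^ 'n) set)"
    and V: "V \<noteq> {}" "\<And>u v t. u \<in> V \<Longrightarrow> v \<in> V \<Longrightarrow> (\<lambda>m. u m + t * (v m - u m)) \<in> V"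
  shows "irreducible_closed (zariski_sing g)
    (zariski_sing g closure_of ((\<lambda>u. param g c s0 d K (exp_param g s0 l0 \<beta> u)) ` V))" (is "irreducible_closed ?X (?X closure_of (?\<pi> ` V))")
  unfolding irreducible_closed_def
proof (intro conjI allI impI)
  have good': "exp_param g s0 l0 \<beta> u \<in> good_param g s0 z" for u :: "nat \<Rightarrow> complex" unfolding good by (rule exp_param_torus)
  have sub: "?\<pi> ` V \<subseteq> topspace ?X"
    by (rule order.trans[OF _ closedin_subset[OF piece_closed[OF p s]]])
      (auto simp: piece_param[OF p s] intro!: imageI good')
  have ne: "?\<pi> ` V \<subseteq> ?X closure_of (?\<pi> ` V)" by (rule closure_of_subset[OF sub])
  then show "?X closure_of (?\<pi> ` V) \<noteq> {}" using V(1) by blast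
  show "closedin ?X (?X closure_of (?\<pi> ` V))" by simp
  fix A B assume AB: "closedin ?X A \<and> closedin ?X B \<and> ?X closure_of (?\<pi> ` V) \<subseteq> A \<union> B"
  show "?X closure_of (?\<pi> ` V) \<subseteq> A \<or> ?X closure_of (?\<pi> ` V) \<subseteq> B"
  proof (rule ccontr)
    assume "\<not> ?thesis"
    then have "\<not> ?\<pi> ` V \<subseteq> A" "\<not> ?\<pi> ` V \<subseteq> B" using AB closure_of_minimal by blast+
    then obtain u v where u: "u \<in> V" "?\<pi> u \<notin> A" and v: "v \<in> V" "?\<pi> v \<notin> B" by blast
    obtain F where F: "inv_poly g s0 F" "F (exp_param g s0 l0 \<beta> u) \<noteq> 0"
        "\<And>y'. y' \<in> good_param g s0 z \<Longrightarrow> param g c s0 d K y' \<in> A \<Longrightarrow> F y' = 0"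
      by (rule inv_poly_separation[OF p s _ good' u(2)]) (use AB in blast)+
    obtain H where H: "inv_poly g s0 H" "H (exp_param g s0 l0 \<beta> v) \<noteq> 0"
        "\<And>y'. y' \<in> good_param g s0 z \<Longrightarrow> param g c s0 d K y' \<in> B \<Longrightarrow> H y' = 0"
      by (rule inv_poly_separation[OF p s _ good' v(2)]) (use AB in blast)+
    define w where "w t = (\<lambda>m. u m + t * (v m - u m))" for t
    have hol: "(\<lambda>t. w t m) holomorphic_on UNIV" for m unfolding w_def by (intro holomorphic_intros)
    have "H (exp_param g s0 l0 \<beta> (w 1)) = 0"
    proof (rule entire_product_zero[where ?h1.0 = "\<lambda>t. F (exp_param g s0 l0 \<beta> (w t))"
          and ?h2.0 = "\<lambda>t. H (exp_param g s0 l0 \<beta> (w t))" and a = 0])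
      show "(\<lambda>t. F (exp_param g s0 l0 \<beta> (w t))) holomorphic_on UNIV" "(\<lambda>t. H (exp_param g s0 l0 \<beta> (w t))) holomorphic_on UNIV"
        using F(1) H(1) by (auto simp: inv_poly_def intro!: entry_poly_exp_param_holomorphic hol)
      show "F (exp_param g s0 l0 \<beta> (w 0)) \<noteq> 0" using F(2) by (simp add: w_def)
      fix t
      have "w t \<in> V" unfolding w_def by (rule V(2)[OF u(1) v(1)])
      then have "?\<pi> (w t) \<in> A \<or> ?\<pi> (w t) \<in> B" using AB ne by blast
      then show "F (exp_param g s0 l0 \<beta> (w t)) * H (exp_param g s0 l0 \<beta> (w t)) = 0" using F(3) H(3) good' by auto
    qed
    then show False using H(2) by (simp add: w_def)
  qed
qed

text \<open>Fixing one more exponential coordinate at a time gives a chain of full length. The value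
  \<open>m + 2\<close> of the entry with number \<open>m\<close> is chosen so that no group element moves another entry of
  the witness to it: the other entries have modulus \<open>1\<close>, \<open>m' + 2\<close> with \<open>m' \<noteq> m\<close>, or at most \<open>1\<close>.\<close>

lemma ex_full_chain:
  assumes p: "prime CARD('n::finite)" and g: "g \<ge> 2"
  obtains Z :: "nat \<Rightarrow> 'n::finite surface_rep set set" where
    "\<And>i. i \<le> 2 * (g - 1) * (CARD('n) - 1) \<Longrightarrow> irreducible_closed (zariski_sing g) (Z i)"
    "\<And>i. i < 2 * (g - 1) * (CARD('n) - 1) \<Longrightarrow> Z i \<subset> Z (Suc i)"
proof -
  let ?p = "CARD('n)" and ?X = "zariski_sing g :: 'n surface_rep set topology"
  define N where "N = 2 * (g - 1) * (?p - 1)"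
  define s0 where "s0 = La 1"
  define z where "z = zeta ?p"
  define l0 where "l0 = (undefined :: 'n)"
  have p1: "?p > 1" using prime_gt_1_nat[OF p] .
  have s0: "s0 \<in> surface_letters g" using g by (auto simp: s0_def surface_letters_def)
  have "normal_at g ?p s0 (letter_unit s0 1)" using s0 p1 by (auto simp: normal_at_def letter_unit_def)
  moreover have z: "z ^ ?p = 1" "z \<noteq> 1"
    using zeta_power_self[of ?p] zeta_power_eq_1_iff[of ?p 1] p1 by (auto simp: z_def)
  ultimately obtain d :: "complex ^ 'n" and K where s: "solves g (letter_unit s0 1) s0 z d K"
    using ex_solves by blast
  let ?Q = "free_coords g s0 l0"
  have good: "good_param g s0 z = (torus_fam g s0 :: (surface_letter \<Rightarrow> complex ^ 'n) set)" using z(2) by (simp add: good_param_def)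
  have cQ: "card ?Q = N" by (simp add: card_free_coords[OF s0] N_def)
  obtain \<beta> where \<beta>: "bij_betw \<beta> ?Q {..<N}"
    using ex_bij_betw_finite_nat[OF finite_free_coords, of g s0 l0] cQ by (auto simp: atLeast0LessThan)
  let ?e = "exp_param g s0 l0 \<beta>"
  define \<pi> where "\<pi> u = param g (letter_unit s0 1) s0 d K (?e u)" for u
  define V where "V i = {u. \<forall>m. i \<le> m \<and> m < N \<longrightarrow> u m = complex_of_real (ln (real m + 2))}" for i
  define Z where "Z i = ?X closure_of (\<pi> ` V i)" for i
  have irr: "irreducible_closed ?X (Z i)" for i
    unfolding Z_def \<pi>_def[abs_def]
  proof (rule irreducible_exp_closure[OF p s good])
    show "V i \<noteq> {}" by (auto simp: V_def intro!: exI[of _ "\<lambda>m. complex_of_real (ln (real m + 2))"])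
    show "(\<lambda>m. u m + t * (v m - u m)) \<in> V i" if "u \<in> V i" "v \<in> V i" for u v t
      using that by (auto simp: V_def)
  qed
  have strict: "Z i \<subset> Z (Suc i)" if i: "i < N" for i
  proof
    show "Z i \<subseteq> Z (Suc i)"
      unfolding Z_def by (intro closure_of_mono image_mono) (auto simp: V_def)
    have "i \<in> \<beta> ` ?Q" using \<beta> i by (auto simp: bij_betw_def)
    then obtain j l where jl: "(j, l) \<in> ?Q" "\<beta> (j, l) = i" by auto
    then have j: "j \<in> free_letters g s0" "l \<noteq> l0" by (auto simp: free_coords_def)
    let ?G = "act_group TYPE('n) g s0"
    define F where "F y = (\<Prod>h\<in>?G. - (of_nat i + 2) + act g s0 (fst h) (snd h) y j $ l)" for y :: "surface_letter \<Rightarrow> complex ^ 'n"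
    have F: "inv_poly g s0 F"
      unfolding F_def by (rule inv_poly_orbit_prod[OF entry_poly.entry[OF j(1)]])
    have Fi: "F (?e u) = 0" if "u \<in> V i" for u
    proof -
      have "?e u j $ l = of_nat i + 2"
        using that j jl(2) i by (simp add: exp_param_def V_def exp_of_real)
      then have "- (of_nat i + 2) + act g s0 (fst (\<lambda>j\<in>free_letters g s0. 1 :: complex, 0 :: nat)) (snd (\<lambda>j\<in>free_letters g s0. 1 :: complex, 0)) (?e u) j $ l = 0"
        by (simp add: act_group_one[OF exp_param_torus])
      then show ?thesis unfolding F_def
        by (intro prod_zero finite_act_group bexI[OF _ one_in_act_group[where 'n='n]])
    qed
    let ?C = "param g (letter_unit s0 1) s0 d K ` {y \<in> good_param g s0 z. F y = 0}"
    have Zi: "Z i \<subseteq> ?C"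
      unfolding Z_def \<pi>_def
      by (rule closure_of_minimal[OF _ inv_poly_zero_set_closed[OF p F s]])
        (auto simp: good intro!: imageI Fi exp_param_torus)
    define w where "w m = (if m \<le> i then 0 else ln (real m + 2))" for m
    let ?y = "?e (\<lambda>m. complex_of_real (w m))"
    have w0: "w m \<ge> 0" for m by (simp add: w_def)
    have mod: "norm (?y j $ l') \<noteq> real i + 2" for l'
    proof (cases "l' = l0")
      case True
      have "norm (?y j $ l') = exp (- (\<Sum>m\<in>UNIV - {l0}. w (\<beta> (j, m))))" using True j by (simp add: exp_param_def)
      also have "\<dots> \<le> 1" using w0 by (simp add: sum_nonneg)
      finally show ?thesis by simp
    next
      case False
      have "norm (?y j $ l') = exp (w (\<beta> (j, l')))" using False j by (simp add: exp_param_def)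
      also have "\<dots> \<noteq> real i + 2" by (simp add: w_def)
      finally show ?thesis .
    qed
    have Fy: "F ?y \<noteq> 0"
    proof -
      have "- (of_nat i + 2) + act g s0 (fst h) (snd h) ?y j $ l \<noteq> 0" if h: "h \<in> ?G" for h
      proof
        assume "- (of_nat i + 2) + act g s0 (fst h) (snd h) ?y j $ l = 0"
        then have e: "fst h j * ?y j $ rot (snd h) l = of_nat i + 2"
          using j by (simp add: act_def add_eq_0_iff)
        have "norm (fst h j) = 1" using power_eq_1_iff[OF act_group_root[OF h j(1)]] p1 by simp
        moreover have "norm (of_nat i + 2 :: complex) = real i + 2"
          by (metis norm_of_nat of_nat_add of_nat_numeral)
        ultimately show False using mod e by (metis mult_1 norm_mult)
      qed
      then show ?thesis unfolding F_def by (simp add: finite_act_group)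
    qed
    have "(\<lambda>m. complex_of_real (w m)) \<in> V (Suc i)" by (auto simp: V_def w_def)
    then have "\<pi> (\<lambda>m. complex_of_real (w m)) \<in> Z (Suc i)"
    proof -
      have "\<pi> ` V (Suc i) \<subseteq> topspace ?X"
        by (rule order.trans[OF _ closedin_subset[OF piece_closed[OF p s]]])
          (unfold piece_param[OF p s] \<pi>_def, auto simp: good intro!: imageI exp_param_torus)
      then show ?thesis unfolding Z_def using \<open>_ \<in> V (Suc i)\<close> closure_of_subset by blast
    qed
    moreover have "\<pi> (\<lambda>m. complex_of_real (w m)) \<notin> ?C"
    proof
      assume "\<pi> (\<lambda>m. complex_of_real (w m)) \<in> ?C"
      then obtain y where y: "y \<in> good_param g s0 z" "F y = 0" "param g (letter_unit s0 1) s0 d K ?y = param g (letter_unit s0 1) s0 d K y"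
        by (auto simp: \<pi>_def)
      have "F ?y = F y" by (rule inv_poly_param_eq[OF p F s exp_param_torus _ y(3)]) (use y(1) good in auto)
      then show False using Fy y(2) by simp
    qed
    ultimately show "Z i \<noteq> Z (Suc i)" using Zi by blast
  qed
  show ?thesis
    by (rule that[of Z]) (use irr strict in \<open>auto simp: N_def\<close>)
qed

theorem corollary5:
  fixes g :: nat
  assumes "g \<ge> 2"
    and "prime CARD('n::finite)"
  shows "card (connected_components_of
      (sing_topology (surface_group g) (surface_gens g) :: 'n surface_rep set topology)) = CARD('n) \<and>
    connected_components_of
      (sing_topology (surface_group g) (surface_gens g) :: 'n surface_rep set topology) =
      (\<lambda>z. {c \<in> sing_locus (surface_group g). euler_class g c = z}) ` center SL \<and>
    krull_dim
      (sing_zariski (surface_group g) (surface_gens g) :: 'n surface_rep set topology) =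
      enat (2 * (g - 1) * (CARD('n) - 1))"
proof (intro conjI)
  let ?X = "sing_topology (surface_group g) (surface_gens g) :: 'n surface_rep set topology"
  note comp = sing_components[OF assms(2,1)]
  show "card (connected_components_of ?X) = CARD('n)"
    unfolding comp(1) card_image[OF comp(2)] by (rule card_center_SL)
  show "connected_components_of ?X = (\<lambda>z. {c \<in> sing_locus (surface_group g). euler_class g c = z}) ` center SL"
    unfolding comp(1) euler_fiber_def ..
  let ?N = "2 * (g - 1) * (CARD('n) - 1)"
  let ?S = "{enat n | n. \<exists>Z :: nat \<Rightarrow> 'n surface_rep set set.
    (\<forall>i\<le>n. irreducible_closed (zariski_sing g) (Z i)) \<and> (\<forall>i<n. Z i \<subset> Z (Suc i))}"
  obtain Z :: "nat \<Rightarrow> 'n surface_rep set set" where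
    "\<And>i. i \<le> ?N \<Longrightarrow> irreducible_closed (zariski_sing g) (Z i)" "\<And>i. i < ?N \<Longrightarrow> Z i \<subset> Z (Suc i)"
    by (rule ex_full_chain[OF assms(2,1)]) blast
  then have "enat ?N \<in> ?S" by blast
  moreover have "x \<le> enat ?N" if "x \<in> ?S" for x
  proof -
    obtain n Z where n: "x = enat n" "\<forall>i\<le>n. irreducible_closed (zariski_sing g) (Z i :: 'n surface_rep set set)"
      "\<forall>i<n. Z i \<subset> Z (Suc i)" using \<open>x \<in> ?S\<close> by blast
    then have "n \<le> ?N" by (intro chain_length_le[OF assms(2), of n g Z]) auto
    then show ?thesis by (simp add: n(1))
  qed
  ultimately have "Sup ?S = enat ?N" by (intro Sup_eqI) auto
  then show "krull_dim (zariski_sing g :: 'n surface_rep set topology) = enat ?N" by (simp only: krull_dim_def)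
qed

end
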